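(* Let $\Gamma\subset\Pi$. Consider $\lambda_0\in\mathfrak h^*$ that satisfies $\langle\lambda_0+\rho,\alpha_i^\vee\rangle\in\mathbb N$ for all $\alpha_i\in\Gamma$ and $\langle\lambda_0+\rho,\beta^\vee\rangle\notin\mathbb N$ for all $\beta\in\mathbf R_+\setminus\operatorname{Span}\Gamma$. Then $\lambda_0$ is $J$-regular.
   Context: Let $\Bbbk$ be the field obtained from $\mathbb C(q)$ by adjoining all fractional powers $q^{1/n}$, $n\in\mathbb N=\{1,2,3,\dots\}$. Let $(a_{ij})$ be an $r\times r$ Cartan matrix of finite type with realization $(\mathfrak h,\Pi,\Pi^\vee)$ over $\mathbb Q$: $\Pi=\{\alpha_1,\dots,\alpha_r\}\subset\mathfrak h^*$ are the simple roots, $\Pi^\vee=\{\alpha_1^\vee,\dots,\alpha_r^\vee\}\subset\mathfrak h$ the simple coroots, $a_{ij}=\langle\alpha_j,\alpha_i^\vee\rangle$; $u_1,\dots,u_r\in\mathfrak h$ are the simple coweights, $\langle\alpha_i,u_j\rangle=\delta_{ij}$. $\mathbf R_+$ is the set of positive roots, $\rho$ their half sum. Let $(\cdot|\cdot)$ be the invariant scalar product on $\mathfrak h^*$ with $(\alpha|\alpha)=2$ for short roots, $d_i=(\alpha_i|\alpha_i)/2$ (so $d_ia_{ij}=d_ja_{ji}$), $[k]_i=\frac{q^{kd_i}-q^{-kd_i}}{q^{d_i}-q^{-d_i}}$, $[k]_i!=[1]_i\cdots[k]_i$. Let $Q_+=\sum_i\mathbb Z_{\ge0}\alpha_i$. $U=\check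 U_q\mathfrak g$ is the $\Bbbk$-algebra generated by $t_i^{\pm1},e_i,f_i$ ($1\le i\le r$) with the $t_i$ commuting and: $t_ie_jt_i^{-1}=q^{d_i\delta_{ij}}e_j$, $t_if_jt_i^{-1}=q^{-d_i\delta_{ij}}f_j$, $e_if_j-f_je_i=\delta_{ij}\frac{k_i-k_i^{-1}}{q^{d_i}-q^{-d_i}}$ with $k_i=\prod_jt_j^{a_{ji}}$, and for $i\ne j$ the Serre relations $\sum_{m=0}^{1-a_{ij}}\frac{(-1)^m}{[m]_i!\,[1-a_{ij}-m]_i!}e_i^me_je_i^{1-a_{ij}-m}=0$ and the same with $f$ in place of $e$. It is a Hopf algebra: $\Delta(t_i)=t_i\otimes t_i$, $\Delta(e_i)=e_i\otimes1+k_i\otimes e_i$, $\Delta(f_i)=f_i\otimes k_i^{-1}+1\otimes f_i$; $\varepsilon(t_i)=1$, $\varepsilon(e_i)=\varepsilon(f_i)=0$; antipode $\sigma(t_i)=t_i^{-1}$, $\sigma(e_i)=-k_i^{-1}e_i$, $\sigma(f_i)=-f_ik_i$. $U^0,U^+,U^-$ are the subalgebras generated by the $t_i^{\pm1}$, the $e_i$, the $f_i$; $U=U^-U^0U^+$. $T$ is the group generated by the $t_i$. $\theta$ is the involutive algebra automorphism with $\theta(e_i)=-f_i$, $\theta(f_i)=-e_i$, $\theta(t_i)=t_i^{-1}$, and $\omega=\sigma\theta$. Each $\lambda\in\mathfrak h^*$ defines the character $q^\lambda:U^0\to\Bbbk$, $t_i\mapsto q^{d_i\langle\lambda,u_i\rangle}$.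 For a $U$-module $V$, $V[\mu]=\{v: tv=q^\mu(t)v\ \forall t\in T\}$; $U^-[-\beta]$ is the span of $y\in U^-$ with $tyt^{-1}=q^{-\beta}(t)y$. $M(\lambda)$ is the Verma module with highest weight vector $\mathbf 1_\lambda$, free over $U^-$ on $\mathbf 1_\lambda$. With $U^\pm_+=\ker\varepsilon|_{U^\pm}$, let $x\mapsto(x)_0$ be the projection $U\to U^0$ along $U^-_+U+UU^+_+$. Put $\pi_\lambda(x\otimes y)=q^\lambda((\sigma(x)y)_0)$ for $x\in U^+$, $y\in U^-$, and $\mathbb S_\lambda(x\otimes y)=q^\lambda((\omega(x)y)_0)$ for $x,y\in U^-$ (Shapovalov form). $K_\lambda=\{y\in U^-:\pi_\lambda(x\otimes y)=0\ \forall x\in U^+\}$, $\widetilde K_\lambda=\{x\in U^+:\pi_\lambda(x\otimes y)=0\ \forall y\in U^-\}=\theta(K_\lambda)$. $L(\lambda)=M(\lambda)/K_\lambda\mathbf 1_\lambda$ is the irreducible module of highest weight $\lambda$. $F=\Bbbk[G]_q$ is the quantized algebra of regular functions on the connected simply connected group $G$ with Cartan matrix $(a_{ij})$: the Hopf subalgebra of the dual Hopf algebra of $U$ spanned by matrix elements of the finite-dimensional modules $L(\mu)$, $\mu$ dominant integral. Left regular action: $(\overrightarrow{a}f)(x)=f(xa)$. $F[0]$ is the zero weight space for it, and $F[0]^{K}$ is the set of $f\in F[0]$ with $\overrightarrow{a}f=0$ for all $a\in K$. $J$-regularity. $\lambda\in\mathfrak h^*$ is generic if $\langle\lambda+\rho,\beta^\vee\rangle\notin\mathbb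 N$ for all $\beta\in\mathbf R_+$; then $L(\lambda)=M(\lambda)$ and $\mathbb S_\lambda$ is nondegenerate. For a basis $y_\beta^i$ of $U^-[-\beta]$ and generic $\lambda$ put $J(\lambda)=\sum_{\beta\in Q_+}\sum_{i,j}(\mathbb S_\lambda^\beta)^{-1}_{ij}\,y_\beta^i\otimes\theta(y_\beta^j)$, where $\mathbb S_\lambda^\beta=(\mathbb S_\lambda(y_\beta^i\otimes y_\beta^j))_{ij}$. The coefficients are the values at $q^\lambda$ of elements of $\operatorname{Frac}(U^0)$ (rational functions in the $t_i$). $\lambda_0\in\mathfrak h^*$ is $J$-regular if for every $U^-$-module $M$ the family of operators $J(\lambda)^M:M\otimes F[0]^{\widetilde K_{\lambda_0}}\to M\otimes F$, $m\otimes f\mapsto\sum_{\beta,i,j}(\mathbb S^\beta_\lambda)^{-1}_{ij}\,y_\beta^im\otimes\overrightarrow{\theta(y_\beta^j)}f$ (a finite sum for given $f$), is regular at $\lambda=\lambda_0$, i.e. each $J(\lambda)^M(m\otimes f)$, as a rational function of $q^\lambda$ with values in $M\otimes F$, has no pole at $q^{\lambda_0}$ (its coefficients can be taken in the localization of $U^0$ at $\ker q^{\lambda_0}$). Equivalently, for every $U^+$-module $N$ the family $J(\lambda)_N:F[0]^{K_{\lambda_0}}\otimes N\to F\otimes N$ defined analogously is regular at $\lambda_0$. *)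

theory Defs
  imports
    "HOL-Analysis.Cartesian_Space"
    "HOL-Algebra.QuotRing"
    "HOL-Algebra.Module"
    "HOL-Algebra.Generated_Rings"
    "HOL-Algebra.Generated_Groups"
    "HOL-Algebra.Embedded_Algebras"
    "HOL-Computational_Algebra.Fraction_Field"
    "HOL-Library.Poly_Mapping"
    "Jordan_Normal_Form.Gauss_Jordan_Elimination"
begin

hide_type (open) Matrix.vec
no_notation Matrix.vec_index (infixl "$" 100)


section \<open>The ground field\<close>

text \<open>
  The group algebra of the additive group of the rationals over the complex numbers is the union of
  the rings of Laurent polynomials in \<open>q\<^bsup>1/n\<^esup>\<close>; its fraction field is therefore the field obtained
  from the rational functions in \<open>q\<close> by adjoining all the roots \<open>q\<^bsup>1/n\<^esup>\<close>.
\<close>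

type_synonym qfield = "(rat \<Rightarrow>\<^sub>0 complex) fract"

definition qpow :: "rat \<Rightarrow> qfield" where
  "qpow r = Fract (Poly_Mapping.single r 1) 1"


section \<open>Algebra that is missing in the library\<close>

definition univ_ring :: "'a::ring_1 ring" where
  "univ_ring = \<lparr>carrier = UNIV, monoid.mult = (*), one = 1, ring.zero = 0, add = (+)\<rparr>"

lemma ring_univ_ring: "ring (univ_ring :: 'a::ring_1 ring)"
proof (rule ringI)
  show "abelian_group (univ_ring :: 'a ring)"
  proof (rule abelian_groupI)
    fix x :: 'a
    have "- x \<oplus>\<^bsub>univ_ring\<^esub> x = \<zero>\<^bsub>univ_ring\<^esub>" by (simp add: univ_ring_def)
    then show "\<exists>y\<in>carrier univ_ring. y \<oplus>\<^bsub>univ_ring\<^esub> x = \<zero>\<^bsub>univ_ring\<^esub>"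
      by (intro bexI[of _ "- x"]) (simp_all add: univ_ring_def)
  qed (simp_all add: univ_ring_def algebra_simps)
  show "monoid (univ_ring :: 'a ring)"
    by (rule monoidI) (simp_all add: univ_ring_def algebra_simps)
qed (simp_all add: univ_ring_def algebra_simps)

definition opposite_ring :: "('a, 'b) ring_scheme \<Rightarrow> ('a, 'b) ring_scheme" where
  "opposite_ring R = R\<lparr>monoid.mult := \<lambda>x y. y \<otimes>\<^bsub>R\<^esub> x\<rparr>"

text \<open>The library locale \<^locale>\<open>module\<close> is restricted to commutative rings.\<close>

locale left_module = R?: ring R + M?: abelian_group M
  for R :: "('a, 'b) ring_scheme" (structure) and M :: "('a, 'm, 'c) module_scheme" (structure) +
  assumes smult_closed [simp, intro]:
      "\<lbrakk>a \<in> carrier R; x \<in> carrier M\<rbrakk> \<Longrightarrow> a \<odot>\<^bsub>M\<^esub> x \<in> carrier M"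
    and smult_l_distr:
      "\<lbrakk>a \<in> carrier R; b \<in> carrier R; x \<in> carrier M\<rbrakk> \<Longrightarrow>
        (a \<oplus> b) \<odot>\<^bsub>M\<^esub> x = a \<odot>\<^bsub>M\<^esub> x \<oplus>\<^bsub>M\<^esub> b \<odot>\<^bsub>M\<^esub> x"
    and smult_r_distr:
      "\<lbrakk>a \<in> carrier R; x \<in> carrier M; y \<in> carrier M\<rbrakk> \<Longrightarrow>
        a \<odot>\<^bsub>M\<^esub> (x \<oplus>\<^bsub>M\<^esub> y) = a \<odot>\<^bsub>M\<^esub> x \<oplus>\<^bsub>M\<^esub> a \<odot>\<^bsub>M\<^esub> y"
    and smult_assoc:
      "\<lbrakk>a \<in> carrier R; b \<in> carrier R; x \<in> carrier M\<rbrakk> \<Longrightarrow>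
        (a \<otimes> b) \<odot>\<^bsub>M\<^esub> x = a \<odot>\<^bsub>M\<^esub> (b \<odot>\<^bsub>M\<^esub> x)"
    and smult_one [simp]: "x \<in> carrier M \<Longrightarrow> \<one> \<odot>\<^bsub>M\<^esub> x = x"

definition regular_module :: "('a, 'b) ring_scheme \<Rightarrow> ('a, 'a) module" where
  "regular_module R =
    \<lparr>carrier = carrier R, monoid.mult = monoid.mult R, one = one R, ring.zero = ring.zero R,
     add = add R, smult = monoid.mult R\<rparr>"

text \<open>The fields \<open>mult\<close> and \<open>one\<close> of the record type \<open>module\<close> play no role for modules.\<close>

definition quotient_module ::
    "('a, 'm, 'c) module_scheme \<Rightarrow> 'm set \<Rightarrow> ('a, 'm set) module" where
  "quotient_module M N =
    \<lparr>carrier = a_rcosets\<^bsub>M\<^esub> N, monoid.mult = undefined, one = undefined, ring.zero = N,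
     add = set_add M, smult = \<lambda>a C. N <+>\<^bsub>M\<^esub> ((\<lambda>x. a \<odot>\<^bsub>M\<^esub> x) ` C)\<rparr>"

text \<open>The additive subgroup generated by the products of elements of two subsets of a ring.\<close>

definition span_mult :: "('a, 'b) ring_scheme \<Rightarrow> 'a set \<Rightarrow> 'a set \<Rightarrow> 'a set" where
  "span_mult R A B = generate (add_monoid R) {x \<otimes>\<^bsub>R\<^esub> y | x y. x \<in> A \<and> y \<in> B}"

text \<open>
  The tensor product over \<^typ>\<open>'k\<close> of two modules \<open>M\<close> and \<open>N\<close> over a \<^typ>\<open>'k\<close>-algebra whose structure
  map is \<open>\<iota>\<close>. Its elements are classes of formal combinations
  \<open>\<Sum> c (m, n)\<close>; \<open>Poly_Mapping.single (m, n) c\<close> represents \<open>c (m \<otimes> n)\<close>.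
\<close>

inductive_set tensor_null ::
    "('k::comm_ring_1 \<Rightarrow> 'a) \<Rightarrow> ('a, 'm, 'c) module_scheme \<Rightarrow> ('a, 'n, 'd) module_scheme \<Rightarrow>
     ('m \<times> 'n \<Rightarrow>\<^sub>0 'k) set"
  for \<iota> and M and N where
  zero: "0 \<in> tensor_null \<iota> M N"
| diff: "\<lbrakk>X \<in> tensor_null \<iota> M N; Y \<in> tensor_null \<iota> M N\<rbrakk> \<Longrightarrow> X - Y \<in> tensor_null \<iota> M N"
| add_left: "\<lbrakk>m \<in> carrier M; m' \<in> carrier M; n \<in> carrier N\<rbrakk> \<Longrightarrow>
    Poly_Mapping.single (m \<oplus>\<^bsub>M\<^esub> m', n) c - Poly_Mapping.single (m, n) c
      - Poly_Mapping.single (m', n) c \<in> tensor_null \<iota> M N"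
| add_right: "\<lbrakk>m \<in> carrier M; n \<in> carrier N; n' \<in> carrier N\<rbrakk> \<Longrightarrow>
    Poly_Mapping.single (m, n \<oplus>\<^bsub>N\<^esub> n') c - Poly_Mapping.single (m, n) c
      - Poly_Mapping.single (m, n') c \<in> tensor_null \<iota> M N"
| smult_left: "\<lbrakk>m \<in> carrier M; n \<in> carrier N\<rbrakk> \<Longrightarrow>
    Poly_Mapping.single (\<iota> b \<odot>\<^bsub>M\<^esub> m, n) c - Poly_Mapping.single (m, n) (b * c)
      \<in> tensor_null \<iota> M N"
| smult_right: "\<lbrakk>m \<in> carrier M; n \<in> carrier N\<rbrakk> \<Longrightarrow>
    Poly_Mapping.single (m, \<iota> b \<odot>\<^bsub>N\<^esub> n) c - Poly_Mapping.single (m, n) (b * c)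
      \<in> tensor_null \<iota> M N"

definition tensor_class ::
    "('k::comm_ring_1 \<Rightarrow> 'a) \<Rightarrow> ('a, 'm, 'c) module_scheme \<Rightarrow> ('a, 'n, 'd) module_scheme \<Rightarrow>
     ('m \<times> 'n \<Rightarrow>\<^sub>0 'k) \<Rightarrow> ('m \<times> 'n \<Rightarrow>\<^sub>0 'k) set" where
  "tensor_class \<iota> M N X = {Y. Y - X \<in> tensor_null \<iota> M N}"


section \<open>Root data\<close>

text \<open>
  The finite index type plays the role of \<open>{1, \<dots>, r}\<close>; its linear order only serves to write down
  products over all indices in a noncommutative ring. The realization of \<open>a\<close>, which is unique up to
  isomorphism, is modelled by rational vectors: elements of \<open>\<hh>\<^sup>*\<close> are given by their coordinates with
  respect to the simple roots, elements of \<open>\<hh>\<close> by their coordinates with respect to the dual basis,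
  which consists of the simple coweights.
\<close>

type_synonym 'i weight = "(rat, 'i) vec"

type_synonym 'i coweight = "(rat, 'i) vec"

definition pairing :: "'i::finite weight \<Rightarrow> 'i coweight \<Rightarrow> rat" where
  "pairing \<nu> h = (\<Sum>i\<in>UNIV. \<nu> $ i * h $ i)"

definition simple_root :: "'i::finite \<Rightarrow> 'i weight" where
  "simple_root i = axis i 1"

definition simple_coweight :: "'i::finite \<Rightarrow> 'i coweight" where
  "simple_coweight i = axis i 1"

text \<open>The set \<open>{1, 2, 3, \<dots>}\<close>.\<close>

definition pos_nats :: "rat set" where
  "pos_nats = of_nat ` {1..}"

locale finite_cartan_matrix =
  fixes a :: "'i::{finite,linorder} \<Rightarrow> 'i \<Rightarrow> int"
  assumes diag: "a i i = 2"
    and off_diag: "i \<noteq> j \<Longrightarrow> a i j \<le> 0"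
    and zero_sym: "a i j = 0 \<Longrightarrow> a j i = 0"
    and finite_type: "\<exists>D :: 'i \<Rightarrow> real. (\<forall>i. 0 < D i) \<and>
      (\<forall>i j. D i * of_int (a i j) = D j * of_int (a j i)) \<and>
      (\<forall>x :: 'i \<Rightarrow> real. (\<exists>i. x i \<noteq> 0) \<longrightarrow>
        0 < (\<Sum>i\<in>UNIV. \<Sum>j\<in>UNIV. x i * (D i * of_int (a i j)) * x j))"
begin

definition simple_coroot :: "'i \<Rightarrow> 'i coweight" where
  "simple_coroot i = (\<chi> j. of_int (a i j))"

definition simple_reflection :: "'i \<Rightarrow> 'i weight \<Rightarrow> 'i weight" where
  "simple_reflection i \<nu> = \<nu> - pairing \<nu> (simple_coroot i) *s simple_root i"

inductive_set roots :: "'i weight set" where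
  simple: "simple_root i \<in> roots"
| reflect: "\<beta> \<in> roots \<Longrightarrow> simple_reflection i \<beta> \<in> roots"

definition pos_roots :: "'i weight set" where
  "pos_roots = {\<beta> \<in> roots. \<forall>i. 0 \<le> \<beta> $ i}"

definition rho :: "'i weight" where
  "rho = (1 / 2) *s (\<Sum>\<beta>\<in>pos_roots. \<beta>)"

definition Q_plus :: "'i weight set" where
  "Q_plus = {\<beta>. \<forall>i. \<beta> $ i \<in> \<nat>}"

definition dominant_integral :: "'i weight \<Rightarrow> bool" where
  "dominant_integral \<mu> \<longleftrightarrow> (\<forall>i. pairing \<mu> (simple_coroot i) \<in> \<nat>)"

text \<open>
  If the root system is reducible, a root is short if it has minimal length within its irreducible
  component, the components being the classes of the equivalence relation generated by
  nonorthogonality.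
\<close>

definition short_root :: "('i weight \<Rightarrow> 'i weight \<Rightarrow> rat) \<Rightarrow> 'i weight \<Rightarrow> bool" where
  "short_root B \<alpha> \<longleftrightarrow> \<alpha> \<in> roots \<and>
    (\<forall>\<beta>. (\<alpha>, \<beta>) \<in> {(\<gamma>, \<delta>). \<gamma> \<in> roots \<and> \<delta> \<in> roots \<and> B \<gamma> \<delta> \<noteq> 0}\<^sup>* \<longrightarrow> B \<alpha> \<alpha> \<le> B \<beta> \<beta>)"

end


section \<open>The quantized universal enveloping algebra\<close>

datatype 'i gen = Gen_e 'i | Gen_f 'i | Gen_t 'i | Gen_tinv 'i

text \<open>
  With concatenation of words as addition, \<open>'g list \<Rightarrow>\<^sub>0 'k\<close> is the free associative algebra on the
  set of generators \<open>'g\<close>.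
\<close>

instantiation list :: (type) monoid_add
begin
definition zero_list :: "'a list" where "zero_list = []"
definition plus_list :: "'a list \<Rightarrow> 'a list \<Rightarrow> 'a list" where "plus_list = (@)"
instance by standard (simp_all add: zero_list_def plus_list_def)
end

type_synonym 'i free_alg = "'i gen list \<Rightarrow>\<^sub>0 qfield"

type_synonym 'i uq = "'i free_alg set"

definition free_gen :: "'i gen \<Rightarrow> 'i free_alg" where
  "free_gen x = Poly_Mapping.single [x] 1"

definition free_const :: "qfield \<Rightarrow> 'i free_alg" where
  "free_const c = Poly_Mapping.single [] c"

definition t_power :: "'i \<Rightarrow> int \<Rightarrow> 'i free_alg" where
  "t_power i n = (if 0 \<le> n then free_gen (Gen_t i) ^ nat n else free_gen (Gen_tinv i) ^ nat (- n))"

locale finite_cartan_datum = finite_cartan_matrix a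
  for a :: "'i::{finite,linorder} \<Rightarrow> 'i \<Rightarrow> int" +
  fixes ip :: "'i weight \<Rightarrow> 'i weight \<Rightarrow> rat"
  assumes ip_sym: "ip x y = ip y x"
    and ip_add: "ip (x + y) z = ip x z + ip y z"
    and ip_scale: "ip (c *s x) y = c * ip x y"
    and ip_pos: "x \<noteq> 0 \<Longrightarrow> 0 < ip x x"
    and ip_invariant: "ip (simple_reflection i x) (simple_reflection i y) = ip x y"
    and ip_short: "short_root ip \<alpha> \<Longrightarrow> ip \<alpha> \<alpha> = 2"
begin

text \<open>
  \<open>coroot \<beta>\<close> corresponds to \<open>2 \<beta> / (\<beta>|\<beta>)\<close> under the identification of \<open>\<hh>\<close> and \<open>\<hh>\<^sup>*\<close>, i.e.
  \<open>pairing \<nu> (coroot \<beta>) = 2 (\<nu>|\<beta>) / (\<beta>|\<beta>)\<close>.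
\<close>

definition coroot :: "'i weight \<Rightarrow> 'i coweight" where
  "coroot \<beta> = (\<chi> j. 2 * ip (simple_root j) \<beta> / ip \<beta> \<beta>)"

definition d :: "'i \<Rightarrow> rat" where
  "d i = ip (simple_root i) (simple_root i) / 2"

definition q_int :: "'i \<Rightarrow> nat \<Rightarrow> qfield" where
  "q_int i k = (qpow (of_nat k * d i) - qpow (- (of_nat k * d i))) / (qpow (d i) - qpow (- d i))"

definition q_fact :: "'i \<Rightarrow> nat \<Rightarrow> qfield" where
  "q_fact i k = (\<Prod>s = 1..k. q_int i s)"

text \<open>\<open>k_power i s\<close> represents \<open>k\<^sub>i\<^sup>s\<close> for \<open>k\<^sub>i = \<Prod>\<^sub>j t\<^sub>j\<^bsup>a j i\<^esup>\<close>; it is used for \<open>s = 1\<close> and \<open>s = -1\<close>.\<close>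

definition k_power :: "'i \<Rightarrow> int \<Rightarrow> 'i free_alg" where
  "k_power i s = prod_list (map (\<lambda>j. t_power j (s * a j i)) (sorted_list_of_set UNIV))"

definition serre :: "('i \<Rightarrow> 'i gen) \<Rightarrow> 'i \<Rightarrow> 'i \<Rightarrow> 'i free_alg" where
  "serre X i j = (let n = nat (1 - a i j) in
    \<Sum>m = 0..n. free_const ((- 1) ^ m / (q_fact i m * q_fact i (n - m)))
      * free_gen (X i) ^ m * free_gen (X j) * free_gen (X i) ^ (n - m))"

inductive_set relations :: "'i free_alg set" where
  t_tinv: "free_gen (Gen_t i) * free_gen (Gen_tinv i) - 1 \<in> relations"
| tinv_t: "free_gen (Gen_tinv i) * free_gen (Gen_t i) - 1 \<in> relations"
| t_t: "free_gen (Gen_t i) * free_gen (Gen_t j) - free_gen (Gen_t j) * free_gen (Gen_t i) \<in> relations"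
| t_e: "free_gen (Gen_t i) * free_gen (Gen_e j) * free_gen (Gen_tinv i)
    - free_const (qpow (if i = j then d i else 0)) * free_gen (Gen_e j) \<in> relations"
| t_f: "free_gen (Gen_t i) * free_gen (Gen_f j) * free_gen (Gen_tinv i)
    - free_const (qpow (if i = j then - d i else 0)) * free_gen (Gen_f j) \<in> relations"
| e_f: "free_gen (Gen_e i) * free_gen (Gen_f j) - free_gen (Gen_f j) * free_gen (Gen_e i)
    - (if i = j then free_const (1 / (qpow (d i) - qpow (- d i))) * (k_power i 1 - k_power i (- 1))
       else 0) \<in> relations"
| serre_e: "i \<noteq> j \<Longrightarrow> serre Gen_e i j \<in> relations"
| serre_f: "i \<noteq> j \<Longrightarrow> serre Gen_f i j \<in> relations"

definition relation_ideal :: "'i free_alg set" where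
  "relation_ideal = genideal univ_ring relations"

definition Uq :: "'i uq ring" where
  "Uq = univ_ring Quot relation_ideal"

lemma ideal_relation_ideal: "ideal relation_ideal univ_ring"
  unfolding relation_ideal_def
  by (rule ring.genideal_ideal[OF ring_univ_ring]) (simp add: univ_ring_def)

lemma ring_Uq: "ring Uq"
  unfolding Uq_def by (rule ideal.quotient_is_ring[OF ideal_relation_ideal])

definition proj :: "'i free_alg \<Rightarrow> 'i uq" where
  "proj x = relation_ideal +>\<^bsub>univ_ring\<^esub> x"

definition scalar :: "qfield \<Rightarrow> 'i uq" where "scalar c = proj (free_const c)"
definition Ue :: "'i \<Rightarrow> 'i uq" where "Ue i = proj (free_gen (Gen_e i))"
definition Uf :: "'i \<Rightarrow> 'i uq" where "Uf i = proj (free_gen (Gen_f i))"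
definition Ut :: "'i \<Rightarrow> 'i uq" where "Ut i = proj (free_gen (Gen_t i))"
definition Utinv :: "'i \<Rightarrow> 'i uq" where "Utinv i = proj (free_gen (Gen_tinv i))"
definition Uk :: "'i \<Rightarrow> 'i uq" where "Uk i = proj (k_power i 1)"
definition Ukinv :: "'i \<Rightarrow> 'i uq" where "Ukinv i = proj (k_power i (- 1))"

definition subalgebra_gen :: "'i uq set \<Rightarrow> 'i uq set" where
  "subalgebra_gen X = generate_ring Uq (range scalar \<union> X)"

definition U_zero :: "'i uq set" where
  "U_zero = subalgebra_gen (range Ut \<union> range Utinv)"

definition U_plus :: "'i uq set" where
  "U_plus = subalgebra_gen (range Ue)"

definition U_minus :: "'i uq set" where
  "U_minus = subalgebra_gen (range Uf)"

definition T_group :: "'i uq set" where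
  "T_group = generate Uq (range Ut)"

text \<open>
  The counit, the antipode, \<open>\<theta>\<close> and the characters \<open>q\<^sup>\<nu>\<close> are the (anti)homomorphisms of algebras with
  the prescribed values on generators; \<^const>\<open>extensional\<close> makes them unique as total functions.
\<close>

definition counit :: "'i uq \<Rightarrow> qfield" where
  "counit = (THE h. h \<in> extensional (carrier Uq) \<and> h \<in> Ring.ring_hom Uq univ_ring \<and>
    (\<forall>c. h (scalar c) = c) \<and> (\<forall>i. h (Ut i) = 1 \<and> h (Ue i) = 0 \<and> h (Uf i) = 0))"

definition antipode :: "'i uq \<Rightarrow> 'i uq" where
  "antipode = (THE h. h \<in> extensional (carrier Uq) \<and> h \<in> Ring.ring_hom Uq (opposite_ring Uq) \<and>
    (\<forall>c. h (scalar c) = scalar c) \<and>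
    (\<forall>i. h (Ut i) = Utinv i \<and> h (Ue i) = \<ominus>\<^bsub>Uq\<^esub> (Ukinv i \<otimes>\<^bsub>Uq\<^esub> Ue i) \<and> h (Uf i) = \<ominus>\<^bsub>Uq\<^esub> (Uf i \<otimes>\<^bsub>Uq\<^esub> Uk i)))"

definition theta :: "'i uq \<Rightarrow> 'i uq" where
  "theta = (THE h. h \<in> extensional (carrier Uq) \<and> h \<in> Ring.ring_hom Uq Uq \<and>
    (\<forall>c. h (scalar c) = scalar c) \<and>
    (\<forall>i. h (Ue i) = \<ominus>\<^bsub>Uq\<^esub> Uf i \<and> h (Uf i) = \<ominus>\<^bsub>Uq\<^esub> Ue i \<and> h (Ut i) = Utinv i))"

definition omega :: "'i uq \<Rightarrow> 'i uq" where
  "omega x = antipode (theta x)"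

definition qchar :: "'i weight \<Rightarrow> 'i uq \<Rightarrow> qfield" where
  "qchar \<nu> = (THE h. h \<in> extensional U_zero \<and> h \<in> Ring.ring_hom (Uq\<lparr>carrier := U_zero\<rparr>) univ_ring \<and>
    (\<forall>c. h (scalar c) = c) \<and> (\<forall>i. h (Ut i) = qpow (d i * pairing \<nu> (simple_coweight i))))"

definition U_plus_aug :: "'i uq set" where
  "U_plus_aug = {x \<in> U_plus. counit x = 0}"

definition U_minus_aug :: "'i uq set" where
  "U_minus_aug = {x \<in> U_minus. counit x = 0}"

definition proj_zero :: "'i uq \<Rightarrow> 'i uq" where
  "proj_zero x = (THE z. z \<in> U_zero \<and>
    x \<ominus>\<^bsub>Uq\<^esub> z \<in> span_mult Uq U_minus_aug (carrier Uq) <+>\<^bsub>Uq\<^esub> span_mult Uq (carrier Uq) U_plus_aug)"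

text \<open>Linear forms on tensor products are written as functions of two arguments.\<close>

definition pi_form :: "'i weight \<Rightarrow> 'i uq \<Rightarrow> 'i uq \<Rightarrow> qfield" where
  "pi_form \<nu> x y = qchar \<nu> (proj_zero (antipode x \<otimes>\<^bsub>Uq\<^esub> y))"

definition shapovalov :: "'i weight \<Rightarrow> 'i uq \<Rightarrow> 'i uq \<Rightarrow> qfield" where
  "shapovalov \<nu> x y = qchar \<nu> (proj_zero (omega x \<otimes>\<^bsub>Uq\<^esub> y))"

definition K_minus :: "'i weight \<Rightarrow> 'i uq set" where
  "K_minus \<nu> = {y \<in> U_minus. \<forall>x\<in>U_plus. pi_form \<nu> x y = 0}"

definition K_tilde :: "'i weight \<Rightarrow> 'i uq set" where
  "K_tilde \<nu> = {x \<in> U_plus. \<forall>y\<in>U_minus. pi_form \<nu> x y = 0}"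

text \<open>\<open>U_minus_weight \<beta>\<close> is \<open>U\<^sup>-[-\<beta>]\<close>.\<close>

definition U_minus_weight :: "'i weight \<Rightarrow> 'i uq set" where
  "U_minus_weight \<beta> = {y \<in> U_minus. \<forall>g\<in>T_group.
    g \<otimes>\<^bsub>Uq\<^esub> y \<otimes>\<^bsub>Uq\<^esub> inv\<^bsub>Uq\<^esub> g = scalar (qchar (- \<beta>) g) \<otimes>\<^bsub>Uq\<^esub> y}"


section \<open>Highest weight modules and the quantized function algebra\<close>

text \<open>
  \<open>verma \<nu>\<close> is the quotient of \<open>U\<close> by the left ideal generated by the \<open>e\<^sub>i\<close> and the \<open>t\<^sub>i - q\<^sup>\<nu>(t\<^sub>i)\<close>.
\<close>

definition verma_ideal :: "'i weight \<Rightarrow> 'i uq set" where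
  "verma_ideal \<nu> = span_mult Uq (carrier Uq)
    (range Ue \<union> range (\<lambda>i. Ut i \<ominus>\<^bsub>Uq\<^esub> scalar (qchar \<nu> (Ut i))))"

definition verma :: "'i weight \<Rightarrow> ('i uq, 'i uq set) module" where
  "verma \<nu> = quotient_module (regular_module Uq) (verma_ideal \<nu>)"

definition hw_vector :: "'i weight \<Rightarrow> 'i uq set" where
  "hw_vector \<nu> = verma_ideal \<nu> +>\<^bsub>Uq\<^esub> \<one>\<^bsub>Uq\<^esub>"

definition simple_module :: "'i weight \<Rightarrow> ('i uq, 'i uq set set) module" where
  "simple_module \<nu> = quotient_module (verma \<nu>) ((\<lambda>y. y \<odot>\<^bsub>verma \<nu>\<^esub> hw_vector \<nu>) ` K_minus \<nu>)"

definition linear_functional :: "('i uq, 'm, 'c) module_scheme \<Rightarrow> ('m \<Rightarrow> qfield) \<Rightarrow> bool" where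
  "linear_functional V \<phi> \<longleftrightarrow>
    (\<forall>v\<in>carrier V. \<forall>w\<in>carrier V. \<phi> (v \<oplus>\<^bsub>V\<^esub> w) = \<phi> v + \<phi> w) \<and>
    (\<forall>c. \<forall>v\<in>carrier V. \<phi> (scalar c \<odot>\<^bsub>V\<^esub> v) = c * \<phi> v)"

text \<open>Elements of the dual of \<open>U\<close> are extended by \<open>0\<close> outside the carrier of \<open>U\<close>.\<close>

definition matrix_element ::
    "('i uq, 'm, 'c) module_scheme \<Rightarrow> ('m \<Rightarrow> qfield) \<Rightarrow> 'm \<Rightarrow> 'i uq \<Rightarrow> qfield" where
  "matrix_element V \<phi> v = (\<lambda>x. if x \<in> carrier Uq then \<phi> (x \<odot>\<^bsub>V\<^esub> v) else 0)"

definition matrix_elements :: "('i uq \<Rightarrow> qfield) set" where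
  "matrix_elements = {matrix_element (simple_module \<mu>) \<phi> v | \<mu> \<phi> v.
    dominant_integral \<mu> \<and> linear_functional (simple_module \<mu>) \<phi> \<and> v \<in> carrier (simple_module \<mu>)}"

definition FG :: "('i uq \<Rightarrow> qfield) set" where
  "FG = {(\<lambda>x. \<Sum>s<n. c s * g s x) | (n :: nat) c g. \<forall>s<n. g s \<in> matrix_elements}"

definition left_action :: "'i uq \<Rightarrow> ('i uq \<Rightarrow> qfield) \<Rightarrow> 'i uq \<Rightarrow> qfield" where
  "left_action b \<phi> = (\<lambda>x. if x \<in> carrier Uq then \<phi> (x \<otimes>\<^bsub>Uq\<^esub> b) else 0)"

definition FG_module :: "('i uq, 'i uq \<Rightarrow> qfield) module" where
  "FG_module = \<lparr>carrier = FG, monoid.mult = undefined, one = undefined, ring.zero = (\<lambda>_. 0),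
    add = (\<lambda>\<phi> \<psi> x. \<phi> x + \<psi> x), smult = left_action\<rparr>"

definition FG_weight :: "'i weight \<Rightarrow> ('i uq \<Rightarrow> qfield) set" where
  "FG_weight \<mu> = {\<phi> \<in> FG. \<forall>g\<in>T_group. left_action g \<phi> = (\<lambda>x. qchar \<mu> g * \<phi> x)}"

definition FG_invariants :: "'i uq set \<Rightarrow> ('i uq \<Rightarrow> qfield) set" where
  "FG_invariants K = {\<phi> \<in> FG_weight 0. \<forall>b\<in>K. left_action b \<phi> = (\<lambda>_. 0)}"


section \<open>\<open>J\<close>-regularity\<close>

definition generic :: "'i weight \<Rightarrow> bool" where
  "generic \<nu> \<longleftrightarrow> (\<forall>\<beta>\<in>pos_roots. pairing (\<nu> + rho) (coroot \<beta>) \<notin> pos_nats)"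

definition weight_bases :: "('i weight \<Rightarrow> 'i uq list) \<Rightarrow> bool" where
  "weight_bases y \<longleftrightarrow> (\<forall>\<beta>\<in>Q_plus.
    ring.independent Uq (range scalar) (y \<beta>) \<and>
    ring.Span Uq (range scalar) (y \<beta>) = U_minus_weight \<beta>)"

definition gram :: "'i weight \<Rightarrow> 'i uq list \<Rightarrow> qfield mat" where
  "gram \<nu> ys = mat (length ys) (length ys) (\<lambda>(i, j). shapovalov \<nu> (ys ! i) (ys ! j))"

text \<open>
  A representative of \<open>J(\<nu>)\<^sup>M (m \<otimes> \<phi>)\<close> for generic \<open>\<nu>\<close>. The sum is restricted to those \<open>\<beta>\<close> for which
  some \<open>\<theta>(y\<^sub>\<beta>\<^sup>j)\<close> acts nontrivially on \<open>\<phi>\<close>; all other \<open>\<beta>\<close> contribute \<open>0\<close>.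
\<close>

definition J_apply ::
    "('i weight \<Rightarrow> 'i uq list) \<Rightarrow> ('i uq, 'm, 'c) module_scheme \<Rightarrow> 'i weight \<Rightarrow>
     'm \<Rightarrow> ('i uq \<Rightarrow> qfield) \<Rightarrow> ('m \<times> ('i uq \<Rightarrow> qfield) \<Rightarrow>\<^sub>0 qfield)" where
  "J_apply y M \<nu> m \<phi> =
    (\<Sum>\<beta>\<in>{\<beta> \<in> Q_plus. \<exists>x\<in>set (y \<beta>). left_action (theta x) \<phi> \<noteq> (\<lambda>_. 0)}.
      \<Sum>i<length (y \<beta>). \<Sum>j<length (y \<beta>).
        Poly_Mapping.single (y \<beta> ! i \<odot>\<^bsub>M\<^esub> m, left_action (theta (y \<beta> ! j)) \<phi>)
          (the (mat_inverse (gram \<nu> (y \<beta>))) $$ (i, j)))"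

text \<open>
  A family \<open>X \<nu>\<close> of elements of the tensor product of \<open>M\<close> and \<open>FG\<close>, defined for generic \<open>\<nu>\<close>, is
  regular at \<open>\<nu>\<^sub>0\<close> if it consists of the values at \<open>q\<^sup>\<nu>\<close> of some \<open>\<Sum> (g s / h) (m s \<otimes> \<phi> s)\<close> where the
  fractions \<open>g s / h\<close> lie in the localization of \<open>U\<^sup>0\<close> at the kernel of \<open>qchar \<nu>\<^sub>0\<close>. The points \<open>q\<^sup>\<nu>\<close>
  with \<open>\<nu>\<close> generic are Zariski dense in the spectrum of \<open>U\<^sup>0\<close>, so these values determine the
  rational function.
\<close>

definition regular_at ::
    "('i uq, 'm, 'c) module_scheme \<Rightarrow> 'i weight \<Rightarrow>
     ('i weight \<Rightarrow> ('m \<times> ('i uq \<Rightarrow> qfield) \<Rightarrow>\<^sub>0 qfield)) \<Rightarrow> bool" where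
  "regular_at M \<nu>\<^sub>0 X \<longleftrightarrow> (\<exists>(n :: nat) g h ms \<phi>s.
    (\<forall>s<n. g s \<in> U_zero \<and> ms s \<in> carrier M \<and> \<phi>s s \<in> FG) \<and>
    h \<in> U_zero \<and> qchar \<nu>\<^sub>0 h \<noteq> 0 \<and>
    (\<forall>\<nu>. generic \<nu> \<and> qchar \<nu> h \<noteq> 0 \<longrightarrow>
      tensor_class scalar M FG_module (X \<nu>) =
      tensor_class scalar M FG_module
        (\<Sum>s<n. Poly_Mapping.single (ms s, \<phi>s s) (qchar \<nu> (g s) / qchar \<nu> h))))"

text \<open>
  The type argument is the type of the elements of the modules \<open>M\<close> over which the definition
  quantifies. The spaces \<open>U\<^sup>-[-\<beta>]\<close> are finite-dimensional, and \<open>J(\<nu>)\<close> does not depend on the choice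
  of their bases \<open>y\<close>.
\<close>

definition J_regular :: "'m itself \<Rightarrow> 'i weight \<Rightarrow> bool" where
  "J_regular TYPE('m) \<nu>\<^sub>0 \<longleftrightarrow>
    (\<forall>y. weight_bases y \<longrightarrow>
      (\<forall>M :: ('i uq, 'm) module. left_module (Uq\<lparr>carrier := U_minus\<rparr>) M \<longrightarrow>
        (\<forall>m\<in>carrier M. \<forall>\<phi>\<in>FG_invariants (K_tilde \<nu>\<^sub>0).
          regular_at M \<nu>\<^sub>0 (\<lambda>\<nu>. J_apply y M \<nu> m \<phi>))))"

end

end

theory Submission
  imports Defs "Jordan_Normal_Form.Determinant"
begin

hide_type (open) Matrix.vec
no_notation Matrix.vec_index (infixl "$" 100)

text \<open>
  For generic \<open>\<nu>\<close> write \<open>J(\<nu>) (m \<otimes> \<phi>) = \<Sum>\<^sub>\<beta> \<Sum>\<^sub>i y\<^sub>\<beta>\<^sup>i m \<otimes> \<psi>\<^sub>\<beta>\<^sup>i(\<nu>)\<close>. The operators \<open>e\<^sub>k\<close> of the Verma module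
  \<open>M(\<nu>)\<close> provide a linear system for the \<open>\<psi>\<^sub>\<beta>\<^sup>i\<close> whose coefficients are regular functions of \<open>q\<^sup>\<nu>\<close> and whose
  right-hand side consists of multiples of the functions \<open>e\<^sub>k \<psi>\<close> with \<open>\<psi>\<close> of weight \<open>\<beta> - \<alpha>\<^sub>k\<close>. At \<open>\<nu>\<^sub>0\<close> the
  system is injective unless \<open>M(\<nu>\<^sub>0)\<close> contains a singular vector of weight \<open>\<nu>\<^sub>0 - \<beta>\<close>; if it is injective,
  regularity of the \<open>\<psi>\<^sub>\<beta>\<^sup>i\<close> follows from that for smaller \<open>\<beta>\<close>.

  Singular vectors are transported by simple reflections to smaller weights. This descent shows that generic
  Verma modules are irreducible, and that for \<open>\<beta> \<noteq> 0\<close> a singular vector of weight \<open>\<nu>\<^sub>0 - \<beta>\<close> forces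
  \<open>\<beta> \<in> Span \<Gamma>\<close> and \<open>|\<nu>\<^sub>0 + \<rho> - \<beta>| = |\<nu>\<^sub>0 + \<rho>|\<close>. Such a weight does not occur in the quotient of
  \<open>M(\<nu>\<^sub>0)\<close> by the vectors \<open>f\<^sub>i\<^bsup>n\<^sub>i\<^esup>\<close> with \<open>n\<^sub>i = \<langle>\<nu>\<^sub>0 + \<rho>, \<alpha>\<^sub>i\<^sup>\<vee>\<rangle>\<close>, \<open>\<alpha>\<^sub>i \<in> \<Gamma>\<close>, because the quotient is integrable
  in these directions. So \<open>U\<^sup>-[-\<beta>]\<close> lies in the left ideal generated by the \<open>f\<^sub>i\<^bsup>n\<^sub>i\<^esup>\<close>, and \<open>\<psi>\<^sub>\<beta>\<^sup>i = 0\<close>, since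
  \<open>e\<^sub>i\<^bsup>n\<^sub>i\<^esup>\<close> annihilates \<open>\<phi>\<close>.

  Verma modules are realised on the free algebra in the \<open>f\<^sub>i\<close> modulo the ideal of the Serre relations, where
  \<open>e\<^sub>j\<close> acts by a combination of two skew derivations.
\<close>

text \<open>A pole of J at \<open>\<nu>\<^sub>0\<close> stems from degenerate Shapovalov forms, and
  inverting Gram matrices directly would require the exact vanishing order of their minors. The
  equations given by the \<open>e\<^sub>k\<close> need less: lower weights enter only through
  coefficients already known to be regular, so a step can fail only for a singular vector of weight
  exactly \<open>\<nu>\<^sub>0 - \<beta>\<close>. The transport of singular vectors rests on one
  formula. Let y be singular in M(\<nu>) of weight \<nu> - \<gamma>, let p = \<langle>\<nu> +
  \<rho>, \<alpha>_i^\<vee>\<rangle> and r = p - \<langle>\<gamma>, \<alpha>_i^\<vee>\<rangle>.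
  Formally f_i^r y f_i^(-p) is singular for the reflected highest weight. By the Serre relations the
  powers of f_i satisfy the Ore conditions, which gives negative exponents a meaning; and y f_i^m
  depends on m through exponentials q^(em), which can be interpolated to nonintegral p. If p > 0 >
  r, the vector f_i^r y is used instead and \<nu> stays fixed. Reflections preserve lengths, so the
  descent also yields the equality of norms that a Casimir element would give.\<close>

lemma qpow_0 [simp]: "qpow 0 = 1"
  by (simp add: qpow_def One_fract_def)

lemma qpow_add: "qpow (r + s) = qpow r * qpow s"
  by (simp add: qpow_def mult_single)

lemma qpow_mult_minus [simp]: "qpow r * qpow (- r) = 1" "qpow (- r) * qpow r = 1"
  by (simp_all flip: qpow_add)

lemma qpow_nonzero [simp]: "qpow r \<noteq> 0"
  using qpow_mult_minus(1)[of r] by (metis mult_zero_left zero_neq_one)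

lemma qpow_minus: "qpow (- r) = inverse (qpow r)"
  using qpow_mult_minus(1)[of r] by (metis inverse_unique)

lemma qpow_diff: "qpow (r - s) = qpow r / qpow s"
  using qpow_add[of r "- s"] by (simp add: qpow_minus divide_inverse)

lemma qpow_inj [simp]: "qpow r = qpow s \<longleftrightarrow> r = s"
  by (auto simp: qpow_def eq_fract dest!: arg_cong[where f = "\<lambda>x. Poly_Mapping.lookup x r"]
        simp: lookup_single when_def split: if_splits)

lemma qpow_eq_1 [simp]: "qpow r = 1 \<longleftrightarrow> r = 0"
  using qpow_inj[of r 0] by simp

lemma qpow_power: "qpow r ^ n = qpow (of_nat n * r)"
  by (induction n) (simp_all add: qpow_add algebra_simps)

section \<open>Symmetric q-numbers with rational argument\<close>

definition bracket :: "rat \<Rightarrow> rat \<Rightarrow> qfield" where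
  "bracket \<delta> x = (qpow (x * \<delta>) - qpow (- (x * \<delta>))) / (qpow \<delta> - qpow (- \<delta>))"

lemma bracket_eq_0 [simp]: "\<delta> \<noteq> 0 \<Longrightarrow> bracket \<delta> x = 0 \<longleftrightarrow> x = 0"
  by (auto simp: bracket_def)

lemma bracket_0 [simp]: "bracket \<delta> 0 = 0"
  by (simp add: bracket_def)

lemma bracket_minus: "bracket \<delta> (- x) = - bracket \<delta> x"
  by (simp add: bracket_def diff_divide_distrib)

text \<open>With x = n + 1 and y = h - n this becomes [n+1][h-n] - [n][h-n-1] = [h], the step from n
  to n + 1 in the commutator of e_i with f_i^n. After clearing denominators the difference of the
  two sides is a multiple of 1 - u v, which is 0.\<close>

lemma bracket_mult_diff:
  assumes "\<delta> \<noteq> 0"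
  shows "bracket \<delta> x * bracket \<delta> y - bracket \<delta> (x - 1) * bracket \<delta> (y - 1) = bracket \<delta> (x + y - 1)"
proof -
  define A B C D where "A = qpow (x * \<delta>)" "B = qpow (- (x * \<delta>))" "C = qpow (y * \<delta>)" "D = qpow (- (y * \<delta>))"
  define u v where "u = qpow \<delta>" "v = qpow (- \<delta>)"
  have uv: "u * v = 1" "u - v \<noteq> 0" using assms by (simp_all add: u_v_def)
  have *: "qpow ((x - 1) * \<delta>) = A * v" "qpow (- ((x - 1) * \<delta>)) = B * u"
    "qpow ((y - 1) * \<delta>) = C * v" "qpow (- ((y - 1) * \<delta>)) = D * u"
    "qpow ((x + y - 1) * \<delta>) = A * C * v" "qpow (- ((x + y - 1) * \<delta>)) = B * D * u"
    unfolding A_B_C_D_def u_v_def by (simp_all flip: qpow_add add: algebra_simps)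
  have "(A - B) * (C - D) - (A * v - B * u) * (C * v - D * u) = (A * C * v - B * D * u) * (u - v)"
  proof -
    have "(A - B) * (C - D) - (A * v - B * u) * (C * v - D * u) - (A * C * v - B * D * u) * (u - v)
      = (1 - u * v) * (A * C + B * D - A * D - B * C)"
      by (simp add: algebra_simps)
    then show ?thesis using uv(1) by simp
  qed
  moreover have "X / w * (Y / w) - X' / w * (Y' / w) = Z / w"
    if "X * Y - X' * Y' = Z * w" "w \<noteq> 0" for X Y X' Y' Z w :: qfield
  proof -
    have "X / w * (Y / w) - X' / w * (Y' / w) = (X * Y - X' * Y') / (w * w)"
      by (simp add: diff_divide_distrib)
    then show ?thesis using that by simp
  qed
  ultimately show ?thesis
    using uv(2) unfolding bracket_def * A_B_C_D_def[symmetric] u_v_def[symmetric] by blast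
qed

text \<open>Dedekind's argument: the relation at \<open>cmp x y\<close> minus \<open>ch e0 y\<close>
  times the relation at x no longer involves \<open>e0\<close>. Everything is taken modulo a
  subspace N, because one application has values in the free algebra modulo
  \<open>serre_ideal\<close>; the other takes N = {0}.\<close>

lemma independence_of_characters:
  fixes ch :: "'s \<Rightarrow> 'm \<Rightarrow> 'k::field" and v :: "'s \<Rightarrow> 'v::ab_group_add"
  assumes "finite S"
    and scale: "\<And>c x. x \<in> N \<Longrightarrow> s c x \<in> N" "\<And>c x y. s c (x + y) = s c x + s c y"
      "\<And>b c x. s (b - c) x = s b x - s c x" "\<And>b c x. s b (s c x) = s (b * c) x" "\<And>x. s 1 x = x"
    and N: "0 \<in> N" "\<And>x y. x \<in> N \<Longrightarrow> y \<in> N \<Longrightarrow> x - y \<in> N"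
    and mult: "\<And>e x y. e \<in> S \<Longrightarrow> ch e (cmp x y) = ch e x * ch e y"
    and distinct: "\<And>e e'. e \<in> S \<Longrightarrow> e' \<in> S \<Longrightarrow> e \<noteq> e' \<Longrightarrow> \<exists>x. ch e x \<noteq> ch e' x"
    and nonzero: "\<And>e. e \<in> S \<Longrightarrow> \<exists>x. ch e x \<noteq> 0"
    and vanish: "\<And>x. (\<Sum>e\<in>S. s (ch e x) (v e)) \<in> N"
  shows "\<forall>e\<in>S. v e \<in> N"
  using assms(1) mult distinct nonzero vanish
proof (induction S arbitrary: v rule: finite_induct)
  case empty
  then show ?case by simp
next
  case (insert e0 S)
  have s0: "s c 0 = 0" for c using scale(2)[of c 0 0] by simp
  have smin: "s c (- x) = - s c x" for c x
    using scale(2)[of c x "- x"] by (simp add: s0 eq_neg_iff_add_eq_0 add.commute)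
  have sdiff: "s c (x - z) = s c x - s c z" for c x z
    using scale(2)[of c x "- z"] by (simp add: smin)
  have ssum: "s c (sum f A) = (\<Sum>a\<in>A. s c (f a))" for c f A
    by (induction A rule: infinite_finite_induct) (simp_all add: s0 scale(2))
  have part: "\<forall>e\<in>S. s (ch e y - ch e0 y) (v e) \<in> N" for y
  proof (rule insert.IH)
    fix x
    have "(\<Sum>e\<in>insert e0 S. s (ch e (cmp x y)) (v e)) - s (ch e0 y) (\<Sum>e\<in>insert e0 S. s (ch e x) (v e)) \<in> N"
      by (intro N(2) insert.prems(4) scale(1))
    also have "(\<Sum>e\<in>insert e0 S. s (ch e (cmp x y)) (v e)) - s (ch e0 y) (\<Sum>e\<in>insert e0 S. s (ch e x) (v e))
      = (\<Sum>e\<in>insert e0 S. s (ch e x) (s (ch e y - ch e0 y) (v e)))"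
      unfolding ssum sum_subtractf[symmetric]
      by (rule sum.cong) (simp_all add: scale(3,4) insert.prems(1) sdiff right_diff_distrib mult.commute)
    also have "\<dots> = (\<Sum>e\<in>S. s (ch e x) (s (ch e y - ch e0 y) (v e)))"
      using insert.hyps scale(3)[of 0 0] by (simp add: s0)
    finally show "(\<Sum>e\<in>S. s (ch e x) (s (ch e y - ch e0 y) (v e))) \<in> N" .
  qed (use insert.prems in auto)
  have S: "v e \<in> N" if e: "e \<in> S" for e
  proof -
    have "e \<noteq> e0" using e insert.hyps(2) by auto
    then obtain y where "ch e y \<noteq> ch e0 y" using insert.prems(2)[of e e0] e by blast
    then have "v e = s (1 / (ch e y - ch e0 y)) (s (ch e y - ch e0 y) (v e))"
      by (simp add: scale(4,5))
    then show ?thesis using part[of y] e scale(1) by metis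
  qed
  have Nadd: "x + y \<in> N" if "x \<in> N" "y \<in> N" for x y
    using N(2)[OF that(1) N(2)[OF N(1) that(2)]] by simp
  obtain y where y: "ch e0 y \<noteq> 0" using insert.prems(3) by auto
  have sum_N: "(\<Sum>e\<in>S. s (ch e y) (v e)) \<in> N"
    using S by (induction S rule: infinite_finite_induct) (simp_all add: N(1) Nadd scale(1))
  have "s (ch e0 y) (v e0) = (\<Sum>e\<in>insert e0 S. s (ch e y) (v e)) - (\<Sum>e\<in>S. s (ch e y) (v e))"
    using insert.hyps by simp
  then have "s (ch e0 y) (v e0) \<in> N" using N(2)[OF insert.prems(4) sum_N] by metis
  then have "s (1 / ch e0 y) (s (ch e0 y) (v e0)) \<in> N" by (rule scale(1))
  then have "v e0 \<in> N" using y by (simp add: scale(4,5))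
  then show ?case using S by simp
qed

section \<open>Free algebras and their representations\<close>

lemma pm_induct [case_names single add]:
  fixes x :: "'g \<Rightarrow>\<^sub>0 'k::comm_monoid_add"
  assumes "\<And>w c. P (Poly_Mapping.single w c)" and "\<And>x y. P x \<Longrightarrow> P y \<Longrightarrow> P (x + y)"
  shows "P x"
proof -
  have "P (\<Sum>w\<in>A. Poly_Mapping.single w (Poly_Mapping.lookup x w))" if "finite A" for A
    using that assms(1)[of _ 0] by (induction A rule: finite_induct) (auto intro: assms)
  moreover have "x = (\<Sum>w\<in>Poly_Mapping.keys x. Poly_Mapping.single w (Poly_Mapping.lookup x w))"
    by (rule poly_mapping_eqI) (simp add: lookup_sum lookup_single when_def in_keys_iff sum.delta)
  ultimately show ?thesis by (metis finite_keys)
qed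

type_synonym 'g falg = "'g list \<Rightarrow>\<^sub>0 qfield"

definition word :: "'g list \<Rightarrow> 'g falg" where "word w = Poly_Mapping.single w 1"
definition const :: "qfield \<Rightarrow> 'g falg" where "const c = Poly_Mapping.single [] c"

lemma word_Nil [simp]: "word [] = 1"
  by (metis word_def zero_list_def single_one)

lemma word_append: "word (u @ v) = word u * word v"
  by (metis mult_single word_def plus_list_def mult_1)

lemma word_Cons: "word (x # v) = word [x] * word v"
  using word_append[of "[x]" v] by simp

lemma single_eq_const_word: "Poly_Mapping.single w c = const c * word w"
  by (simp add: const_def word_def mult_single plus_list_def)

lemma const_0 [simp]: "const 0 = 0"
  by (simp add: const_def)

lemma lookup_const_mult [simp]: "Poly_Mapping.lookup (const c * x) w = c * Poly_Mapping.lookup x w"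
  by (induction x rule: pm_induct)
    (simp_all add: const_def mult_single plus_list_def lookup_single when_def distrib_left lookup_add)

text \<open>The computations with q-Serre elements are needed both for elements of a free algebra
  and for operators on it; abstracting from the algebra lets them be done once. The interpretations
  \<open>fa\<close>, \<open>li\<close> and \<open>qf\<close> are the free algebra, its linear
  endomorphisms and the ground field.\<close>

locale algebra_over_qfield =
  fixes cst :: "qfield \<Rightarrow> 'r::ring_1"
  assumes cst_add: "cst (b + c) = cst b + cst c"
    and cst_mult: "cst (b * c) = cst b * cst c"
    and cst_1: "cst 1 = 1"
    and cst_central: "cst c * x = x * cst c"
begin

definition sc :: "qfield \<Rightarrow> 'r \<Rightarrow> 'r" where "sc c x = cst c * x"

lemma cst_0: "cst 0 = 0"
  using cst_add[of 0 0] by simp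

lemma cst_minus: "cst (- c) = - cst c"
  using cst_add[of c "- c"] by (simp add: cst_0 eq_neg_iff_add_eq_0 add.commute)

lemma cst_diff: "cst (b - c) = cst b - cst c"
  using cst_add[of b "- c"] by (simp add: cst_minus)

lemma sc_add: "sc (b + c) x = sc b x + sc c x"
  by (simp add: sc_def cst_add distrib_right)
lemma sc_diff: "sc (b - c) x = sc b x - sc c x"
  by (simp add: sc_def cst_diff left_diff_distrib)
lemma sc_minus: "sc (- c) x = - sc c x"
  by (simp add: sc_def cst_minus)
lemma sc_0 [simp]: "sc 0 x = 0" "sc c 0 = 0"
  by (simp_all add: sc_def cst_0 cst_1)
lemma sc_1 [simp]: "sc 1 x = x"
  by (simp add: sc_def cst_1)
lemma sc_sc [simp]: "sc b (sc c x) = sc (b * c) x"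
  by (simp add: sc_def cst_mult mult.assoc)
lemma sc_mult_left [simp]: "sc c x * y = sc c (x * y)"
  by (simp add: sc_def mult.assoc)
lemma sc_mult_right [simp]: "x * sc c y = sc c (x * y)"
  by (simp add: sc_def cst_central mult.assoc)
lemma sc_plus: "sc c (x + y) = sc c x + sc c y"
  by (simp add: sc_def distrib_left)
lemma sc_minus_right: "sc c (x - y) = sc c x - sc c y"
  by (simp add: sc_def right_diff_distrib)
lemma sc_uminus: "sc c (- x) = - sc c x"
  by (simp add: sc_def)
lemma sc_sum: "sc c (sum f A) = (\<Sum>a\<in>A. sc c (f a))"
  by (simp add: sc_def sum_distrib_left)
lemma cst_eq_sc: "cst c = sc c 1"
  by (simp add: sc_def)

definition ev :: "('g \<Rightarrow> 'r) \<Rightarrow> 'g falg \<Rightarrow> 'r" where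
  "ev g x = (\<Sum>w\<in>Poly_Mapping.keys x. sc (Poly_Mapping.lookup x w) (prod_list (map g w)))"

lemma ev_superset:
  assumes "finite A" "Poly_Mapping.keys x \<subseteq> A"
  shows "ev g x = (\<Sum>w\<in>A. sc (Poly_Mapping.lookup x w) (prod_list (map g w)))"
  unfolding ev_def by (rule sum.mono_neutral_left) (use assms in \<open>auto simp: in_keys_iff\<close>)

lemma ev_add [simp]: "ev g (x + y) = ev g x + ev g y"
proof -
  have "ev g z = (\<Sum>w\<in>Poly_Mapping.keys x \<union> Poly_Mapping.keys y. sc (Poly_Mapping.lookup z w) (prod_list (map g w)))"
    if "z \<in> {x, y, x + y}" for z
    by (rule ev_superset) (use that keys_add[of x y] in auto)
  then show ?thesis by (simp add: lookup_add sc_add sum.distrib)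
qed

lemma ev_0 [simp]: "ev g 0 = 0"
  by (simp add: ev_def)

lemma ev_minus [simp]: "ev g (- x) = - ev g x"
  using ev_add[of g x "- x"] by (simp add: eq_neg_iff_add_eq_0 add.commute)

lemma ev_diff [simp]: "ev g (x - y) = ev g x - ev g y"
  using ev_add[of g x "- y"] by simp

lemma ev_sum: "ev g (sum f A) = (\<Sum>a\<in>A. ev g (f a))"
  by (induction A rule: infinite_finite_induct) simp_all

lemma ev_single [simp]: "ev g (Poly_Mapping.single w c) = sc c (prod_list (map g w))"
  by (simp add: ev_def)

lemma ev_word [simp]: "ev g (word w) = prod_list (map g w)"
  by (simp add: word_def)

lemma ev_const [simp]: "ev g (const c) = cst c"
  by (simp add: const_def cst_eq_sc)

lemma ev_mult [simp]: "ev g (x * y) = ev g x * ev g y"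
proof (induction x rule: pm_induct)
  case (single w c)
  show ?case
    by (induction y rule: pm_induct) (simp_all add: mult_single plus_list_def distrib_left mult.commute)
qed (simp add: distrib_right)

lemma ev_1 [simp]: "ev g 1 = 1"
  using ev_word[of g "[]"] by simp

lemma ev_power [simp]: "ev g (x ^ n) = ev g x ^ n"
  by (induction n) simp_all

end

global_interpretation fa: algebra_over_qfield const
  defines fa_sc = fa.sc and fa_ev = fa.ev
proof
  show "const c * x = x * const c" for c and x :: "'g falg"
    by (induction x rule: pm_induct)
      (simp_all add: const_def mult_single plus_list_def distrib_left distrib_right mult.commute)
qed (simp_all add: const_def single_add mult_single plus_list_def word_Nil[unfolded word_def])

global_interpretation qf: algebra_over_qfield "\<lambda>c. c"
  defines qf_sc = qf.sc and qf_ev = qf.ev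
  by standard (simp_all add: algebra_simps)

section \<open>Quantum Serre relations\<close>

definition qfact :: "rat \<Rightarrow> nat \<Rightarrow> qfield" where
  "qfact \<delta> n = (\<Prod>s = 1..n. bracket \<delta> (of_nat s))"

lemma qfact_0 [simp]: "qfact \<delta> 0 = 1"
  by (simp add: qfact_def)

lemma qfact_Suc: "qfact \<delta> (Suc n) = bracket \<delta> (of_nat (Suc n)) * qfact \<delta> n"
  by (simp add: qfact_def)

lemma qfact_nonzero [simp]: "\<delta> \<noteq> 0 \<Longrightarrow> qfact \<delta> n \<noteq> 0"
  by (simp add: qfact_def)

definition qbinom :: "rat \<Rightarrow> nat \<Rightarrow> nat \<Rightarrow> qfield" where
  "qbinom \<delta> n m = (if m \<le> n then qfact \<delta> n / (qfact \<delta> m * qfact \<delta> (n - m)) else 0)"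

lemma bracket_split:
  "qpow (\<delta> * y) * bracket \<delta> (x + y) = bracket \<delta> x + qpow (\<delta> * (x + y)) * bracket \<delta> y"
proof -
  have "qpow (\<delta> * y) * (qpow ((x + y) * \<delta>) - qpow (- ((x + y) * \<delta>)))
    = (qpow (x * \<delta>) - qpow (- (x * \<delta>))) + qpow (\<delta> * (x + y)) * (qpow (y * \<delta>) - qpow (- (y * \<delta>)))"
    unfolding right_diff_distrib qpow_add[symmetric] by (simp add: algebra_simps)
  then show ?thesis unfolding bracket_def times_divide_eq_right add_divide_distrib[symmetric] by simp
qed

text \<open>The q-Pascal rule for symmetric Gaussian binomials, in the one-sided normalisation that
  matches the recursion of \<open>adq\<close>. For m < n it is \<open>bracket_split\<close> for the
  decomposition n + 1 = (k + 1) + (m + 1), divided by q-factorials.\<close>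

lemma qbinom_Suc_Suc:
  assumes "\<delta> \<noteq> 0"
  shows "qpow (\<delta> * (of_nat m + 1)) * qbinom \<delta> (Suc n) (Suc m)
    = qbinom \<delta> n (Suc m) + qpow (\<delta> * (of_nat n + 1)) * qbinom \<delta> n m"
proof -
  consider "m > n" | "m = n" | "m < n" by linarith
  then show ?thesis
  proof cases
    case 3
    then obtain k where k: "n = m + Suc k" using less_imp_add_positive by (metis add_Suc_right less_natE)
    have *: "qpow (\<delta> * (of_nat m + 1)) * bracket \<delta> (of_nat (Suc n))
      = bracket \<delta> (of_nat (Suc k)) + qpow (\<delta> * (of_nat n + 1)) * bracket \<delta> (of_nat (Suc m))"
      using bracket_split[of \<delta> "of_nat (Suc m)" "of_nat (Suc k)"] k by (simp add: algebra_simps)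
    have ne: "bracket \<delta> (of_nat (Suc k)) \<noteq> 0" "bracket \<delta> (of_nat (Suc m)) \<noteq> 0"
      using assms by (simp_all del: of_nat_Suc)
    have "qpow (\<delta> * (of_nat m + 1)) * qbinom \<delta> (Suc n) (Suc m)
      = qpow (\<delta> * (of_nat m + 1)) * bracket \<delta> (of_nat (Suc n)) *
        (qfact \<delta> n / (qfact \<delta> (Suc m) * qfact \<delta> (Suc k)))"
      unfolding qbinom_def qfact_Suc[of _ n] using k by (simp del: of_nat_Suc)
    also have "\<dots> = bracket \<delta> (of_nat (Suc k)) * (qfact \<delta> n / (qfact \<delta> (Suc m) * qfact \<delta> (Suc k)))
      + qpow (\<delta> * (of_nat n + 1)) * (bracket \<delta> (of_nat (Suc m)) * (qfact \<delta> n / (qfact \<delta> (Suc m) * qfact \<delta> (Suc k))))"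
      unfolding * by (simp add: algebra_simps)
    also have "bracket \<delta> (of_nat (Suc k)) * (qfact \<delta> n / (qfact \<delta> (Suc m) * qfact \<delta> (Suc k))) = qbinom \<delta> n (Suc m)"
      using k ne assms by (simp add: qbinom_def qfact_Suc[of _ k] del: of_nat_Suc)
    also have "bracket \<delta> (of_nat (Suc m)) * (qfact \<delta> n / (qfact \<delta> (Suc m) * qfact \<delta> (Suc k))) = qbinom \<delta> n m"
      using k ne assms by (simp add: qbinom_def qfact_Suc[of _ m] del: of_nat_Suc)
    finally show ?thesis .
  qed (use assms in \<open>auto simp: qbinom_def\<close>)
qed

lemma qbinom_0 [simp]: "\<delta> \<noteq> 0 \<Longrightarrow> qbinom \<delta> n 0 = 1"
  by (simp add: qbinom_def)

context algebra_over_qfield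
begin

text \<open>\<open>adq s x z n = \<Prod>\<^sub>k\<^sub><\<^sub>n (R - s\<^sub>k L) z\<close>, where \<open>L\<close> and \<open>R\<close> are the multiplications by \<open>x\<close>.\<close>

primrec adq :: "(nat \<Rightarrow> qfield) \<Rightarrow> 'r \<Rightarrow> 'r \<Rightarrow> nat \<Rightarrow> 'r" where
  "adq s x z 0 = z"
| "adq s x z (Suc k) = adq s x z k * x - sc (s k) (x * adq s x z k)"

text \<open>The q-binomial theorem: L and R commute and the factors \<open>s k\<close> form a
  geometric progression with ratio q^(2\<delta>), so their elementary symmetric functions are
  Gaussian binomials times powers of q.\<close>

lemma adq_expand:
  assumes "\<delta> \<noteq> 0" and s: "s = (\<lambda>k. qpow (\<delta> * (t + 2 * of_nat k)))"
  shows "adq s x z j = (\<Sum>m\<le>j. sc ((- 1) ^ m * qpow (\<delta> * of_nat m * (t + of_nat j - 1)) * qbinom \<delta> j m)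
    (x ^ m * z * x ^ (j - m)))"
proof (induction j)
  case 0
  then show ?case using assms(1) by simp
next
  case (Suc j)
  define c where "c j m = (- 1) ^ m * qpow (\<delta> * of_nat m * (t + of_nat j - 1)) * qbinom \<delta> j m" for j m
  define T where "T m = x ^ m * z * x ^ (Suc j - m)" for m
  have rec: "c (Suc j) (Suc m) = c j (Suc m) - s j * c j m" for m
  proof -
    have e1: "qpow (\<delta> * of_nat (Suc m) * (t + of_nat (Suc j) - 1))
      = qpow (\<delta> * of_nat (Suc m) * (t + of_nat j - 1)) * qpow (\<delta> * (of_nat m + 1))"
      by (simp flip: qpow_add) (simp add: algebra_simps)
    have e2: "qpow (\<delta> * of_nat (Suc m) * (t + of_nat j - 1)) * qpow (\<delta> * (of_nat j + 1))
      = s j * qpow (\<delta> * of_nat m * (t + of_nat j - 1))"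
      unfolding s by (simp flip: qpow_add) (simp add: algebra_simps)
    have "c (Suc j) (Suc m) = (- 1) ^ Suc m * qpow (\<delta> * of_nat (Suc m) * (t + of_nat j - 1)) *
      (qpow (\<delta> * (of_nat m + 1)) * qbinom \<delta> (Suc j) (Suc m))"
      unfolding c_def e1 by (simp only: mult.assoc)
    also have "\<dots> = c j (Suc m) + (- 1) ^ Suc m *
      (qpow (\<delta> * of_nat (Suc m) * (t + of_nat j - 1)) * qpow (\<delta> * (of_nat j + 1))) * qbinom \<delta> j m"
      unfolding qbinom_Suc_Suc[OF assms(1)] c_def by (simp only: algebra_simps)
    also have "\<dots> = c j (Suc m) - s j * c j m"
      unfolding e2 c_def by (simp add: algebra_simps)
    finally show ?thesis .
  qed
  have c0: "c (Suc j) 0 = c j 0" using assms(1) by (simp add: c_def)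
  have top: "c j (Suc j) = 0" by (simp add: c_def qbinom_def)
  have IH: "adq s x z j = (\<Sum>m\<le>j. sc (c j m) (x ^ m * z * x ^ (j - m)))"
    using Suc.IH unfolding c_def .
  have "adq s x z j * x = (\<Sum>m\<le>j. sc (c j m) (T m))"
    unfolding IH sum_distrib_right T_def
    by (rule sum.cong) (simp_all add: mult.assoc Suc_diff_le flip: power_Suc2)
  also have "\<dots> = (\<Sum>m\<le>Suc j. sc (c j m) (T m))" using top by simp
  also have "\<dots> = sc (c j 0) (T 0) + (\<Sum>m\<le>j. sc (c j (Suc m)) (T (Suc m)))"
    by (rule sum.atMost_Suc_shift)
  finally have 1: "adq s x z j * x = sc (c j 0) (T 0) + (\<Sum>m\<le>j. sc (c j (Suc m)) (T (Suc m)))" .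
  have 2: "sc (s j) (x * adq s x z j) = (\<Sum>m\<le>j. sc (s j * c j m) (T (Suc m)))"
    unfolding IH sum_distrib_left sc_sum T_def
    by (rule sum.cong) (simp_all add: mult.assoc)
  have "adq s x z (Suc j) = sc (c (Suc j) 0) (T 0) + (\<Sum>m\<le>j. sc (c (Suc j) (Suc m)) (T (Suc m)))"
    unfolding adq.simps 1 2 rec c0 sc_diff sum_subtractf by (simp add: algebra_simps)
  also have "\<dots> = (\<Sum>m\<le>Suc j. sc (c (Suc j) m) (T m))"
    by (rule sum.atMost_Suc_shift[symmetric])
  finally show ?case unfolding c_def T_def .
qed

text \<open>For t = 1 - n and j = n the exponent t + j - 1 in \<open>adq_expand\<close> is 0, so
  only signs and Gaussian binomials remain. The Serre element thus becomes a product of factors R -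
  s_k L applied to z.\<close>

lemma serre_eq_adq:
  assumes "\<delta> \<noteq> 0"
  shows "(\<Sum>m = 0..n. cst ((- 1) ^ m / (qfact \<delta> m * qfact \<delta> (n - m))) * x ^ m * z * x ^ (n - m))
    = sc (1 / qfact \<delta> n) (adq (\<lambda>k. qpow (\<delta> * (1 - of_nat n + 2 * of_nat k))) x z n)"
  unfolding adq_expand[OF assms refl] sc_sum sc_sc atLeast0AtMost
  by (rule sum.cong) (use assms in \<open>simp_all add: sc_def qbinom_def mult.assoc\<close>)

lemma adq_commute:
  assumes "w * x = x * w" "w * z = z * w"
  shows "w * adq s x z n = adq s x z n * w"
proof (induction n)
  case (Suc n)
  have "w * adq s x z (Suc n) = (w * adq s x z n) * x - sc (s n) ((w * x) * adq s x z n)"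
    by (simp add: algebra_simps)
  also have "\<dots> = adq s x z n * (w * x) - sc (s n) (x * (w * adq s x z n))"
    by (simp add: Suc.IH assms(1) mult.assoc)
  finally show ?case by (simp add: Suc.IH assms(1) algebra_simps)
qed (simp add: assms)

lemma adq_skew_commute:
  assumes "K * x = sc b (x * K)" "K * z = sc c (z * K)"
  shows "K * adq s x z n = sc (b ^ n * c) (adq s x z n * K)"
proof (induction n)
  case (Suc n)
  have "K * adq s x z (Suc n) = (K * adq s x z n) * x - sc (s n) ((K * x) * adq s x z n)"
    by (simp add: algebra_simps)
  also have "\<dots> = sc (b ^ n * c) (adq s x z n * (K * x)) - sc (s n) (sc b (x * (K * adq s x z n)))"
    by (simp add: Suc.IH assms(1) mult.assoc)
  finally show ?case by (simp add: Suc.IH assms(1) algebra_simps sc_minus_right)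
qed (simp add: assms)

text \<open>The two commutator computations behind the triangular decomposition: the Serre elements commute
  with the generators of the opposite nilpotent part, of the same and of the other index.\<close>

lemma adq_serre_commute:
  assumes "\<delta> \<noteq> 0"
    and wx: "w * x = x * w + sc g (K - K')"
    and wz: "w * z = z * w"
    and Kx: "K * x = sc (qpow (- 2 * \<delta>)) (x * K)" "K' * x = sc (qpow (2 * \<delta>)) (x * K')"
    and Kz: "K * z = sc (qpow (- (t * \<delta>))) (z * K)" "K' * z = sc (qpow (t * \<delta>)) (z * K')"
    and s: "s = (\<lambda>k. qpow (\<delta> * (t + 2 * of_nat k)))"
    and n: "t = 1 - of_nat n"
  shows "w * adq s x z n = adq s x z n * w"
proof -
  define Q where "Q = qpow (2 * \<delta>)"
  define A where "A = qpow (2 * t * \<delta>)"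
  have Q: "1 - Q \<noteq> 0" using assms(1) by (simp add: Q_def)
  \<comment> \<open>The solution of \<open>c_rec\<close> with c 0 = 0. Its factor 1 - A Q^(k-1) is
    the one that vanishes at k = n, because t = 1 - n makes A = Q^(1-n).\<close>
  define c where "c k = - (g * (1 - A * Q ^ k / Q) * (1 - Q ^ k) / (1 - Q))" for k
  have c_rec: "c (Suc k) = Q * c k - g * (1 - s k * s k)" for k
  proof -
    have "s k * s k = A * Q ^ k * Q ^ k"
      unfolding s A_def Q_def qpow_power by (simp flip: qpow_add) (simp add: algebra_simps)
    moreover have "- (g * (1 - A * U) * (1 - Q * U) / (1 - Q)) = Q * - (g * (1 - A * U / Q) * (1 - U) / (1 - Q)) - g * (1 - A * U * U)" for U
    proof -
      have "Q * (1 - A * U / Q) = Q - A * U" by (simp add: Q_def right_diff_distrib)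
      moreover have "(Q - A * U) * (1 - U) + (1 - Q) * (1 - A * U * U) = (1 - A * U) * (1 - Q * U)"
        by (simp add: algebra_simps)
      moreover have "Q * - (g * P * (1 - U) / (1 - Q)) - g * (1 - A * U * U)
        = - (g * ((Q * P) * (1 - U) / (1 - Q) + (1 - A * U * U)))" for P
        by (simp add: algebra_simps)
      moreover have "(Q - A * U) * (1 - U) / (1 - Q) + (1 - A * U * U)
        = ((Q - A * U) * (1 - U) + (1 - Q) * (1 - A * U * U)) / (1 - Q)"
        using Q by (simp add: add_divide_distrib)
      ultimately show ?thesis by (simp only:) (simp add: mult.assoc)
    qed
    ultimately show ?thesis unfolding c_def by (simp add: Q_def)
  qed
  have Ky: "K * adq s x z k = sc (inverse (s k)) (adq s x z k * K)"
    "K' * adq s x z k = sc (s k) (adq s x z k * K')" for k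
  proof -
    have "qpow (- 2 * \<delta>) ^ k * qpow (- (t * \<delta>)) = inverse (s k)" "qpow (2 * \<delta>) ^ k * qpow (t * \<delta>) = s k"
      unfolding qpow_power s qpow_minus[symmetric] by (simp_all flip: qpow_add) (simp_all add: algebra_simps)
    then show "K * adq s x z k = sc (inverse (s k)) (adq s x z k * K)"
      "K' * adq s x z k = sc (s k) (adq s x z k * K')"
      using adq_skew_commute[OF Kx(1) Kz(1), of s k] adq_skew_commute[OF Kx(2) Kz(2), of s k] by simp_all
  qed
  have s_nz: "s k \<noteq> 0" for k by (simp add: s)
  have s_Suc: "s (Suc k) = Q * s k" for k
    unfolding s Q_def by (simp flip: qpow_add) (simp add: algebra_simps)
  \<comment> \<open>The two terms with K cancel: K passes \<open>adq s x z k\<close> with the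
    inverse of \<open>s k\<close>, which undoes the coefficient \<open>s k\<close>. Only K' is left,
    with the coefficient -g (1 - s_k^2).\<close>
  have step: "w * adq s x z (Suc k) = adq s x z (Suc k) * w - sc (g * (1 - s k * s k)) (adq s x z k * K')
      + (D' * x - sc (s k) (x * D'))"
    if "w * adq s x z k = adq s x z k * w + D'" for k D'
  proof -
    have "w * adq s x z (Suc k) = (w * adq s x z k) * x - sc (s k) ((w * x) * adq s x z k)"
      by (simp add: algebra_simps)
    also have "\<dots> = adq s x z k * (w * x) + D' * x
      - sc (s k) (x * (w * adq s x z k) + sc g (K * adq s x z k - K' * adq s x z k))"
      unfolding that wx by (simp add: algebra_simps that wx)
    also have "\<dots> = adq s x z k * (x * w + sc g (K - K')) + D' * x
      - sc (s k) (x * (adq s x z k * w + D'))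
      - sc g (adq s x z k * K) + sc (g * (s k * s k)) (adq s x z k * K')"
      unfolding that wx Ky using s_nz[of k]
      by (simp add: algebra_simps sc_plus sc_minus_right)
    also have "\<dots> = adq s x z (Suc k) * w - sc (g * (1 - s k * s k)) (adq s x z k * K')
       + (D' * x - sc (s k) (x * D'))"
      by (simp add: algebra_simps sc_plus sc_minus_right sc_diff)
    finally show ?thesis .
  qed
  have main: "w * adq s x z (Suc k) = adq s x z (Suc k) * w + sc (c (Suc k)) (adq s x z k * K')" for k
  proof (induction k)
    case 0
    have "c 0 = 0" by (simp add: c_def)
    then show ?case using step[of 0 0] wz by (simp add: c_rec sc_minus)
  next
    case (Suc k)
    have "sc (c (Suc k)) (adq s x z k * K') * x - sc (s (Suc k)) (x * sc (c (Suc k)) (adq s x z k * K'))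
      = sc (Q * c (Suc k)) (adq s x z (Suc k) * K')"
    proof -
      have "adq s x z k * K' * x = sc Q (adq s x z k * x * K')"
        by (simp add: mult.assoc Kx(2) Q_def)
      then show ?thesis
        by (simp add: s_Suc algebra_simps sc_minus_right)
    qed
    then show ?case
      unfolding step[OF Suc.IH] c_rec[of "Suc k"] by (simp add: sc_diff sc_add algebra_simps)
  qed
  show ?thesis
  proof (cases n)
    case 0
    then show ?thesis by (simp add: wz)
  next
    case (Suc m)
    have "A * Q ^ n / Q = 1"
      unfolding A_def Q_def qpow_power qpow_diff[symmetric] qpow_add[symmetric] n by (simp add: algebra_simps)
    then have "c (Suc m) = 0" using Suc by (simp add: c_def)
    then show ?thesis using main[of m] Suc by simp
  qed
qed

lemma adq_serre_commute':
  assumes wx: "w * x = x * w"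
    and wz: "w * z = z * w + sc g (K - K')"
    and Kx: "K * x = sc (qpow (- (t * \<delta>))) (x * K)" "K' * x = sc (qpow (t * \<delta>)) (x * K')"
    and s: "s = (\<lambda>k. qpow (\<delta> * (t + 2 * of_nat k)))"
    and n: "t = 1 - of_nat n" "n > 0"
  shows "w * adq s x z n = adq s x z n * w"
proof -
  \<comment> \<open>The scalars that K and K' collect while k factors R - s_l L are applied. Both
    vanish at k = n: u through its last factor, since s_(n-1) = q^(-t \<delta>), and v through its
    first, since s_0 = q^(t \<delta>).\<close>
  define u v where "u k = (\<Prod>l<k. qpow (- (t * \<delta>)) - s l)" and "v k = (\<Prod>l<k. qpow (t * \<delta>) - s l)" for k
  have main: "w * adq s x z k = adq s x z k * w + sc (g * u k) (x ^ k * K) - sc (g * v k) (x ^ k * K')" for k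
  proof (induction k)
    case 0
    then show ?case by (simp add: wz u_def v_def sc_minus_right)
  next
    case (Suc k)
    have "w * adq s x z (Suc k) = (w * adq s x z k) * x - sc (s k) (x * (w * adq s x z k))"
      by (simp add: algebra_simps wx flip: mult.assoc)
    also have "\<dots> = adq s x z (Suc k) * w + sc (g * u k) (x ^ k * (K * x)) - sc (g * v k) (x ^ k * (K' * x))
      - sc (s k * (g * u k)) (x ^ Suc k * K) + sc (s k * (g * v k)) (x ^ Suc k * K')"
      unfolding Suc.IH by (simp add: algebra_simps wx sc_plus sc_minus_right)
    also have "\<dots> = adq s x z (Suc k) * w + sc (g * u (Suc k)) (x ^ Suc k * K) - sc (g * v (Suc k)) (x ^ Suc k * K')"
      unfolding Kx u_def v_def
      by (simp add: algebra_simps sc_diff power_commutes flip: mult.assoc)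
    finally show ?case .
  qed
  have "u n = 0"
  proof -
    have "qpow (- (t * \<delta>)) - s (n - 1) = 0" using n(2) by (simp add: s n(1) of_nat_diff algebra_simps)
    then show ?thesis using n(2) unfolding u_def by (intro prod_zero) auto
  qed
  moreover have "v n = 0"
    using n(2) unfolding v_def by (intro prod_zero bexI[of _ 0]) (auto simp: s algebra_simps)
  ultimately show ?thesis using main[of n] by simp
qed

end

section \<open>Linear operators on a free algebra\<close>

definition falg_linear :: "('g falg \<Rightarrow> 'g falg) \<Rightarrow> bool" where
  "falg_linear \<phi> \<longleftrightarrow> (\<forall>x y. \<phi> (x + y) = \<phi> x + \<phi> y) \<and> (\<forall>c x. \<phi> (const c * x) = const c * \<phi> x)"

text \<open>As elements of a type of class \<open>ring_1\<close>, with composition as product,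
  linear operators become an instance of \<open>algebra_over_qfield\<close>.\<close>

typedef 'g lin = "{\<phi> :: 'g falg \<Rightarrow> 'g falg. falg_linear \<phi>}" morphisms app Lin
  by (rule exI[of _ "\<lambda>x. x"]) (simp add: falg_linear_def)

lemma app_add [simp]: "app \<phi> (x + y) = app \<phi> x + app \<phi> y"
  and app_scale [simp]: "app \<phi> (const c * x) = const c * app \<phi> x"
  using app[of \<phi>] by (simp_all add: falg_linear_def)

lemma lin_eqI: "(\<And>x. app \<phi> x = app \<psi> x) \<Longrightarrow> \<phi> = \<psi>"
  by (metis app_inverse ext)

lemma app_0_right [simp]: "app \<phi> 0 = 0"
  using app_add[of \<phi> 0 0] by simp

lemma app_uminus_right [simp]: "app \<phi> (- x) = - app \<phi> x"
  using app_add[of \<phi> x "- x"] by (simp add: eq_neg_iff_add_eq_0 add.commute)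

lemma app_diff_right [simp]: "app \<phi> (x - y) = app \<phi> x - app \<phi> y"
  using app_add[of \<phi> x "- y"] by simp

lemma app_sum: "app \<phi> (sum f A) = (\<Sum>a\<in>A. app \<phi> (f a))"
  by (induction A rule: infinite_finite_induct) simp_all

lemma app_Lin [simp]: "falg_linear \<phi> \<Longrightarrow> app (Lin \<phi>) = \<phi>"
  by (simp add: Lin_inverse)

instantiation lin :: (type) ring_1
begin
definition zero_lin :: "'a lin" where "zero_lin = Lin (\<lambda>_. 0)"
definition one_lin :: "'a lin" where "one_lin = Lin (\<lambda>x. x)"
definition plus_lin :: "'a lin \<Rightarrow> 'a lin \<Rightarrow> 'a lin" where "plus_lin \<phi> \<psi> = Lin (\<lambda>x. app \<phi> x + app \<psi> x)"
definition minus_lin :: "'a lin \<Rightarrow> 'a lin \<Rightarrow> 'a lin" where "minus_lin \<phi> \<psi> = Lin (\<lambda>x. app \<phi> x - app \<psi> x)"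
definition uminus_lin :: "'a lin \<Rightarrow> 'a lin" where "uminus_lin \<phi> = Lin (\<lambda>x. - app \<phi> x)"
definition times_lin :: "'a lin \<Rightarrow> 'a lin \<Rightarrow> 'a lin" where "times_lin \<phi> \<psi> = Lin (\<lambda>x. app \<phi> (app \<psi> x))"

lemma app_lin [simp]:
  "app 0 x = 0" "app 1 x = x" "app (\<phi> + \<psi>) x = app \<phi> x + app \<psi> x"
  "app (\<phi> - \<psi>) x = app \<phi> x - app \<psi> x" "app (- \<phi>) x = - app \<phi> x" "app (\<phi> * \<psi>) x = app \<phi> (app \<psi> x)"
  by (simp_all add: zero_lin_def one_lin_def plus_lin_def minus_lin_def uminus_lin_def times_lin_def
      falg_linear_def algebra_simps)

instance
proof
  show "(0 :: 'a lin) \<noteq> 1"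
    by (metis app_lin(1,2) zero_neq_one)
qed (auto intro!: lin_eqI simp: algebra_simps)
end

definition lmult :: "'g falg \<Rightarrow> 'g lin" where "lmult a = Lin (\<lambda>x. a * x)"

lemma app_lmult [simp]: "app (lmult a) x = a * x"
  unfolding lmult_def
  by (subst app_Lin) (simp_all add: falg_linear_def distrib_left fa.cst_central mult.assoc)

lemma lmult_simps: "lmult (a + b) = lmult a + lmult b" "lmult (a * b) = lmult a * lmult b"
  "lmult (a - b) = lmult a - lmult b" "lmult 1 = 1"
  by (auto intro!: lin_eqI simp: algebra_simps)

global_interpretation li: algebra_over_qfield "\<lambda>c. lmult (const c)"
  defines li_sc = li.sc and li_ev = li.ev and li_adq = li.adq
proof
  show "lmult (const (b * c)) = lmult (const b) * lmult (const c)" for b c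
    by (simp add: fa.cst_mult lmult_simps)
qed (auto intro!: lin_eqI simp: fa.cst_add fa.cst_1 distrib_right)

lemma app_sc [simp]: "app (li_sc c \<phi>) x = const c * app \<phi> x"
  by (simp add: li.sc_def)

definition linext :: "('g list \<Rightarrow> 'g falg) \<Rightarrow> 'g lin" where
  "linext h = Lin (\<lambda>x. \<Sum>w\<in>Poly_Mapping.keys x. const (Poly_Mapping.lookup x w) * h w)"

lemma app_linext:
  "app (linext h) x = (\<Sum>w\<in>Poly_Mapping.keys x. const (Poly_Mapping.lookup x w) * h w)"
proof -
  let ?f = "\<lambda>x A. \<Sum>w\<in>A. const (Poly_Mapping.lookup x w) * h w"
  have sup: "?f x (Poly_Mapping.keys x) = ?f x A" if "finite A" "Poly_Mapping.keys x \<subseteq> A" for x A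
    by (rule sum.mono_neutral_left) (use that in \<open>auto simp: in_keys_iff\<close>)
  have "?f (x + y) (Poly_Mapping.keys (x + y)) = ?f x (Poly_Mapping.keys x) + ?f y (Poly_Mapping.keys y)" for x y
  proof -
    let ?A = "Poly_Mapping.keys x \<union> Poly_Mapping.keys y"
    have z: "?f z (Poly_Mapping.keys z) = ?f z ?A" if "z \<in> {x, y, x + y}" for z
      by (rule sup) (use that keys_add[of x y] in auto)
    show ?thesis unfolding z[of x, simplified] z[of y, simplified] z[of "x + y", simplified]
      by (simp add: lookup_add fa.cst_add distrib_right sum.distrib)
  qed
  moreover have "?f (const c * x) (Poly_Mapping.keys (const c * x)) = const c * ?f x (Poly_Mapping.keys x)" for c x
  proof -
    have "Poly_Mapping.keys (const c * x) \<subseteq> Poly_Mapping.keys x" by (auto simp: in_keys_iff)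
    then have "?f (const c * x) (Poly_Mapping.keys (const c * x)) = ?f (const c * x) (Poly_Mapping.keys x)"
      by (intro sup) auto
    then show ?thesis by (simp add: fa.cst_mult sum_distrib_left mult.assoc)
  qed
  ultimately show ?thesis unfolding linext_def by (subst app_Lin) (auto simp: falg_linear_def)
qed

lemma linext_word [simp]: "app (linext h) (word w) = h w"
  by (simp add: app_linext word_def fa.cst_1)

lemma lin_word_eqI:
  assumes "\<And>w. app \<phi> (word w) = app \<psi> (word w)"
  shows "\<phi> = \<psi>"
proof (rule lin_eqI)
  show "app \<phi> x = app \<psi> x" for x
    by (induction x rule: pm_induct) (simp_all add: single_eq_const_word assms)
qed

section \<open>Root combinatorics\<close>

lemmas weight_eq_iff = Finite_Cartesian_Product.vec_eq_iff

context finite_cartan_datum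
begin

lemma ip_add_right: "ip x (y + z) = ip x y + ip x z"
  using ip_add[of y z x] by (simp add: ip_sym)

lemma ip_scale_right: "ip x (c *s y) = c * ip x y"
  using ip_scale[of c y x] by (simp add: ip_sym)

lemma ip_zero [simp]: "ip 0 x = 0" "ip x 0 = 0"
  using ip_scale[of 0 x x] ip_scale_right[of x 0 x] by simp_all

lemma ip_minus: "ip (- x) y = - ip x y" "ip x (- y) = - ip x y"
  using ip_scale[of "-1" x y] ip_scale_right[of x "-1" y] by simp_all

lemma ip_diff: "ip (x - y) z = ip x z - ip y z"
  using ip_add[of x "- y" z] by (simp add: ip_minus)

lemma ip_diff_right: "ip z (x - y) = ip z x - ip z y"
  using ip_add_right[of z x "- y"] by (simp add: ip_minus)

lemmas ip_simps = ip_add ip_add_right ip_scale ip_scale_right ip_minus ip_diff ip_diff_right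

lemma ip_sum: "ip (sum f A) y = (\<Sum>a\<in>A. ip (f a) y)"
  by (induction A rule: infinite_finite_induct) (simp_all add: ip_add)

lemma ip_self_nonneg: "0 \<le> ip x x"
  using ip_pos[of x] by (cases "x = 0") auto

lemma simple_root_nth: "simple_root i $ j = (if i = j then 1 else 0)"
  by (simp add: simple_root_def axis_def)

lemma simple_root_nonzero [simp]: "simple_root i \<noteq> 0"
  by (metis simple_root_nth zero_index zero_neq_one)

lemma weight_expand: "x = (\<Sum>i\<in>UNIV. x $ i *s simple_root i)"
  by (simp add: weight_eq_iff simple_root_nth if_distrib cong: if_cong)

lemma ip_expand: "ip x y = (\<Sum>i\<in>UNIV. x $ i * ip (simple_root i) y)"
  by (subst weight_expand[of x]) (simp add: ip_sum ip_scale)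

lemma ip_expand2:
  "ip x y = (\<Sum>j\<in>UNIV. \<Sum>k\<in>UNIV. x $ j * y $ k * ip (simple_root j) (simple_root k))"
proof -
  have "ip (simple_root j) y = (\<Sum>k\<in>UNIV. y $ k * ip (simple_root j) (simple_root k))" for j
    by (subst ip_sym, subst ip_expand) (simp add: ip_sym)
  then show ?thesis by (subst ip_expand) (simp add: sum_distrib_left mult.assoc)
qed

lemma d_pos: "0 < d i"
  by (simp add: d_def ip_pos)

lemma d_nonzero [simp]: "d i \<noteq> 0"
  using d_pos[of i] by simp

lemma ip_simple_self: "ip (simple_root i) (simple_root i) = 2 * d i"
  by (simp add: d_def)

lemma pairing_add: "pairing (x + y) h = pairing x h + pairing y h"
  by (simp add: pairing_def distrib_right sum.distrib)

lemma pairing_scale: "pairing (c *s x) h = c * pairing x h"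
  by (simp add: pairing_def sum_distrib_left mult.assoc)

lemma pairing_simple_root: "pairing (simple_root j) (simple_coroot i) = of_int (a i j)"
  by (simp add: pairing_def simple_root_nth simple_coroot_def if_distrib[of "\<lambda>x. x * _"] cong: if_cong)

lemma simple_reflection_simple: "simple_reflection i (simple_root i) = - simple_root i"
  by (simp add: simple_reflection_def pairing_simple_root diag weight_eq_iff)

lemma pairing_simple_coroot: "pairing x (simple_coroot i) * d i = ip x (simple_root i)"
proof -
  have "ip (x - pairing x (simple_coroot i) *s simple_root i) (- simple_root i) = ip x (simple_root i)"
    using ip_invariant[of i x "simple_root i"] by (simp add: simple_reflection_simple) (simp add: simple_reflection_def)
  then show ?thesis by (simp add: ip_simps ip_simple_self)
qed

lemma pairing_simple_coroot': "pairing x (simple_coroot i) = ip x (simple_root i) / d i"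
  by (simp add: pairing_simple_coroot[symmetric])

lemma ip_simple_roots: "ip (simple_root j) (simple_root i) = d i * of_int (a i j)"
  using pairing_simple_coroot[of "simple_root j" i] by (simp add: pairing_simple_root mult.commute)

lemma d_a_sym: "d i * of_int (a i j) = d j * of_int (a j i)"
  by (metis ip_simple_roots ip_sym)

lemma simple_reflection_eq: "simple_reflection i x = x - (ip x (simple_root i) / d i) *s simple_root i"
  by (simp add: simple_reflection_def pairing_simple_coroot')

lemma simple_reflection_nth: "j \<noteq> i \<Longrightarrow> simple_reflection i x $ j = x $ j"
  by (simp add: simple_reflection_def simple_root_nth)

lemma simple_reflection_add: "simple_reflection i (x + y) = simple_reflection i x + simple_reflection i y"
  by (simp add: simple_reflection_def pairing_add weight_eq_iff algebra_simps)

lemma simple_reflection_scale: "simple_reflection i (c *s x) = c *s simple_reflection i x"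
  by (simp add: simple_reflection_def pairing_scale weight_eq_iff algebra_simps)

lemma simple_reflection_minus: "simple_reflection i (- x) = - simple_reflection i x"
  using simple_reflection_scale[of i "-1" x] by (metis scalar_mult_eq_scaleR vector_scalar_commute vec.scale_minus_left vec.scale_one)

lemma simple_reflection_diff: "simple_reflection i (x - y) = simple_reflection i x - simple_reflection i y"
  using simple_reflection_add[of i x "- y"] by (simp add: simple_reflection_minus)

lemma simple_reflection_involution [simp]: "simple_reflection i (simple_reflection i x) = x"
  by (simp add: simple_reflection_eq ip_simps ip_simple_self weight_eq_iff algebra_simps)

lemma ip_reflection: "ip (simple_reflection i x) y = ip x (simple_reflection i y)"
  using ip_invariant[of i x "simple_reflection i y"] by simp

lemma pairing_coroot: "pairing x (coroot \<beta>) = 2 * ip x \<beta> / ip \<beta> \<beta>"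
  by (subst ip_expand) (simp add: pairing_def coroot_def sum_distrib_left sum_divide_distrib algebra_simps)

lemma pairing_coroot_reflection:
  "pairing (simple_reflection i x) (coroot \<beta>) = pairing x (coroot (simple_reflection i \<beta>))"
  by (simp add: pairing_coroot ip_reflection)

lemma pairing_coroot_simple: "pairing x (coroot (simple_root i)) = pairing x (simple_coroot i)"
  by (simp add: pairing_coroot pairing_simple_coroot' ip_simple_self)

text \<open>The second condition says that the coordinates of the coroot of \<open>\<beta>\<close> are integers, too.\<close>

lemma root_integrality:
  assumes "\<beta> \<in> roots"
  shows "\<exists>i. ip \<beta> \<beta> = 2 * d i \<and> (\<forall>j. \<beta> $ j \<in> \<int> \<and> \<beta> $ j * d j / d i \<in> \<int>)"
  using assms
proof induction
  case (simple i)
  show ?case by (rule exI[of _ i]) (simp add: simple_root_nth ip_simple_self)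
next
  case (reflect \<beta> k)
  then obtain i where i: "ip \<beta> \<beta> = 2 * d i" "\<And>j. \<beta> $ j \<in> \<int>" "\<And>j. \<beta> $ j * d j / d i \<in> \<int>" by blast
  have "pairing \<beta> (simple_coroot k) = (\<Sum>j\<in>UNIV. \<beta> $ j * of_int (a k j))"
    by (simp add: pairing_def simple_coroot_def)
  then have p1: "pairing \<beta> (simple_coroot k) \<in> \<int>" using i(2) by (auto intro!: Ints_sum Ints_mult)
  have "pairing \<beta> (simple_coroot k) * d k / d i = (\<Sum>j\<in>UNIV. (\<beta> $ j * d j / d i) * of_int (a j k))"
    unfolding pairing_def simple_coroot_def sum_divide_distrib sum_distrib_right
    by (rule sum.cong) (simp_all, metis d_a_sym mult.commute mult.left_commute)
  then have p2: "pairing \<beta> (simple_coroot k) * d k / d i \<in> \<int>"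
    by (simp only:) (intro Ints_sum Ints_mult i(3) Ints_of_int)
  have "simple_reflection k \<beta> $ j \<in> \<int> \<and> simple_reflection k \<beta> $ j * d j / d i \<in> \<int>" for j
    using i(2,3)[of j] p1 p2
    by (auto simp: simple_reflection_def simple_root_nth left_diff_distrib diff_divide_distrib)
  then show ?case using i(1) by (auto simp: ip_invariant)
qed

section \<open>Sign, finiteness and permutation of the roots\<close>

lemma sum_symmetric:
  fixes f :: "'i \<Rightarrow> 'i \<Rightarrow> 'b::comm_semiring_1"
  assumes "\<And>j k. f j k = f k j"
  shows "(\<Sum>j\<in>UNIV. \<Sum>k\<in>UNIV. f j k) = (\<Sum>j\<in>UNIV. f j j) + 2 * (\<Sum>j\<in>UNIV. \<Sum>k | k < j. f j k)"
proof -
  have "(\<Sum>k\<in>UNIV. f j k) = f j j + (\<Sum>k | k < j. f j k) + (\<Sum>k | j < k. f j k)" for j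
  proof -
    have "UNIV = {j} \<union> ({k. k < j} \<union> {k. j < k})" by auto
    then have "(\<Sum>k\<in>UNIV. f j k) = sum (f j) ({j} \<union> ({k. k < j} \<union> {k. j < k}))" by simp
    also have "\<dots> = sum (f j) {j} + (sum (f j) {k. k < j} + sum (f j) {k. j < k})"
      by (subst sum.union_disjoint, simp, simp, force, subst sum.union_disjoint) auto
    finally show ?thesis by (simp add: add.assoc)
  qed
  moreover have "(\<Sum>j\<in>UNIV. \<Sum>k | j < k. f j k) = (\<Sum>j\<in>UNIV. \<Sum>k | k < j. f j k)"
    using sum.swap_restrict[of UNIV UNIV f "\<lambda>j k. j < k"] assms by simp
  ultimately show ?thesis by (simp add: sum.distrib mult_2 add.assoc)
qed

text \<open>Split \<beta> = x - y into positive and negative part. The integrality of \<beta> and of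
  its coroot makes (x|x) and (y|y) integral multiples of (\<beta>|\<beta>), while (x|y) \<le> 0
  because the supports are disjoint. If both parts were nonzero, (\<beta>|\<beta>) would be at least
  2 (\<beta>|\<beta>).\<close>

lemma root_pos_or_neg:
  assumes "\<beta> \<in> roots"
  shows "(\<forall>j. 0 \<le> \<beta> $ j) \<or> (\<forall>j. \<beta> $ j \<le> 0)"
proof (rule ccontr)
  assume neg: "\<not> ?thesis"
  obtain i where i: "ip \<beta> \<beta> = 2 * d i" "\<And>j. \<beta> $ j \<in> \<int>" "\<And>j. \<beta> $ j * d j / d i \<in> \<int>"
    using root_integrality[OF assms] by blast
  have norm: "ip x x \<ge> 2 * d i"
    if x: "x \<noteq> 0" "\<And>j. x $ j = 0 \<or> x $ j = \<beta> $ j \<or> x $ j = - \<beta> $ j" for x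
  proof -
    have m: "x $ j \<in> \<int>" "x $ j * d j / d i \<in> \<int>" for j
      using i(2,3)[of j] x(2)[of j] by auto
    define f where "f j k = x $ j * x $ k * ip (simple_root j) (simple_root k)" for j k
    have f: "f j k / d i = (x $ j * d j / d i) * (x $ k * of_int (a j k))" for j k
      by (subst f_def, subst ip_sym, subst ip_simple_roots) simp
    have "ip x x = (\<Sum>j\<in>UNIV. \<Sum>k\<in>UNIV. f j k)"
      unfolding f_def by (rule ip_expand2)
    also have "\<dots> = (\<Sum>j\<in>UNIV. f j j) + 2 * (\<Sum>j\<in>UNIV. \<Sum>k | k < j. f j k)"
      by (rule sum_symmetric) (simp add: f_def ip_sym mult.commute)
    finally have "ip x x / (2 * d i) = (\<Sum>j\<in>UNIV. (x $ j * d j / d i) * x $ j) + (\<Sum>j\<in>UNIV. \<Sum>k | k < j. f j k / d i)"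
    proof -
      have "f j j / (2 * d i) = (x $ j * d j / d i) * x $ j" for j
        by (simp add: f_def ip_simple_self)
      moreover assume "ip x x = (\<Sum>j\<in>UNIV. f j j) + 2 * (\<Sum>j\<in>UNIV. \<Sum>k | k < j. f j k)"
      ultimately show ?thesis
        by (simp add: add_divide_distrib sum_divide_distrib)
    qed
    also have "\<dots> \<in> \<int>" unfolding f using m by (intro Ints_add Ints_sum Ints_mult) auto
    finally have "ip x x / (2 * d i) \<in> \<int>" .
    then obtain z where z: "ip x x / (2 * d i) = of_int z" by (auto elim: Ints_cases)
    moreover have "ip x x / (2 * d i) > 0" using ip_pos[OF x(1)] d_pos[of i] by simp
    ultimately have "(1 :: rat) \<le> of_int z" by simp
    then show ?thesis using z d_pos[of i] by (simp add: field_simps)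
  qed
  define x y where "x = (\<chi> j. max (\<beta> $ j) 0)" and "y = (\<chi> j. max (- \<beta> $ j) 0)"
  have \<beta>: "\<beta> = x - y" by (auto simp: x_def y_def weight_eq_iff max_def)
  have "x \<noteq> 0" "y \<noteq> 0" using neg by (auto simp: x_def y_def weight_eq_iff max_def not_le)
  then have "ip x x \<ge> 2 * d i" "ip y y \<ge> 2 * d i"
    by (auto intro!: norm simp: x_def y_def max_def split: if_splits)
  moreover have "ip x y \<le> 0"
  proof -
    have "ip x y = (\<Sum>j\<in>UNIV. \<Sum>k\<in>UNIV. x $ j * y $ k * ip (simple_root j) (simple_root k))"
      by (rule ip_expand2)
    also have "\<dots> \<le> 0"
    proof (intro sum_nonpos)
      fix j k
      show "x $ j * y $ k * ip (simple_root j) (simple_root k) \<le> 0"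
      proof (cases "j = k")
        case True
        then show ?thesis by (simp add: x_def y_def max_def)
      next
        case False
        then have "ip (simple_root j) (simple_root k) \<le> 0"
          using off_diag[of k j] d_pos[of k] by (simp add: ip_simple_roots mult_nonneg_nonpos)
        then show ?thesis by (simp add: x_def y_def mult_nonneg_nonpos)
      qed
    qed
    finally show ?thesis .
  qed
  moreover have "ip \<beta> \<beta> = ip x x + ip y y - 2 * ip x y"
    unfolding \<beta> by (simp add: ip_simps ip_sym[of y x])
  ultimately show False using i(1) d_pos[of i] by simp
qed

lemma root_nonzero: "\<beta> \<in> roots \<Longrightarrow> \<beta> \<noteq> 0"
  using root_integrality[of \<beta>] d_pos by fastforce

lemma Cauchy_Schwarz: "(ip x y)\<^sup>2 \<le> ip x x * ip y y"
proof (cases "y = 0")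
  case False
  then have pos: "ip y y > 0" by (rule ip_pos)
  define t where "t = ip x y / ip y y"
  have "0 \<le> ip (x - t *s y) (x - t *s y)" by (rule ip_self_nonneg)
  also have "\<dots> = ip x x - (ip x y)\<^sup>2 / ip y y"
    using pos by (simp add: ip_simps ip_sym[of y x] t_def power2_eq_square)
  finally show ?thesis using pos by (simp add: field_simps)
qed simp

lemma dual_vector: "\<exists>w. \<forall>x. ip x w = x $ j"
proof -
  define L :: "'i weight \<Rightarrow> 'i weight" where "L x = (\<chi> k. ip x (simple_root k))" for x
  have lin: "Vector_Spaces.linear (*s) (*s) L"
    by unfold_locales (simp_all add: L_def weight_eq_iff ip_simps)
  have zero: "x = 0" if "L x = 0" for x
  proof (rule ccontr)
    have "ip x (simple_root k) = 0" for k using that by (simp add: L_def weight_eq_iff)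
    then have "ip x x = 0" by (subst ip_expand) (simp add: ip_sym)
    moreover assume "x \<noteq> 0"
    ultimately show False using ip_pos by fastforce
  qed
  have "inj L"
  proof (rule injI)
    fix x y assume "L x = L y"
    then have "L (x - y) = 0" by (simp add: L_def weight_eq_iff ip_simps)
    then show "x = y" using zero[of "x - y"] by simp
  qed
  then have "surj L" by (intro vec.linear_injective_imp_surjective[OF lin] refl)
  then obtain w where w: "L w = simple_root j" by (metis surjD)
  have "ip (simple_root k) w = (if j = k then 1 else 0)" for k
    using arg_cong[OF w, of "\<lambda>v. v $ k"] by (simp add: L_def simple_root_nth ip_sym)
  then have "ip x w = x $ j" for x
    by (subst ip_expand, simp only:) (simp add: if_distrib cong: if_cong)
  then show ?thesis by blast
qed

text \<open>The coordinates of a root are integers, and Cauchy-Schwarz against the dual vectors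
  bounds them, since (\<beta>|\<beta>) is one of the finitely many values 2 d_i.\<close>

lemma finite_roots: "finite roots"
proof -
  define D where "D = Max (range d)"
  have D: "d i \<le> D" for i by (simp add: D_def)
  have "\<exists>S. finite S \<and> (\<forall>\<beta>\<in>roots. \<beta> $ j \<in> S)" for j
  proof -
    obtain w where w: "\<And>x. ip x w = x $ j" using dual_vector by blast
    define B where "B = 2 * D * ip w w"
    have "\<beta> $ j \<in> of_int ` {- \<lceil>B\<rceil>..\<lceil>B\<rceil>}" if "\<beta> \<in> roots" for \<beta>
    proof -
      obtain i where i: "ip \<beta> \<beta> = 2 * d i" "\<beta> $ j \<in> \<int>" using root_integrality[OF \<open>\<beta> \<in> roots\<close>] by blast
      obtain z where z: "\<beta> $ j = of_int z" using i(2) by (auto elim: Ints_cases)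
      have "(of_int z :: rat)\<^sup>2 \<le> B"
        using Cauchy_Schwarz[of \<beta> w] mult_right_mono[OF D[of i], of "2 * ip w w"] ip_self_nonneg[of w]
        by (simp add: w z i B_def mult.commute mult.left_commute)
      then have "z\<^sup>2 \<le> \<lceil>B\<rceil>" by (simp add: le_ceiling_iff flip: of_int_power)
      moreover have "\<bar>z\<bar> * 1 \<le> \<bar>z\<bar> * \<bar>z\<bar>" by (cases "z = 0") (simp, intro mult_left_mono, auto)
      ultimately have "\<bar>z\<bar> \<le> \<lceil>B\<rceil>" by (simp add: power2_eq_square)
      then show ?thesis unfolding z by (intro imageI) auto
    qed
    then show ?thesis by (intro exI[of _ "of_int ` {- \<lceil>B\<rceil>..\<lceil>B\<rceil>}"]) auto
  qed
  then obtain S where S: "\<And>j. finite (S j)" "\<And>j \<beta>. \<beta> \<in> roots \<Longrightarrow> \<beta> $ j \<in> S j" by metis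
  have "inj_on vec_nth roots" by (auto simp: inj_on_def weight_eq_iff)
  moreover have "vec_nth ` roots \<subseteq> (\<Pi>\<^sub>E j\<in>UNIV. S j)" using S(2) by auto
  then have "finite (vec_nth ` roots)" by (rule finite_subset) (simp add: finite_PiE S(1))
  ultimately show ?thesis by (rule finite_imageD[rotated])
qed

lemma simple_root_in_pos_roots: "simple_root i \<in> pos_roots"
  by (simp add: pos_roots_def roots.simple simple_root_nth)

text \<open>The reflection changes only the coordinate i, so a positive coordinate elsewhere
  survives and keeps the root positive. Such a coordinate exists: \<beta> = c \<alpha>_i would force
  c and, by the integrality of the coroot, also 1/c to be integers, hence c = 1.\<close>

lemma reflection_pos_root:
  assumes \<beta>: "\<beta> \<in> pos_roots" "\<beta> \<noteq> simple_root i"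
  shows "simple_reflection i \<beta> \<in> pos_roots"
proof -
  have root: "\<beta> \<in> roots" "\<And>j. 0 \<le> \<beta> $ j" using \<beta> by (auto simp: pos_roots_def)
  have "\<exists>j. j \<noteq> i \<and> \<beta> $ j \<noteq> 0"
  proof (rule ccontr)
    assume *: "\<nexists>j. j \<noteq> i \<and> \<beta> $ j \<noteq> 0"
    define c where "c = \<beta> $ i"
    have \<beta>c: "\<beta> = c *s simple_root i" using * by (auto simp: weight_eq_iff simple_root_nth c_def)
    obtain k where k: "ip \<beta> \<beta> = 2 * d k" "\<beta> $ i \<in> \<int>" "\<beta> $ i * d i / d k \<in> \<int>"
      using root_integrality[OF root(1)] by blast
    have "c \<noteq> 0" using \<beta>c root_nonzero[OF root(1)] by auto
    then have c: "c > 0" using root(2)[of i] by (simp add: c_def)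
    have "d k = c * c * d i" using k(1) by (simp add: \<beta>c ip_simps ip_simple_self)
    then have "1 / c \<in> \<int>" using k(3) c by (simp add: c_def[symmetric])
    then obtain z where z: "1 / c = of_int z" by (auto elim: Ints_cases)
    obtain w where w: "c = of_int w" using k(2) c_def by (auto elim: Ints_cases)
    have "of_int (w * z) = (1 :: rat)" using c by (simp add: z[symmetric] w[symmetric])
    then have "w * z = 1" by (simp only: of_int_eq_1_iff)
    then have "w = 1" using c w by (auto simp: zmult_eq_1_iff)
    then show False using \<beta>(2) \<beta>c w by simp
  qed
  then obtain j where "j \<noteq> i" "\<beta> $ j > 0" using root(2) by (metis order_le_less)
  then have "simple_reflection i \<beta> $ j > 0" by (simp add: simple_reflection_nth)
  moreover have "simple_reflection i \<beta> \<in> roots" using root(1) by (rule roots.reflect)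
  ultimately show ?thesis using root_pos_or_neg[of "simple_reflection i \<beta>"]
    by (auto simp: pos_roots_def) (meson leD)
qed

text \<open>The simple reflection permutes the positive roots other than \<alpha>_i, so it fixes
  their sum and sends rho to rho - \<alpha>_i.\<close>

lemma pairing_rho: "pairing rho (simple_coroot i) = 1"
proof -
  define P where "P = pos_roots - {simple_root i}"
  have fin: "finite pos_roots" using finite_roots by (simp add: pos_roots_def)
  have ne: "simple_reflection i \<beta> \<noteq> simple_root i" if "\<beta> \<in> pos_roots" for \<beta>
  proof
    assume "simple_reflection i \<beta> = simple_root i"
    then have "\<beta> = - simple_root i"
      using simple_reflection_involution[of i \<beta>] simple_reflection_simple by metis
    then have "\<beta> $ i = -1" by (simp add: simple_root_nth)
    then show False using that by (auto simp: pos_roots_def dest!: spec[of _ i])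
  qed
  have P: "simple_reflection i ` P = P"
  proof
    show sub: "simple_reflection i ` P \<subseteq> P" using reflection_pos_root ne by (auto simp: P_def)
    show "P \<subseteq> simple_reflection i ` P"
    proof
      fix \<beta> assume "\<beta> \<in> P"
      then have "simple_reflection i \<beta> \<in> P" using sub by auto
      then show "\<beta> \<in> simple_reflection i ` P" by (metis imageI simple_reflection_involution)
    qed
  qed
  have inj: "inj_on (simple_reflection i) P" by (metis inj_onI simple_reflection_involution)
  have refl_sum: "simple_reflection i (sum f A) = (\<Sum>x\<in>A. simple_reflection i (f x))" for f :: "'i weight \<Rightarrow> 'i weight" and A
    using simple_reflection_scale[of i 0 0]
    by (induction A rule: infinite_finite_induct) (simp_all add: simple_reflection_add)
  have total: "\<Sum>pos_roots = simple_root i + \<Sum>P"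
    using fin simple_root_in_pos_roots[of i] by (simp add: P_def sum.remove)
  have "simple_reflection i (\<Sum>P) = \<Sum>P"
    using sum.reindex[OF inj, of "\<lambda>x. x"] by (simp add: refl_sum P)
  then have "simple_reflection i rho = rho - simple_root i"
    unfolding rho_def total simple_reflection_scale simple_reflection_add simple_reflection_simple
    by (simp add: weight_eq_iff field_simps)
  then have "pairing rho (simple_coroot i) *s simple_root i = simple_root i"
    by (simp add: simple_reflection_def)
  from arg_cong[OF this, of "\<lambda>v. v $ i"] show ?thesis by (simp add: simple_root_nth)
qed

end

section \<open>Verma modules on the free algebra modulo the Serre ideal\<close>

lemma falg_induct [case_names word scale add]:
  fixes x :: "'g falg"
  assumes "\<And>w. P (word w)" "\<And>c x. P x \<Longrightarrow> P (const c * x)" "\<And>x y. P x \<Longrightarrow> P y \<Longrightarrow> P (x + y)"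
  shows "P x"
  by (induction x rule: pm_induct) (simp_all add: single_eq_const_word assms)

lemma const_left_commute: "x * (const c * y) = const c * (x * y)" for x :: "'g falg"
  by (metis fa.cst_central mult.assoc)

lemma app_fa_sc [simp]: "app \<phi> (fa_sc c x) = fa_sc c (app \<phi> x)"
  by (simp add: fa.sc_def)

lemma lookup_word [simp]: "Poly_Mapping.lookup (word w) u = (if w = u then 1 else 0)"
  by (simp add: word_def lookup_single when_def)

lemma const_uminus: "const (- c) = - const c"
  by (rule fa.cst_minus)

context finite_cartan_datum
begin

section \<open>Weights, homogeneous elements and diagonal operators\<close>

definition wt :: "'i list \<Rightarrow> 'i weight" where
  "wt w = sum_list (map simple_root w)"

lemma wt_simps [simp]: "wt [] = 0" "wt (k # w) = simple_root k + wt w" "wt (u @ v) = wt u + wt v"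
  by (simp_all add: wt_def)

definition homog :: "'i weight \<Rightarrow> 'i falg \<Rightarrow> bool" where
  "homog \<gamma> v \<longleftrightarrow> (\<forall>w\<in>Poly_Mapping.keys v. wt w = \<gamma>)"

lemma homog_word: "homog (wt w) (word w)"
  by (simp add: homog_def word_def)

lemma homog_0 [simp]: "homog \<gamma> 0"
  by (simp add: homog_def)

lemma homog_add: "homog \<gamma> x \<Longrightarrow> homog \<gamma> y \<Longrightarrow> homog \<gamma> (x + y)"
  using keys_add[of x y] by (auto simp: homog_def)

lemma homog_scale: "homog \<gamma> x \<Longrightarrow> homog \<gamma> (const c * x)"
  by (auto simp: homog_def in_keys_iff)

lemma homog_uminus: "homog \<gamma> x \<Longrightarrow> homog \<gamma> (- x)"
  by (auto simp: homog_def in_keys_iff)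

lemma homog_diff: "homog \<gamma> x \<Longrightarrow> homog \<gamma> y \<Longrightarrow> homog \<gamma> (x - y)"
  using homog_add[of \<gamma> x "- y"] homog_uminus by simp

lemma homog_sum: "(\<And>a. a \<in> A \<Longrightarrow> homog \<gamma> (f a)) \<Longrightarrow> homog \<gamma> (sum f A)"
  by (induction A rule: infinite_finite_induct) (auto intro: homog_add)

lemma homog_mult: "homog \<gamma> x \<Longrightarrow> homog \<delta> y \<Longrightarrow> homog (\<gamma> + \<delta>) (x * y)"
  using keys_mult[of x y] by (fastforce simp: homog_def plus_list_def)

lemma homog_cong: "homog \<gamma> x \<Longrightarrow> \<gamma> = \<delta> \<Longrightarrow> homog \<delta> x"
  by simp

lemma homog_gen: "homog (simple_root k) (word [k])"
  using homog_word[of "[k]"] by simp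

lemma homog_1: "homog 0 1"
  using homog_word[of "[]"] by simp

lemma homog_gen_power: "homog (of_nat n *s simple_root k) (word [k] ^ n)"
proof (induction n)
  case (Suc n)
  then show ?case using homog_mult[OF homog_gen Suc.IH, of k]
    by (rule_tac homog_cong, simp) (simp add: weight_eq_iff algebra_simps)
qed (simp add: homog_1)

text \<open>Since \<kappa> is arbitrary, this covers both the action of the torus on a Verma module
  and the projections to weight spaces.\<close>

definition diag :: "('i weight \<Rightarrow> qfield) \<Rightarrow> 'i lin" where
  "diag \<kappa> = linext (\<lambda>w. const (\<kappa> (wt w)) * word w)"

lemma diag_word [simp]: "app (diag \<kappa>) (word w) = const (\<kappa> (wt w)) * word w"
  by (simp add: diag_def)

lemma lookup_diag: "Poly_Mapping.lookup (app (diag \<kappa>) v) w = \<kappa> (wt w) * Poly_Mapping.lookup v w"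
  by (induction v rule: falg_induct) (simp_all add: lookup_add distrib_left)

lemma diag_homog: "homog \<gamma> v \<Longrightarrow> app (diag \<kappa>) v = const (\<kappa> \<gamma>) * v"
  by (rule poly_mapping_eqI) (auto simp: lookup_diag homog_def in_keys_iff)

lemma diag_mult: "diag \<kappa> * diag \<kappa>' = diag (\<lambda>\<beta>. \<kappa> \<beta> * \<kappa>' \<beta>)"
  by (rule lin_word_eqI) (simp add: mult.commute flip: mult.assoc fa.cst_mult)

lemma diag_1: "diag (\<lambda>_. 1) = 1"
  by (rule lin_word_eqI) (simp add: fa.cst_1)

lemma diag_gen: "diag \<kappa> * lmult (word [k]) = lmult (word [k]) * diag (\<lambda>\<beta>. \<kappa> (\<beta> + simple_root k))"
  by (rule lin_word_eqI) (simp add: add.commute flip: word_Cons[of k] fa.sc_def)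

lemma diag_scale: "diag (\<lambda>\<beta>. c * \<kappa> \<beta>) = li_sc c (diag \<kappa>)"
  by (rule lin_word_eqI) (simp add: fa.cst_mult mult.assoc)

section \<open>Operators of the generators on a Verma module\<close>

definition qstep :: "'i \<Rightarrow> qfield" where
  "qstep i = 1 / (qpow (d i) - qpow (- d i))"

text \<open>The two skew derivations \<open>skew 1 j\<close> and \<open>skew (-1) j\<close> make up the action of \<open>e\<^sub>j\<close> on a Verma module.\<close>

fun skew_word :: "rat \<Rightarrow> 'i \<Rightarrow> 'i list \<Rightarrow> 'i falg" where
  "skew_word s j [] = 0"
| "skew_word s j (k # w) = word [k] * skew_word s j w
    + (if k = j then const (qstep j * qpow (- (s * ip (wt w) (simple_root j)))) * word w else 0)"

definition skew :: "rat \<Rightarrow> 'i \<Rightarrow> 'i lin" where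
  "skew s j = linext (skew_word s j)"

text \<open>The skew derivations do not depend on \<nu>; the highest weight enters only through
  q^(\<nu>|\<alpha>_j) and its inverse. This is why the matrix entries of e_j are regular functions
  of q^\<nu>.\<close>

definition eop :: "'i weight \<Rightarrow> 'i \<Rightarrow> 'i lin" where
  "eop \<nu> j = li_sc (qpow (ip \<nu> (simple_root j))) (skew 1 j) - li_sc (qpow (- ip \<nu> (simple_root j))) (skew (- 1) j)"

definition fop :: "'i \<Rightarrow> 'i lin" where
  "fop j = lmult (word [j])"

definition kop :: "'i weight \<Rightarrow> rat \<Rightarrow> 'i \<Rightarrow> 'i lin" where
  "kop \<nu> s i = diag (\<lambda>\<beta>. qpow (s * ip (\<nu> - \<beta>) (simple_root i)))"

lemma skew_1 [simp]: "app (skew s j) 1 = 0"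
  using linext_word[of "skew_word s j" "[]"] by (simp add: skew_def)

lemma eop_1 [simp]: "app (eop \<nu> j) 1 = 0"
  by (simp add: eop_def)

lemma skew_fop: "skew s j * fop k = fop k * skew s j
    + (if k = j then li_sc (qstep j) (diag (\<lambda>\<beta>. qpow (- (s * ip \<beta> (simple_root j))))) else 0)"
  by (rule lin_word_eqI) (auto simp: fop_def skew_def word_Cons[of k, symmetric] fa.cst_mult mult.assoc)

text \<open>The definition strips letters from the left. Stripping them from the right shows how e_j
  acts on a product v f_k, as is needed once vectors are multiplied on the right by powers of
  f_i.\<close>

lemma skew_right: "app (skew s j) (v * word [k])
    = const (qpow (- (s * ip (simple_root k) (simple_root j)))) * (app (skew s j) v * word [k])
      + (if k = j then const (qstep j) * v else 0)"
proof (induction v rule: falg_induct)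
  case (word w)
  have *: "app (skew s j) (word (l # w)) = word [l] * app (skew s j) (word w)
    + (if l = j then const (qstep j * qpow (- (s * ip (wt w) (simple_root j)))) * word w else 0)" for l w
    by (simp add: skew_def)
  show ?case
  proof (induction w)
    case Nil
    show ?case using *[of k "[]"] by auto
  next
    case (Cons l w)
    have "app (skew s j) (word (l # w) * word [k]) = app (skew s j) (word (l # (w @ [k])))"
      by (simp add: word_append[symmetric])
    also have "\<dots> = word [l] * app (skew s j) (word w * word [k])
      + (if l = j then const (qstep j * qpow (- (s * ip (wt w) (simple_root j)))
          * qpow (- (s * ip (simple_root k) (simple_root j)))) * (word w * word [k]) else 0)"
      by (subst *) (simp add: word_append[symmetric] ip_add distrib_left qpow_add[symmetric] mult.assoc algebra_simps)
    finally show ?case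
      unfolding Cons.IH *[of l w]
      by (simp add: distrib_left distrib_right mult.assoc fa.sc_plus mult.commute[of "qpow _" "qstep _ * _"]
          word_Cons[of l w] flip: fa.sc_def)
  qed
next
  case (add x y)
  then show ?case by (simp add: distrib_right distrib_left)
next
  case (scale c x)
  have "app (skew s j) (const c * x * word [k]) = const c * app (skew s j) (x * word [k])"
    by (simp add: mult.assoc)
  then show ?case
    unfolding scale.IH
    by (simp add: distrib_left mult.assoc fa.sc_plus mult.commute[of "qpow _" c] mult.commute[of "qstep _" c] flip: fa.sc_def)
qed

lemma skew_homog: "homog \<gamma> v \<Longrightarrow> homog (\<gamma> - simple_root j) (app (skew s j) v)"
proof -
  have word: "homog (wt w - simple_root j) (skew_word s j w)" for w
  proof (induction w)
    case (Cons k w)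
    have "homog (wt (k # w) - simple_root j) (word [k] * skew_word s j w)"
      using homog_mult[OF homog_gen Cons.IH] by (rule homog_cong) simp
    moreover have "k = j \<Longrightarrow> homog (wt (k # w) - simple_root j) (const c * word w)" for c
      using homog_scale[OF homog_word] by simp
    ultimately show ?case by (auto intro: homog_add)
  qed simp
  assume "homog \<gamma> v"
  then have "wt w = \<gamma>" if "w \<in> Poly_Mapping.keys v" for w using that by (simp add: homog_def)
  then show ?thesis
    unfolding skew_def app_linext using word by (fastforce intro!: homog_sum homog_scale)
qed

lemma eop_homog: "homog \<gamma> v \<Longrightarrow> homog (\<gamma> - simple_root j) (app (eop \<nu> j) v)"
  by (simp add: eop_def homog_diff homog_scale skew_homog)

lemma diag_eop: "diag \<kappa> * eop \<nu> j = eop \<nu> j * diag (\<lambda>\<beta>. \<kappa> (\<beta> - simple_root j))"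
  by (rule lin_word_eqI) (simp add: diag_homog[OF eop_homog[OF homog_word]])

lemma kop_fop: "kop \<nu> s i * fop j = li_sc (qpow (- (s * ip (simple_root j) (simple_root i)))) (fop j * kop \<nu> s i)"
proof -
  have "qpow (s * ip (\<nu> - (\<beta> + simple_root j)) (simple_root i))
    = qpow (- (s * ip (simple_root j) (simple_root i))) * qpow (s * ip (\<nu> - \<beta>) (simple_root i))" for \<beta>
    by (simp add: ip_simps algebra_simps flip: qpow_add)
  then show ?thesis
    unfolding kop_def fop_def diag_gen by (simp add: diag_scale)
qed

lemma kop_eop: "kop \<nu> s i * eop \<mu> j = li_sc (qpow (s * ip (simple_root j) (simple_root i))) (eop \<mu> j * kop \<nu> s i)"
proof -
  have "qpow (s * ip (\<nu> - (\<beta> - simple_root j)) (simple_root i))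
    = qpow (s * ip (simple_root j) (simple_root i)) * qpow (s * ip (\<nu> - \<beta>) (simple_root i))" for \<beta>
    by (simp add: ip_simps algebra_simps flip: qpow_add)
  then show ?thesis
    unfolding kop_def diag_eop by (simp add: diag_scale)
qed

lemma eop_fop: "eop \<nu> j * fop k = fop k * eop \<nu> j
    + (if k = j then li_sc (qstep j) (kop \<nu> 1 j - kop \<nu> (- 1) j) else 0)"
proof -
  have k: "kop \<nu> s j = li_sc (qpow (s * ip \<nu> (simple_root j))) (diag (\<lambda>\<beta>. qpow (- (s * ip \<beta> (simple_root j)))))" for s
    unfolding kop_def by (simp add: ip_diff right_diff_distrib qpow_diff qpow_minus divide_inverse diag_scale)
  have "eop \<nu> j * fop k = li_sc (qpow (ip \<nu> (simple_root j))) (skew 1 j * fop k)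
     - li_sc (qpow (- ip \<nu> (simple_root j))) (skew (- 1) j * fop k)"
    by (simp add: eop_def left_diff_distrib)
  then show ?thesis
    unfolding skew_fop k eop_def
    by (simp add: right_diff_distrib li.sc_plus li.sc_minus_right mult.commute)
qed

lemma eop_fop_homog:
  assumes "homog \<gamma> v"
  shows "app (eop \<nu> j) (word [j] * v) = word [j] * app (eop \<nu> j) v
    + const (bracket (d j) (ip (\<nu> - \<gamma>) (simple_root j) / d j)) * v"
proof -
  have "app (eop \<nu> j) (word [j] * v) = app (eop \<nu> j * fop j) v" by (simp add: fop_def)
  also have "\<dots> = word [j] * app (eop \<nu> j) v + const (qstep j) *
     (const (qpow (ip (\<nu> - \<gamma>) (simple_root j))) * v - const (qpow (- ip (\<nu> - \<gamma>) (simple_root j))) * v)"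
    unfolding eop_fop by (simp add: fop_def kop_def diag_homog[OF assms])
  finally show ?thesis
    by (simp add: bracket_def qstep_def fa.cst_diff diff_divide_distrib left_diff_distrib right_diff_distrib
        flip: mult.assoc fa.cst_mult)
qed

text \<open>Think of v f_k as v applied to the vector f_k of weight \<nu> - \<alpha>_k: hence the
  operator of M(\<nu> - \<alpha>_k), and the correction v e_j f_k when k = j.\<close>

lemma eop_right: "app (eop \<nu> j) (v * word [k]) = app (eop (\<nu> - simple_root k) j) v * word [k]
    + (if k = j then const (bracket (d j) (ip \<nu> (simple_root j) / d j)) * v else 0)"
proof -
  have e: "qpow (ip \<nu> (simple_root j)) * qpow (- (1 * ip (simple_root k) (simple_root j))) = qpow (ip (\<nu> - simple_root k) (simple_root j))"
    "qpow (- ip \<nu> (simple_root j)) * qpow (- (- 1 * ip (simple_root k) (simple_root j))) = qpow (- ip (\<nu> - simple_root k) (simple_root j))"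
    by (simp_all add: ip_simps flip: qpow_add)
  show ?thesis
    unfolding eop_def app_lin app_sc skew_right distrib_left mult.assoc[symmetric] fa.cst_mult[symmetric] e
    by (auto simp: left_diff_distrib bracket_def qstep_def fa.cst_diff diff_divide_distrib
        simp flip: mult.assoc fa.cst_mult)
qed

section \<open>The Serre elements and their ideal\<close>

definition serre_f :: "'i \<Rightarrow> 'i \<Rightarrow> 'i falg" where
  "serre_f i j = (let n = nat (1 - a i j) in
    \<Sum>m = 0..n. const ((- 1) ^ m / (q_fact i m * q_fact i (n - m))) * word [i] ^ m * word [j] * word [i] ^ (n - m))"

text \<open>With scalar and word multiples of the Serre elements as generators, sums are the only
  closure rule, so inductions have one substantial case.\<close>

inductive_set serre_ideal :: "'i falg set" where
  zero: "0 \<in> serre_ideal"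
| gen: "i \<noteq> j \<Longrightarrow> const c * (word u * serre_f i j * word v) \<in> serre_ideal"
| add: "x \<in> serre_ideal \<Longrightarrow> y \<in> serre_ideal \<Longrightarrow> x + y \<in> serre_ideal"

lemma q_int_bracket: "q_int i k = bracket (d i) (of_nat k)"
  by (simp add: q_int_def bracket_def)

lemma q_fact_qfact: "q_fact i k = qfact (d i) k"
  by (simp add: q_fact_def qfact_def q_int_bracket)

lemma serre_general:
  fixes cst :: "qfield \<Rightarrow> 'r::ring_1"
  assumes "algebra_over_qfield cst" "i \<noteq> j"
  shows "(let n = nat (1 - a i j) in
      \<Sum>m = 0..n. cst ((- 1) ^ m / (q_fact i m * q_fact i (n - m))) * x ^ m * z * x ^ (n - m))
    = algebra_over_qfield.sc cst (1 / qfact (d i) (nat (1 - a i j)))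
      (algebra_over_qfield.adq cst (\<lambda>k. qpow (d i * (of_int (a i j) + 2 * of_nat k))) x z (nat (1 - a i j)))"
proof -
  interpret algebra_over_qfield cst by fact
  have t: "of_int (a i j) = (1 - of_nat (nat (1 - a i j)) :: rat)"
    using off_diag[OF assms(2)] by simp
  show ?thesis unfolding Let_def q_fact_qfact t by (rule serre_eq_adq) simp
qed

lemma lmult_power: "lmult (x ^ n) = lmult x ^ n"
  by (induction n) (simp_all add: lmult_simps)

lemma lmult_sum: "lmult (sum f A) = (\<Sum>a\<in>A. lmult (f a))"
  by (induction A rule: infinite_finite_induct) (auto simp: lmult_simps intro: lin_eqI)

lemma lmult_serre_f:
  assumes "i \<noteq> j"
  shows "lmult (serre_f i j) = li_sc (1 / qfact (d i) (nat (1 - a i j)))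
      (li_adq (\<lambda>k. qpow (d i * (of_int (a i j) + 2 * of_nat k))) (fop i) (fop j) (nat (1 - a i j)))"
  unfolding li_sc_def li_adq_def serre_general[OF li.algebra_over_qfield_axioms assms, symmetric]
  by (simp add: serre_f_def Let_def lmult_sum lmult_simps lmult_power fop_def)

text \<open>The case k = i is \<open>adq_serre_commute\<close>, the case k = j is its variant, and
  any other e_k commutes with both letters. Hence e_k preserves the Serre ideal and acts on the
  quotient.\<close>

lemma eop_serre_f:
  assumes "i \<noteq> j"
  shows "eop \<nu> k * lmult (serre_f i j) = lmult (serre_f i j) * eop \<nu> k"
proof -
  let ?t = "of_int (a i j) :: rat"
  let ?n = "nat (1 - a i j)"
  have t: "?t = 1 - of_nat ?n" "?n > 0" using off_diag[OF assms] by simp_all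
  have ij: "ip (simple_root j) (simple_root i) = ?t * d i" "ip (simple_root i) (simple_root j) = ?t * d i"
    by (simp_all add: ip_simple_roots) (metis d_a_sym mult.commute)
  have "eop \<nu> k * li_adq (\<lambda>k. qpow (d i * (?t + 2 * of_nat k))) (fop i) (fop j) ?n
    = li_adq (\<lambda>k. qpow (d i * (?t + 2 * of_nat k))) (fop i) (fop j) ?n * eop \<nu> k"
  proof -
    consider "k = i" | "k = j" | "k \<noteq> i" "k \<noteq> j" by blast
    then show ?thesis
    proof cases
      case 1
      show ?thesis
        by (rule li.adq_serre_commute[where \<delta> = "d i" and t = ?t and K = "kop \<nu> 1 i" and K' = "kop \<nu> (- 1) i" and g = "qstep i"])
          (use 1 assms t in \<open>simp_all add: eop_fop kop_fop ij ip_simple_self\<close>)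
    next
      case 2
      show ?thesis
        by (rule li.adq_serre_commute'[where \<delta> = "d i" and t = ?t and K = "kop \<nu> 1 j" and K' = "kop \<nu> (- 1) j" and g = "qstep j"])
          (use 2 assms t in \<open>simp_all add: eop_fop kop_fop ij\<close>)
    next
      case 3
      then show ?thesis by (intro li.adq_commute) (simp_all add: eop_fop)
    qed
  qed
  then show ?thesis unfolding lmult_serre_f[OF assms] by simp
qed

text \<open>An operator that commutes with all f_k and kills 1 is zero, as the words arise from 1 by
  the f_k. So the Serre relations of the e_j hold on the free algebra itself, before any quotient is
  taken.\<close>

lemma serre_e_zero:
  assumes "i \<noteq> j"
  shows "li_adq (\<lambda>k. qpow (d i * (of_int (a i j) + 2 * of_nat k))) (eop \<nu> i) (eop \<nu> j) (nat (1 - a i j)) = 0"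
    (is "?S = 0")
proof -
  let ?t = "of_int (a i j) :: rat"
  let ?n = "nat (1 - a i j)"
  have t: "?t = 1 - of_nat ?n" "?n > 0" using off_diag[OF assms] by simp_all
  have ij: "ip (simple_root j) (simple_root i) = ?t * d i" "ip (simple_root i) (simple_root j) = ?t * d i"
    by (simp_all add: ip_simple_roots) (metis d_a_sym mult.commute)
  have comm: "fop k * ?S = ?S * fop k" for k
  proof -
    consider "k = i" | "k = j" | "k \<noteq> i" "k \<noteq> j" by blast
    then show ?thesis
    proof cases
      case 1
      \<comment> \<open>K and K' change places in comparison with \<open>eop_serre_f\<close>, since
        f_i e_i - e_i f_i has the opposite sign.\<close>
      show ?thesis
        by (rule li.adq_serre_commute[where \<delta> = "d i" and t = ?t and K = "kop \<nu> (- 1) i" and K' = "kop \<nu> 1 i" and g = "qstep i"])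
          (use 1 assms t in \<open>simp_all add: eop_fop kop_eop ij ip_simple_self li.sc_minus_right\<close>)
    next
      case 2
      show ?thesis
        by (rule li.adq_serre_commute'[where \<delta> = "d i" and t = ?t and K = "kop \<nu> (- 1) j" and K' = "kop \<nu> 1 j" and g = "qstep j"])
          (use 2 assms t in \<open>simp_all add: eop_fop kop_eop ij li.sc_minus_right\<close>)
    next
      case 3
      then show ?thesis by (intro li.adq_commute) (simp_all add: eop_fop)
    qed
  qed
  have one: "app (li_adq s (eop \<nu> i) (eop \<nu> j) n) 1 = 0" for s n
    by (induction n) simp_all
  have "app ?S (word w) = 0" for w
  proof (induction w)
    case Nil
    show ?case using one by simp
  next
    case (Cons k w)
    have "app ?S (word (k # w)) = app (?S * fop k) (word w)" by (simp add: fop_def word_Cons[of k w])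
    also have "\<dots> = word [k] * app ?S (word w)" unfolding comm[symmetric] by (simp add: fop_def)
    finally show ?case using Cons.IH by simp
  qed
  then show ?thesis by (intro lin_word_eqI) simp
qed

lemma serre_f_homog: "homog (of_nat (nat (1 - a i j)) *s simple_root i + simple_root j) (serre_f i j)"
  unfolding serre_f_def Let_def
proof (intro homog_sum)
  fix m assume "m \<in> {0..nat (1 - a i j)}"
  then have "of_nat m *s simple_root i + simple_root j + of_nat (nat (1 - a i j) - m) *s simple_root i
    = of_nat (nat (1 - a i j)) *s simple_root i + simple_root j"
    by (simp add: weight_eq_iff of_nat_diff algebra_simps)
  then show "homog (of_nat (nat (1 - a i j)) *s simple_root i + simple_root j)
    (const ((- 1) ^ m / (q_fact i m * q_fact i (nat (1 - a i j) - m))) * word [i] ^ m * word [j] * word [i] ^ (nat (1 - a i j) - m))"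
    using homog_mult[OF homog_mult[OF homog_scale[OF homog_gen_power] homog_gen] homog_gen_power] by metis
qed

lemma serre_ideal_scale: "x \<in> serre_ideal \<Longrightarrow> const c * x \<in> serre_ideal"
proof (induction rule: serre_ideal.induct)
  case (gen i j b u v)
  then show ?case using serre_ideal.gen[OF gen, of "c * b" u v] by (simp add: fa.cst_mult mult.assoc)
qed (auto simp: distrib_left intro: serre_ideal.intros)

lemma serre_ideal_uminus: "x \<in> serre_ideal \<Longrightarrow> - x \<in> serre_ideal"
  using serre_ideal_scale[of x "- 1"] by (simp add: const_uminus fa.cst_1)

lemma serre_ideal_diff: "x \<in> serre_ideal \<Longrightarrow> y \<in> serre_ideal \<Longrightarrow> x - y \<in> serre_ideal"
  using serre_ideal.add[of x "- y"] serre_ideal_uminus by simp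

lemma serre_ideal_sum: "(\<And>a. a \<in> A \<Longrightarrow> f a \<in> serre_ideal) \<Longrightarrow> sum f A \<in> serre_ideal"
  by (induction A rule: infinite_finite_induct) (auto intro: serre_ideal.intros)

lemma serre_ideal_lmult: "x \<in> serre_ideal \<Longrightarrow> y * x \<in> serre_ideal"
proof (induction rule: serre_ideal.induct)
  case (gen i j c u v)
  show ?case
  proof (induction y rule: falg_induct)
    case (word w)
    have "word w * (const c * (word u * serre_f i j * word v)) = const c * (word (w @ u) * serre_f i j * word v)"
      by (simp add: word_append mult.assoc flip: fa.sc_def)
    then show ?case using serre_ideal.gen[OF gen] by simp
  qed (auto simp: distrib_right mult.assoc intro: serre_ideal.add serre_ideal_scale)
qed (auto simp: distrib_left intro: serre_ideal.intros)

lemma serre_ideal_rmult: "x \<in> serre_ideal \<Longrightarrow> x * y \<in> serre_ideal"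
proof (induction rule: serre_ideal.induct)
  case (gen i j c u v)
  show ?case
  proof (induction y rule: falg_induct)
    case (word w)
    have "const c * (word u * serre_f i j * word v) * word w = const c * (word u * serre_f i j * word (v @ w))"
      by (simp add: word_append mult.assoc)
    then show ?case using serre_ideal.gen[OF gen] by simp
  next
    case (scale b x)
    then show ?case by (metis const_left_commute serre_ideal_scale)
  qed (auto simp: distrib_left intro: serre_ideal.add)
qed (auto simp: distrib_right intro: serre_ideal.intros)

lemma serre_f_in: "i \<noteq> j \<Longrightarrow> serre_f i j \<in> serre_ideal"
  using serre_ideal.gen[of i j 1 "[]" "[]"] by (simp add: fa.cst_1)

lemma diag_serre_ideal: "x \<in> serre_ideal \<Longrightarrow> app (diag \<kappa>) x \<in> serre_ideal"
proof (induction rule: serre_ideal.induct)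
  case (gen i j c u v)
  show ?case
    by (subst diag_homog[OF homog_scale[OF homog_mult[OF homog_mult[OF homog_word serre_f_homog] homog_word]]])
      (intro serre_ideal_scale serre_ideal.gen gen)
qed (auto intro: serre_ideal.intros)

lemma eop_serre_ideal: "x \<in> serre_ideal \<Longrightarrow> app (eop \<nu> k) x \<in> serre_ideal"
proof (induction rule: serre_ideal.induct)
  case (gen i j c u v)
  have "app (eop \<nu> k) (word u * (serre_f i j * y)) \<in> serre_ideal" for y
  proof (induction u)
    case Nil
    have "app (eop \<nu> k) (serre_f i j * y) = app (eop \<nu> k * lmult (serre_f i j)) y" by simp
    also have "\<dots> = serre_f i j * app (eop \<nu> k) y" unfolding eop_serre_f[OF gen] by simp
    finally show ?case using serre_ideal_rmult[OF serre_f_in[OF gen]] by simp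
  next
    case (Cons l u)
    let ?z = "word u * (serre_f i j * y)"
    have z: "?z \<in> serre_ideal" by (intro serre_ideal_lmult serre_ideal_rmult serre_f_in gen)
    have "app (eop \<nu> k) (word (l # u) * (serre_f i j * y)) = app (eop \<nu> k * fop l) ?z"
      by (simp add: fop_def word_Cons[of l u] mult.assoc)
    also have "\<dots> \<in> serre_ideal"
      unfolding eop_fop using Cons.IH z
      by (auto simp: fop_def kop_def intro!: serre_ideal.add serre_ideal_lmult serre_ideal_scale serre_ideal_diff diag_serre_ideal)
    finally show ?case .
  qed
  then show ?case by (simp add: mult.assoc serre_ideal_scale)
qed (auto intro: serre_ideal.intros)

text \<open>The coefficient of the highest weight vector. It vanishes on \<open>serre_ideal\<close>
  and so is a functional on every Verma module.\<close>

definition vac :: "'i falg \<Rightarrow> qfield" where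
  "vac v = Poly_Mapping.lookup v []"

lemma vac_simps [simp]: "vac (x + y) = vac x + vac y" "vac (x - y) = vac x - vac y" "vac (const c * x) = c * vac x"
  "vac 0 = 0" "vac 1 = 1" "vac (- x) = - vac x"
  by (simp_all add: vac_def lookup_add lookup_minus lookup_one zero_list_def[symmetric])

lemma vac_sum: "vac (sum f A) = (\<Sum>a\<in>A. vac (f a))"
  by (simp add: vac_def lookup_sum)

lemma vac_word: "vac (word w) = (if w = [] then 1 else 0)"
  by (simp add: vac_def)

lemma vac_mult: "vac (x * y) = vac x * vac y"
proof (induction x rule: falg_induct)
  case (word w)
  show ?case by (induction y rule: falg_induct) (simp_all add: vac_word const_left_commute[of "word _"] distrib_left flip: word_append)
qed (simp_all add: distrib_right mult.assoc)

lemma vac_serre_ideal: "x \<in> serre_ideal \<Longrightarrow> vac x = 0"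
proof (induction rule: serre_ideal.induct)
  case (gen i j c u v)
  have "vac (serre_f i j) = 0" by (simp add: serre_f_def Let_def vac_sum vac_mult vac_word)
  then show ?case by (simp add: vac_mult)
qed simp_all

lemma homog_vac: "homog \<gamma> v \<Longrightarrow> \<gamma> \<noteq> 0 \<Longrightarrow> vac v = 0"
  by (metis homog_def in_keys_iff vac_def wt_simps(1))

lemma homog_zero_weight:
  assumes "homog 0 v"
  shows "v = const (vac v)"
proof (rule poly_mapping_eqI)
  fix w
  have "w = []" if "wt w = 0"
  proof (cases w)
    case (Cons k u)
    have "0 \<le> wt u $ k" for u by (induction u) (simp_all add: simple_root_nth)
    then have "wt w $ k > 0" using Cons by (simp add: simple_root_nth add_pos_nonneg)
    then show ?thesis using that by simp
  qed
  then have "w \<noteq> [] \<Longrightarrow> w \<notin> Poly_Mapping.keys v" using assms by (auto simp: homog_def)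
  then show "Poly_Mapping.lookup v w = Poly_Mapping.lookup (const (vac v)) w"
    by (cases "w = []") (auto simp: homog_def const_def vac_def lookup_single when_def in_keys_iff)
qed

lemma wt_nonneg: "wt w $ k \<in> \<nat>"
  by (induction w) (auto simp: simple_root_nth)

lemma homog_not_Q_plus: "homog \<gamma> v \<Longrightarrow> \<gamma> \<notin> Q_plus \<Longrightarrow> v = 0"
  using wt_nonneg by (fastforce simp: homog_def Q_plus_def keys_eq_empty[symmetric] simp del: keys_eq_empty)

end

section \<open>Singular vectors and simple reflections\<close>

context finite_cartan_datum
begin

abbreviation cow :: "'i \<Rightarrow> 'i weight \<Rightarrow> rat" where
  "cow i x \<equiv> pairing x (simple_coroot i)"

lemma cow_diff: "cow i (x - y) = cow i x - cow i y"
  by (simp add: pairing_def left_diff_distrib sum_subtractf)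

lemma cow_simple [simp]: "cow i (simple_root i) = 2"
  by (simp add: pairing_simple_root diag)

lemmas cow_simps = pairing_add pairing_scale cow_diff

section \<open>Congruence modulo the Serre ideal\<close>

definition eqv :: "'i falg \<Rightarrow> 'i falg \<Rightarrow> bool" (infix "\<doteq>" 50) where
  "x \<doteq> y \<longleftrightarrow> x - y \<in> serre_ideal"

lemma eqv_refl [simp]: "x \<doteq> x"
  by (simp add: eqv_def serre_ideal.zero)

lemma eqv_sym: "x \<doteq> y \<Longrightarrow> y \<doteq> x"
  using serre_ideal_uminus[of "x - y"] by (simp add: eqv_def)

lemma eqv_trans [trans]: "x \<doteq> y \<Longrightarrow> y \<doteq> z \<Longrightarrow> x \<doteq> z"
  using serre_ideal.add[of "x - y" "y - z"] by (simp add: eqv_def)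

lemma eqv_trans_eq [trans]: "x = y \<Longrightarrow> y \<doteq> z \<Longrightarrow> x \<doteq> z" "x \<doteq> y \<Longrightarrow> y = z \<Longrightarrow> x \<doteq> z"
  by simp_all

lemma eqv_0: "x \<doteq> 0 \<longleftrightarrow> x \<in> serre_ideal"
  by (simp add: eqv_def)

lemma eqv_add: "x \<doteq> y \<Longrightarrow> x' \<doteq> y' \<Longrightarrow> x + x' \<doteq> y + y'"
  using serre_ideal.add[of "x - y" "x' - y'"] by (simp add: eqv_def algebra_simps)

lemma eqv_diff: "x \<doteq> y \<Longrightarrow> x' \<doteq> y' \<Longrightarrow> x - x' \<doteq> y - y'"
  using serre_ideal_diff[of "x - y" "x' - y'"] by (simp add: eqv_def algebra_simps)

lemma eqv_lmult: "x \<doteq> y \<Longrightarrow> z * x \<doteq> z * y"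
  using serre_ideal_lmult[of "x - y" z] by (simp add: eqv_def algebra_simps)

lemma eqv_rmult: "x \<doteq> y \<Longrightarrow> x * z \<doteq> y * z"
  using serre_ideal_rmult[of "x - y" z] by (simp add: eqv_def algebra_simps)

lemma eqv_eop: "x \<doteq> y \<Longrightarrow> app (eop \<nu> j) x \<doteq> app (eop \<nu> j) y"
  using eop_serre_ideal[of "x - y"] by (simp add: eqv_def)

lemma eqv_sum: "(\<And>a. a \<in> A \<Longrightarrow> f a \<doteq> g a) \<Longrightarrow> sum f A \<doteq> sum g A"
  by (induction A rule: infinite_finite_induct) (auto intro: eqv_add)

lemma eqv_mem: "x \<doteq> y \<Longrightarrow> x \<in> serre_ideal \<longleftrightarrow> y \<in> serre_ideal"
  by (metis eqv_0 eqv_sym eqv_trans)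

lemma serre_ideal_scale_iff: "c \<noteq> 0 \<Longrightarrow> const c * x \<in> serre_ideal \<longleftrightarrow> x \<in> serre_ideal"
  using serre_ideal_scale[of x c] serre_ideal_scale[of "const c * x" "inverse c"]
  by (auto simp: fa.cst_1 simp flip: mult.assoc fa.cst_mult)

section \<open>Commutation of e_j with powers of f_i\<close>

lemma word_power_commute: "word [i] ^ n * (word [i] * v) = word [i] * (word [i] ^ n * v)"
  by (simp add: power_commutes flip: mult.assoc)

lemma homog_power_left: "homog \<gamma> v \<Longrightarrow> homog (\<gamma> + of_nat n *s simple_root i) (word [i] ^ n * v)"
  using homog_mult[OF homog_gen_power, of \<gamma> v n i] by (simp add: add.commute)

lemma homog_power_right: "homog \<gamma> v \<Longrightarrow> homog (\<gamma> + of_nat n *s simple_root i) (v * word [i] ^ n)"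
  using homog_mult[OF _ homog_gen_power, of \<gamma> v n i] by simp

lemma eop_left:
  assumes "homog \<gamma> v"
  shows "app (eop \<nu> j) (word [k] * v) = word [k] * app (eop \<nu> j) v
    + (if k = j then const (bracket (d j) (cow j (\<nu> - \<gamma>))) * v else 0)"
proof (cases "k = j")
  case True
  then show ?thesis using eop_fop_homog[OF assms] by (simp add: pairing_simple_coroot')
next
  case False
  have "app (eop \<nu> j) (word [k] * v) = app (eop \<nu> j * fop k) v" by (simp add: fop_def)
  then show ?thesis using False by (subst (asm) eop_fop) (simp add: fop_def)
qed

lemma eop_right': "app (eop \<nu> j) (v * word [k]) = app (eop (\<nu> - simple_root k) j) v * word [k]
    + (if k = j then const (bracket (d j) (cow j \<nu>)) * v else 0)"
  using eop_right by (simp add: pairing_simple_coroot')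

text \<open>The sl_2 coefficient [n][h - n + 1], with h the \<alpha>_i^\<vee>-weight of v in
  M(\<nu>). At n = h + 1 it vanishes, and then e_i passes f_i^n freely; at n = 0 the truncated
  exponent n - 1 is harmless because of [0] = 0.\<close>

lemma eop_power_left:
  assumes "homog \<gamma> v"
  shows "app (eop \<nu> j) (word [i] ^ n * v) = word [i] ^ n * app (eop \<nu> j) v
    + (if i = j then const (bracket (d i) (of_nat n) * bracket (d i) (cow i (\<nu> - \<gamma>) - of_nat n + 1)) * (word [i] ^ (n - 1) * v) else 0)"
proof (induction n)
  case (Suc n)
  have h: "cow k (\<nu> - (\<gamma> + of_nat n *s simple_root k)) = cow k (\<nu> - \<gamma>) - 2 * of_nat n" for k
    by (simp add: cow_simps)
  let ?h = "cow i (\<nu> - \<gamma>)"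
  have coef: "bracket (d i) (of_nat n) * bracket (d i) (?h - of_nat n + 1) + bracket (d i) (?h - 2 * of_nat n)
    = bracket (d i) (of_nat (Suc n)) * bracket (d i) (?h - of_nat n)"
    using bracket_mult_diff[of "d i" "of_nat (Suc n)" "of_nat n - ?h"]
      bracket_minus[of "d i" "?h - of_nat n"] bracket_minus[of "d i" "?h - of_nat n + 1"] bracket_minus[of "d i" "?h - 2 * of_nat n"]
    by (simp add: algebra_simps)
  have IH: "word [i] * app (eop \<nu> j) (word [i] ^ n * v) = word [i] ^ Suc n * app (eop \<nu> j) v
    + (if i = j then const (bracket (d i) (of_nat n) * bracket (d i) (?h - of_nat n + 1)) * (word [i] ^ n * v) else 0)"
  proof (cases n)
    case (Suc m)
    then show ?thesis unfolding Suc.IH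
      by (simp add: distrib_left const_left_commute[of "word _"] mult.assoc)
  qed simp
  have "app (eop \<nu> j) (word [i] ^ Suc n * v) = app (eop \<nu> j) (word [i] * (word [i] ^ n * v))"
    by (simp add: mult.assoc)
  also have "\<dots> = word [i] ^ Suc n * app (eop \<nu> j) v
    + (if i = j then const (bracket (d i) (of_nat (Suc n)) * bracket (d i) (?h - of_nat n)) * (word [i] ^ n * v) else 0)"
    unfolding eop_left[OF homog_power_left[OF assms]] IH coef[symmetric]
    by (auto simp: h fa.cst_add distrib_right)
  finally show ?case by simp
qed simp

text \<open>Here f_i^n acts on the highest weight vector, so the coefficient depends on \<nu> alone,
  and e_j reaches v in the module of highest weight \<nu> - n \<alpha>_i.\<close>

lemma eop_power_right:
  "app (eop \<nu> j) (v * word [i] ^ n) = app (eop (\<nu> - of_nat n *s simple_root i) j) v * word [i] ^ n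
    + (if i = j then const (bracket (d i) (of_nat n) * bracket (d i) (cow i \<nu> - of_nat n + 1)) * (v * word [i] ^ (n - 1)) else 0)"
proof (induction n arbitrary: \<nu>)
  case (Suc n)
  let ?h = "cow i \<nu>"
  have coef: "bracket (d i) (of_nat n) * bracket (d i) (?h - 2 - of_nat n + 1) + bracket (d i) ?h
    = bracket (d i) (of_nat (Suc n)) * bracket (d i) (?h - of_nat n)"
    using bracket_mult_diff[of "d i" "of_nat (Suc n)" "?h - of_nat n"] by (simp add: algebra_simps)
  have \<nu>: "\<nu> - simple_root i - of_nat n *s simple_root i = \<nu> - of_nat (Suc n) *s simple_root i"
    by (simp add: weight_eq_iff algebra_simps)
  have IH: "app (eop (\<nu> - simple_root i) j) (v * word [i] ^ n) * word [i]
    = app (eop (\<nu> - of_nat (Suc n) *s simple_root i) j) v * word [i] ^ Suc n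
    + (if i = j then const (bracket (d i) (of_nat n) * bracket (d i) (?h - 2 - of_nat n + 1)) * (v * word [i] ^ n) else 0)"
  proof (cases n)
    case 0
    then show ?thesis by simp
  next
    case (Suc m)
    have "v * word [i] ^ m * word [i] = v * word [i] ^ n" by (simp add: Suc power_commutes mult.assoc)
    then show ?thesis unfolding Suc.IH \<nu>
      by (simp add: distrib_right mult.assoc power_commutes cow_diff Suc)
  qed
  have "app (eop \<nu> j) (v * word [i] ^ Suc n) = app (eop \<nu> j) (v * word [i] ^ n * word [i])"
    by (simp add: mult.assoc power_commutes)
  also have "\<dots> = app (eop (\<nu> - of_nat (Suc n) *s simple_root i) j) v * word [i] ^ Suc n
    + (if i = j then const (bracket (d i) (of_nat (Suc n)) * bracket (d i) (?h - of_nat n)) * (v * word [i] ^ n) else 0)"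
    unfolding eop_right' IH coef[symmetric] by (auto simp: fa.cst_add distrib_right)
  finally show ?case by simp
qed simp

section \<open>Cancellation of powers of f_i modulo the Serre ideal\<close>

lemma half_not_int: "(1 / 2 :: rat) + of_int z \<noteq> 0"
proof
  assume "(1 / 2 :: rat) + of_int z = 0"
  then have "of_int (2 * z + 1) = (0 :: rat)" by simp
  then show False by (simp only: of_int_eq_0_iff) presburger
qed

lemma exists_half_weight: "\<exists>\<nu>. cow i (\<nu> - \<gamma>) = 1 / 2"
  by (rule exI[of _ "(1 / 4) *s simple_root i + \<gamma>"]) (simp add: cow_simps)

text \<open>Both cancellation lemmas use a Verma module in which \<open>f\<^sub>i\<close> acts with half-integral weights, so that the
  coefficients of \<open>e\<^sub>i f\<^sub>i\<^sup>n - f\<^sub>i\<^sup>n e\<^sub>i\<close> do not vanish.\<close>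

lemma left_cancel:
  assumes "homog \<gamma> v" "word [i] ^ n * v \<in> serre_ideal"
  shows "v \<in> serre_ideal"
proof -
  \<comment> \<open>Outer induction on a bound for the \<alpha>_i-coordinate of the weight, which
    e_i lowers, and inner induction on n. For K = 0 the coordinate is negative and v is
    zero.\<close>
  have "\<forall>\<gamma> v n. \<gamma> $ i < of_nat K \<longrightarrow> homog \<gamma> v \<longrightarrow> word [i] ^ n * v \<in> serre_ideal \<longrightarrow> v \<in> serre_ideal" for K
  proof (induction K)
    case 0
    then show ?case using homog_not_Q_plus serre_ideal.zero
      by (auto simp: Q_plus_def) (metis Nats_cases linorder_not_le of_nat_0_le_iff)
  next
    case (Suc K)
    note outer = Suc.IH
    show ?case
    proof (intro allI impI)
      fix \<gamma> v n
      assume \<gamma>: "\<gamma> $ i < of_nat (Suc K)" and v: "homog \<gamma> v" and "word [i] ^ n * v \<in> serre_ideal"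
      from this(3) show "v \<in> serre_ideal"
      proof (induction n)
        case (Suc n)
        obtain \<nu> where \<nu>: "cow i (\<nu> - \<gamma>) = 1 / 2" using exists_half_weight by blast
        define c where "c = bracket (d i) (of_nat (Suc n)) * bracket (d i) (1 / 2 - of_nat n)"
        have "1 / 2 - of_nat n \<noteq> (0 :: rat)" using half_not_int[of "- int n"] by simp
        then have c: "c \<noteq> 0" by (simp add: c_def del: of_nat_Suc)
        have "app (eop \<nu> i) (word [i] ^ Suc n * v) \<in> serre_ideal" using Suc.prems by (rule eop_serre_ideal)
        then have *: "word [i] ^ Suc n * app (eop \<nu> i) v + const c * (word [i] ^ n * v) \<in> serre_ideal"
          unfolding eop_power_left[OF v] by (simp add: \<nu> c_def)
        \<comment> \<open>One more factor f_i turns the second term into a multiple of the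
          assumption; what remains is of the form that the outer induction requires for e_i
          v.\<close>
        have "word [i] * (word [i] ^ Suc n * app (eop \<nu> i) v + const c * (word [i] ^ n * v)) - const c * (word [i] ^ Suc n * v) \<in> serre_ideal"
          by (rule serre_ideal_diff[OF serre_ideal_lmult[OF *] serre_ideal_scale[OF Suc.prems]])
        then have "word [i] ^ Suc (Suc n) * app (eop \<nu> i) v \<in> serre_ideal"
          by (simp add: distrib_left const_left_commute[of "word _"] mult.assoc)
        moreover have "(\<gamma> - simple_root i) $ i < of_nat K" using \<gamma> by (simp add: simple_root_nth)
        ultimately have "app (eop \<nu> i) v \<in> serre_ideal"
          using outer eop_homog[OF v] by blast
        then have "word [i] ^ Suc n * app (eop \<nu> i) v \<in> serre_ideal" by (rule serre_ideal_lmult)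
        from serre_ideal_diff[OF * this] have "const c * (word [i] ^ n * v) \<in> serre_ideal" by simp
        then show ?case using Suc.IH c by (simp add: serre_ideal_scale_iff)
      qed simp
    qed
  qed
  then show ?thesis using assms reals_Archimedean2[of "\<gamma> $ i"] by blast
qed

lemma right_cancel:
  assumes "homog \<gamma> v" "v * word [i] ^ n \<in> serre_ideal"
  shows "v \<in> serre_ideal"
proof -
  have "\<forall>\<gamma> v n. \<gamma> $ i < of_nat K \<longrightarrow> homog \<gamma> v \<longrightarrow> v * word [i] ^ n \<in> serre_ideal \<longrightarrow> v \<in> serre_ideal" for K
  proof (induction K)
    case 0
    then show ?case using homog_not_Q_plus serre_ideal.zero
      by (auto simp: Q_plus_def) (metis Nats_cases linorder_not_le of_nat_0_le_iff)
  next
    case (Suc K)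
    note outer = Suc.IH
    show ?case
    proof (intro allI impI)
      fix \<gamma> v n
      assume \<gamma>: "\<gamma> $ i < of_nat (Suc K)" and v: "homog \<gamma> v" and "v * word [i] ^ n \<in> serre_ideal"
      from this(3) show "v \<in> serre_ideal"
      proof (induction n)
        case (Suc n)
        obtain \<nu> where \<nu>: "cow i \<nu> = 1 / 2" using exists_half_weight[where i = i and \<gamma> = 0] by auto
        define c where "c = bracket (d i) (of_nat (Suc n)) * bracket (d i) (1 / 2 - of_nat n)"
        have "1 / 2 - of_nat n \<noteq> (0 :: rat)" using half_not_int[of "- int n"] by simp
        then have c: "c \<noteq> 0" by (simp add: c_def del: of_nat_Suc)
        define E where "E = app (eop (\<nu> - of_nat (Suc n) *s simple_root i) i) v"
        have "app (eop \<nu> i) (v * word [i] ^ Suc n) \<in> serre_ideal" using Suc.prems by (rule eop_serre_ideal)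
        then have *: "E * word [i] ^ Suc n + const c * (v * word [i] ^ n) \<in> serre_ideal"
          unfolding eop_power_right E_def by (simp add: \<nu> c_def)
        have "(E * word [i] ^ Suc n + const c * (v * word [i] ^ n)) * word [i] - const c * (v * word [i] ^ Suc n) \<in> serre_ideal"
          by (rule serre_ideal_diff[OF serre_ideal_rmult[OF *] serre_ideal_scale[OF Suc.prems]])
        then have "E * word [i] ^ Suc (Suc n) \<in> serre_ideal"
          by (simp add: distrib_right mult.assoc power_commutes)
        moreover have "(\<gamma> - simple_root i) $ i < of_nat K" using \<gamma> by (simp add: simple_root_nth)
        ultimately have "E \<in> serre_ideal"
          using outer eop_homog[OF v] E_def by blast
        then have "E * word [i] ^ Suc n \<in> serre_ideal" by (rule serre_ideal_rmult)
        from serre_ideal_diff[OF * this] have "const c * (v * word [i] ^ n) \<in> serre_ideal" by simp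
        then show ?case using Suc.IH c by (simp add: serre_ideal_scale_iff)
      qed simp
    qed
  qed
  then show ?thesis using assms reals_Archimedean2[of "\<gamma> $ i"] by blast
qed

lemma left_cancel_eqv:
  assumes "homog \<gamma> u" "homog \<gamma> v" "word [i] ^ n * u \<doteq> word [i] ^ n * v"
  shows "u \<doteq> v"
  unfolding eqv_def
  by (rule left_cancel[of \<gamma> _ i n]) (use assms in \<open>simp_all add: homog_diff eqv_def right_diff_distrib\<close>)

text \<open>The elements \<open>u\<close> with \<open>u f\<^sub>i = q\<^sub>i\<^sup>e f\<^sub>i u\<close>; by the Serre relations, a power of \<open>f\<^sub>i\<close> times any element is
  a sum of such elements.\<close>

definition qcomm :: "'i \<Rightarrow> rat \<Rightarrow> 'i falg \<Rightarrow> bool" where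
  "qcomm i e u \<longleftrightarrow> u * word [i] \<doteq> const (qpow (d i * e)) * (word [i] * u)"

lemma qcomm_power:
  assumes "qcomm i e u"
  shows "u * word [i] ^ n \<doteq> const (qpow (d i * e * of_nat n)) * (word [i] ^ n * u)"
proof (induction n)
  case 0
  then show ?case by (simp add: fa.cst_1)
next
  case (Suc n)
  have "u * word [i] ^ Suc n = (u * word [i] ^ n) * word [i]" by (simp add: mult.assoc power_commutes)
  also have "\<dots> \<doteq> const (qpow (d i * e * of_nat n)) * (word [i] ^ n * u) * word [i]"
    by (rule eqv_rmult[OF Suc])
  also have "\<dots> = const (qpow (d i * e * of_nat n)) * (word [i] ^ n * (u * word [i]))" by (simp add: mult.assoc)
  also have "\<dots> \<doteq> const (qpow (d i * e * of_nat n)) * (word [i] ^ n * (const (qpow (d i * e)) * (word [i] * u)))"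
    by (intro eqv_lmult) (use assms in \<open>simp add: qcomm_def\<close>)
  also have "\<dots> = const (qpow (d i * e * of_nat (Suc n))) * (word [i] ^ Suc n * u)"
  proof -
    have "qpow (d i * e) * qpow (d i * e * of_nat n) = qpow (d i * e * of_nat (Suc n))"
      by (simp add: algebra_simps flip: qpow_add)
    then show ?thesis
      by (simp add: word_power_commute mult.assoc del: of_nat_Suc flip: fa.sc_def)
  qed
  finally show ?case .
qed

lemma qcomm_scale:
  assumes "qcomm i e u"
  shows "qcomm i e (const c * u)"
proof -
  have "const c * u * word [i] = const c * (u * word [i])" by (simp add: mult.assoc)
  also have "\<dots> \<doteq> const c * (const (qpow (d i * e)) * (word [i] * u))"
    using assms unfolding qcomm_def by (rule eqv_lmult)
  also have "\<dots> = const (qpow (d i * e)) * (word [i] * (const c * u))"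
    by (simp add: mult.commute flip: fa.sc_def)
  finally show ?thesis unfolding qcomm_def .
qed

lemma qcomm_lmult: "qcomm i e u \<Longrightarrow> qcomm i e (word [i] ^ n * u)"
proof -
  assume "qcomm i e u"
  then have "word [i] ^ n * (u * word [i]) \<doteq> word [i] ^ n * (const (qpow (d i * e)) * (word [i] * u))"
    unfolding qcomm_def by (rule eqv_lmult)
  then show ?thesis unfolding qcomm_def
    by (simp add: mult.assoc const_left_commute[of "word _ ^ _"] word_power_commute)
qed

lemma qcomm_mult:
  assumes "qcomm i e u" "qcomm i e' v"
  shows "qcomm i (e + e') (u * v)"
proof -
  have "u * v * word [i] = u * (v * word [i])" by (simp add: mult.assoc)
  also have "\<dots> \<doteq> u * (const (qpow (d i * e')) * (word [i] * v))"
    using assms(2) unfolding qcomm_def by (rule eqv_lmult)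
  also have "\<dots> = const (qpow (d i * e')) * ((u * word [i]) * v)"
    by (simp add: mult.assoc flip: fa.sc_def)
  also have "\<dots> \<doteq> const (qpow (d i * e')) * ((const (qpow (d i * e)) * (word [i] * u)) * v)"
    using assms(1) unfolding qcomm_def by (intro eqv_lmult eqv_rmult)
  also have "\<dots> = const (qpow (d i * (e + e'))) * (word [i] * (u * v))"
    by (simp add: mult.assoc distrib_left qpow_add mult.commute flip: fa.sc_def)
  finally show ?thesis unfolding qcomm_def .
qed

text \<open>The exponents e are recorded along with the summands u: moving f_i^m past u costs q^(d_i
  e m), and these factors carry the dependence on m that is interpolated later.\<close>

definition qsplit :: "'i \<Rightarrow> 'i weight \<Rightarrow> nat \<Rightarrow> 'i falg \<Rightarrow> (rat \<times> 'i falg) list \<Rightarrow> bool" where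
  "qsplit i \<gamma> N y L \<longleftrightarrow> (\<forall>(e, u)\<in>set L. qcomm i e u \<and> homog (\<gamma> + of_nat N *s simple_root i) u)
    \<and> word [i] ^ N * y \<doteq> sum_list (map snd L)"

lemma sum_list_lmult: "x * sum_list (map f L) = sum_list (map (\<lambda>u. x * f u) L)" for x :: "'b::ring_1"
  by (induction L) (simp_all add: distrib_left)

lemma sum_list_rmult: "sum_list (map f L) * x = sum_list (map (\<lambda>u. f u * x) L)" for x :: "'b::ring_1"
  by (induction L) (simp_all add: distrib_right)

lemma eqv_sum_list: "(\<And>u. u \<in> set L \<Longrightarrow> f u \<doteq> g u) \<Longrightarrow> sum_list (map f L) \<doteq> sum_list (map g L)"
  by (induction L) (auto intro: eqv_add)

lemma qsplit_raise:
  assumes "qsplit i \<gamma> N y L"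
  shows "qsplit i \<gamma> (k + N) y (map (\<lambda>(e, u). (e, word [i] ^ k * u)) L)"
proof -
  have "word [i] ^ (k + N) * y = word [i] ^ k * (word [i] ^ N * y)" by (simp add: power_add mult.assoc)
  also have "\<dots> \<doteq> word [i] ^ k * sum_list (map snd L)"
    using assms unfolding qsplit_def by (intro eqv_lmult) simp
  also have "\<dots> = sum_list (map snd (map (\<lambda>(e, u). (e, word [i] ^ k * u)) L))"
    by (simp add: sum_list_lmult o_def case_prod_unfold)
  finally have "word [i] ^ (k + N) * y \<doteq> sum_list (map snd (map (\<lambda>(e, u). (e, word [i] ^ k * u)) L))" .
  moreover have "homog (\<gamma> + of_nat (k + N) *s simple_root i) (word [i] ^ k * u)"
    if "homog (\<gamma> + of_nat N *s simple_root i) u" for u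
    using homog_power_left[OF that, of k i] by (rule homog_cong) (simp add: weight_eq_iff algebra_simps)
  ultimately show ?thesis
    using assms unfolding qsplit_def by (auto simp: qcomm_lmult)
qed

lemma qsplit_add:
  assumes "qsplit i \<gamma> N x L" "qsplit i \<gamma> N' y L'"
  shows "\<exists>N L. qsplit i \<gamma> N (x + y) L"
proof -
  have "qsplit i \<gamma> (N' + N) x (map (\<lambda>(e, u). (e, word [i] ^ N' * u)) L)"
    "qsplit i \<gamma> (N' + N) y (map (\<lambda>(e, u). (e, word [i] ^ N * u)) L')"
    using qsplit_raise[OF assms(1), of N'] qsplit_raise[OF assms(2), of N] by (simp_all add: add.commute)
  then obtain M L L' where "qsplit i \<gamma> M x L" "qsplit i \<gamma> M y L'" by blast
  then have "qsplit i \<gamma> M (x + y) (L @ L')"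
    unfolding qsplit_def by (auto simp: distrib_left intro: eqv_add)
  then show ?thesis by blast
qed

lemma qsplit_scale:
  assumes "qsplit i \<gamma> N x L"
  shows "qsplit i \<gamma> N (const c * x) (map (\<lambda>(e, u). (e, const c * u)) L)"
proof -
  have "const c * (word [i] ^ N * x) \<doteq> const c * sum_list (map snd L)"
    using assms unfolding qsplit_def by (intro eqv_lmult) simp
  then show ?thesis using assms
    unfolding qsplit_def by (auto simp: sum_list_lmult o_def case_prod_unfold qcomm_scale homog_scale const_left_commute[of "word _ ^ _"])
qed

text \<open>The power f_i^N is spent on x; the remaining f_i^N' passes the q-commuting summands, at
  the cost of powers of q, and is then spent on y.\<close>

lemma qsplit_mult:
  assumes "qsplit i \<gamma> N x L" "qsplit i \<gamma>' N' y L'"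
  shows "\<exists>M. qsplit i (\<gamma> + \<gamma>') (N' + N) (x * y) M"
proof -
  define M where "M = concat (map (\<lambda>(e, u). map (\<lambda>(e', v). (e + e', const (qpow (- (d i * e * of_nat N'))) * (u * v))) L') L)"
  have L: "qcomm i e u" "homog (\<gamma> + of_nat N *s simple_root i) u" if "(e, u) \<in> set L" for e u
    using assms(1) that by (auto simp: qsplit_def)
  have L': "qcomm i e u" "homog (\<gamma>' + of_nat N' *s simple_root i) u" if "(e, u) \<in> set L'" for e u
    using assms(2) that by (auto simp: qsplit_def)
  have pass: "word [i] ^ N' * u \<doteq> const (qpow (- (d i * e * of_nat N'))) * (u * word [i] ^ N')" if "(e, u) \<in> set L" for e u
    using eqv_sym[OF eqv_lmult[OF qcomm_power[OF L(1)[OF that], of N'], of "const (qpow (- (d i * e * of_nat N')))"]]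
    by (simp flip: mult.assoc fa.cst_mult) (simp add: fa.cst_1)
  have "word [i] ^ (N' + N) * (x * y) = word [i] ^ N' * (word [i] ^ N * x) * y"
    by (simp add: power_add mult.assoc)
  also have "\<dots> \<doteq> word [i] ^ N' * sum_list (map snd L) * y"
    using assms(1) unfolding qsplit_def by (intro eqv_lmult eqv_rmult) simp
  also have "\<dots> = sum_list (map (\<lambda>(e, u). word [i] ^ N' * u * y) L)"
    by (simp add: sum_list_lmult sum_list_rmult case_prod_unfold)
  also have "\<dots> \<doteq> sum_list (map (\<lambda>(e, u). const (qpow (- (d i * e * of_nat N'))) * (u * (word [i] ^ N' * y))) L)"
    using eqv_rmult[OF pass, of _ _ y] by (intro eqv_sum_list) (auto simp: mult.assoc)
  also have "\<dots> \<doteq> sum_list (map (\<lambda>(e, u). const (qpow (- (d i * e * of_nat N'))) * (u * sum_list (map snd L'))) L)"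
    using assms(2) by (intro eqv_sum_list) (auto simp: qsplit_def intro!: eqv_lmult)
  also have "\<dots> = sum_list (map snd M)"
    unfolding M_def by (induction L) (auto simp: sum_list_lmult case_prod_unfold o_def)
  finally have "word [i] ^ (N' + N) * (x * y) \<doteq> sum_list (map snd M)" .
  moreover have "homog (\<gamma> + \<gamma>' + of_nat (N' + N) *s simple_root i) (const c * (u * v))"
    if "(e, u) \<in> set L" "(e', v) \<in> set L'" for e u e' v c
    using homog_scale[OF homog_mult[OF L(2)[OF that(1)] L'(2)[OF that(2)]], of c]
    by (rule homog_cong) (simp add: weight_eq_iff algebra_simps)
  moreover have "qcomm i (e + e') (const c * (u * v))" if "(e, u) \<in> set L" "(e', v) \<in> set L'" for e u e' v c
    using qcomm_scale[OF qcomm_mult[OF L(1)[OF that(1)] L'(1)[OF that(2)]]] .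
  ultimately have "qsplit i (\<gamma> + \<gamma>') (N' + N) (x * y) M"
    unfolding qsplit_def by (auto simp: M_def simp del: of_nat_add)
  then show ?thesis by blast
qed

lemma adq_shift: "fa.adq s x z (Suc n) = fa.adq (\<lambda>k. s (Suc k)) x (z * x - fa_sc (s 0) (x * z)) n"
  by (induction n) simp_all

text \<open>Elimination as for partial fractions: if a product of n + 1 factors R - \<lambda>_k L
  with distinct \<lambda>_k kills z, then z should decompose into parts on which R = \<lambda>_k L.
  As L is not invertible, each elimination step costs one factor f_i.\<close>

lemma qsplit_adq:
  assumes "homog \<gamma> z" "inj e" "fa.adq (\<lambda>k. qpow (d i * e k)) (word [i]) z (Suc n) \<in> serre_ideal"
  shows "\<exists>L. qsplit i \<gamma> n z L \<and> fst ` set L \<subseteq> range e"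
  using assms
proof (induction n arbitrary: z e \<gamma>)
  case 0
  then have "qcomm i (e 0) z"
    by (simp add: qcomm_def eqv_def fa.sc_def)
  then show ?case using 0(1) by (intro exI[of _ "[(e 0, z)]"]) (simp add: qsplit_def)
next
  case (Suc n)
  define lam where "lam k = qpow (d i * e k)" for k
  define z' where "z' = z * word [i] - const (lam 0) * (word [i] * z)"
  have hz': "homog (\<gamma> + simple_root i) z'"
    using homog_mult[OF Suc.prems(1) homog_gen, of i] homog_mult[OF homog_gen Suc.prems(1), of i]
    unfolding z'_def by (intro homog_diff homog_scale) (simp_all add: add.commute)
  have "fa.adq (\<lambda>k. qpow (d i * e (Suc k))) (word [i]) z' (Suc n) \<in> serre_ideal"
    using Suc.prems(3) unfolding adq_shift[of _ _ _ "Suc n"] z'_def lam_def fa.sc_def .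
  then obtain L' where L': "qsplit i (\<gamma> + simple_root i) n z' L'" "fst ` set L' \<subseteq> range (\<lambda>k. e (Suc k))"
    using Suc.IH[OF hz', of "\<lambda>k. e (Suc k)"] Suc.prems(2) by (auto simp: inj_def)
  \<comment> \<open>On a summand of exponent x the operator R - \<lambda>_0 L is c x times L.
    Dividing by c x lifts the decomposition of f_i^n z' to one of f_i^(n+1) z, up to the part
    \<open>y0\<close> that R - \<lambda>_0 L kills.\<close>
  define c where "c x = qpow (d i * x) - lam 0" for x
  have ne: "x \<noteq> e 0" if "(x, u) \<in> set L'" for x u
  proof -
    have "x \<in> range (\<lambda>k. e (Suc k))" using L'(2) that by force
    then show ?thesis using Suc.prems(2) by (auto simp: inj_def)
  qed
  then have c: "c x \<noteq> 0" if "(x, u) \<in> set L'" for x u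
    using that by (auto simp: c_def lam_def)
  define L1 where "L1 = map (\<lambda>(x, u). (x, const (1 / c x) * u)) L'"
  have wt: "\<gamma> + simple_root i + of_nat n *s simple_root i = \<gamma> + of_nat (Suc n) *s simple_root i"
    by (simp add: weight_eq_iff algebra_simps)
  have L1: "qcomm i x u" "homog (\<gamma> + of_nat (Suc n) *s simple_root i) u" "x \<noteq> e 0" "x \<in> range e" if "(x, u) \<in> set L1" for x u
    using L' that wt ne by (fastforce simp: L1_def qsplit_def qcomm_scale homog_scale)+
  define y0 where "y0 = word [i] ^ Suc n * z - sum_list (map snd L1)"
  have y0h: "homog (\<gamma> + of_nat (Suc n) *s simple_root i) y0"
  proof -
    have "homog (\<gamma> + of_nat (Suc n) *s simple_root i) (sum_list (map snd L1))" if "set L1 \<subseteq> {(x, u). homog (\<gamma> + of_nat (Suc n) *s simple_root i) u}"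
      using that by (induction L1) (auto intro: homog_add)
    then show ?thesis unfolding y0_def using L1(2)
      by (intro homog_diff homog_power_left[OF Suc.prems(1)]) auto
  qed
  have "(word [i] ^ Suc n * z) * word [i] - const (lam 0) * (word [i] * (word [i] ^ Suc n * z))
    = word [i] ^ Suc n * z'"
    unfolding z'_def by (simp add: right_diff_distrib const_left_commute[of "word _"] const_left_commute[of "word _ ^ _"] mult.assoc)
      (simp flip: mult.assoc add: power_commutes)
  also have "\<dots> = word [i] * (word [i] ^ n * z')" by (simp add: mult.assoc)
  also have "\<dots> \<doteq> word [i] * sum_list (map snd L')"
    using L'(1) unfolding qsplit_def by (intro eqv_lmult) simp
  finally have A: "(word [i] ^ Suc n * z) * word [i] - const (lam 0) * (word [i] * (word [i] ^ Suc n * z))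
    \<doteq> word [i] * sum_list (map snd L')" .
  have "sum_list (map snd L1) * word [i] - const (lam 0) * (word [i] * sum_list (map snd L1))
    = sum_list (map (\<lambda>(x, u). const (1 / c x) * u * word [i] - const (lam 0) * (word [i] * (const (1 / c x) * u))) L')"
    unfolding L1_def by (induction L') (auto simp: algebra_simps)
  also have "\<dots> \<doteq> sum_list (map (\<lambda>(x, u). word [i] * u) L')"
  proof (intro eqv_sum_list, clarify)
    fix x u assume xu: "(x, u) \<in> set L'"
    then have "qcomm i x (const (1 / c x) * u)" using L'(1) by (auto simp: qsplit_def qcomm_scale)
    then have "const (1 / c x) * u * word [i] - const (lam 0) * (word [i] * (const (1 / c x) * u))
      \<doteq> const (qpow (d i * x)) * (word [i] * (const (1 / c x) * u)) - const (lam 0) * (word [i] * (const (1 / c x) * u))"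
      unfolding qcomm_def by (intro eqv_diff) simp_all
    also have "\<dots> = const (c x) * (word [i] * (const (1 / c x) * u))"
      by (simp add: c_def fa.cst_diff left_diff_distrib)
    also have "\<dots> = word [i] * u"
      using c[OF xu] by (simp flip: fa.sc_def)
    finally show "const (1 / c x) * u * word [i] - const (lam 0) * (word [i] * (const (1 / c x) * u)) \<doteq> word [i] * u" .
  qed
  also have "\<dots> = word [i] * sum_list (map snd L')" by (simp add: sum_list_lmult case_prod_unfold)
  finally have B: "sum_list (map snd L1) * word [i] - const (lam 0) * (word [i] * sum_list (map snd L1))
    \<doteq> word [i] * sum_list (map snd L')" .
  have "y0 * word [i] - const (lam 0) * (word [i] * y0) \<doteq> word [i] * sum_list (map snd L') - word [i] * sum_list (map snd L')"
    using eqv_diff[OF A B] by (simp add: y0_def algebra_simps)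
  then have "qcomm i (e 0) y0"
    by (simp add: qcomm_def eqv_def lam_def)
  then have "qsplit i \<gamma> (Suc n) z ((e 0, y0) # L1) \<and> fst ` set ((e 0, y0) # L1) \<subseteq> range e"
    using L1 y0h by (fastforce simp: qsplit_def y0_def)
  then show ?case by blast
qed

lemma qsplit_gen: "\<exists>N L. qsplit i (simple_root j) N (word [j]) L"
proof (cases "i = j")
  case True
  then show ?thesis
    by (intro exI[of _ 0] exI[of _ "[(0, word [j])]"]) (simp add: qsplit_def qcomm_def homog_gen fa.cst_1)
next
  case False
  define n where "n = nat (- a i j)"
  have n: "nat (1 - a i j) = Suc n" using off_diag[OF False] by (simp add: n_def)
  have "serre_f i j = fa.sc (1 / qfact (d i) (Suc n))
    (fa.adq (\<lambda>k. qpow (d i * (of_int (a i j) + 2 * of_nat k))) (word [i]) (word [j]) (Suc n))"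
    unfolding serre_f_def n[symmetric] fa_sc_def by (rule serre_general[OF fa.algebra_over_qfield_axioms False])
  then have "fa.adq (\<lambda>k. qpow (d i * (of_int (a i j) + 2 * of_nat k))) (word [i]) (word [j]) (Suc n) \<in> serre_ideal"
    using serre_f_in[OF False] unfolding fa_sc_def[symmetric]
    by (simp add: fa.sc_def serre_ideal_scale_iff del: fa.adq.simps)
  moreover have "inj (\<lambda>k. of_int (a i j) + 2 * of_nat k :: rat)" by (simp add: inj_def)
  ultimately obtain L where "qsplit i (simple_root j) n (word [j]) L"
    using qsplit_adq[OF homog_gen, where e = "\<lambda>k. of_int (a i j) + 2 * of_nat k"] by blast
  then show ?thesis by blast
qed

lemma qsplit_exists:
  assumes "homog \<gamma> y"
  shows "\<exists>N L. qsplit i \<gamma> N y L"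
proof -
  have word: "\<exists>N L. qsplit i (wt w) N (word w) L" for w
  proof (induction w)
    case Nil
    show ?case by (intro exI[of _ 0] exI[of _ "[(0, 1)]"]) (simp add: qsplit_def qcomm_def homog_1 fa.cst_1)
  next
    case (Cons k w)
    then obtain N L where "qsplit i (wt w) N (word w) L" by blast
    moreover obtain N' L' where "qsplit i (simple_root k) N' (word [k]) L'" using qsplit_gen by blast
    ultimately show ?case using qsplit_mult word_Cons[of k w] by (metis wt_simps(2))
  qed
  have sum: "\<exists>N L. qsplit i \<gamma> N (\<Sum>w\<in>A. const (Poly_Mapping.lookup y w) * word w) L"
    if "finite A" "A \<subseteq> Poly_Mapping.keys y" for A
    using that
  proof (induction A rule: finite_induct)
    case empty
    show ?case by (intro exI[of _ 0] exI[of _ "[]"]) (simp add: qsplit_def)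
  next
    case (insert w A)
    have "wt w = \<gamma>" using insert.prems assms by (simp add: homog_def)
    then obtain N L where "qsplit i \<gamma> N (word w) L" using word[of w] by blast
    note 1 = qsplit_scale[OF this, of "Poly_Mapping.lookup y w"]
    obtain N' L' where 2: "qsplit i \<gamma> N' (\<Sum>w\<in>A. const (Poly_Mapping.lookup y w) * word w) L'"
      using insert.IH insert.prems by auto
    show ?case using qsplit_add[OF 1 2] insert.hyps by simp
  qed
  have "(\<Sum>w\<in>Poly_Mapping.keys y. const (Poly_Mapping.lookup y w) * word w) = y"
    by (rule poly_mapping_eqI) (simp add: lookup_sum if_distrib in_keys_iff cong: if_cong)
  then show ?thesis using sum[OF finite_keys order_refl] by simp
qed

text \<open>Pass f_i^m through the summands of f_i^N y, then cancel f_i^N on the left. The result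
  depends on m only through the scalars q^(d_i e m) and the exponent m - N.\<close>

lemma qsplit_ore_right:
  assumes "qsplit i \<gamma> N y L" "homog \<gamma> y" "m \<ge> N"
  shows "y * word [i] ^ m \<doteq> word [i] ^ (m - N) * sum_list (map (\<lambda>(e, u). const (qpow (d i * e * of_nat m)) * u) L)"
    and "homog (\<gamma> + of_nat N *s simple_root i) (sum_list (map (\<lambda>(e, u). const (qpow (d i * e * s)) * u) L))"
proof -
  have L: "qcomm i e u" "homog (\<gamma> + of_nat N *s simple_root i) u" if "(e, u) \<in> set L" for e u
    using assms(1) that by (auto simp: qsplit_def)
  show hom: "homog (\<gamma> + of_nat N *s simple_root i) (sum_list (map (\<lambda>(e, u). const (qpow (d i * e * s)) * u) L))" for s
    using L(2) by (induction L) (auto intro!: homog_add homog_scale)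
  have "word [i] ^ N * (y * word [i] ^ m) = (word [i] ^ N * y) * word [i] ^ m" by (simp add: mult.assoc)
  also have "\<dots> \<doteq> sum_list (map snd L) * word [i] ^ m"
    using assms(1) unfolding qsplit_def by (intro eqv_rmult) simp
  also have "\<dots> = sum_list (map (\<lambda>(e, u). u * word [i] ^ m) L)"
    by (simp add: sum_list_rmult case_prod_unfold)
  also have "\<dots> \<doteq> sum_list (map (\<lambda>(e, u). const (qpow (d i * e * of_nat m)) * (word [i] ^ m * u)) L)"
    using L(1) by (intro eqv_sum_list) (auto intro: qcomm_power)
  also have "\<dots> = word [i] ^ m * sum_list (map (\<lambda>(e, u). const (qpow (d i * e * of_nat m)) * u) L)"
    by (simp add: sum_list_lmult case_prod_unfold const_left_commute[of "word _ ^ _"])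
  also have "\<dots> = word [i] ^ N * (word [i] ^ (m - N) * sum_list (map (\<lambda>(e, u). const (qpow (d i * e * of_nat m)) * u) L))"
    using assms(3) by (simp flip: mult.assoc power_add)
  finally have *: "word [i] ^ N * (y * word [i] ^ m) \<doteq> \<dots>" .
  have "homog (\<gamma> + of_nat m *s simple_root i) (word [i] ^ (m - N) * sum_list (map (\<lambda>(e, u). const (qpow (d i * e * of_nat m)) * u) L))"
    using assms(3) by (intro homog_cong[OF homog_power_left[OF hom]]) (simp add: weight_eq_iff of_nat_diff algebra_simps)
  from left_cancel_eqv[OF homog_power_right[OF assms(2)] this *]
  show "y * word [i] ^ m \<doteq> word [i] ^ (m - N) * sum_list (map (\<lambda>(e, u). const (qpow (d i * e * of_nat m)) * u) L)" .
qed

lemma qsplit_ore_left: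
  assumes "qsplit i \<gamma> N y L"
  shows "\<exists>Y. homog (\<gamma> + of_nat N *s simple_root i) Y \<and> word [i] ^ (p + N) * y \<doteq> Y * word [i] ^ p"
proof -
  have L: "qcomm i e u" "homog (\<gamma> + of_nat N *s simple_root i) u" if "(e, u) \<in> set L" for e u
    using assms(1) that by (auto simp: qsplit_def)
  let ?Y = "sum_list (map (\<lambda>(e, u). const (qpow (- (d i * e * of_nat p))) * u) L)"
  have hom: "homog (\<gamma> + of_nat N *s simple_root i) ?Y"
    using L(2) by (induction L) (auto intro!: homog_add homog_scale)
  have pass: "word [i] ^ p * u \<doteq> const (qpow (- (d i * e * of_nat p))) * (u * word [i] ^ p)" if "(e, u) \<in> set L" for e u
    using eqv_sym[OF eqv_lmult[OF qcomm_power[OF L(1)[OF that], of p], of "const (qpow (- (d i * e * of_nat p)))"]]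
    by (simp flip: mult.assoc fa.cst_mult) (simp add: fa.cst_1)
  have "word [i] ^ (p + N) * y = word [i] ^ p * (word [i] ^ N * y)" by (simp add: power_add mult.assoc)
  also have "\<dots> \<doteq> word [i] ^ p * sum_list (map snd L)"
    using assms(1) unfolding qsplit_def by (intro eqv_lmult) simp
  also have "\<dots> = sum_list (map (\<lambda>(e, u). word [i] ^ p * u) L)"
    by (simp add: sum_list_lmult case_prod_unfold)
  also have "\<dots> \<doteq> sum_list (map (\<lambda>(e, u). const (qpow (- (d i * e * of_nat p))) * (u * word [i] ^ p)) L)"
    using pass by (intro eqv_sum_list) auto
  also have "\<dots> = ?Y * word [i] ^ p"
    by (simp add: sum_list_rmult case_prod_unfold mult.assoc)
  finally have "word [i] ^ (p + N) * y \<doteq> ?Y * word [i] ^ p" .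
  with hom show ?thesis by blast
qed

end

section \<open>Singular vectors under one simple reflection\<close>

lemma nat_descend: "P n \<Longrightarrow> (\<And>m. P (Suc m) \<Longrightarrow> P m) \<Longrightarrow> P (0 :: nat)"
  by (induction n) auto

context finite_cartan_datum
begin

text \<open>Here \<gamma> is the depth below the highest weight: y stands for a vector of weight
  \<nu> - \<gamma> in M(\<nu>), and nonmembership in \<open>serre_ideal\<close> says that this
  vector is not zero.\<close>

definition sing :: "'i weight \<Rightarrow> 'i weight \<Rightarrow> 'i falg \<Rightarrow> bool" where
  "sing \<nu> \<gamma> y \<longleftrightarrow> homog \<gamma> y \<and> y \<notin> serre_ideal \<and> (\<forall>j. app (eop \<nu> j) y \<in> serre_ideal)"

definition singular :: "'i weight \<Rightarrow> 'i weight \<Rightarrow> bool" where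
  "singular \<nu> \<gamma> \<longleftrightarrow> (\<exists>y. sing \<nu> \<gamma> y)"

lemma singular_Q_plus: "singular \<nu> \<gamma> \<Longrightarrow> \<gamma> \<in> Q_plus"
  using homog_not_Q_plus serre_ideal.zero by (auto simp: singular_def sing_def)

lemma cow_Q_plus: "\<gamma> \<in> Q_plus \<Longrightarrow> cow i \<gamma> \<in> \<int>"
  using Nats_subset_Ints unfolding pairing_def simple_coroot_def Q_plus_def
  by (auto intro!: Ints_sum Ints_mult)

lemma eqv_divide:
  assumes "const c * x \<doteq> y" "c \<noteq> 0"
  shows "x \<doteq> const (1 / c) * y"
proof -
  have "const (1 / c) * (const c * x) \<doteq> const (1 / c) * y" using assms(1) by (rule eqv_lmult)
  moreover have "const (1 / c) * (const c * x) = x" using assms(2) by (simp flip: fa.sc_def)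
  ultimately show ?thesis by simp
qed

lemma eqv_drop: "u + x \<doteq> y \<Longrightarrow> u \<in> serre_ideal \<Longrightarrow> x \<doteq> y"
  using serre_ideal_diff[of "u + x - y" u] by (simp add: eqv_def algebra_simps)

text \<open>Multiplying \<open>y\<close> on the right by a large power of \<open>f\<^sub>i\<close> makes it divisible by \<open>f\<^sub>i\<^sup>b\<close> on the left, and
  \<open>e\<^sub>i\<close> removes the factors on the right one by one.\<close>

lemma singular_lift:
  assumes "singular \<nu> \<gamma>" and p: "cow i \<nu> + 1 = of_nat p" and b: "cow i (\<nu> - \<gamma>) + 1 = - of_nat b"
  shows "singular \<nu> (\<gamma> - of_nat b *s simple_root i)"
proof -
  obtain y where y: "homog \<gamma> y" "y \<notin> serre_ideal" "\<And>j. app (eop \<nu> j) y \<in> serre_ideal"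
    using assms(1) by (auto simp: singular_def sing_def)
  define Q where "Q m \<longleftrightarrow> (\<exists>Y. homog (\<gamma> + of_nat m *s simple_root i - of_nat b *s simple_root i) Y
    \<and> y * word [i] ^ m \<doteq> word [i] ^ b * Y)" for m
  obtain N L where NL: "qsplit i \<gamma> N y L" using qsplit_exists[OF y(1)] by blast
  have "Q (N + b)"
  proof -
    have "homog (\<gamma> + of_nat (N + b) *s simple_root i - of_nat b *s simple_root i)
      (sum_list (map (\<lambda>(e, u). const (qpow (d i * e * of_nat (N + b))) * u) L))"
      by (rule homog_cong[OF qsplit_ore_right(2)[OF NL y(1) order_refl]]) (simp add: weight_eq_iff algebra_simps)
    then show ?thesis using qsplit_ore_right(1)[OF NL y(1), of "N + b"] unfolding Q_def by auto
  qed
  moreover have "Q m" if "Q (Suc m)" for m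
  proof -
    obtain Y where Y: "homog (\<gamma> + of_nat (Suc m) *s simple_root i - of_nat b *s simple_root i) Y"
      "y * word [i] ^ Suc m \<doteq> word [i] ^ b * Y" using \<open>Q (Suc m)\<close> by (auto simp: Q_def)
    \<comment> \<open>In the Verma module of highest weight \<nu>' the factor f_i^(m+1) leads to
      weight \<nu>, where y is singular; so e_i merely reduces the power of f_i.\<close>
    define \<nu>' where "\<nu>' = \<nu> + of_nat (Suc m) *s simple_root i"
    define c where "c = bracket (d i) (of_nat (Suc m)) * bracket (d i) (of_nat (p + Suc m))"
    have "c \<noteq> 0" by (simp add: c_def del: of_nat_Suc of_nat_add)
    have h1: "cow i \<nu>' - of_nat (Suc m) + 1 = of_nat (p + Suc m)"
      using p by (simp add: \<nu>'_def cow_simps)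
    \<comment> \<open>By the choice of b the coefficient of f_i^(b-1) Y vanishes, so divisibility by
      f_i^b on the left is preserved.\<close>
    have h2: "cow i (\<nu>' - (\<gamma> + of_nat (Suc m) *s simple_root i - of_nat b *s simple_root i)) - of_nat b + 1 = 0"
      using b by (simp add: \<nu>'_def cow_simps algebra_simps)
    have "app (eop \<nu>' i) (y * word [i] ^ Suc m) \<doteq> app (eop \<nu>' i) (word [i] ^ b * Y)"
      using Y(2) by (rule eqv_eop)
    then have "app (eop \<nu> i) y * word [i] ^ Suc m + const c * (y * word [i] ^ m) \<doteq> word [i] ^ b * app (eop \<nu>' i) Y"
      unfolding eop_power_right eop_power_left[OF Y(1)] h1 h2 by (simp add: \<nu>'_def c_def)
    then have "const c * (y * word [i] ^ m) \<doteq> word [i] ^ b * app (eop \<nu>' i) Y"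
      by (rule eqv_drop) (rule serre_ideal_rmult[OF y(3)])
    then have "y * word [i] ^ m \<doteq> const (1 / c) * (word [i] ^ b * app (eop \<nu>' i) Y)"
      using \<open>c \<noteq> 0\<close> by (rule eqv_divide)
    then have "y * word [i] ^ m \<doteq> word [i] ^ b * (const (1 / c) * app (eop \<nu>' i) Y)"
      by (simp flip: fa.sc_def)
    moreover have "homog (\<gamma> + of_nat m *s simple_root i - of_nat b *s simple_root i) (const (1 / c) * app (eop \<nu>' i) Y)"
      by (rule homog_cong[OF homog_scale[OF eop_homog[OF Y(1)]]]) (simp add: weight_eq_iff algebra_simps)
    ultimately show ?thesis unfolding Q_def by blast
  qed
  ultimately have "Q 0" by (rule nat_descend)
  then obtain Y where Y: "homog (\<gamma> - of_nat b *s simple_root i) Y" "y \<doteq> word [i] ^ b * Y"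
    by (auto simp: Q_def)
  have h: "cow i (\<nu> - (\<gamma> - of_nat b *s simple_root i)) - of_nat b + 1 = 0"
    using b by (simp add: cow_simps algebra_simps)
  have "app (eop \<nu> j) Y \<in> serre_ideal" for j
  proof -
    have "app (eop \<nu> j) y \<doteq> word [i] ^ b * app (eop \<nu> j) Y"
      using eqv_eop[OF Y(2), of \<nu> j] unfolding eop_power_left[OF Y(1)] h by (simp split: if_splits)
    then have "word [i] ^ b * app (eop \<nu> j) Y \<in> serre_ideal" using y(3)[of j] by (simp add: eqv_mem)
    then show ?thesis by (rule left_cancel[OF eop_homog[OF Y(1)]])
  qed
  moreover have "Y \<notin> serre_ideal" using Y(2) y(2) serre_ideal_lmult eqv_mem by blast
  ultimately show ?thesis using Y(1) by (auto simp: singular_def sing_def)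
qed

text \<open>The new vector is f_i^r y f_i^(-p). A high power of f_i on the left of y makes the
  product divisible by f_i^p on the right; then e_i removes left factors one by one, with nonzero
  coefficients until r of them are left.\<close>

lemma singular_lower:
  assumes "singular \<nu> \<gamma>" and p: "cow i \<nu> + 1 = of_nat p" and r: "cow i (\<nu> - \<gamma>) + 1 = of_nat r"
  shows "singular (\<nu> - of_nat p *s simple_root i) (\<gamma> + of_nat r *s simple_root i - of_nat p *s simple_root i)"
proof -
  obtain y where y: "homog \<gamma> y" "y \<notin> serre_ideal" "\<And>j. app (eop \<nu> j) y \<in> serre_ideal"
    using assms(1) by (auto simp: singular_def sing_def)
  define Q where "Q n \<longleftrightarrow> (\<exists>Y. homog (\<gamma> + of_nat n *s simple_root i - of_nat p *s simple_root i) Y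
    \<and> word [i] ^ n * y \<doteq> Y * word [i] ^ p)" for n
  obtain N L where "qsplit i \<gamma> N y L" using qsplit_exists[OF y(1)] by blast
  from qsplit_ore_left[OF qsplit_raise[OF this, of r], of p]
  obtain Y where Y: "homog (\<gamma> + of_nat (r + N) *s simple_root i) Y" "word [i] ^ (p + (r + N)) * y \<doteq> Y * word [i] ^ p"
    by blast
  have h0: "cow i \<nu> - of_nat p + 1 = 0" using p by simp
  have "Q (r + (p + N))"
    using homog_cong[OF Y(1), of "\<gamma> + of_nat (r + (p + N)) *s simple_root i - of_nat p *s simple_root i"] Y(2)
    unfolding Q_def by (intro exI[of _ Y]) (simp add: weight_eq_iff algebra_simps)
  moreover have "Q (r + m)" if "Q (r + Suc m)" for m
  proof -
    obtain Y where Y: "homog (\<gamma> + of_nat (r + Suc m) *s simple_root i - of_nat p *s simple_root i) Y"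
      "word [i] ^ (Suc (r + m)) * y \<doteq> Y * word [i] ^ p" using \<open>Q (r + Suc m)\<close> by (auto simp: Q_def)
    define c where "c = bracket (d i) (of_nat (Suc (r + m))) * bracket (d i) (- of_nat (Suc m))"
    have "c \<noteq> 0" by (simp add: c_def del: of_nat_Suc)
    have h: "cow i (\<nu> - \<gamma>) - of_nat (Suc (r + m)) + 1 = - of_nat (Suc m)" using r by simp
    have "app (eop \<nu> i) (word [i] ^ Suc (r + m) * y) \<doteq> app (eop \<nu> i) (Y * word [i] ^ p)"
      using Y(2) by (rule eqv_eop)
    then have "word [i] ^ Suc (r + m) * app (eop \<nu> i) y + const c * (word [i] ^ (r + m) * y)
      \<doteq> app (eop (\<nu> - of_nat p *s simple_root i) i) Y * word [i] ^ p"
      unfolding eop_power_right eop_power_left[OF y(1)] h h0 by (simp add: c_def)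
    then have "const c * (word [i] ^ (r + m) * y) \<doteq> app (eop (\<nu> - of_nat p *s simple_root i) i) Y * word [i] ^ p"
      by (rule eqv_drop) (rule serre_ideal_lmult[OF y(3)])
    then have "word [i] ^ (r + m) * y \<doteq> const (1 / c) * (app (eop (\<nu> - of_nat p *s simple_root i) i) Y * word [i] ^ p)"
      using \<open>c \<noteq> 0\<close> by (rule eqv_divide)
    then have "word [i] ^ (r + m) * y \<doteq> (const (1 / c) * app (eop (\<nu> - of_nat p *s simple_root i) i) Y) * word [i] ^ p"
      by (simp add: mult.assoc)
    moreover have "homog (\<gamma> + of_nat (r + m) *s simple_root i - of_nat p *s simple_root i)
        (const (1 / c) * app (eop (\<nu> - of_nat p *s simple_root i) i) Y)"
      by (rule homog_cong[OF homog_scale[OF eop_homog[OF Y(1)]]]) (simp add: weight_eq_iff algebra_simps)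
    ultimately show ?thesis unfolding Q_def by blast
  qed
  ultimately have "Q (r + 0)" by (rule nat_descend[where P = "\<lambda>m. Q (r + m)"])
  then obtain Y where Y: "homog (\<gamma> + of_nat r *s simple_root i - of_nat p *s simple_root i) Y"
    "word [i] ^ r * y \<doteq> Y * word [i] ^ p"
    by (auto simp: Q_def)
  have h: "cow i (\<nu> - \<gamma>) - of_nat r + 1 = 0" using r by simp
  have "app (eop (\<nu> - of_nat p *s simple_root i) j) Y \<in> serre_ideal" for j
  proof -
    have "word [i] ^ r * app (eop \<nu> j) y \<doteq> app (eop (\<nu> - of_nat p *s simple_root i) j) Y * word [i] ^ p"
      using eqv_eop[OF Y(2), of \<nu> j] unfolding eop_power_right eop_power_left[OF y(1)] h h0 by (simp split: if_splits)
    then have "app (eop (\<nu> - of_nat p *s simple_root i) j) Y * word [i] ^ p \<in> serre_ideal"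
      using serre_ideal_lmult[OF y(3)] eqv_mem by blast
    then show ?thesis by (rule right_cancel[OF eop_homog[OF Y(1)]])
  qed
  moreover have "Y \<notin> serre_ideal"
    using Y(2) y(2) serre_ideal_rmult eqv_mem left_cancel[OF y(1)] by blast
  ultimately show ?thesis using Y(1) by (auto simp: singular_def sing_def)
qed

text \<open>The vector f_i^k is singular of weight \<nu> in the Verma module of highest weight \<nu>
  + k \<alpha>_i, so right multiplication by it embeds M(\<nu>).\<close>

lemma singular_shift:
  assumes "singular \<nu> \<gamma>" and k: "cow i \<nu> + 1 = - of_nat k"
  shows "singular (\<nu> + of_nat k *s simple_root i) (\<gamma> + of_nat k *s simple_root i)"
proof -
  obtain y where y: "homog \<gamma> y" "y \<notin> serre_ideal" "\<And>j. app (eop \<nu> j) y \<in> serre_ideal"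
    using assms(1) by (auto simp: singular_def sing_def)
  have h: "cow i (\<nu> + of_nat k *s simple_root i) - of_nat k + 1 = 0" using k by (simp add: cow_simps)
  have "app (eop (\<nu> + of_nat k *s simple_root i) j) (y * word [i] ^ k) \<in> serre_ideal" for j
    unfolding eop_power_right h using serre_ideal_rmult[OF y(3)] by simp
  moreover have "y * word [i] ^ k \<notin> serre_ideal" using right_cancel[OF y(1)] y(2) by blast
  ultimately show ?thesis
    using homog_power_right[OF y(1)] unfolding singular_def sing_def by blast
qed

text \<open>Exponential polynomials: families that depend polynomially on \<open>q\<^sup>s\<close>. They interpolate \<open>y f\<^sub>i\<^sup>m\<close> to
  nonintegral exponents.\<close>

definition exppoly :: "(rat \<Rightarrow> 'i falg) \<Rightarrow> bool" where
  "exppoly g \<longleftrightarrow> (\<exists>S v. finite S \<and> (\<forall>s. g s = (\<Sum>e\<in>S. const (qpow (e * s)) * v e)))"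

lemma exppolyI: "finite S \<Longrightarrow> (\<And>s. g s = (\<Sum>e\<in>S. const (qpow (e * s)) * v e)) \<Longrightarrow> exppoly g"
  unfolding exppoly_def by blast

lemma exppoly_const: "exppoly (\<lambda>_. v)"
  by (rule exppolyI[of "{0}" _ "\<lambda>_. v"]) (simp_all add: fa.cst_1)

lemma exppoly_qpow:
  assumes "exppoly g"
  shows "exppoly (\<lambda>s. const (qpow (e * s)) * g s)"
proof -
  obtain S v where S: "finite S" "\<And>s. g s = (\<Sum>e\<in>S. const (qpow (e * s)) * v e)"
    using assms by (auto simp: exppoly_def)
  have "const (qpow (e * s)) * g s = (\<Sum>x\<in>(+) e ` S. const (qpow (x * s)) * v (x - e))" for s
  proof -
    have "(\<Sum>x\<in>(+) e ` S. const (qpow (x * s)) * v (x - e)) = (\<Sum>x\<in>S. const (qpow ((e + x) * s)) * v x)"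
      by (subst sum.reindex) (simp_all add: o_def)
    also have "\<dots> = const (qpow (e * s)) * g s"
      unfolding S(2) sum_distrib_left
      by (rule sum.cong) (simp_all add: distrib_right qpow_add fa.cst_mult mult.assoc)
    finally show ?thesis by simp
  qed
  then show ?thesis using S(1) by (intro exppolyI[of "(+) e ` S"]) auto
qed

lemma exppoly_app:
  assumes "exppoly g"
  shows "exppoly (\<lambda>s. app \<phi> (g s))"
proof -
  obtain S v where S: "finite S" "\<And>s. g s = (\<Sum>e\<in>S. const (qpow (e * s)) * v e)"
    using assms by (auto simp: exppoly_def)
  then show ?thesis by (intro exppolyI[of S _ "\<lambda>e. app \<phi> (v e)"]) (simp_all add: app_sum)
qed

lemma exppoly_add:
  assumes "exppoly g" "exppoly h"
  shows "exppoly (\<lambda>s. g s + h s)"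
proof -
  obtain S v where S: "finite S" "\<And>s. g s = (\<Sum>e\<in>S. const (qpow (e * s)) * v e)"
    using assms(1) by (auto simp: exppoly_def)
  obtain T w where T: "finite T" "\<And>s. h s = (\<Sum>e\<in>T. const (qpow (e * s)) * w e)"
    using assms(2) by (auto simp: exppoly_def)
  define v' w' where "v' e = (if e \<in> S then v e else 0)" and "w' e = (if e \<in> T then w e else 0)" for e
  have "g s = (\<Sum>e\<in>S \<union> T. const (qpow (e * s)) * v' e)" for s
    unfolding S(2) by (rule sum.mono_neutral_cong_left) (use S(1) T(1) in \<open>auto simp: v'_def\<close>)
  moreover have "h s = (\<Sum>e\<in>S \<union> T. const (qpow (e * s)) * w' e)" for s
    unfolding T(2) by (rule sum.mono_neutral_cong_left) (use S(1) T(1) in \<open>auto simp: w'_def\<close>)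
  ultimately have "g s + h s = (\<Sum>e\<in>S \<union> T. const (qpow (e * s)) * (v' e + w' e))" for s
    by (simp add: distrib_left sum.distrib)
  then show ?thesis using S(1) T(1) by (intro exppolyI[of "S \<union> T"]) auto
qed

lemma exppoly_lmult: "exppoly g \<Longrightarrow> exppoly (\<lambda>s. x * g s)"
  using exppoly_app[of g "lmult x"] by simp

lemma exppoly_diff: "exppoly g \<Longrightarrow> exppoly h \<Longrightarrow> exppoly (\<lambda>s. g s - h s)"
  using exppoly_add[of g "\<lambda>s. - 1 * h s"] exppoly_lmult[of h "- 1"] by simp

lemma exppoly_sum_list: "(\<And>x. x \<in> set L \<Longrightarrow> exppoly (g x)) \<Longrightarrow> exppoly (\<lambda>s. sum_list (map (\<lambda>x. g x s) L))"
  by (induction L) (auto intro: exppoly_const exppoly_add)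

lemma exppoly_shift:
  assumes "exppoly g"
  shows "exppoly (\<lambda>s. g (s + c))"
proof -
  obtain S v where S: "finite S" "\<And>s. g s = (\<Sum>e\<in>S. const (qpow (e * s)) * v e)"
    using assms by (auto simp: exppoly_def)
  have "g (s + c) = (\<Sum>e\<in>S. const (qpow (e * s)) * (const (qpow (e * c)) * v e))" for s
    unfolding S(2) by (rule sum.cong) (simp_all add: distrib_left qpow_add fa.cst_mult mult.assoc)
  then show ?thesis using S(1) by (intro exppolyI[of S]) auto
qed

lemma exppoly_bracket:
  assumes "exppoly g"
  shows "exppoly (\<lambda>s. const (bracket \<delta> (s + c)) * g s)"
proof -
  have "const (bracket \<delta> (s + c)) * g s = const (1 / (qpow \<delta> - qpow (- \<delta>))) *
    (const (qpow (c * \<delta>)) * (const (qpow (\<delta> * s)) * g s) - const (qpow (- (c * \<delta>))) * (const (qpow (- \<delta> * s)) * g s))" for s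
  proof -
    have "qpow ((s + c) * \<delta>) = qpow (c * \<delta>) * qpow (\<delta> * s)" "qpow (- ((s + c) * \<delta>)) = qpow (- (c * \<delta>)) * qpow (- \<delta> * s)"
      by (simp_all flip: qpow_add) (simp_all add: algebra_simps)
    then have "bracket \<delta> (s + c) = 1 / (qpow \<delta> - qpow (- \<delta>)) * (qpow (c * \<delta>) * qpow (\<delta> * s) - qpow (- (c * \<delta>)) * qpow (- \<delta> * s))"
      by (simp add: bracket_def)
    then show ?thesis by (simp only: fa.cst_mult fa.cst_diff mult.assoc left_diff_distrib right_diff_distrib)
  qed
  then show ?thesis by (simp only:) (intro exppoly_lmult exppoly_diff exppoly_qpow assms)
qed

lemma exppoly_eop:
  assumes "exppoly g"
  shows "exppoly (\<lambda>s. app (eop (\<nu> + s *s simple_root i) j) (g s))"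
proof -
  let ?k = "ip (simple_root i) (simple_root j)"
  have "app (eop (\<nu> + s *s simple_root i) j) (g s)
    = const (qpow (ip \<nu> (simple_root j))) * (const (qpow (?k * s)) * app (skew 1 j) (g s))
    - const (qpow (- ip \<nu> (simple_root j))) * (const (qpow (- ?k * s)) * app (skew (- 1) j) (g s))" for s
    by (simp add: eop_def ip_simps qpow_add qpow_diff qpow_minus[of "_ * _"] divide_inverse mult.commute flip: fa.sc_def)
  then show ?thesis by (simp only:) (intro exppoly_lmult exppoly_diff exppoly_qpow exppoly_app assms)
qed

text \<open>For distinct e the functions m \<mapsto> q^(e m) are distinct characters of the additive
  monoid of naturals, hence independent modulo the ideal. Scaling the coefficients by q^(e M) shifts
  the range m \<ge> M to all naturals.\<close>

lemma exppoly_vanish: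
  assumes "exppoly g" and "\<And>m. m \<ge> M \<Longrightarrow> g (of_nat m) \<in> serre_ideal"
  shows "g s \<in> serre_ideal"
proof -
  obtain S v where S: "finite S" "\<And>s. g s = (\<Sum>e\<in>S. const (qpow (e * s)) * v e)"
    using assms(1) by (auto simp: exppoly_def)
  have "\<forall>e\<in>S. const (qpow (e * of_nat M)) * v e \<in> serre_ideal"
  proof (rule independence_of_characters[where ch = "\<lambda>e m. qpow (e * of_nat m)" and s = "\<lambda>c x. const c * x" and cmp = "(+)"])
    show "(\<Sum>e\<in>S. const (qpow (e * of_nat m)) * (const (qpow (e * of_nat M)) * v e)) \<in> serre_ideal" for m :: nat
    proof -
      have "(\<Sum>e\<in>S. const (qpow (e * of_nat m)) * (const (qpow (e * of_nat M)) * v e)) = g (of_nat (M + m))"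
        unfolding S(2) by (rule sum.cong) (simp_all add: distrib_left qpow_add mult.commute flip: mult.assoc fa.cst_mult)
      then show ?thesis using assms(2)[of "M + m"] by simp
    qed
    show "\<exists>m. qpow (e * of_nat m) \<noteq> qpow (e' * of_nat m)" if "e \<noteq> e'" for e e'
      using that by (intro exI[of _ 1]) simp
  qed (use S(1) in \<open>auto simp: serre_ideal_scale distrib_left distrib_right qpow_add fa.cst_mult fa.cst_diff fa.cst_1
      left_diff_distrib mult.assoc serre_ideal.zero serre_ideal_diff\<close>)
  then have "v e \<in> serre_ideal" if "e \<in> S" for e using that by (simp add: serre_ideal_scale_iff)
  then show ?thesis unfolding S(2) by (intro serre_ideal_sum serre_ideal_scale)
qed

text \<open>With c = \<langle>\<gamma>, \<alpha>_i^\<vee>\<rangle> the new vector is formally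
  f_i^(p-c) y f_i^(-p). For integers m \<ge> N one has y f_i^m = f_i^(m-N) Y(m) with Y an
  exponential polynomial, so Y(-p) can serve as f_i^(p+N) y f_i^(-p). The equations for e_j Y(m) at
  large m persist at m = -p, and N + c left factors f_i are removed at the end.\<close>

lemma singular_reflect_nonint:
  assumes sing: "singular \<nu> \<gamma>" and p: "p = cow i \<nu> + 1" "p \<notin> \<int>"
  shows "singular (\<nu> - p *s simple_root i) (\<gamma> - cow i \<gamma> *s simple_root i)"
proof -
  obtain y where y: "homog \<gamma> y" "y \<notin> serre_ideal" "\<And>j. app (eop \<nu> j) y \<in> serre_ideal"
    using sing by (auto simp: singular_def sing_def)
  have "cow i \<gamma> \<in> \<int>" using singular_Q_plus[OF sing] by (rule cow_Q_plus)
  then obtain c where c: "cow i \<gamma> = of_int c" by (auto elim: Ints_cases)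
  obtain N' L' where "qsplit i \<gamma> N' y L'" using qsplit_exists[OF y(1)] by blast
  \<comment> \<open>Enlarged so that N + c, the number of factors to be removed from Y(-p), is not
    negative.\<close>
  define N where "N = nat \<bar>c\<bar> + N'"
  have N: "int N + c \<ge> 0" unfolding N_def by linarith
  obtain L where NL: "qsplit i \<gamma> N y L"
    using qsplit_raise[OF \<open>qsplit i \<gamma> N' y L'\<close>, of "nat \<bar>c\<bar>"] unfolding N_def by blast
  have L: "qcomm i e u" "homog (\<gamma> + of_nat N *s simple_root i) u" if "(e, u) \<in> set L" for e u
    using NL that by (auto simp: qsplit_def)
  define Y where "Y s = sum_list (map (\<lambda>(e, u). const (qpow (d i * e * s)) * u) L)" for s
  have Yh: "homog (\<gamma> + of_nat N *s simple_root i) (Y s)" for s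
    unfolding Y_def by (rule qsplit_ore_right(2)[OF NL y(1) order_refl])
  have Yexp: "exppoly Y"
    unfolding Y_def by (rule exppoly_sum_list) (auto simp: exppoly_qpow exppoly_const)
  have ore: "y * word [i] ^ m \<doteq> word [i] ^ (m - N) * Y (of_nat m)" if "m \<ge> N" for m
    unfolding Y_def using qsplit_ore_right(1)[OF NL y(1) that] .
  have shift: "\<nu> + of_nat m *s simple_root i - of_nat m *s simple_root i = \<nu>" for m
    by simp
  define \<nu>' where "\<nu>' = \<nu> - p *s simple_root i"
  have \<nu>': "\<nu> + (- p) *s simple_root i = \<nu>'" by (simp add: \<nu>'_def weight_eq_iff)
  have Ej: "app (eop \<nu>' j) (Y (- p)) \<in> serre_ideal" if "j \<noteq> i" for j
  proof -
    have "app (eop (\<nu> + s *s simple_root i) j) (Y s) \<in> serre_ideal" for s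
    proof (rule exppoly_vanish[where M = N])
      show "exppoly (\<lambda>s. app (eop (\<nu> + s *s simple_root i) j) (Y s))" by (rule exppoly_eop[OF Yexp])
      fix m assume m: "m \<ge> N"
      have "app (eop \<nu> j) y * word [i] ^ m \<doteq> word [i] ^ (m - N) * app (eop (\<nu> + of_nat m *s simple_root i) j) (Y (of_nat m))"
        using eqv_eop[OF ore[OF m], of "\<nu> + of_nat m *s simple_root i" j] that
        unfolding eop_power_right eop_power_left[OF Yh] shift by simp
      then have "word [i] ^ (m - N) * app (eop (\<nu> + of_nat m *s simple_root i) j) (Y (of_nat m)) \<in> serre_ideal"
        using serre_ideal_rmult[OF y(3)] eqv_mem by blast
      then show "app (eop (\<nu> + of_nat m *s simple_root i) j) (Y (of_nat m)) \<in> serre_ideal"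
        by (rule left_cancel[OF eop_homog[OF Yh]])
    qed
    from this[of "- p"] show ?thesis unfolding \<nu>' .
  qed
  \<comment> \<open>Apply e_i to y f_i^m = f_i^(m-N) Y(m), replace y f_i^(m-1) by f_i^(m-1-N) Y(m-1)
    and cancel f_i^(m-N-1): this puts g(m) into the ideal. At s = -p the last term drops out,
    because its bracket of s + p is 0.\<close>
  define g where "g s = word [i] * app (eop (\<nu> + s *s simple_root i) i) (Y s)
    + const (bracket (d i) (s + - of_nat N)) * (const (bracket (d i) (s + (p - of_int c - of_nat N))) * Y s)
    - const (bracket (d i) (s + 0)) * (const (bracket (d i) (s + p)) * Y (s + - 1))" for s
  have gh: "homog (\<gamma> + of_nat N *s simple_root i) (g s)" for s
    unfolding g_def
    by (intro homog_add homog_diff homog_scale Yh homog_cong[OF homog_mult[OF homog_gen eop_homog[OF Yh]]]) simp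
  have "g s \<in> serre_ideal" for s
  proof (rule exppoly_vanish[where M = "Suc N"])
    show "exppoly g" unfolding g_def
      by (intro exppoly_diff exppoly_add exppoly_lmult exppoly_eop exppoly_bracket Yexp exppoly_shift[OF Yexp])
    fix m assume m: "m \<ge> Suc N"
    then obtain k where k: "m = Suc (N + k)" by (metis add_Suc less_eqE)
    let ?\<nu> = "\<nu> + of_nat m *s simple_root i"
    have h1: "cow i ?\<nu> - of_nat m + 1 = of_nat m + p" using p(1) by (simp add: cow_simps)
    have h2: "cow i (?\<nu> - (\<gamma> + of_nat N *s simple_root i)) - of_nat (Suc k) + 1 = of_nat m + (p - of_int c - of_nat N)"
      using p(1) by (simp add: cow_simps c k)
    have m1: "m - N = Suc k" "m - 1 - N = k" "m - N - 1 = k" "of_nat (m - 1) = of_nat m + (- 1 :: rat)"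
      "of_nat (Suc k) = of_nat m + (- of_nat N :: rat)" "m - 1 \<ge> N"
      by (simp_all add: k)
    have "app (eop \<nu> i) y * word [i] ^ m + const (bracket (d i) (of_nat m) * bracket (d i) (of_nat m + p)) * (y * word [i] ^ (m - 1))
      \<doteq> word [i] ^ Suc k * app (eop ?\<nu> i) (Y (of_nat m)) + const (bracket (d i) (of_nat m + - of_nat N) *
        bracket (d i) (of_nat m + (p - of_int c - of_nat N))) * (word [i] ^ k * Y (of_nat m))"
      using eqv_eop[OF ore[of m], of ?\<nu> i] k
      unfolding eop_power_right eop_power_left[OF Yh] shift h1 h2 m1(1,3) by (simp add: m1(5) del: of_nat_Suc)
    then have "const (bracket (d i) (of_nat m) * bracket (d i) (of_nat m + p)) * (y * word [i] ^ (m - 1))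
      \<doteq> word [i] ^ Suc k * app (eop ?\<nu> i) (Y (of_nat m)) + const (bracket (d i) (of_nat m + - of_nat N) *
        bracket (d i) (of_nat m + (p - of_int c - of_nat N))) * (word [i] ^ k * Y (of_nat m))"
      by (rule eqv_drop) (rule serre_ideal_rmult[OF y(3)])
    moreover have "y * word [i] ^ (m - 1) \<doteq> word [i] ^ k * Y (of_nat m + - 1)"
      using ore[OF m1(6)] unfolding m1(2,4) .
    then have "const (bracket (d i) (of_nat m) * bracket (d i) (of_nat m + p)) * (y * word [i] ^ (m - 1))
      \<doteq> const (bracket (d i) (of_nat m) * bracket (d i) (of_nat m + p)) * (word [i] ^ k * Y (of_nat m + - 1))"
      by (rule eqv_lmult)
    ultimately have "word [i] ^ Suc k * app (eop ?\<nu> i) (Y (of_nat m)) + const (bracket (d i) (of_nat m + - of_nat N) *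
        bracket (d i) (of_nat m + (p - of_int c - of_nat N))) * (word [i] ^ k * Y (of_nat m))
      \<doteq> const (bracket (d i) (of_nat m) * bracket (d i) (of_nat m + p)) * (word [i] ^ k * Y (of_nat m + - 1))"
      using eqv_sym eqv_trans by blast
    then have "word [i] ^ k * g (of_nat m) \<in> serre_ideal"
      unfolding eqv_def g_def
      by (simp add: distrib_left right_diff_distrib power_commutes mult.assoc flip: fa.sc_def)
        (simp flip: mult.assoc add: power_commutes mult.commute[of "bracket _ _" "bracket _ _"])
    then show "g (of_nat m) \<in> serre_ideal" by (rule left_cancel[OF gh])
  qed
  note gp = this[of "- p"]
  have base: "word [i] * app (eop \<nu>' i) (Y (- p))
    + const (bracket (d i) (p + of_nat N) * bracket (d i) (of_int c + of_nat N)) * Y (- p) \<in> serre_ideal"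
  proof -
    have "bracket (d i) (- p + - of_nat N) * bracket (d i) (- p + (p - of_int c - of_nat N))
      = bracket (d i) (p + of_nat N) * bracket (d i) (of_int c + of_nat N)"
      using bracket_minus[of "d i" "p + of_nat N"] bracket_minus[of "d i" "of_int c + of_nat N"] by (simp add: algebra_simps)
    then show ?thesis
      using gp unfolding g_def \<nu>' mult.assoc[symmetric] fa.cst_mult[symmetric] by simp
  qed
  \<comment> \<open>By q-commutation Y(-p) f_i^m = f_i^m Y(m - p). If Y(-p) were zero, then so would
    be all Y(m - p) and, by interpolation, Y(0), which represents f_i^N y.\<close>
  have Y_notin: "Y (- p) \<notin> serre_ideal"
  proof
    assume *: "Y (- p) \<in> serre_ideal"
    have "Y (s + - p) \<in> serre_ideal" for s
    proof (rule exppoly_vanish[where M = 0 and g = "\<lambda>s. Y (s + - p)"])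
      show "exppoly (\<lambda>s. Y (s + - p))" by (rule exppoly_shift[OF Yexp])
      fix m
      have "Y (- p) * word [i] ^ m = sum_list (map (\<lambda>(e, u). const (qpow (d i * e * - p)) * (u * word [i] ^ m)) L)"
        unfolding Y_def by (simp add: sum_list_rmult case_prod_unfold mult.assoc)
      also have "\<dots> \<doteq> sum_list (map (\<lambda>(e, u). const (qpow (d i * e * - p)) * (const (qpow (d i * e * of_nat m)) * (word [i] ^ m * u))) L)"
        using L(1) by (intro eqv_sum_list) (auto intro!: eqv_lmult qcomm_power)
      also have "\<dots> = word [i] ^ m * Y (of_nat m + - p)"
      proof -
        have "qpow (d i * e * (of_nat m + - p)) = qpow (d i * e * - p) * qpow (d i * e * of_nat m)" for e
          by (simp flip: qpow_add add: algebra_simps)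
        then show ?thesis unfolding Y_def
          by (simp add: sum_list_lmult case_prod_unfold mult.commute[of "qpow _" "qpow _"] flip: fa.sc_def)
      qed
      finally have "word [i] ^ m * Y (of_nat m + - p) \<in> serre_ideal"
        using serre_ideal_rmult[OF *] eqv_mem by blast
      then show "Y (of_nat m + - p) \<in> serre_ideal" by (rule left_cancel[OF Yh])
    qed
    from this[of p] have "Y 0 \<in> serre_ideal" by simp
    moreover have "Y 0 = sum_list (map snd L)" by (simp add: Y_def fa.cst_1 case_prod_unfold)
    ultimately have "word [i] ^ N * y \<in> serre_ideal" using NL eqv_mem by (auto simp: qsplit_def)
    then show False using left_cancel[OF y(1)] y(2) by blast
  qed
  define K where "K = nat (int N + c)"
  have K: "of_nat K = of_nat N + (of_int c :: rat)" using N by (simp add: K_def)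
  have p_ne: "p + of_int z \<noteq> 0" for z
    using p(2) by (metis Ints_minus Ints_of_int add_eq_0_iff2)
  \<comment> \<open>The relation f_i e_i Z + b Z = 0 exhibits Z as f_i times -e_i Z / b, and this
    quotient satisfies a relation of the same kind with both bracket arguments lowered by 1. For k <
    K the scalar b is nonzero, since p is not an integer; at k = K it is zero, and f_i e_i Z = 0
    results.\<close>
  have "\<exists>Z. homog (\<gamma> + (of_nat N - of_nat k) *s simple_root i) Z \<and> word [i] ^ k * Z \<doteq> Y (- p)
    \<and> word [i] * app (eop \<nu>' i) Z + const (bracket (d i) (p + of_nat N - of_nat k) * bracket (d i) (of_int c + of_nat N - of_nat k)) * Z \<in> serre_ideal"
    if "k \<le> K" for k
    using that
  proof (induction k)
    case 0
    then show ?case using Yh base by (intro exI[of _ "Y (- p)"]) simp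
  next
    case (Suc k)
    then obtain Z where Z: "homog (\<gamma> + (of_nat N - of_nat k) *s simple_root i) Z" "word [i] ^ k * Z \<doteq> Y (- p)"
      "word [i] * app (eop \<nu>' i) Z + const (bracket (d i) (p + of_nat N - of_nat k) * bracket (d i) (of_int c + of_nat N - of_nat k)) * Z \<in> serre_ideal"
      by auto
    define b where "b = bracket (d i) (p + of_nat N - of_nat k) * bracket (d i) (of_int c + of_nat N - of_nat k)"
    have "p + of_nat N - of_nat k \<noteq> 0" using p_ne[of "int N - int k"] by (simp add: add_diff_eq)
    moreover have "of_int c + of_nat N - of_nat k \<noteq> (0 :: rat)"
    proof -
      have "of_nat k < (of_nat K :: rat)" using Suc.prems by (simp only: of_nat_less_iff)
      then show ?thesis using K by simp
    qed
    ultimately have b: "b \<noteq> 0" by (simp add: b_def)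
    define W where "W = const (- 1 / b) * app (eop \<nu>' i) Z"
    have Wh: "homog (\<gamma> + (of_nat N - of_nat (Suc k)) *s simple_root i) W"
      unfolding W_def by (rule homog_cong[OF homog_scale[OF eop_homog[OF Z(1)]]]) (simp add: weight_eq_iff algebra_simps)
    have fW: "word [i] * W \<doteq> Z"
    proof -
      have "const (- 1 / b) * (word [i] * app (eop \<nu>' i) Z + const b * Z) \<in> serre_ideal"
        using Z(3) unfolding b_def by (rule serre_ideal_scale)
      also have "const (- 1 / b) * (word [i] * app (eop \<nu>' i) Z + const b * Z) = word [i] * W - Z"
        using b by (simp add: W_def distrib_left fa.sc_minus fa.sc_uminus flip: fa.sc_def)
      finally show ?thesis by (simp add: eqv_def)
    qed
    have "word [i] ^ Suc k * W = word [i] ^ k * (word [i] * W)" by (simp add: power_commutes mult.assoc flip: mult.assoc)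
    also have "\<dots> \<doteq> word [i] ^ k * Z" using fW by (rule eqv_lmult)
    also have "\<dots> \<doteq> Y (- p)" by (rule Z(2))
    finally have 1: "word [i] ^ Suc k * W \<doteq> Y (- p)" .
    define h where "h = cow i (\<nu>' - (\<gamma> + (of_nat N - of_nat (Suc k)) *s simple_root i))"
    have h: "h = - (p + of_nat N - of_nat k + (of_int c + of_nat N - of_nat k) - 1)"
      using p(1) by (simp add: h_def \<nu>'_def cow_simps c algebra_simps)
    have "app (eop \<nu>' i) (word [i] * W) \<doteq> app (eop \<nu>' i) Z" using fW by (rule eqv_eop)
    then have "word [i] * app (eop \<nu>' i) W + const (bracket (d i) h) * W \<doteq> const (- b) * W"
      unfolding eop_left[OF Wh] h_def[symmetric] using b by (simp add: W_def flip: mult.assoc fa.cst_mult) (simp add: fa.cst_1)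
    then have "word [i] * app (eop \<nu>' i) W + const (bracket (d i) h + b) * W \<in> serre_ideal"
      by (simp add: eqv_def fa.cst_add const_uminus algebra_simps)
    moreover have "bracket (d i) h + b = bracket (d i) (p + of_nat N - of_nat (Suc k)) * bracket (d i) (of_int c + of_nat N - of_nat (Suc k))"
      unfolding h bracket_minus b_def
      using bracket_mult_diff[of "d i" "p + of_nat N - of_nat k" "of_int c + of_nat N - of_nat k"] by (simp add: algebra_simps)
    ultimately show ?case using Wh 1 by (intro exI[of _ W]) simp
  qed
  from this[OF order_refl] obtain Z where Z: "homog (\<gamma> + (of_nat N - of_nat K) *s simple_root i) Z" "word [i] ^ K * Z \<doteq> Y (- p)"
      "word [i] * app (eop \<nu>' i) Z \<in> serre_ideal"
    by (auto simp: K)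
  have "app (eop \<nu>' j) Z \<in> serre_ideal" for j
  proof (cases "j = i")
    case True
    have "word [i] ^ 1 * app (eop \<nu>' i) Z \<in> serre_ideal" using Z(3) by simp
    then show ?thesis using left_cancel[OF eop_homog[OF Z(1)]] True by blast
  next
    case False
    then have "word [i] ^ K * app (eop \<nu>' j) Z \<doteq> app (eop \<nu>' j) (Y (- p))"
      using eqv_eop[OF Z(2), of \<nu>' j] unfolding eop_power_left[OF Z(1)] by auto
    then show ?thesis using Ej[OF False] left_cancel[OF eop_homog[OF Z(1)]] eqv_mem by blast
  qed
  moreover have "Z \<notin> serre_ideal" using Z(2) Y_notin serre_ideal_lmult eqv_mem by blast
  moreover have "\<gamma> + (of_nat N - of_nat K) *s simple_root i = \<gamma> - cow i \<gamma> *s simple_root i"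
    by (simp add: K c weight_eq_iff)
  ultimately show ?thesis using Z(1) unfolding \<nu>'_def by (auto simp: singular_def sing_def)
qed


section \<open>Descent of singular vectors to depth 0\<close>

lemma cow_rho: "cow i (\<nu> + rho) = cow i \<nu> + 1"
  by (simp add: pairing_add pairing_rho)

lemma simple_reflection_cow: "simple_reflection i x = x - cow i x *s simple_root i"
  by (simp add: simple_reflection_def)

text \<open>Let p = \<langle>\<nu> + rho, \<alpha>_i^\<vee>\<rangle> and r = p - \<langle>\<gamma>,
  \<alpha>_i^\<vee>\<rangle>. Nonintegral p is treated by interpolation, and p > 0, r \<ge> 0 by
  \<open>singular_lower\<close>. For integral p \<le> 0, right multiplication by f_i^(-p) first
  embeds M(\<nu>), and then f_i^(-r) is divided off on the left. The last hypothesis excludes just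
  the integral case p > 0 > r.\<close>

lemma singular_reflect:
  assumes "singular \<nu> \<gamma>" and pos: "cow i \<gamma> > 0"
    and c: "cow i (\<nu> + rho) \<notin> pos_nats \<or> cow i (\<nu> + rho - \<gamma>) \<ge> 0"
  shows "singular (simple_reflection i (\<nu> + rho) - rho) (simple_reflection i \<gamma>)"
proof -
  let ?p = "cow i \<nu> + 1"
  obtain c' where c': "cow i \<gamma> = of_int c'"
    using cow_Q_plus[OF singular_Q_plus[OF assms(1)]] by (auto elim: Ints_cases)
  have eq: "simple_reflection i (\<nu> + rho) - rho = \<nu> - ?p *s simple_root i"
    by (simp add: simple_reflection_cow cow_rho)
  have r: "cow i (\<nu> - \<gamma>) + 1 = ?p - of_int c'" by (simp add: cow_diff c')
  consider "?p \<notin> \<int>" | z where "?p = of_int z" by (cases "?p \<in> \<int>"; blast elim: Ints_cases)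
  then show ?thesis
  proof cases
    case 1
    show ?thesis using singular_reflect_nonint[OF assms(1) refl 1] unfolding eq simple_reflection_cow[of i \<gamma>] .
  next
    case (2 z)
    show ?thesis
    proof (cases "z > 0")
      case True
      then have "?p \<in> pos_nats"
        unfolding pos_nats_def 2 by (intro image_eqI[of _ _ "nat z"]) simp_all
      then have "(of_int (z - c') :: rat) \<ge> 0" using c 2 by (simp add: cow_rho cow_diff pairing_add pairing_rho c')
      then have "z - c' \<ge> 0" by (simp only: of_int_0_le_iff)
      then have "singular (\<nu> - of_nat (nat z) *s simple_root i) (\<gamma> + of_nat (nat (z - c')) *s simple_root i - of_nat (nat z) *s simple_root i)"
        using True 2 by (intro singular_lower[OF assms(1)]) (simp_all add: r)
      moreover have "\<gamma> + of_nat (nat (z - c')) *s simple_root i - of_nat (nat z) *s simple_root i = simple_reflection i \<gamma>"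
        using True \<open>z - c' \<ge> 0\<close> by (simp add: simple_reflection_cow c' weight_eq_iff algebra_simps)
      ultimately show ?thesis using True 2 by (simp add: eq)
    next
      case False
      let ?\<nu> = "\<nu> + of_nat (nat (- z)) *s simple_root i" and ?\<gamma> = "\<gamma> + of_nat (nat (- z)) *s simple_root i"
      have "singular ?\<nu> ?\<gamma>" using False 2 by (intro singular_shift[OF assms(1)]) simp
      moreover have "cow i ?\<nu> + 1 = of_nat (nat (- z))" using False 2 by (simp add: cow_simps)
      moreover have "cow i (?\<nu> - ?\<gamma>) + 1 = - of_nat (nat (c' - z))"
      proof -
        have "c' > 0" using pos c' by simp
        then show ?thesis using False r 2 by simp
      qed
      ultimately have "singular ?\<nu> (?\<gamma> - of_nat (nat (c' - z)) *s simple_root i)" by (rule singular_lift)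
      moreover have "?\<gamma> - of_nat (nat (c' - z)) *s simple_root i = simple_reflection i \<gamma>"
      proof -
        have "c' > 0" using pos c' by simp
        then show ?thesis using False by (simp add: simple_reflection_cow c' weight_eq_iff algebra_simps)
      qed
      moreover have "?\<nu> = simple_reflection i (\<nu> + rho) - rho"
        using False 2 by (simp add: eq weight_eq_iff algebra_simps)
      ultimately show ?thesis by simp
    qed
  qed
qed

text \<open>In the case p > 0 > r left out by \<open>singular_reflect\<close>, the power f_i^(-r)
  divides y on the left and the quotient is singular in the same module: only \<nu> + rho - \<gamma>
  is reflected.\<close>

lemma singular_reflect_weight:
  assumes "singular \<nu> \<gamma>" and p: "cow i (\<nu> + rho) \<in> pos_nats" and r: "cow i (\<nu> + rho - \<gamma>) < 0"
  shows "singular \<nu> (\<gamma> + cow i (\<nu> + rho - \<gamma>) *s simple_root i)"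
proof -
  obtain n where n: "cow i \<nu> + 1 = of_nat n" using p by (auto simp: pos_nats_def cow_rho)
  obtain c' where c': "cow i \<gamma> = of_int c'"
    using cow_Q_plus[OF singular_Q_plus[OF assms(1)]] by (auto elim: Ints_cases)
  have eq: "cow i (\<nu> + rho - \<gamma>) = of_int (int n - c')" using n by (simp add: cow_diff cow_rho c')
  then have "int n < c'" using r by simp
  then have b: "cow i (\<nu> - \<gamma>) + 1 = - of_nat (nat (c' - int n))" using n by (simp add: cow_diff c' algebra_simps)
  have "\<gamma> - of_nat (nat (c' - int n)) *s simple_root i = \<gamma> + cow i (\<nu> + rho - \<gamma>) *s simple_root i"
    using \<open>int n < c'\<close> by (simp add: eq weight_eq_iff algebra_simps)
  then show ?thesis using singular_lift[OF assms(1) n b] by (simp only:)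
qed

text \<open>Otherwise (\<gamma>|\<gamma>) would be a sum of terms \<gamma>_i (\<alpha>_i|\<gamma>)
  \<le> 0.\<close>

lemma exists_simple_acute:
  assumes "\<gamma> \<in> Q_plus" "\<gamma> \<noteq> 0"
  shows "\<exists>i. cow i \<gamma> > 0"
proof (rule ccontr)
  assume "\<nexists>i. cow i \<gamma> > 0"
  then have "ip \<gamma> (simple_root i) \<le> 0" for i
    using d_pos[of i] by (metis linorder_not_less pairing_simple_coroot' zero_less_divide_iff)
  moreover have "\<gamma> $ i \<ge> 0" for i using assms(1) by (auto simp: Q_plus_def Nats_def) (metis Nats_def assms(1) Nats_cases of_nat_0_le_iff mem_Collect_eq Q_plus_def)
  ultimately have "ip \<gamma> \<gamma> \<le> 0"
    by (subst ip_expand) (auto intro!: sum_nonpos mult_nonneg_nonpos simp: ip_sym)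
  then show False using ip_pos[OF assms(2)] by simp
qed

definition height :: "'i weight \<Rightarrow> rat" where
  "height \<gamma> = (\<Sum>i\<in>UNIV. \<gamma> $ i)"

lemma height_nat: "\<gamma> \<in> Q_plus \<Longrightarrow> height \<gamma> \<in> \<nat>"
proof -
  have "sum f A \<in> \<nat>" if "\<And>i. f i \<in> \<nat>" for f :: "'i \<Rightarrow> rat" and A
    using that by (induction A rule: infinite_finite_induct) auto
  then show "\<gamma> \<in> Q_plus \<Longrightarrow> height \<gamma> \<in> \<nat>" by (simp add: height_def Q_plus_def)
qed

lemma height_add: "height (x + c *s simple_root i) = height x + c"
  unfolding height_def vector_add_component vector_smult_component sum.distrib sum_distrib_left[symmetric]
  by (simp add: simple_root_nth)

lemma height_reflection: "height (simple_reflection i x) = height x - cow i x"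
  using height_add[of x "- cow i x" i] by (simp add: simple_reflection_cow)

text \<open>A singular vector of a Verma module is moved by simple reflections, which lowers its weight, until
  the weight is \<open>0\<close>.\<close>

lemma singular_induct [consumes 1, case_names zero reflect weight]:
  assumes "singular \<nu> \<gamma>"
    and zero: "\<And>\<nu>. P \<nu> 0"
    and reflect: "\<And>\<nu> \<gamma> i. singular \<nu> \<gamma> \<Longrightarrow> cow i \<gamma> > 0 \<Longrightarrow>
      P (simple_reflection i (\<nu> + rho) - rho) (simple_reflection i \<gamma>) \<Longrightarrow> P \<nu> \<gamma>"
    and weight: "\<And>\<nu> \<gamma> i. singular \<nu> \<gamma> \<Longrightarrow> cow i \<gamma> > 0 \<Longrightarrow> cow i (\<nu> + rho) \<in> pos_nats \<Longrightarrow>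
      cow i (\<nu> + rho - \<gamma>) < 0 \<Longrightarrow> P \<nu> (\<gamma> + cow i (\<nu> + rho - \<gamma>) *s simple_root i) \<Longrightarrow> P \<nu> \<gamma>"
  shows "P \<nu> \<gamma>"
proof -
  have "\<forall>\<nu> \<gamma>. singular \<nu> \<gamma> \<longrightarrow> height \<gamma> < of_nat n \<longrightarrow> P \<nu> \<gamma>" for n
  proof (induction n)
    case 0
    then show ?case using height_nat[OF singular_Q_plus] by (auto simp: Nats_def) (metis height_nat Nats_cases of_nat_less_0_iff singular_Q_plus)
  next
    case (Suc n)
    show ?case
    proof (intro allI impI)
      fix \<nu> \<gamma> assume s: "singular \<nu> \<gamma>" and h: "height \<gamma> < of_nat (Suc n)"
      have less: "height \<gamma>' < of_nat n" if s': "singular \<nu>' \<gamma>'" and lt: "height \<gamma>' < height \<gamma>" for \<nu>' \<gamma>'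
      proof -
        obtain k where k: "height \<gamma> = of_nat k" using height_nat[OF singular_Q_plus[OF s]] by (auto elim: Nats_cases)
        obtain k' where k': "height \<gamma>' = of_nat k'" using height_nat[OF singular_Q_plus[OF s']] by (auto elim: Nats_cases)
        have "k' < k" "k < Suc n" using lt h unfolding k k' by (simp_all only: of_nat_less_iff)
        then show ?thesis unfolding k' by simp
      qed
      show "P \<nu> \<gamma>"
      proof (cases "\<gamma> = 0")
        case True
        then show ?thesis using zero by simp
      next
        case False
        then obtain i where i: "cow i \<gamma> > 0" using exists_simple_acute singular_Q_plus[OF s] by blast
        show ?thesis
        proof (cases "cow i (\<nu> + rho) \<notin> pos_nats \<or> cow i (\<nu> + rho - \<gamma>) \<ge> 0")
          case True
          have s': "singular (simple_reflection i (\<nu> + rho) - rho) (simple_reflection i \<gamma>)"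
            using singular_reflect[OF s i True] .
          show ?thesis
            by (rule reflect[OF s i]) (use Suc.IH s' less[OF s'] i in \<open>simp add: height_reflection\<close>)
        next
          case False
          then have *: "cow i (\<nu> + rho) \<in> pos_nats" "cow i (\<nu> + rho - \<gamma>) < 0" by auto
          have s': "singular \<nu> (\<gamma> + cow i (\<nu> + rho - \<gamma>) *s simple_root i)"
            using singular_reflect_weight[OF s *] .
          show ?thesis
            by (rule weight[OF s i *]) (use Suc.IH s' less[OF s'] * in \<open>simp add: height_add\<close>)
        qed
      qed
    qed
  qed
  then show ?thesis using assms(1) reals_Archimedean2[of "height \<gamma>"] by blast
qed

text \<open>Each step of the descent applies a reflection to \<nu> + rho - \<gamma>, and the same
  one or none to \<nu> + rho, so both norms are kept; at \<gamma> = 0 they agree.\<close>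

lemma singular_norm:
  assumes "singular \<nu> \<gamma>"
  shows "ip (\<nu> + rho - \<gamma>) (\<nu> + rho - \<gamma>) = ip (\<nu> + rho) (\<nu> + rho)"
  using assms
proof (induction rule: singular_induct)
  case (reflect \<nu> \<gamma> i)
  then show ?case
    by (simp add: simple_reflection_diff[symmetric] ip_invariant)
next
  case (weight \<nu> \<gamma> i)
  have "\<nu> + rho - (\<gamma> + cow i (\<nu> + rho - \<gamma>) *s simple_root i) = simple_reflection i (\<nu> + rho - \<gamma>)"
    by (simp add: simple_reflection_cow algebra_simps)
  then show ?case using weight by (simp add: ip_invariant)
qed simp

section \<open>Excluding singular vectors by conditions on the positive roots\<close>

lemma coroot_integral:
  assumes "\<beta> \<in> roots"
  shows "pairing (simple_root i) (coroot \<beta>) \<in> \<int>"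
proof -
  obtain k where k: "ip \<beta> \<beta> = 2 * d k" "\<And>j. \<beta> $ j * d j / d k \<in> \<int>"
    using root_integrality[OF assms] by blast
  have "pairing (simple_root i) (coroot \<beta>) = ip \<beta> (simple_root i) / d k"
    by (simp add: pairing_coroot k(1) ip_sym)
  also have "\<dots> = (\<Sum>j\<in>UNIV. \<beta> $ j * d j / d k * of_int (a j i))"
    by (subst ip_expand, subst ip_sym) (simp add: ip_simple_roots sum_divide_distrib mult.assoc)
  also have "\<dots> \<in> \<int>" using k(2) by (intro Ints_sum Ints_mult) auto
  finally show ?thesis .
qed

lemma pos_nats_add:
  assumes "x \<in> pos_nats" "y \<in> \<int>" "y > 0"
  shows "x + y \<in> pos_nats"
proof -
  obtain n where n: "x = of_nat n" "n \<ge> 1" using assms(1) by (auto simp: pos_nats_def)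
  obtain z where z: "y = of_int z" using assms(2) by (auto elim: Ints_cases)
  have "x + y = of_nat (n + nat z)" using n z assms(3) by simp
  then show ?thesis unfolding pos_nats_def using n(2) by (intro image_eqI[of _ _ "n + nat z"]) auto
qed

text \<open>The hypothesis is shaped to survive the descent. The subspace S varies because a
  reflection moves it along with \<nu> and \<gamma>. Only roots with (\<gamma>|\<beta>) > 0 are
  restricted: for the reflected \<gamma> this excludes \<beta> = \<alpha>_i, the only positive root
  that s_i makes negative. At \<gamma> = 0 the assumption \<gamma> \<notin> S fails.\<close>

lemma no_singular:
  assumes "singular \<nu> \<gamma>" "vec.subspace S" "\<gamma> \<notin> S"
    and "\<And>\<beta>. \<beta> \<in> pos_roots \<Longrightarrow> \<beta> \<notin> S \<Longrightarrow> ip \<gamma> \<beta> > 0 \<Longrightarrow> pairing (\<nu> + rho) (coroot \<beta>) \<notin> pos_nats"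
  shows False
  using assms
proof (induction arbitrary: S rule: singular_induct)
  case (zero \<nu>)
  then show False using vec.subspace_0 by blast
next
  case (reflect \<nu> \<gamma> i)
  define S' where "S' = simple_reflection i -` S"
  have sub: "vec.subspace S'"
    using reflect.prems(1) simple_reflection_scale[of i 0 0]
    by (auto simp: S'_def vec.subspace_def simple_reflection_add simple_reflection_scale)
  have notin: "simple_reflection i \<gamma> \<notin> S'" using reflect.prems(2) by (simp add: S'_def)
  show False
  proof (rule reflect.IH[OF sub notin])
    fix \<beta> assume \<beta>: "\<beta> \<in> pos_roots" "\<beta> \<notin> S'" "ip (simple_reflection i \<gamma>) \<beta> > 0"
    have "ip (simple_reflection i \<gamma>) (simple_root i) < 0"
    proof -
      have "ip (simple_reflection i \<gamma>) (simple_root i) = - (cow i \<gamma> * d i)"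
        unfolding ip_reflection simple_reflection_simple pairing_simple_coroot by (simp add: ip_minus)
      then show ?thesis using reflect.hyps(2) d_pos[of i] by simp
    qed
    then have "\<beta> \<noteq> simple_root i" using \<beta>(3) by auto
    then have "simple_reflection i \<beta> \<in> pos_roots" using reflection_pos_root \<beta>(1) by blast
    then have "pairing (\<nu> + rho) (coroot (simple_reflection i \<beta>)) \<notin> pos_nats"
      using \<beta> by (intro reflect.prems(3)) (auto simp: S'_def ip_reflection)
    then show "pairing (simple_reflection i (\<nu> + rho) - rho + rho) (coroot \<beta>) \<notin> pos_nats"
      by (simp add: pairing_coroot_reflection)
  qed
next
  case (weight \<nu> \<gamma> i)
  define p where "p = cow i (\<nu> + rho)"
  define r where "r = cow i (\<nu> + rho - \<gamma>)"
  have p: "p > 0" "p \<in> \<int>" using weight.hyps(3) by (auto simp: p_def pos_nats_def)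
  \<comment> \<open>Here \<langle>\<nu> + rho, \<alpha>_i^\<vee>\<rangle> is a positive integer and
    (\<gamma>|\<alpha>_i) > 0, which the hypothesis permits only inside S. Consequently s_i maps S
    and its complement to themselves.\<close>
  have iS: "simple_root i \<in> S"
  proof (rule ccontr)
    assume "simple_root i \<notin> S"
    moreover have "ip \<gamma> (simple_root i) > 0"
      using weight.hyps(2) d_pos[of i] by (simp add: pairing_simple_coroot[symmetric])
    ultimately show False
      using weight.prems(3)[OF simple_root_in_pos_roots] weight.hyps(3) by (simp add: pairing_coroot_simple)
  qed
  have notin: "\<gamma> + r *s simple_root i \<notin> S"
  proof
    assume "\<gamma> + r *s simple_root i \<in> S"
    from vec.subspace_diff[OF weight.prems(1) this vec.subspace_scale[OF weight.prems(1) iS, of r]]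
    show False using weight.prems(2) by simp
  qed
  show False
  proof (rule weight.IH[OF weight.prems(1) notin[unfolded r_def]])
    fix \<beta> assume \<beta>: "\<beta> \<in> pos_roots" "\<beta> \<notin> S" "ip (\<gamma> + cow i (\<nu> + rho - \<gamma>) *s simple_root i) \<beta> > 0"
    have gt: "ip \<gamma> \<beta> + r * ip (simple_root i) \<beta> > 0" using \<beta>(3) by (simp add: ip_simps r_def)
    \<comment> \<open>If (\<alpha>_i|\<beta>) \<ge> 0, then r < 0 gives (\<gamma>|\<beta>) > 0 and
      the hypothesis applies to \<beta>. Otherwise it applies to s_i \<beta>, whose coroot value
      exceeds that of \<beta> by a positive integer, so the value for \<beta> cannot be a positive
      integer either.\<close>
    show "pairing (\<nu> + rho) (coroot \<beta>) \<notin> pos_nats"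
    proof (cases "ip (simple_root i) \<beta> \<ge> 0")
      case True
      then have "r * ip (simple_root i) \<beta> \<le> 0" using weight.hyps(4) by (simp add: r_def mult_nonpos_nonneg)
      then show ?thesis using weight.prems(3)[OF \<beta>(1,2)] gt by simp
    next
      case False
      then have neg: "ip (simple_root i) \<beta> < 0" by simp
      have "\<beta> \<noteq> simple_root i" using \<beta>(2) iS by auto
      then have pos: "simple_reflection i \<beta> \<in> pos_roots" using reflection_pos_root \<beta>(1) by blast
      have "simple_reflection i \<beta> \<notin> S"
      proof
        assume "simple_reflection i \<beta> \<in> S"
        from vec.subspace_add[OF weight.prems(1) this vec.subspace_scale[OF weight.prems(1) iS, of "cow i \<beta>"]]
        show False using \<beta>(2) by (simp add: simple_reflection_cow)
      qed
      moreover have "ip \<gamma> (simple_reflection i \<beta>) > 0"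
      proof -
        have "ip \<gamma> (simple_reflection i \<beta>) = ip (simple_reflection i \<gamma>) \<beta>" by (simp add: ip_reflection)
        also have "\<dots> = ip \<gamma> \<beta> + (r - p) * ip (simple_root i) \<beta>"
          by (simp add: simple_reflection_cow ip_simps r_def p_def cow_diff)
        also have "\<dots> = (ip \<gamma> \<beta> + r * ip (simple_root i) \<beta>) + p * (- ip (simple_root i) \<beta>)"
          by (simp add: algebra_simps)
        finally show ?thesis using gt mult_pos_neg[OF p(1) neg] by linarith
      qed
      ultimately have n: "pairing (\<nu> + rho) (coroot (simple_reflection i \<beta>)) \<notin> pos_nats"
        using weight.prems(3)[OF pos] by blast
      have "\<beta> \<in> roots" using \<beta>(1) by (simp add: pos_roots_def)
      define t where "t = - pairing (simple_root i) (coroot \<beta>)"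
      have t: "t \<in> \<int>" "t > 0"
        using coroot_integral[OF \<open>\<beta> \<in> roots\<close>, of i] neg ip_pos[OF root_nonzero[OF \<open>\<beta> \<in> roots\<close>]]
        by (auto simp: t_def pairing_coroot divide_neg_pos mult_pos_neg)
      have "pairing (\<nu> + rho) (coroot (simple_reflection i \<beta>)) = pairing (\<nu> + rho - p *s simple_root i) (coroot \<beta>)"
        unfolding p_def pairing_coroot_reflection[symmetric] by (simp only: simple_reflection_cow)
      also have "\<dots> = pairing (\<nu> + rho) (coroot \<beta>) + p * t"
        by (simp add: pairing_def t_def left_diff_distrib sum_subtractf sum_distrib_left mult.assoc sum_negf)
      finally show ?thesis using n pos_nats_add[of _ "p * t"] p t by auto
    qed
  qed
qed

lemma generic_no_singular:
  assumes "generic \<nu>" "\<gamma> \<noteq> 0"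
  shows "\<not> singular \<nu> \<gamma>"
  using no_singular[of \<nu> \<gamma> "{0}"] assms by (auto simp: generic_def vec.subspace_0 vec.subspace_single_0)

section \<open>Integrability in the directions of \<open>\<Gamma>\<close>\<close>

text \<open>For \<open>\<langle>\<nu> + rho, \<alpha>\<^sub>i\<^sup>\<vee>\<rangle> = n i\<close> this is the submodule of the Verma module generated by the vectors \<open>f\<^sub>i\<^bsup>n i\<^esup>\<close>, \<open>i \<in> G\<close>.\<close>

inductive_set parabolic :: "'i set \<Rightarrow> ('i \<Rightarrow> nat) \<Rightarrow> 'i falg set" for G n where
  serre: "x \<in> serre_ideal \<Longrightarrow> x \<in> parabolic G n"
| gen: "i \<in> G \<Longrightarrow> x * word [i] ^ n i \<in> parabolic G n"
| add: "x \<in> parabolic G n \<Longrightarrow> y \<in> parabolic G n \<Longrightarrow> x + y \<in> parabolic G n"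

lemma parabolic_lmult: "x \<in> parabolic G n \<Longrightarrow> y * x \<in> parabolic G n"
  by (induction rule: parabolic.induct)
    (auto simp: distrib_left mult.assoc[symmetric] intro: parabolic.intros serre_ideal_lmult)

lemma parabolic_diff: "x \<in> parabolic G n \<Longrightarrow> y \<in> parabolic G n \<Longrightarrow> x - y \<in> parabolic G n"
  using parabolic.add[of x G n "- y"] parabolic_lmult[of y G n "- 1"] by simp

lemma parabolic_scale_iff: "c \<noteq> 0 \<Longrightarrow> const c * x \<in> parabolic G n \<longleftrightarrow> x \<in> parabolic G n"
  using parabolic_lmult[of x G n "const c"] parabolic_lmult[of "const c * x" G n "const (inverse c)"]
  by (auto simp: fa.cst_1 simp flip: mult.assoc fa.cst_mult)

text \<open>Each f_i^(n_i) with i in G is singular in M(\<nu>), so the left ideal generated by these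
  powers is stable under all e_j.\<close>

lemma parabolic_eop:
  assumes "\<And>i. i \<in> G \<Longrightarrow> cow i \<nu> + 1 = of_nat (n i)" "x \<in> parabolic G n"
  shows "app (eop \<nu> j) x \<in> parabolic G n"
  using assms(2)
proof induction
  case (gen i x)
  then have h: "cow i \<nu> - of_nat (n i) + 1 = 0" using assms(1)[of i] by simp
  show ?case unfolding eop_power_right h using gen by (auto intro: parabolic.gen)
qed (auto intro: parabolic.intros eop_serre_ideal)

lemma parabolic_eqv: "x \<doteq> y \<Longrightarrow> y \<in> parabolic G n \<Longrightarrow> x \<in> parabolic G n"
  using parabolic.add[OF parabolic.serre, of "x - y" y G n] by (simp add: eqv_def)

text \<open>By the Ore property some f_i^M x is congruent to a left multiple of f_i^(n_i); thus f_i
  is locally nilpotent on the quotient.\<close>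

lemma parabolic_nilpotent:
  assumes "i \<in> G" "homog \<gamma> x"
  shows "\<exists>M. word [i] ^ M * x \<in> parabolic G n"
proof -
  obtain N L where "qsplit i \<gamma> N x L" using qsplit_exists[OF assms(2)] by blast
  from qsplit_ore_left[OF this, of "n i"] show ?thesis
    using parabolic_eqv parabolic.gen[OF assms(1)] by blast
qed

lemma bracket_1: "\<delta> \<noteq> 0 \<Longrightarrow> bracket \<delta> 1 = 1"
  by (simp add: bracket_def)

lemma bracket_recursion:
  assumes "\<delta> \<noteq> 0"
  shows "bracket \<delta> m * bracket \<delta> (h - m + 1) + bracket \<delta> (h - 2 * m) = bracket \<delta> (m + 1) * bracket \<delta> (h - m)"
  using bracket_mult_diff[OF assms, of "m + 1" "m - h"]
    bracket_minus[of \<delta> "h - m"] bracket_minus[of \<delta> "h - m + 1"] bracket_minus[of \<delta> "h - 2 * m"]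
  by (simp add: algebra_simps)

text \<open>The weights of the quotient by \<open>parabolic G n\<close> are invariant under the reflections \<open>s\<^sub>i\<close>, \<open>i \<in> G\<close>: if \<open>x\<close>
  were a counterexample, \<open>e\<^sub>i\<close> would act injectively on the \<open>f\<^sub>i\<close>-lowest vector of the string through \<open>x\<close> up to the
  reflected weight.\<close>

lemma parabolic_reflect:
  assumes n: "\<And>i. i \<in> G \<Longrightarrow> cow i \<nu> + 1 = of_nat (n i)" and i: "i \<in> G"
    and x: "homog \<gamma> x" and m: "cow i (\<nu> - \<gamma>) = - of_nat m"
    and refl: "\<And>z. homog (\<gamma> - of_nat m *s simple_root i) z \<Longrightarrow> z \<in> parabolic G n"
  shows "x \<in> parabolic G n"
proof (rule ccontr)
  let ?K = "parabolic G n"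
  assume notin: "x \<notin> ?K"
  define M where "M = (LEAST M. word [i] ^ M * x \<in> ?K)"
  have M: "word [i] ^ M * x \<in> ?K" unfolding M_def using parabolic_nilpotent[OF i x] by (rule LeastI_ex)
  then have "M \<noteq> 0" using notin by (cases M) auto
  then obtain k where k: "M = Suc k" by (cases M) auto
  define z where "z = word [i] ^ k * x"
  have z: "z \<notin> ?K" using not_less_Least[of k "\<lambda>M. word [i] ^ M * x \<in> ?K"] k by (auto simp: M_def z_def)
  have fz: "word [i] * z \<in> ?K" using M by (simp add: z_def k mult.assoc)
  have zh: "homog (\<gamma> + of_nat k *s simple_root i) z" unfolding z_def by (rule homog_power_left[OF x])
  \<comment> \<open>The \<alpha>_i^\<vee>-weight of the lowest vector z is -l. Applying e_i to z m +
    k times, which is at most l times, leads to the reflected weight.\<close>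
  define l where "l = m + 2 * k"
  define E where "E j = (app (eop \<nu> i) ^^ j) z" for j
  have Eh: "homog (\<gamma> + (of_nat k - of_nat j) *s simple_root i) (E j)" for j
  proof (induction j)
    case (Suc j)
    show ?case using eop_homog[OF Suc.IH, of i \<nu>] unfolding E_def
      by (simp, elim homog_cong) (simp add: weight_eq_iff algebra_simps)
  qed (simp add: E_def zh)
  \<comment> \<open>In the quotient f_i e_i^j z = c_j e_i^(j-1) z for j \<ge> 1, as f_i z = 0 there.
    Since c_j is nonzero for 1 \<le> j \<le> l, the vectors e_i^j z stay nonzero up to j =
    l.\<close>
  define c where "c j = bracket (d i) (of_nat j) * bracket (d i) (of_nat l - of_nat j + 1)" for j
  have rec: "word [i] * E (Suc j) - const (c (Suc j)) * E j \<in> ?K" for j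
  proof (induction j)
    case 0
    have "app (eop \<nu> i) (word [i] * z) \<in> ?K" using parabolic_eop[OF n fz] by blast
    moreover have "cow i (\<nu> - (\<gamma> + of_nat k *s simple_root i)) = - of_nat l" using m by (simp add: cow_simps l_def)
    moreover have "c (Suc 0) = - bracket (d i) (- of_nat l)" by (simp add: c_def bracket_minus bracket_1)
    ultimately show ?case using eop_left[OF zh, of \<nu> i i] by (simp add: E_def const_uminus)
  next
    case (Suc j)
    have "app (eop \<nu> i) (word [i] * E (Suc j) - const (c (Suc j)) * E j) \<in> ?K" using parabolic_eop[OF n Suc.IH] by blast
    moreover have "app (eop \<nu> i) (word [i] * E (Suc j)) = word [i] * E (Suc (Suc j))
      + const (bracket (d i) (2 * of_nat (Suc j) - of_nat l)) * E (Suc j)"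
    proof -
      have "cow i (\<nu> - (\<gamma> + (of_nat k - of_nat (Suc j)) *s simple_root i)) = 2 * of_nat (Suc j) - of_nat l"
        using m by (simp add: cow_simps l_def algebra_simps)
      then show ?thesis using eop_left[OF Eh[of "Suc j"], of \<nu> i i] by (simp add: E_def)
    qed
    ultimately have "word [i] * E (Suc (Suc j)) + const (bracket (d i) (2 * of_nat (Suc j) - of_nat l)) * E (Suc j)
      - const (c (Suc j)) * E (Suc j) \<in> ?K"
      by (simp add: E_def)
    moreover have crec: "c (Suc (Suc j)) = c (Suc j) - bracket (d i) (2 * of_nat (Suc j) - of_nat l)"
      using bracket_recursion[of "d i" "of_nat (Suc j)" "of_nat l"] bracket_minus[of "d i" "of_nat l - 2 * of_nat (Suc j)"]
      by (simp add: c_def algebra_simps)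
    ultimately show ?case
      unfolding crec fa.cst_diff left_diff_distrib by (simp add: diff_diff_eq2 del: of_nat_Suc)
  qed
  have "E j \<notin> ?K" if "j \<le> l" for j
    using that
  proof (induction j)
    case 0
    then show ?case using z by (simp add: E_def)
  next
    case (Suc j)
    show ?case
    proof
      assume "E (Suc j) \<in> ?K"
      then have "word [i] * E (Suc j) - (word [i] * E (Suc j) - const (c (Suc j)) * E j) \<in> ?K"
        by (intro parabolic_diff parabolic_lmult rec)
      then have "const (c (Suc j)) * E j \<in> ?K" by simp
      moreover have "c (Suc j) \<noteq> 0"
      proof -
        have "(of_nat l - of_nat (Suc j) + 1 :: rat) = of_nat (l - j)" using Suc.prems by (simp add: of_nat_diff)
        then show ?thesis using Suc.prems unfolding c_def by (simp del: of_nat_Suc)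
      qed
      ultimately show False using Suc by (simp add: parabolic_scale_iff)
    qed
  qed
  moreover have "E (m + k) \<in> ?K"
    by (rule refl, rule homog_cong[OF Eh]) (simp add: weight_eq_iff algebra_simps)
  ultimately show False by (simp add: l_def)
qed

text \<open>If \<nu> - \<gamma> were dominant for G, then \<nu> + rho - \<gamma> would be strictly
  shorter than \<nu> + rho. So some \<langle>\<nu> - \<gamma>, \<alpha>_i^\<vee>\<rangle> = -m is
  negative, and \<open>parabolic_reflect\<close> passes to \<gamma> - m \<alpha>_i of smaller
  height. The reflection is that of \<nu> - \<gamma>, without the shift by rho, hence the norm grows
  strictly; this preserves the hypotheses and excludes \<gamma> - m \<alpha>_i = 0.\<close>

lemma parabolic_weight_space:
  assumes n: "\<And>i. i \<in> G \<Longrightarrow> cow i \<nu> + 1 = of_nat (n i)" "\<And>i. i \<in> G \<Longrightarrow> n i > 0"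
    and "\<gamma> \<in> Q_plus" "\<gamma> \<noteq> 0" "\<And>j. j \<notin> G \<Longrightarrow> \<gamma> $ j = 0"
    and "ip (\<nu> + rho - \<gamma>) (\<nu> + rho - \<gamma>) \<ge> ip (\<nu> + rho) (\<nu> + rho)"
    and "homog \<gamma> x"
  shows "x \<in> parabolic G n"
proof -
  have "\<forall>\<gamma> x. \<gamma> \<in> Q_plus \<longrightarrow> \<gamma> \<noteq> 0 \<longrightarrow> (\<forall>j. j \<notin> G \<longrightarrow> \<gamma> $ j = 0) \<longrightarrow>
    ip (\<nu> + rho - \<gamma>) (\<nu> + rho - \<gamma>) \<ge> ip (\<nu> + rho) (\<nu> + rho) \<longrightarrow> homog \<gamma> x \<longrightarrow> height \<gamma> < of_nat N \<longrightarrow>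
    x \<in> parabolic G n" for N
  proof (induction N)
    case 0
    then show ?case using height_nat by (auto elim!: Nats_cases) (metis Nats_cases height_nat of_nat_less_0_iff)
  next
    case (Suc N)
    show ?case
    proof (intro allI impI)
      fix \<gamma> x
      assume \<gamma>: "\<gamma> \<in> Q_plus" "\<gamma> \<noteq> 0" "\<forall>j. j \<notin> G \<longrightarrow> \<gamma> $ j = 0"
        and norm: "ip (\<nu> + rho - \<gamma>) (\<nu> + rho - \<gamma>) \<ge> ip (\<nu> + rho) (\<nu> + rho)"
        and x: "homog \<gamma> x" and h: "height \<gamma> < of_nat (Suc N)"
      have nonneg: "\<gamma> $ j \<ge> 0" for j using \<gamma>(1) by (metis (mono_tags, lifting) Nats_cases Q_plus_def mem_Collect_eq of_nat_0_le_iff)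
      have "\<exists>i\<in>G. cow i (\<nu> - \<gamma>) < 0"
      proof (rule ccontr)
        assume "\<not> ?thesis"
        then have dom: "cow i (\<nu> - \<gamma>) \<ge> 0" if "i \<in> G" for i using that by (meson not_le)
        \<comment> \<open>The difference of the squared norms of \<nu> + rho and \<nu> + rho -
          \<gamma> is (\<gamma>|w), and w pairs positively with the simple roots of G, on which
          \<gamma> is supported.\<close>
        define w where "w = (\<nu> + rho) + (\<nu> + rho - \<gamma>)"
        have pos: "ip (simple_root i) w > 0" if "i \<in> G" for i
        proof -
          have "cow i w = cow i (\<nu> + rho) + cow i (\<nu> + rho - \<gamma>)"
            unfolding w_def by (rule pairing_add)
          also have "\<dots> = of_nat (n i) + (cow i (\<nu> - \<gamma>) + 1)"
            using n(1)[OF that] by (simp add: cow_diff cow_rho)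
          finally have "cow i w = of_nat (n i) + (cow i (\<nu> - \<gamma>) + 1)" .
          then have "cow i w > 0" using dom[OF that] by simp
          then show ?thesis using d_pos[of i] by (simp add: ip_sym[of _ w] pairing_simple_coroot[symmetric])
        qed
        obtain j where j: "\<gamma> $ j \<noteq> 0" using \<gamma>(2) by (auto simp: weight_eq_iff)
        then have "j \<in> G" using \<gamma>(3) by auto
        have "ip \<gamma> w = (\<Sum>i\<in>UNIV. \<gamma> $ i * ip (simple_root i) w)" by (rule ip_expand)
        also have "\<dots> > 0"
        proof (rule sum_pos2[of _ j])
          show "0 < \<gamma> $ j * ip (simple_root j) w" using j nonneg[of j] pos[OF \<open>j \<in> G\<close>] by simp
          show "0 \<le> \<gamma> $ i * ip (simple_root i) w" for i
          proof (cases "i \<in> G")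
            case True
            then show ?thesis using nonneg[of i] pos[OF True] by simp
          next
            case False
            then show ?thesis using \<gamma>(3) by simp
          qed
        qed simp_all
        finally have "ip \<gamma> w > 0" .
        moreover have "ip (\<nu> + rho) (\<nu> + rho) - ip (\<nu> + rho - \<gamma>) (\<nu> + rho - \<gamma>) = ip \<gamma> w"
        proof -
          have "ip u u - ip (u - \<gamma>) (u - \<gamma>) = ip \<gamma> (u + (u - \<gamma>))" for u
            by (simp only: ip_add_right ip_diff ip_diff_right ip_sym[of u \<gamma>])
          then show ?thesis by (simp only: w_def)
        qed
        ultimately show False using norm by simp
      qed
      then obtain i where i: "i \<in> G" "cow i (\<nu> - \<gamma>) < 0" by blast
      obtain z where z: "cow i \<gamma> = of_int z" using cow_Q_plus[OF \<gamma>(1)] by (auto elim: Ints_cases)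
      define m where "m = nat (z - int (n i) + 1)"
      have cz: "cow i (\<nu> - \<gamma>) = of_int (int (n i) - 1 - z)" using n(1)[OF i(1)] by (simp add: cow_diff z)
      then have "int (n i) - 1 - z < 0" using i(2) by (simp only: of_int_less_0_iff)
      then have m: "cow i (\<nu> - \<gamma>) = - of_nat m" "m > 0" unfolding cz by (auto simp: m_def)
      define \<gamma>' where "\<gamma>' = \<gamma> - of_nat m *s simple_root i"
      have cow': "cow i (\<nu> + rho - \<gamma>) = 1 - of_nat m" using m(1) by (simp add: cow_diff cow_rho)
      have "\<nu> + rho - \<gamma>' = (\<nu> + rho - \<gamma>) + of_nat m *s simple_root i" by (simp add: \<gamma>'_def)
      then have "ip (\<nu> + rho - \<gamma>') (\<nu> + rho - \<gamma>')
        = ip (\<nu> + rho - \<gamma>) (\<nu> + rho - \<gamma>) + 2 * of_nat m * ip (\<nu> + rho - \<gamma>) (simple_root i) + of_nat m * of_nat m * (2 * d i)"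
        by (simp only: ip_add ip_add_right ip_scale ip_scale_right ip_simple_self ip_sym[of "simple_root i"]) (simp add: algebra_simps)
      also have "ip (\<nu> + rho - \<gamma>) (simple_root i) = (1 - of_nat m) * d i"
        using cow' by (simp add: pairing_simple_coroot[symmetric])
      finally have norm_eq: "ip (\<nu> + rho - \<gamma>') (\<nu> + rho - \<gamma>') = ip (\<nu> + rho - \<gamma>) (\<nu> + rho - \<gamma>) + 2 * of_nat m * d i"
        by (simp add: algebra_simps)
      then have norm': "ip (\<nu> + rho - \<gamma>') (\<nu> + rho - \<gamma>') > ip (\<nu> + rho) (\<nu> + rho)"
      proof -
        have "2 * of_nat m * d i > 0" using m(2) d_pos[of i] by simp
        then show ?thesis using norm_eq norm by linarith
      qed
      show "x \<in> parabolic G n"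
      proof (rule parabolic_reflect[OF n(1) i(1) x m(1)])
        fix y assume "homog (\<gamma> - of_nat m *s simple_root i) y"
        then have y: "homog \<gamma>' y" by (simp add: \<gamma>'_def)
        show "y \<in> parabolic G n"
        proof (cases "\<gamma>' \<in> Q_plus")
          case True
          have ne: "\<gamma>' \<noteq> 0" using norm' by auto
          have zero: "\<forall>j. j \<notin> G \<longrightarrow> \<gamma>' $ j = 0" using \<gamma>(3) i(1) by (auto simp: \<gamma>'_def simple_root_nth)
          have "height \<gamma>' = height \<gamma> - of_nat m"
            using height_add[of \<gamma> "- of_nat m" i] by (simp add: \<gamma>'_def)
          moreover obtain k where "height \<gamma> = of_nat k" using height_nat[OF \<gamma>(1)] by (auto elim: Nats_cases)
          ultimately have "height \<gamma>' < of_nat N" using h m(2) by simp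
          then show ?thesis using Suc.IH True ne zero norm' y by (meson order_less_imp_le)
        next
          case False
          then have "y = 0" using homog_not_Q_plus[OF y] by blast
          then show ?thesis by (simp add: parabolic.serre serre_ideal.zero)
        qed
      qed simp
    qed
  qed
  then show ?thesis using assms(3-) reals_Archimedean2[of "height \<gamma>"] by blast
qed

lemma singular_or_parabolic:
  assumes \<Gamma>: "\<Gamma> \<subseteq> range simple_root"
    and n: "\<And>i. simple_root i \<in> \<Gamma> \<Longrightarrow> cow i \<nu> + 1 = of_nat (n i)" "\<And>i. simple_root i \<in> \<Gamma> \<Longrightarrow> n i > 0"
    and out: "\<And>\<beta>. \<beta> \<in> pos_roots - vec.span \<Gamma> \<Longrightarrow> pairing (\<nu> + rho) (coroot \<beta>) \<notin> pos_nats"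
    and s: "singular \<nu> \<gamma>" "\<gamma> \<noteq> 0" and x: "homog \<gamma> x"
  shows "x \<in> parabolic {i. simple_root i \<in> \<Gamma>} n"
proof -
  have "\<gamma> \<in> vec.span \<Gamma>"
  proof (rule ccontr)
    assume "\<gamma> \<notin> vec.span \<Gamma>"
    then show False using no_singular[OF s(1) vec.subspace_span] out by blast
  qed
  then have zero: "\<gamma> $ j = 0" if "simple_root j \<notin> \<Gamma>" for j
  proof (induction rule: vec.span_induct)
    case base
    show ?case by (auto simp: vec.subspace_def)
  next
    case (step y)
    then obtain k where "y = simple_root k" using \<Gamma> by auto
    then show ?case using step that by (auto simp: simple_root_nth)
  qed
  show ?thesis
    by (rule parabolic_weight_space[OF _ _ singular_Q_plus[OF s(1)] s(2) _ _ x])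
      (use n zero singular_norm[OF s(1)] in auto)
qed

end

section \<open>The algebra \<open>U\<close> in terms of the free algebra\<close>

lemma free_gen_word: "free_gen x = word [x]"
  by (simp add: free_gen_def word_def)

lemma free_const_const: "free_const c = const c"
  by (simp add: free_const_def const_def)

lemma univ_ring_simps [simp]:
  "carrier (univ_ring :: 'a::ring_1 ring) = UNIV" "x \<otimes>\<^bsub>univ_ring\<^esub> y = x * y" "x \<oplus>\<^bsub>univ_ring\<^esub> y = x + y"
  "\<one>\<^bsub>univ_ring\<^esub> = (1 :: 'a)" "\<zero>\<^bsub>univ_ring\<^esub> = (0 :: 'a)"
  for x y :: "'a::ring_1"
  by (simp_all add: univ_ring_def)

context finite_cartan_datum
begin

section \<open>Congruence modulo the defining relations of U\<close>

definition ueq :: "'i free_alg \<Rightarrow> 'i free_alg \<Rightarrow> bool" (infix "\<approx>" 50) where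
  "x \<approx> y \<longleftrightarrow> x - y \<in> relation_ideal"

lemma relation_ideal_add: "x \<in> relation_ideal \<Longrightarrow> y \<in> relation_ideal \<Longrightarrow> x + y \<in> relation_ideal"
  using additive_subgroup.a_closed[OF ideal.axioms(1)[OF ideal_relation_ideal], of x y] by simp

lemma relation_ideal_0: "0 \<in> relation_ideal"
  using additive_subgroup.zero_closed[OF ideal.axioms(1)[OF ideal_relation_ideal]] by simp

lemma relation_ideal_lmult: "x \<in> relation_ideal \<Longrightarrow> y * x \<in> relation_ideal"
  using ideal.I_l_closed[OF ideal_relation_ideal, of x y] by simp

lemma relation_ideal_rmult: "x \<in> relation_ideal \<Longrightarrow> x * y \<in> relation_ideal"
  using ideal.I_r_closed[OF ideal_relation_ideal, of x y] by simp

lemma relation_ideal_uminus: "x \<in> relation_ideal \<Longrightarrow> - x \<in> relation_ideal"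
  using relation_ideal_lmult[of x "- 1"] by simp

lemma relation_ideal_diff: "x \<in> relation_ideal \<Longrightarrow> y \<in> relation_ideal \<Longrightarrow> x - y \<in> relation_ideal"
  using relation_ideal_add[of x "- y"] relation_ideal_uminus by simp

lemma relations_in_ideal: "x \<in> relations \<Longrightarrow> x \<in> relation_ideal"
  using ring.genideal_self[OF ring_univ_ring, of relations] unfolding relation_ideal_def by auto

lemma relation_ideal_induct [consumes 1, case_names relation add lmult rmult]:
  assumes "x \<in> relation_ideal"
    and rel: "\<And>r. r \<in> relations \<Longrightarrow> P r" and add: "\<And>x y. P x \<Longrightarrow> P y \<Longrightarrow> P (x + y)"
    and lm: "\<And>x y. P x \<Longrightarrow> P (y * x)" and rm: "\<And>x y. P x \<Longrightarrow> P (x * y)"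
  shows "P x"
proof -
  interpret U: ring "univ_ring :: 'i free_alg ring" by (rule ring_univ_ring)
  have "P (free_gen (Gen_t i) * free_gen (Gen_tinv i) - 1)" for i by (rule rel[OF relations.t_tinv])
  then have P0: "P 0" using lm[of _ 0] by (metis mult_zero_left)
  have minus: "P (- x)" if "P x" for x using lm[OF that, of "- 1"] by simp
  have "ideal {x. P x} (univ_ring :: 'i free_alg ring)"
  proof (rule idealI[OF ring_univ_ring])
    show "subgroup {x. P x} (add_monoid (univ_ring :: 'i free_alg ring))"
    proof
      fix x assume x: "x \<in> {x. P x}"
      have "\<ominus>\<^bsub>univ_ring\<^esub> x = - x" by (rule U.minus_equality) simp_all
      then show "inv\<^bsub>add_monoid univ_ring\<^esub> x \<in> {x. P x}"
        using minus x by (simp add: a_inv_def)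
    qed (use P0 add in auto)
  qed (use lm rm in auto)
  then have "genideal univ_ring relations \<subseteq> {x. P x}"
    using rel by (intro U.genideal_minimal) auto
  then show ?thesis using assms(1) by (auto simp: relation_ideal_def)
qed

lemma ueq_refl [simp]: "x \<approx> x"
  by (simp add: ueq_def relation_ideal_0)

lemma ueq_sym: "x \<approx> y \<Longrightarrow> y \<approx> x"
  using relation_ideal_uminus[of "x - y"] by (simp add: ueq_def)

lemma ueq_trans [trans]: "x \<approx> y \<Longrightarrow> y \<approx> z \<Longrightarrow> x \<approx> z"
  using relation_ideal_add[of "x - y" "y - z"] by (simp add: ueq_def)

lemma ueq_trans_eq [trans]: "x = y \<Longrightarrow> y \<approx> z \<Longrightarrow> x \<approx> z" "x \<approx> y \<Longrightarrow> y = z \<Longrightarrow> x \<approx> z"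
  by simp_all

lemma ueq_add: "x \<approx> y \<Longrightarrow> x' \<approx> y' \<Longrightarrow> x + x' \<approx> y + y'"
  using relation_ideal_add[of "x - y" "x' - y'"] by (simp add: ueq_def algebra_simps)

lemma ueq_diff: "x \<approx> y \<Longrightarrow> x' \<approx> y' \<Longrightarrow> x - x' \<approx> y - y'"
  using relation_ideal_diff[of "x - y" "x' - y'"] by (simp add: ueq_def algebra_simps)

lemma ueq_lmult: "x \<approx> y \<Longrightarrow> z * x \<approx> z * y"
  using relation_ideal_lmult[of "x - y" z] by (simp add: ueq_def algebra_simps)

lemma ueq_rmult: "x \<approx> y \<Longrightarrow> x * z \<approx> y * z"
  using relation_ideal_rmult[of "x - y" z] by (simp add: ueq_def algebra_simps)

lemma ueq_mult: "x \<approx> y \<Longrightarrow> x' \<approx> y' \<Longrightarrow> x * x' \<approx> y * y'"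
  using ueq_trans[OF ueq_rmult ueq_lmult] by blast

lemma ueq_uminus: "x \<approx> y \<Longrightarrow> - x \<approx> - y"
  using ueq_diff[of 0 0 x y] by simp

lemma ueq_sum: "(\<And>a. a \<in> A \<Longrightarrow> f a \<approx> g a) \<Longrightarrow> sum f A \<approx> sum g A"
  by (induction A rule: infinite_finite_induct) (auto intro: ueq_add)

lemma ueq_0: "x \<approx> 0 \<longleftrightarrow> x \<in> relation_ideal"
  by (simp add: ueq_def)

lemma ueq_mem: "x \<approx> y \<Longrightarrow> x \<in> relation_ideal \<longleftrightarrow> y \<in> relation_ideal"
  unfolding ueq_def using relation_ideal_add[of "x - y" y] relation_ideal_diff[of x "x - y"] by auto

lemma ueq_relation: "x - y \<in> relations \<Longrightarrow> x \<approx> y"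
  by (simp add: ueq_def relations_in_ideal)

lemma proj_set: "proj x = {y. y \<approx> x}"
  unfolding proj_def a_r_coset_def' ueq_def by (auto intro: exI[of _ "_ - x"])

lemma proj_eq_iff: "proj x = proj y \<longleftrightarrow> x \<approx> y"
  unfolding proj_set using ueq_refl ueq_sym ueq_trans by blast

lemma proj_hom: "proj \<in> Ring.ring_hom univ_ring Uq"
  unfolding proj_def Uq_def by (rule ideal.rcos_ring_hom[OF ideal_relation_ideal])

lemma carrier_Uq: "carrier Uq = range proj"
  unfolding Uq_def FactRing_def by (auto simp: A_RCOSETS_def' proj_def)

lemma proj_carrier [simp]: "proj x \<in> carrier Uq"
  by (simp add: carrier_Uq)

lemma proj_mult: "proj (x * y) = proj x \<otimes>\<^bsub>Uq\<^esub> proj y"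
  using ring_hom_mult[OF proj_hom, of x y] by simp

lemma proj_add: "proj (x + y) = proj x \<oplus>\<^bsub>Uq\<^esub> proj y"
  using ring_hom_add[OF proj_hom, of x y] by simp

lemma proj_1: "proj 1 = \<one>\<^bsub>Uq\<^esub>"
  using ring_hom_one[OF proj_hom] by simp

lemma proj_0: "proj 0 = \<zero>\<^bsub>Uq\<^esub>"
  by (auto simp: proj_set ueq_0 Uq_def FactRing_def)

lemma proj_uminus: "proj (- x) = \<ominus>\<^bsub>Uq\<^esub> proj x"
proof -
  interpret U: ring Uq by (rule ring_Uq)
  have "proj (- x) \<oplus>\<^bsub>Uq\<^esub> proj x = \<zero>\<^bsub>Uq\<^esub>" by (simp flip: proj_add add: proj_0)
  then show ?thesis using U.minus_equality by simp
qed

lemma proj_diff: "proj (x - y) = proj x \<ominus>\<^bsub>Uq\<^esub> proj y"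
  using proj_add[of x "- y"] by (simp add: proj_uminus a_minus_def)

lemma scalar_proj: "scalar c = proj (const c)"
  by (simp add: scalar_def free_const_const)

lemma Ugen_proj: "Ue i = proj (word [Gen_e i])" "Uf i = proj (word [Gen_f i])"
  "Ut i = proj (word [Gen_t i])" "Utinv i = proj (word [Gen_tinv i])"
  by (simp_all add: Ue_def Uf_def Ut_def Utinv_def free_gen_word)

section \<open>Words in the torus generators\<close>

fun tinv_gen :: "'i gen \<Rightarrow> 'i gen" where
  "tinv_gen (Gen_t i) = Gen_tinv i"
| "tinv_gen (Gen_tinv i) = Gen_t i"
| "tinv_gen g = g"

fun texp_gen :: "'i gen \<Rightarrow> 'i \<Rightarrow> int" where
  "texp_gen (Gen_t i) j = (if i = j then 1 else 0)"
| "texp_gen (Gen_tinv i) j = (if i = j then -1 else 0)"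
| "texp_gen _ j = 0"

definition texp :: "'i gen list \<Rightarrow> 'i \<Rightarrow> int" where
  "texp w j = (\<Sum>g\<leftarrow>w. texp_gen g j)"

definition tword :: "'i gen list \<Rightarrow> bool" where
  "tword w \<longleftrightarrow> set w \<subseteq> range Gen_t \<union> range Gen_tinv"

lemma texp_simps [simp]: "texp [] = (\<lambda>_. 0)" "texp (g # w) = (\<lambda>j. texp_gen g j + texp w j)"
  "texp (u @ v) = (\<lambda>j. texp u j + texp v j)"
  by (simp_all add: texp_def fun_eq_iff)

lemma tword_simps [simp]: "tword []" "tword (g # w) \<longleftrightarrow> g \<in> range Gen_t \<union> range Gen_tinv \<and> tword w"
  "tword (u @ v) \<longleftrightarrow> tword u \<and> tword v" "tword (rev w) \<longleftrightarrow> tword w"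
  by (auto simp: tword_def)

definition tw_inv :: "'i gen list \<Rightarrow> 'i gen list" where
  "tw_inv w = rev (map tinv_gen w)"

lemma texp_gen_inv: "texp_gen (tinv_gen g) j = - texp_gen g j"
  by (cases g) auto

lemma texp_map_inv: "texp (map tinv_gen w) j = - texp w j"
  by (induction w) (simp_all add: texp_gen_inv)

lemma texp_rev: "texp (rev w) j = texp w j"
  by (simp add: texp_def rev_map[symmetric])

lemma tw_inv: "tword w \<Longrightarrow> tword (tw_inv w)" "texp (tw_inv w) j = - texp w j"
  by (auto simp: tword_def tw_inv_def texp_rev texp_map_inv)

lemma t_letters_inverse: "g \<in> range Gen_t \<union> range Gen_tinv \<Longrightarrow> word [g] * word [tinv_gen g] \<approx> 1"
  using relations.t_tinv relations.tinv_t by (auto simp: free_gen_word intro!: ueq_relation)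

lemma skew_inverse:
  assumes "y * x \<approx> const c * (x * y)" "y * y' \<approx> 1" "y' * y \<approx> 1" "c \<noteq> 0"
  shows "y' * x \<approx> const (1 / c) * (x * y')"
proof -
  have "y' * x = const (1 / c) * (const c * (y' * x))" using assms(4) by (simp flip: fa.sc_def)
  also have "\<dots> \<approx> const (1 / c) * (const c * (y' * x * (y * y')))"
    using ueq_lmult[OF ueq_sym[OF assms(2)], of "y' * x"] by (intro ueq_lmult) simp
  also have "\<dots> = const (1 / c) * (y' * (const c * (x * y)) * y')" by (simp add: mult.assoc flip: fa.sc_def)
  also have "\<dots> \<approx> const (1 / c) * (y' * (y * x) * y')"
    using assms(1) by (intro ueq_lmult ueq_rmult) (rule ueq_sym)
  also have "\<dots> = const (1 / c) * (y' * y * (x * y'))" by (simp add: mult.assoc)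
  also have "\<dots> \<approx> const (1 / c) * (1 * (x * y'))" using assms(3) by (intro ueq_lmult ueq_rmult)
  finally show ?thesis by simp
qed

lemma t_e_commute:
  assumes g: "g \<in> range Gen_t \<union> range Gen_tinv" and x: "x = Gen_e j \<and> s = 1 \<or> x = Gen_f j \<and> s = -1"
  shows "word [g] * word [x] \<approx> const (qpow (s * d j * of_int (texp_gen g j))) * (word [x] * word [g])"
proof -
  have t: "word [Gen_t i] * word [x] \<approx> const (qpow (s * d j * of_int (texp_gen (Gen_t i) j))) * (word [x] * word [Gen_t i])" for i
  proof -
    have "word [Gen_t i] * word [x] * word [Gen_tinv i] \<approx> const (qpow (s * d j * of_int (texp_gen (Gen_t i) j))) * word [x]"
      using x relations.t_e[of i j] relations.t_f[of i j]
      by (intro ueq_relation) (auto simp: free_gen_word free_const_const)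
    from ueq_rmult[OF this, of "word [Gen_t i]"]
    have *: "word [Gen_t i] * word [x] * (word [Gen_tinv i] * word [Gen_t i])
      \<approx> const (qpow (s * d j * of_int (texp_gen (Gen_t i) j))) * (word [x] * word [Gen_t i])"
      by (simp add: mult.assoc)
    have "word [Gen_t i] * word [x] * 1 \<approx> word [Gen_t i] * word [x] * (word [Gen_tinv i] * word [Gen_t i])"
      by (rule ueq_lmult, rule ueq_sym) (use t_letters_inverse[of "Gen_tinv i"] in simp)
    from ueq_trans[OF this *] show ?thesis by simp
  qed
  from g show ?thesis
  proof
    assume "g \<in> range Gen_tinv"
    then obtain i where g: "g = Gen_tinv i" by auto
    have "word [Gen_tinv i] * word [x] \<approx> const (1 / qpow (s * d j * of_int (texp_gen (Gen_t i) j))) * (word [x] * word [Gen_tinv i])"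
      using t_letters_inverse[of "Gen_tinv i"] t_letters_inverse[of "Gen_t i"] by (intro skew_inverse[OF t]) simp_all
    then show ?thesis by (cases "i = j") (simp_all add: g qpow_minus inverse_eq_divide)
  qed (use t in auto)
qed

lemma tword_commute:
  assumes "tword w" and x: "x = Gen_e j \<and> s = 1 \<or> x = Gen_f j \<and> s = -1"
  shows "word w * word [x] \<approx> const (qpow (s * d j * of_int (texp w j))) * (word [x] * word w)"
  using assms(1)
proof (induction w)
  case Nil
  then show ?case by (simp add: fa.cst_1)
next
  case (Cons g w)
  have "word (g # w) * word [x] = word [g] * (word w * word [x])" by (simp add: word_Cons[of g w] mult.assoc)
  also have "\<dots> \<approx> word [g] * (const (qpow (s * d j * of_int (texp w j))) * (word [x] * word w))"
    using Cons by (intro ueq_lmult) simp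
  also have "\<dots> = const (qpow (s * d j * of_int (texp w j))) * ((word [g] * word [x]) * word w)"
    by (simp add: mult.assoc flip: fa.sc_def)
  also have "\<dots> \<approx> const (qpow (s * d j * of_int (texp w j))) *
    ((const (qpow (s * d j * of_int (texp_gen g j))) * (word [x] * word [g])) * word w)"
    using Cons.prems by (intro ueq_lmult ueq_rmult t_e_commute[OF _ x]) simp
  also have "\<dots> = const (qpow (s * d j * of_int (texp (g # w) j))) * (word [x] * word (g # w))"
    by (simp add: word_Cons[of g w] mult.assoc distrib_left qpow_add mult.commute[of "qpow _" "qpow _"] flip: fa.sc_def)
  finally show ?case .
qed

lemma t_t_commute:
  assumes "g \<in> range Gen_t \<union> range Gen_tinv" "h \<in> range Gen_t \<union> range Gen_tinv"
  shows "word [g] * word [h] \<approx> word [h] * word [g]"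
proof -
  have inv: "word [Gen_t i] * word [Gen_tinv i] \<approx> 1" "word [Gen_tinv i] * word [Gen_t i] \<approx> 1" for i
    using t_letters_inverse[of "Gen_tinv i"] t_letters_inverse[of "Gen_t i"] by simp_all
  have tt: "word [Gen_t i] * word [Gen_t j] \<approx> word [Gen_t j] * word [Gen_t i]" for i j
    using relations.t_t[of i j] by (intro ueq_relation) (simp add: free_gen_word)
  have 1: "word [Gen_tinv i] * word [Gen_t j] \<approx> word [Gen_t j] * word [Gen_tinv i]" for i j
    using skew_inverse[of "word [Gen_t i]" "word [Gen_t j]" 1 "word [Gen_tinv i]"] tt[of i j] inv by (simp add: fa.cst_1)
  have 2: "word [Gen_tinv i] * word [Gen_tinv j] \<approx> word [Gen_tinv j] * word [Gen_tinv i]" for i j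
    using skew_inverse[of "word [Gen_t i]" "word [Gen_tinv j]" 1 "word [Gen_tinv i]"] ueq_sym[OF 1[of j i]] inv by (simp add: fa.cst_1)
  from assms show ?thesis using tt 1 2 ueq_sym[OF 1] by auto
qed

lemma t_tword_commute:
  assumes "g \<in> range Gen_t \<union> range Gen_tinv" "tword w"
  shows "word [g] * word w \<approx> word w * word [g]"
  using assms(2)
proof (induction w)
  case (Cons h w)
  have "word [g] * word (h # w) = word [g] * word [h] * word w" by (simp add: word_Cons[of h w] mult.assoc)
  also have "\<dots> \<approx> word [h] * word [g] * word w" using Cons.prems by (intro ueq_rmult t_t_commute[OF assms(1)]) simp
  also have "\<dots> = word [h] * (word [g] * word w)" by (simp add: mult.assoc)
  also have "\<dots> \<approx> word [h] * (word w * word [g])" using Cons by (intro ueq_lmult) simp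
  finally show ?case by (simp add: word_Cons[of h w] mult.assoc)
qed simp

lemma texp_gen_sign: "g \<noteq> Gen_t i \<Longrightarrow> texp_gen g i \<le> 0" "g \<noteq> Gen_tinv i \<Longrightarrow> 0 \<le> texp_gen g i"
  by (cases g; simp)+

lemma texp_pos_in_set: "texp w i > 0 \<Longrightarrow> Gen_t i \<in> set w"
proof (rule ccontr)
  assume "Gen_t i \<notin> set w"
  then have "texp w i \<le> 0"
    by (induction w) (auto intro!: add_nonpos_nonpos texp_gen_sign(1))
  then show "texp w i > 0 \<Longrightarrow> False" by simp
qed

lemma texp_neg_in_set: "texp w i < 0 \<Longrightarrow> Gen_tinv i \<in> set w"
proof (rule ccontr)
  assume "Gen_tinv i \<notin> set w"
  then have "0 \<le> texp w i"
    by (induction w) (auto intro!: add_nonneg_nonneg texp_gen_sign(2))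
  then show "texp w i < 0 \<Longrightarrow> False" by simp
qed

text \<open>Total exponent 0 forces the inverse of the first letter to occur later on; torus letters
  commute, so the pair cancels and the word becomes shorter.\<close>

lemma tword_texp_0:
  assumes "tword w" "\<And>j. texp w j = 0"
  shows "word w \<approx> 1"
  using assms
proof (induction w rule: length_induct)
  case (1 w)
  show ?case
  proof (cases w)
    case (Cons g u)
    have g: "g \<in> range Gen_t \<union> range Gen_tinv" using 1(2) Cons by simp
    have "tinv_gen g \<in> set u"
    proof -
      consider i where "g = Gen_t i" | i where "g = Gen_tinv i" using g by auto
      then show ?thesis
      proof cases
        case (1 i)
        then show ?thesis using \<open>\<And>j. texp w j = 0\<close>[of i] texp_neg_in_set[of u i] by (simp add: Cons)
      next
        case (2 i)
        then show ?thesis using \<open>\<And>j. texp w j = 0\<close>[of i] texp_pos_in_set[of u i] by (simp add: Cons)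
      qed
    qed
    then obtain u1 u2 where u: "u = u1 @ tinv_gen g # u2" by (meson split_list)
    have tw: "tword u1" "tword u2" using 1(2) by (simp_all add: Cons u)
    have "texp (u1 @ u2) j = 0" for j using 1(3)[of j] by (simp add: Cons u texp_gen_inv)
    then have IH: "word (u1 @ u2) \<approx> 1" using 1(1) tw by (simp add: Cons u)
    have "word w = word [g] * word u1 * (word [tinv_gen g] * word u2)"
      by (simp add: Cons u flip: word_append)
    also have "\<dots> \<approx> word u1 * word [g] * (word [tinv_gen g] * word u2)" by (intro ueq_rmult t_tword_commute g tw)
    also have "\<dots> = word u1 * (word [g] * word [tinv_gen g]) * word u2" by (simp add: mult.assoc)
    also have "\<dots> \<approx> word u1 * 1 * word u2" by (intro ueq_lmult ueq_rmult t_letters_inverse g)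
    also have "\<dots> = word (u1 @ u2)" by (simp add: word_append)
    finally show ?thesis using IH ueq_trans by blast
  qed simp
qed

lemma tword_inverse: "tword w \<Longrightarrow> word w * word (tw_inv w) \<approx> 1" "tword w \<Longrightarrow> word (tw_inv w) * word w \<approx> 1"
  using tword_texp_0[of "w @ tw_inv w"] tword_texp_0[of "tw_inv w @ w"] tw_inv by (simp_all add: word_append)

lemma tword_eqI:
  assumes "tword w" "tword w'" "\<And>j. texp w j = texp w' j"
  shows "word w \<approx> word w'"
proof -
  have "word w * 1 \<approx> word w * (word (tw_inv w') * word w')"
    by (rule ueq_lmult, rule ueq_sym, rule tword_inverse(2)[OF assms(2)])
  also have "\<dots> = word (w @ tw_inv w') * word w'" by (simp add: word_append mult.assoc)
  also have "\<dots> \<approx> 1 * word w'"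
    using assms by (intro ueq_rmult tword_texp_0) (simp_all add: tw_inv)
  finally show ?thesis by simp
qed

definition tpow :: "'i \<Rightarrow> int \<Rightarrow> 'i gen list" where
  "tpow i n = (if 0 \<le> n then replicate (nat n) (Gen_t i) else replicate (nat (- n)) (Gen_tinv i))"

definition kword :: "'i \<Rightarrow> int \<Rightarrow> 'i gen list" where
  "kword i s = concat (map (\<lambda>j. tpow j (s * a j i)) (sorted_list_of_set UNIV))"

lemma word_replicate: "word (replicate n x) = word [x] ^ n"
proof (induction n)
  case (Suc n)
  then show ?case by (simp add: word_Cons[of x "replicate n x"])
qed simp

lemma t_power_word: "t_power i n = word (tpow i n)"
  by (simp add: t_power_def tpow_def word_replicate free_gen_word)

lemma k_power_word: "k_power i s = word (kword i s)"
proof -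
  have "prod_list (map (\<lambda>j. t_power j (n j)) L) = word (concat (map (\<lambda>j. tpow j (n j)) L))" for n L
    by (induction L) (simp_all add: t_power_word word_append)
  then show ?thesis by (simp add: k_power_def kword_def)
qed

lemma tword_tpow: "tword (tpow i n)"
  by (auto simp: tpow_def tword_def)

lemma texp_tpow: "texp (tpow i n) j = (if i = j then n else 0)"
proof -
  have "texp (replicate k (Gen_t i)) j = (if i = j then int k else 0)"
    "texp (replicate k (Gen_tinv i)) j = (if i = j then - int k else 0)" for k
    by (induction k) auto
  then show ?thesis by (auto simp: tpow_def)
qed

lemma tword_kword: "tword (kword i s)"
proof -
  have "tword (concat (map (\<lambda>j. tpow j (n j)) L))" for n L
    by (induction L) (simp_all add: tword_tpow)
  then show ?thesis by (simp add: kword_def)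
qed

lemma texp_kword: "texp (kword i s) j = s * a j i"
proof -
  have "distinct L \<Longrightarrow> texp (concat (map (\<lambda>j. tpow j (n j)) L)) j = (if j \<in> set L then n j else 0)" for n L
    by (induction L) (auto simp: texp_tpow)
  then show ?thesis by (simp add: kword_def)
qed

lemma kword_commute:
  assumes "x = Gen_e j \<and> s = 1 \<or> x = Gen_f j \<and> s = -1"
  shows "word (kword i m) * word [x] \<approx> const (qpow (s * of_int m * ip (simple_root i) (simple_root j))) * (word [x] * word (kword i m))"
proof -
  have "s * d j * of_int (texp (kword i m) j) = s * of_int m * ip (simple_root i) (simple_root j)"
    by (simp add: texp_kword ip_simple_roots)
  then show ?thesis using tword_commute[OF tword_kword[of i m] assms] by (simp only:)
qed

lemma kword_inverse: "word (kword i 1) * word (kword i (- 1)) \<approx> 1" "word (kword i (- 1)) * word (kword i 1) \<approx> 1"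
  using tword_texp_0[of "kword i 1 @ kword i (- 1)"] tword_texp_0[of "kword i (- 1) @ kword i 1"]
  by (simp_all add: tword_kword texp_kword word_append)

lemma e_f_commute: "word [Gen_e i] * word [Gen_f j] \<approx> word [Gen_f j] * word [Gen_e i]
    + (if i = j then const (qstep i) * (word (kword i 1) - word (kword i (- 1))) else 0)"
  using relations.e_f[of i j]
  by (intro ueq_relation) (simp add: free_gen_word free_const_const k_power_word qstep_def diff_diff_eq split: if_splits)

section \<open>The action on Verma modules\<close>

fun act_gen :: "'i weight \<Rightarrow> 'i gen \<Rightarrow> 'i lin" where
  "act_gen \<nu> (Gen_e j) = eop \<nu> j"
| "act_gen \<nu> (Gen_f j) = fop j"
| "act_gen \<nu> (Gen_t j) = diag (\<lambda>\<beta>. qpow (d j * (\<nu> - \<beta>) $ j))"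
| "act_gen \<nu> (Gen_tinv j) = diag (\<lambda>\<beta>. qpow (- (d j * (\<nu> - \<beta>) $ j)))"

definition act :: "'i weight \<Rightarrow> 'i free_alg \<Rightarrow> 'i lin" where
  "act \<nu> = li_ev (act_gen \<nu>)"

lemma act_simps [simp]: "act \<nu> (x + y) = act \<nu> x + act \<nu> y" "act \<nu> (x - y) = act \<nu> x - act \<nu> y"
  "act \<nu> (x * y) = act \<nu> x * act \<nu> y" "act \<nu> (- x) = - act \<nu> x" "act \<nu> 0 = 0" "act \<nu> 1 = 1"
  "act \<nu> (const c) = lmult (const c)"
  by (simp_all add: act_def)

lemma act_letter [simp]: "act \<nu> (word [g]) = act_gen \<nu> g"
  by (simp add: act_def)

lemma act_word_Cons: "act \<nu> (word (g # w)) = act_gen \<nu> g * act \<nu> (word w)"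
  by (simp add: act_def)

text \<open>The exponent of q in the value of q^\<nu> at the torus word w.\<close>

definition texp_weight :: "'i gen list \<Rightarrow> 'i weight \<Rightarrow> rat" where
  "texp_weight w \<nu> = (\<Sum>j\<in>UNIV. of_int (texp w j) * d j * \<nu> $ j)"

lemma texp_weight_letter:
  "texp_weight (g # w) \<nu> = (\<Sum>j\<in>UNIV. of_int (texp_gen g j) * d j * \<nu> $ j) + texp_weight w \<nu>"
  by (simp add: texp_weight_def distrib_right sum.distrib)

lemma texp_gen_sum: "(\<Sum>j\<in>UNIV. of_int (texp_gen (Gen_t i) j) * d j * \<nu> $ j) = d i * \<nu> $ i"
  "(\<Sum>j\<in>UNIV. of_int (texp_gen (Gen_tinv i) j) * d j * \<nu> $ j) = - (d i * \<nu> $ i)"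
  by (simp_all add: if_distrib[of of_int] if_distrib[of "\<lambda>x. x * _"] cong: if_cong)

lemma act_tword:
  assumes "tword w"
  shows "act \<nu> (word w) = diag (\<lambda>\<beta>. qpow (texp_weight w (\<nu> - \<beta>)))"
  using assms
proof (induction w)
  case Nil
  then show ?case by (simp add: texp_weight_def diag_1)
next
  case (Cons g w)
  then show ?case
    unfolding act_word_Cons texp_weight_letter
    by (auto simp only: tword_simps texp_gen_sum act_gen.simps diag_mult qpow_add simp_thms)
qed

lemma texp_weight_kword: "texp_weight (kword i s) \<nu> = of_int s * ip \<nu> (simple_root i)"
proof -
  have "texp_weight (kword i s) \<nu> = (\<Sum>j\<in>UNIV. of_int s * (\<nu> $ j * ip (simple_root j) (simple_root i)))"
    unfolding texp_weight_def texp_kword by (rule sum.cong) (simp_all add: ip_simple_roots d_a_sym[of _ i] mult.commute mult.left_commute)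
  also have "\<dots> = of_int s * ip \<nu> (simple_root i)" by (subst (2) ip_expand) (simp add: sum_distrib_left)
  finally show ?thesis .
qed

lemma act_kword: "act \<nu> (word (kword i s)) = kop \<nu> (of_int s) i"
  by (simp add: act_tword[OF tword_kword] texp_weight_kword kop_def)

lemma act_serre_ideal: "v \<in> serre_ideal \<Longrightarrow> app (act \<nu> x) v \<in> serre_ideal"
proof (induction x arbitrary: v rule: falg_induct)
  case (word w)
  then show ?case
  proof (induction w)
    case (Cons g w)
    then show ?case unfolding act_word_Cons
      by (cases g) (simp_all add: eop_serre_ideal fop_def serre_ideal_lmult diag_serre_ideal)
  qed simp
qed (simp_all add: serre_ideal_scale serre_ideal.add)

lemma serre_gen:
  assumes "i \<noteq> j"
  shows "serre X i j = fa_sc (1 / qfact (d i) (nat (1 - a i j)))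
    (fa.adq (\<lambda>k. qpow (d i * (of_int (a i j) + 2 * of_nat k))) (word [X i]) (word [X j]) (nat (1 - a i j)))"
  unfolding serre_def free_gen_word free_const_const fa_sc_def
  by (rule serre_general[OF fa.algebra_over_qfield_axioms assms])

lemma act_adq: "act \<nu> (fa.adq s x z n) = li_adq s (act \<nu> x) (act \<nu> z) n"
  by (induction n) (simp_all add: fa.sc_def li.sc_def)

text \<open>All relations act as 0 on the free algebra already, except the Serre relations of the
  f_j, whose values lie in \<open>serre_ideal\<close>. So the free algebra modulo
  \<open>serre_ideal\<close> is a U-module for every \<nu>.\<close>

lemma act_relation_ideal: "x \<in> relation_ideal \<Longrightarrow> app (act \<nu> x) v \<in> serre_ideal"
proof (induction arbitrary: v rule: relation_ideal_induct)
  case (relation r)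
  then show ?case
  proof cases
    case (t_tinv i)
    have "act \<nu> r = 0" by (simp add: t_tinv free_gen_word diag_mult diag_1)
    then show ?thesis by (simp add: serre_ideal.zero)
  next
    case (tinv_t i)
    have "act \<nu> r = 0" by (simp add: tinv_t free_gen_word diag_mult diag_1)
    then show ?thesis by (simp add: serre_ideal.zero)
  next
    case (t_t i j)
    have "act \<nu> r = 0" by (simp add: t_t free_gen_word diag_mult mult.commute)
    then show ?thesis by (simp add: serre_ideal.zero)
  next
    case (t_e i j)
    have "qpow (d i * (\<nu> - \<beta>) $ i) * qpow (- (d i * (\<nu> - (\<beta> + simple_root j)) $ i)) = qpow (if i = j then d i else 0)" for \<beta>
      by (simp add: simple_root_nth algebra_simps flip: qpow_add)
    then have "diag (\<lambda>\<beta>. qpow (d i * (\<nu> - \<beta>) $ i)) * eop \<nu> j * diag (\<lambda>\<beta>. qpow (- (d i * (\<nu> - \<beta>) $ i)))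
      = eop \<nu> j * diag (\<lambda>\<beta>. qpow (if i = j then d i else 0))"
      unfolding diag_eop mult.assoc diag_mult
      by (metis (no_types, lifting) ext add_diff_cancel_right' diff_add_cancel)
    also have "diag (\<lambda>\<beta>. qpow (if i = j then d i else 0)) = li_sc (qpow (if i = j then d i else 0)) 1"
      using diag_scale[of "qpow (if i = j then d i else 0)" "\<lambda>_. 1"] by (simp add: diag_1)
    finally have "act \<nu> r = 0" by (simp add: t_e free_gen_word free_const_const li.sc_def li.cst_central)
    then show ?thesis by (simp add: serre_ideal.zero)
  next
    case (t_f i j)
    have "qpow (d i * (\<nu> - (\<beta> + simple_root j)) $ i) * qpow (- (d i * (\<nu> - \<beta>) $ i)) = qpow (if i = j then - d i else 0)" for \<beta>
      by (simp add: simple_root_nth algebra_simps flip: qpow_add)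
    then have "diag (\<lambda>\<beta>. qpow (d i * (\<nu> - \<beta>) $ i)) * fop j * diag (\<lambda>\<beta>. qpow (- (d i * (\<nu> - \<beta>) $ i)))
      = fop j * diag (\<lambda>\<beta>. qpow (if i = j then - d i else 0))"
      unfolding fop_def diag_gen mult.assoc diag_mult by simp
    also have "diag (\<lambda>\<beta>. qpow (if i = j then - d i else 0)) = li_sc (qpow (if i = j then - d i else 0)) 1"
      using diag_scale[of "qpow (if i = j then - d i else 0)" "\<lambda>_. 1"] by (simp add: diag_1)
    finally have "act \<nu> r = 0" by (simp add: t_f free_gen_word free_const_const li.sc_def li.cst_central)
    then show ?thesis by (simp add: serre_ideal.zero)
  next
    case (e_f i j)
    have "act \<nu> r = 0"
      by (simp add: e_f free_gen_word free_const_const k_power_word act_kword eop_fop li.sc_def flip: qstep_def)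
    then show ?thesis by (simp add: serre_ideal.zero)
  next
    case (serre_e i j)
    have "act \<nu> r = 0"
      unfolding serre_e(1) serre_gen[OF serre_e(2)] fa.sc_def act_simps act_adq act_letter act_gen.simps serre_e_zero[OF serre_e(2)]
      by simp
    then show ?thesis by (simp add: serre_ideal.zero)
  next
    case (serre_f i j)
    have "act \<nu> r = lmult (local.serre_f i j)"
      unfolding serre_f(1) serre_gen[OF serre_f(2)] lmult_serre_f[OF serre_f(2)] fa.sc_def li.sc_def act_simps act_adq
        act_letter act_gen.simps ..
    then show ?thesis using serre_f(2) by (simp add: serre_ideal_rmult serre_f_in)
  qed
qed (simp_all add: serre_ideal.add act_serre_ideal)

lemma act_ueq: "x \<approx> y \<Longrightarrow> app (act \<nu> x) v \<doteq> app (act \<nu> y) v"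
  using act_relation_ideal[of "x - y"] by (simp add: ueq_def eqv_def)

text \<open>The names are to be read in-f and in-e, and later in-t: U^-, U^+ and U^0 are handled as
  images of free algebras.\<close>

definition inf_alg :: "'i falg \<Rightarrow> 'i free_alg" where "inf_alg = fa_ev (\<lambda>i. word [Gen_f i])"
definition ine_alg :: "'i falg \<Rightarrow> 'i free_alg" where "ine_alg = fa_ev (\<lambda>i. word [Gen_e i])"

lemma in_alg_simps [simp]:
  "inf_alg (x + y) = inf_alg x + inf_alg y" "inf_alg (x - y) = inf_alg x - inf_alg y" "inf_alg (x * y) = inf_alg x * inf_alg y"
  "inf_alg 0 = 0" "inf_alg 1 = 1" "inf_alg (const c) = const c" "inf_alg (- x) = - inf_alg x" "inf_alg (x ^ n) = inf_alg x ^ n"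
  "ine_alg (x + y) = ine_alg x + ine_alg y" "ine_alg (x - y) = ine_alg x - ine_alg y" "ine_alg (x * y) = ine_alg x * ine_alg y"
  "ine_alg 0 = 0" "ine_alg 1 = 1" "ine_alg (const c) = const c" "ine_alg (- x) = - ine_alg x" "ine_alg (x ^ n) = ine_alg x ^ n"
  by (simp_all add: inf_alg_def ine_alg_def)

lemma prod_list_letters: "prod_list (map (\<lambda>i. word [X i]) w) = word (map X w)"
proof (induction w)
  case (Cons i w)
  then show ?case by (simp add: word_Cons[of "X i" "map X w"])
qed simp

lemma in_alg_word [simp]: "inf_alg (word w) = word (map Gen_f w)" "ine_alg (word w) = word (map Gen_e w)"
  by (simp_all add: inf_alg_def ine_alg_def prod_list_letters)

lemma inf_alg_sum: "inf_alg (sum f A) = (\<Sum>a\<in>A. inf_alg (f a))"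
  by (simp add: inf_alg_def fa.ev_sum)

lemma act_inf [simp]: "act \<nu> (inf_alg x) = lmult x"
proof (induction x rule: falg_induct)
  case (word w)
  show ?case
  proof (induction w)
    case (Cons k w)
    then show ?case by (simp add: act_word_Cons fop_def word_Cons[of k w] lmult_simps)
  qed (simp add: lmult_simps)
qed (simp_all add: lmult_simps)

lemma inf_serre_ideal: "x \<in> serre_ideal \<Longrightarrow> inf_alg x \<in> relation_ideal"
proof (induction rule: serre_ideal.induct)
  case (gen i j c u v)
  have "inf_alg (serre_f i j) = serre Gen_f i j"
    by (simp add: serre_f_def serre_def Let_def inf_alg_sum free_gen_word free_const_const)
  then have "inf_alg (serre_f i j) \<in> relation_ideal" using relations.serre_f[OF gen] relations_in_ideal by simp
  then show ?case by (simp add: relation_ideal_lmult relation_ideal_rmult)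
qed (simp_all add: relation_ideal_0 relation_ideal_add)

text \<open>Applied to the vector 1, \<open>inf_alg x\<close> gives back x. So the f_j satisfy no
  relations in U beyond those of Serre: U^- is the free algebra modulo
  \<open>serre_ideal\<close>.\<close>

lemma inf_ueq_iff: "inf_alg x \<approx> inf_alg y \<longleftrightarrow> x \<doteq> y"
proof
  assume "inf_alg x \<approx> inf_alg y"
  from act_ueq[OF this, of 0 1] show "x \<doteq> y" by simp
next
  assume "x \<doteq> y"
  then show "inf_alg x \<approx> inf_alg y" using inf_serre_ideal[of "x - y"] by (simp add: eqv_def ueq_def)
qed

end

section \<open>Counit, \<open>\<theta>\<close> and antipode\<close>

context finite_cartan_datum
begin

section \<open>Maps that descend to U\<close>

definition rep :: "'i uq \<Rightarrow> 'i free_alg" where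
  "rep X = (SOME x. proj x = X)"

lemma proj_rep: "X \<in> carrier Uq \<Longrightarrow> proj (rep X) = X"
  unfolding rep_def carrier_Uq by (rule someI_ex) auto

lemma rep_proj: "rep (proj x) \<approx> x"
  using proj_rep[of "proj x"] by (simp add: proj_eq_iff)

definition descend :: "('i free_alg \<Rightarrow> 'b) \<Rightarrow> 'i uq \<Rightarrow> 'b" where
  "descend \<phi> = restrict (\<lambda>X. \<phi> (rep X)) (carrier Uq)"

lemma descend_proj: "(\<And>x y. x \<approx> y \<Longrightarrow> \<phi> x = \<phi> y) \<Longrightarrow> descend \<phi> (proj x) = \<phi> x"
  using rep_proj[of x] by (simp add: descend_def)

lemma descend_extensional: "descend \<phi> \<in> extensional (carrier Uq)"
  by (simp add: descend_def)

lemma descend_hom: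
  assumes cong: "\<And>x y. x \<approx> y \<Longrightarrow> \<phi> x = \<phi> y" and hom: "\<And>x. \<phi> x \<in> carrier S"
    "\<And>x y. \<phi> (x * y) = \<phi> x \<otimes>\<^bsub>S\<^esub> \<phi> y" "\<And>x y. \<phi> (x + y) = \<phi> x \<oplus>\<^bsub>S\<^esub> \<phi> y" "\<phi> 1 = \<one>\<^bsub>S\<^esub>"
  shows "descend \<phi> \<in> Ring.ring_hom Uq S"
proof (rule ring_hom_memI)
  note d = descend_proj[of \<phi>, OF cong]
  show "descend \<phi> X \<in> carrier S" if "X \<in> carrier Uq" for X
    using that hom(1) d by (auto simp: carrier_Uq)
  show "descend \<phi> (X \<otimes>\<^bsub>Uq\<^esub> Y) = descend \<phi> X \<otimes>\<^bsub>S\<^esub> descend \<phi> Y" if "X \<in> carrier Uq" "Y \<in> carrier Uq" for X Y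
    using that hom(2) d by (auto simp: carrier_Uq simp flip: proj_mult)
  show "descend \<phi> (X \<oplus>\<^bsub>Uq\<^esub> Y) = descend \<phi> X \<oplus>\<^bsub>S\<^esub> descend \<phi> Y" if "X \<in> carrier Uq" "Y \<in> carrier Uq" for X Y
    using that hom(3) d by (auto simp: carrier_Uq simp flip: proj_add)
  show "descend \<phi> \<one>\<^bsub>Uq\<^esub> = \<one>\<^bsub>S\<^esub>" using hom(4) d by (simp flip: proj_1)
qed

lemma Ut_inverse: "Ut i \<otimes>\<^bsub>Uq\<^esub> Utinv i = \<one>\<^bsub>Uq\<^esub>" "Utinv i \<otimes>\<^bsub>Uq\<^esub> Ut i = \<one>\<^bsub>Uq\<^esub>"
  using t_letters_inverse[of "Gen_t i"] t_letters_inverse[of "Gen_tinv i"]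
  by (simp_all add: Ugen_proj proj_eq_iff flip: proj_mult proj_1)

text \<open>The prescribed values omit t_i^(-1), whose image is forced as the inverse of the image
  of t_i.\<close>

lemma Uq_hom_unique:
  assumes S: "ring S" and h: "h \<in> Ring.ring_hom Uq S" and h': "h' \<in> Ring.ring_hom Uq S"
    and eq: "\<And>c. h (scalar c) = h' (scalar c)" "\<And>i. h (Ut i) = h' (Ut i)" "\<And>i. h (Ue i) = h' (Ue i)" "\<And>i. h (Uf i) = h' (Uf i)"
  shows "h (proj x) = h' (proj x)"
proof -
  interpret S: ring S by fact
  have cl: "h (proj x) \<in> carrier S" "h' (proj x) \<in> carrier S" for x
    using ring_hom_closed[OF h] ring_hom_closed[OF h'] by simp_all
  have carr: "Ut i \<in> carrier Uq" "Utinv i \<in> carrier Uq" for i by (simp_all add: Ugen_proj)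
  have inv: "h (Utinv i) = h' (Utinv i)" for i
  proof -
    have 1: "h (Ut i) \<otimes>\<^bsub>S\<^esub> h (Utinv i) = \<one>\<^bsub>S\<^esub>"
      using ring_hom_mult[OF h carr(1) carr(2), of i i] ring_hom_one[OF h] by (simp add: Ut_inverse)
    have 2: "h' (Utinv i) \<otimes>\<^bsub>S\<^esub> h (Ut i) = \<one>\<^bsub>S\<^esub>"
      using ring_hom_mult[OF h' carr(2) carr(1), of i i] ring_hom_one[OF h'] by (simp add: Ut_inverse eq)
    have c: "h (Ut i) \<in> carrier S" "h (Utinv i) \<in> carrier S" "h' (Utinv i) \<in> carrier S"
      using cl by (simp_all add: Ugen_proj)
    have "h' (Utinv i) \<otimes>\<^bsub>S\<^esub> (h (Ut i) \<otimes>\<^bsub>S\<^esub> h (Utinv i)) = h (Utinv i)"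
      using 2 c by (simp flip: S.m_assoc)
    then show ?thesis using 1 c by simp
  qed
  have gen: "h (proj (word [g])) = h' (proj (word [g]))" for g
    by (cases g) (use eq inv in \<open>simp_all add: Ugen_proj\<close>)
  show ?thesis
  proof (induction x rule: falg_induct)
    case (word w)
    show ?case
    proof (induction w)
      case Nil
      show ?case using ring_hom_one[OF h] ring_hom_one[OF h'] by (simp add: proj_1)
    next
      case (Cons g w)
      then show ?case
        by (simp add: word_Cons[of g w] proj_mult ring_hom_mult[OF h] ring_hom_mult[OF h'] gen)
    qed
  next
    case (scale c x)
    then show ?case using eq(1)[of c] by (simp add: proj_mult ring_hom_mult[OF h] ring_hom_mult[OF h'] scalar_proj)
  next
    case (add x y)
    then show ?case by (simp add: proj_add ring_hom_add[OF h] ring_hom_add[OF h'])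
  qed
qed

text \<open>This evaluates the definite descriptions of the counit, of \<open>theta\<close> and of
  the antipode: a map of the free algebra that respects the relations gives existence, agreement on
  generators gives uniqueness.\<close>

lemma the_Uq_hom:
  assumes "ring S" "\<And>x y. x \<approx> y \<Longrightarrow> \<phi> x = \<phi> y" "\<And>x. \<phi> x \<in> carrier S"
    "\<And>x y. \<phi> (x * y) = \<phi> x \<otimes>\<^bsub>S\<^esub> \<phi> y" "\<And>x y. \<phi> (x + y) = \<phi> x \<oplus>\<^bsub>S\<^esub> \<phi> y" "\<phi> 1 = \<one>\<^bsub>S\<^esub>"
    and P: "P (descend \<phi>)"
    "\<And>h. P h \<Longrightarrow> (\<forall>c. h (scalar c) = \<phi> (const c)) \<and> (\<forall>i. h (Ut i) = \<phi> (word [Gen_t i])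
      \<and> h (Ue i) = \<phi> (word [Gen_e i]) \<and> h (Uf i) = \<phi> (word [Gen_f i]))"
  shows "(THE h. h \<in> extensional (carrier Uq) \<and> h \<in> Ring.ring_hom Uq S \<and> P h) = descend \<phi>"
proof (rule the_equality)
  show "descend \<phi> \<in> extensional (carrier Uq) \<and> descend \<phi> \<in> Ring.ring_hom Uq S \<and> P (descend \<phi>)"
    using descend_extensional descend_hom[of \<phi> S] assms by blast
next
  fix h assume h: "h \<in> extensional (carrier Uq) \<and> h \<in> Ring.ring_hom Uq S \<and> P h"
  have d: "descend \<phi> (proj x) = \<phi> x" for x using descend_proj[of \<phi>] assms(2) by blast
  show "h = descend \<phi>"
  proof (rule extensionalityI)
    fix X assume "X \<in> carrier Uq"
    then obtain x where X: "X = proj x" by (auto simp: carrier_Uq)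
    show "h X = descend \<phi> X"
      unfolding X
      by (rule Uq_hom_unique[OF assms(1) _ descend_hom[of \<phi> S, OF assms(2-6)]])
        (use h P(2)[of h] in \<open>simp_all add: d scalar_proj Ugen_proj\<close>)
  qed (use h descend_extensional in auto)
qed

section \<open>The counit\<close>

definition cu :: "'i free_alg \<Rightarrow> qfield" where
  "cu = qf_ev (\<lambda>g. case g of Gen_e i \<Rightarrow> 0 | Gen_f i \<Rightarrow> 0 | _ \<Rightarrow> 1)"

lemma cu_simps [simp]: "cu (x + y) = cu x + cu y" "cu (x - y) = cu x - cu y" "cu (x * y) = cu x * cu y" "cu 0 = 0" "cu 1 = 1"
  "cu (const c) = c" "cu (word [Gen_e i]) = 0" "cu (word [Gen_f i]) = 0" "cu (word [Gen_t i]) = 1" "cu (word [Gen_tinv i]) = 1"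
  by (simp_all add: cu_def)

lemma cu_tword: "tword w \<Longrightarrow> cu (word w) = 1"
proof (induction w)
  case (Cons g w)
  then show ?case by (auto simp: word_Cons[of g w])
qed simp

lemma cu_adq: "cu z = 0 \<Longrightarrow> cu (fa.adq s x z n) = 0"
  by (induction n) (simp_all add: fa.sc_def)

lemma cu_relation_ideal: "x \<in> relation_ideal \<Longrightarrow> cu x = 0"
proof (induction rule: relation_ideal_induct)
  case (relation r)
  then show ?case
    by cases (simp_all add: free_gen_word free_const_const k_power_word cu_tword tword_kword serre_gen cu_adq fa.sc_def)
qed simp_all

lemma counit_proj: "counit (proj x) = cu x"
proof -
  have cong: "cu x = cu y" if "x \<approx> y" for x y
    using cu_relation_ideal[of "x - y"] that by (simp add: ueq_def)
  have "counit = descend cu"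
    unfolding counit_def
    by (rule the_Uq_hom[OF ring_univ_ring cong])
      (auto simp: descend_proj[of cu, OF cong] scalar_proj Ugen_proj)
  then show ?thesis using descend_proj[of cu, OF cong] by simp
qed

section \<open>The automorphism \<open>theta\<close>\<close>

fun th_gen :: "'i gen \<Rightarrow> 'i free_alg" where
  "th_gen (Gen_e i) = - word [Gen_f i]"
| "th_gen (Gen_f i) = - word [Gen_e i]"
| "th_gen g = word [tinv_gen g]"

definition th :: "'i free_alg \<Rightarrow> 'i free_alg" where
  "th = fa_ev th_gen"

lemma th_simps [simp]: "th (x + y) = th x + th y" "th (x - y) = th x - th y" "th (x * y) = th x * th y" "th 0 = 0" "th 1 = 1"
  "th (const c) = const c" "th (- x) = - th x"
  by (simp_all add: th_def)

lemma th_letter [simp]: "th (word [g]) = th_gen g"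
  by (simp add: th_def)

lemma th_tword: "tword w \<Longrightarrow> th (word w) = word (map tinv_gen w)"
proof (induction w)
  case (Cons g w)
  then show ?case by (auto simp: word_Cons[of g w] word_Cons[of "tinv_gen g" "map tinv_gen w"] word_Cons[of "Gen_t _" "map tinv_gen w"] word_Cons[of "Gen_tinv _" "map tinv_gen w"])
qed simp

lemma th_kword: "th (word (kword i s)) \<approx> word (kword i (- s))"
  unfolding th_tword[OF tword_kword]
proof (rule tword_eqI)
  show "tword (map tinv_gen (kword i s))" using tw_inv(1)[OF tword_kword, of i s] by (simp add: tw_inv_def)
qed (simp_all add: tword_kword texp_map_inv texp_kword)

lemma adq_sign: "fa.adq s (- x) (- z) n = fa_sc ((- 1) ^ Suc n) (fa.adq s x z n)"
  by (induction n) (simp_all add: fa.sc_minus fa.sc_uminus fa.sc_minus_right mult.commute[of "s _"])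

lemma th_adq: "th (fa.adq s x z n) = fa.adq s (th x) (th z) n"
  by (induction n) (simp_all add: fa.sc_def)

lemma serre_mem: "i \<noteq> j \<Longrightarrow> serre Gen_e i j \<in> relation_ideal" "i \<noteq> j \<Longrightarrow> serre Gen_f i j \<in> relation_ideal"
  by (simp_all add: relations_in_ideal relations.intros)

lemma th_relation_ideal: "x \<in> relation_ideal \<Longrightarrow> th x \<in> relation_ideal"
proof (induction rule: relation_ideal_induct)
  case (relation r)
  have swap: "word [Gen_tinv i] * word [x] * word [Gen_t i] \<approx> const (qpow (- s * (if i = j then d i else 0))) * word [x]"
    if "x = Gen_e j \<and> s = 1 \<or> x = Gen_f j \<and> s = -1" for i j x s
  proof -
    have "word [Gen_tinv i] * word [x] * word [Gen_t i] \<approx>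
      const (qpow (s * d j * of_int (texp_gen (Gen_tinv i) j))) * (word [x] * word [Gen_tinv i]) * word [Gen_t i]"
      using that by (intro ueq_rmult t_e_commute) simp_all
    also have "\<dots> = const (qpow (s * d j * of_int (texp_gen (Gen_tinv i) j))) * (word [x] * (word [Gen_tinv i] * word [Gen_t i]))"
      by (simp add: mult.assoc)
    also have "\<dots> \<approx> const (qpow (s * d j * of_int (texp_gen (Gen_tinv i) j))) * (word [x] * 1)"
      using t_letters_inverse[of "Gen_tinv i"] by (intro ueq_lmult) simp
    finally show ?thesis by (cases "i = j") simp_all
  qed
  from relation show ?case
  proof cases
    case (t_tinv i)
    then show ?thesis using t_letters_inverse[of "Gen_tinv i"] by (simp add: free_gen_word ueq_def)
  next
    case (tinv_t i)
    then show ?thesis using t_letters_inverse[of "Gen_t i"] by (simp add: free_gen_word ueq_def)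
  next
    case (t_t i j)
    then show ?thesis using t_t_commute[of "Gen_tinv i" "Gen_tinv j"] by (simp add: free_gen_word ueq_def)
  next
    case (t_e i j)
    have "th r = - (word [Gen_tinv i] * word [Gen_f j] * word [Gen_t i] - const (qpow (if i = j then d i else 0)) * word [Gen_f j])"
      by (simp add: t_e free_gen_word free_const_const)
    moreover have "- (- 1) * (if i = j then d i else 0) = (if i = j then d i else 0)" by simp
    ultimately show ?thesis using swap[of "Gen_f j" j "-1" i] relation_ideal_uminus by (simp only: ueq_def simp_thms)
  next
    case (t_f i j)
    have "th r = - (word [Gen_tinv i] * word [Gen_e j] * word [Gen_t i] - const (qpow (if i = j then - d i else 0)) * word [Gen_e j])"
      by (simp add: t_f free_gen_word free_const_const)
    moreover have "- 1 * (if i = j then d i else 0) = (if i = j then - d i else 0)" by simp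
    ultimately show ?thesis using swap[of "Gen_e j" j 1 i] relation_ideal_uminus by (simp only: ueq_def simp_thms)
  next
    case (e_f i j)
    have "word [Gen_f i] * word [Gen_e j] - word [Gen_e j] * word [Gen_f i]
      \<approx> (if i = j then const (qstep i) * (word (kword i (- 1)) - word (kword i 1)) else 0)"
      using relation_ideal_uminus[of "word [Gen_e j] * word [Gen_f i] - (word [Gen_f i] * word [Gen_e j]
         + (if j = i then const (qstep j) * (word (kword j 1) - word (kword j (- 1))) else 0))"] e_f_commute[of j i]
      by (auto simp: ueq_def algebra_simps split: if_splits)
    also have "\<dots> \<approx> th (if i = j then const (qstep i) * (word (kword i 1) - word (kword i (- 1))) else 0)"
      using ueq_sym[OF th_kword[of i 1]] ueq_sym[OF th_kword[of i "- 1"]] by (auto intro!: ueq_lmult ueq_diff)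
    finally have "word [Gen_f i] * word [Gen_e j] - word [Gen_e j] * word [Gen_f i]
      \<approx> th (if i = j then const (qstep i) * (word (kword i 1) - word (kword i (- 1))) else 0)" .
    then show ?thesis
      by (simp add: ueq_def e_f free_gen_word free_const_const k_power_word qstep_def split: if_splits)
  next
    case (serre_e i j)
    have "th r = const ((- 1) ^ Suc (nat (1 - a i j))) * serre Gen_f i j"
      unfolding serre_e(1) serre_gen[OF serre_e(2)] fa.sc_def th_simps th_adq th_letter th_gen.simps adq_sign
      by (simp add: mult.commute[of "inverse _"] divide_inverse flip: fa.sc_def)
    then show ?thesis using serre_mem(2)[OF serre_e(2)] relation_ideal_lmult by simp
  next
    case (serre_f i j)
    have "th r = const ((- 1) ^ Suc (nat (1 - a i j))) * serre Gen_e i j"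
      unfolding serre_f(1) serre_gen[OF serre_f(2)] fa.sc_def th_simps th_adq th_letter th_gen.simps adq_sign
      by (simp add: mult.commute[of "inverse _"] divide_inverse flip: fa.sc_def)
    then show ?thesis using serre_mem(1)[OF serre_f(2)] relation_ideal_lmult by simp
  qed
qed (simp_all add: relation_ideal_add relation_ideal_lmult relation_ideal_rmult)

lemma theta_proj: "theta (proj x) = proj (th x)"
proof -
  have cong: "proj (th x) = proj (th y)" if "x \<approx> y" for x y
    using th_relation_ideal[of "x - y"] that by (simp add: ueq_def proj_eq_iff)
  have "theta = descend (\<lambda>x. proj (th x))"
    unfolding theta_def
    by (rule the_Uq_hom[OF ring_Uq cong])
      (auto simp: descend_proj[of "\<lambda>x. proj (th x)", OF cong] scalar_proj Ugen_proj proj_mult proj_add proj_1 proj_uminus)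
  then show ?thesis using descend_proj[of "\<lambda>x. proj (th x)", OF cong] by simp
qed

section \<open>The antipode\<close>

definition falg_rev :: "'g falg \<Rightarrow> 'g falg" where
  "falg_rev = app (linext (\<lambda>w. word (rev w)))"

lemma falg_rev_simps [simp]: "falg_rev (x + y) = falg_rev x + falg_rev y" "falg_rev (x - y) = falg_rev x - falg_rev y"
  "falg_rev (word w) = word (rev w)" "falg_rev (const c * x) = const c * falg_rev x"
  by (simp_all add: falg_rev_def)

lemma falg_rev_mult [simp]: "falg_rev (x * y) = falg_rev y * falg_rev x" for x :: "'g falg"
proof (induction x rule: falg_induct)
  case (word w)
  show ?case
  proof (induction y rule: falg_induct)
    case (word u)
    show ?case by (simp flip: word_append)
  next
    case (scale c y)
    have "falg_rev (word w * (const c * y)) = const c * falg_rev (word w * y)" by (simp add: const_left_commute[of "word w"])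
    then show ?case using scale by (simp add: mult.assoc)
  qed (simp add: distrib_left distrib_right)
next
  case (scale c x)
  then show ?case by (simp add: mult.assoc const_left_commute[of "falg_rev y"])
qed (simp add: distrib_left distrib_right)

lemma falg_rev_const [simp]: "falg_rev 1 = 1" "falg_rev 0 = 0" "falg_rev (const c) = const c"
proof -
  show 1: "falg_rev 1 = (1 :: 'g falg)" using falg_rev_simps(3)[of "[]"] by simp
  show "falg_rev 0 = (0 :: 'g falg)" using falg_rev_simps(2)[of 1 "1 :: 'g falg"] by simp
  show "falg_rev (const c) = (const c :: 'g falg)" using falg_rev_simps(4)[of c "1 :: 'g falg"] unfolding 1 by simp
qed

fun an_gen :: "'i gen \<Rightarrow> 'i free_alg" where
  "an_gen (Gen_e i) = - (word (kword i (- 1)) * word [Gen_e i])"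
| "an_gen (Gen_f i) = - (word [Gen_f i] * word (kword i 1))"
| "an_gen g = word [tinv_gen g]"

text \<open>Reversal followed by evaluation is an antihomomorphism, and the lemmas on
  \<open>fa_ev\<close> still apply to it.\<close>

definition an :: "'i free_alg \<Rightarrow> 'i free_alg" where
  "an x = fa_ev an_gen (falg_rev x)"

lemma an_simps [simp]: "an (x + y) = an x + an y" "an (x - y) = an x - an y" "an (x * y) = an y * an x" "an 0 = 0" "an 1 = 1"
  "an (const c) = const c"
  by (simp_all add: an_def)

lemma an_letter [simp]: "an (word [g]) = an_gen g"
  by (simp add: an_def)

lemma an_sum: "an (sum f A) = (\<Sum>a\<in>A. an (f a))"
  by (induction A rule: infinite_finite_induct) simp_all

lemma an_tword: "tword w \<Longrightarrow> an (word w) = word (tw_inv w)"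
proof (induction w)
  case (Cons g w)
  then show ?case by (auto simp: word_Cons[of g w] tw_inv_def word_append)
qed (simp add: tw_inv_def)

lemma an_kword: "an (word (kword i s)) \<approx> word (kword i (- s))"
  unfolding an_tword[OF tword_kword]
  by (rule tword_eqI) (simp_all add: tword_kword tw_inv texp_kword)

definition kwords :: "int \<Rightarrow> 'i list \<Rightarrow> 'i gen list" where
  "kwords s v = concat (map (\<lambda>i. kword i s) v)"

lemma tword_kwords: "tword (kwords s v)"
  by (induction v) (simp_all add: kwords_def tword_kword)

lemma texp_kwords: "texp (kwords s v) j = s * (\<Sum>i\<leftarrow>v. a j i)"
  by (induction v) (simp_all add: kwords_def texp_kword distrib_left)

lemma ip_wt: "ip (simple_root j) (wt v) = d j * of_int (\<Sum>i\<leftarrow>v. a j i)"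
proof (induction v)
  case (Cons i v)
  have "ip (simple_root j) (simple_root i) = d j * of_int (a j i)" by (simp add: ip_simple_roots d_a_sym[of i])
  then show ?case using Cons by (simp add: ip_simps distrib_left)
qed (simp add: ip_simps)

text \<open>The sum of (\<alpha>_i|\<alpha>_j) over all pairs of positions in the word: the power of
  q that arises when the factors k_i^(-1) or k_i of a product are collected on one side.\<close>

fun inversion_form :: "'i list \<Rightarrow> rat" where
  "inversion_form [] = 0"
| "inversion_form (i # v) = inversion_form v + ip (simple_root i) (wt v)"

text \<open>The right-hand side depends only on the multiset of letters, so the value is common to
  all words of a Serre element.\<close>

lemma inversion_form_eq: "2 * inversion_form v = ip (wt v) (wt v) - (\<Sum>i\<leftarrow>v. 2 * d i)"
proof (induction v)
  case (Cons i v)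
  then show ?case by (simp add: ip_simps ip_simple_self ip_sym[of "wt v" "simple_root i"])
qed (simp add: ip_simps)

lemma kwords_commute:
  assumes "x = Gen_e j \<and> s = 1 \<or> x = Gen_f j \<and> s = -1"
  shows "word (kwords m v) * word [x] \<approx> const (qpow (s * of_int m * ip (simple_root j) (wt v))) * (word [x] * word (kwords m v))"
proof -
  have "s * d j * of_int (texp (kwords m v) j) = s * of_int m * ip (simple_root j) (wt v)"
    by (simp add: texp_kwords ip_wt)
  then show ?thesis using tword_commute[OF tword_kwords[of m v] assms] by (simp only:)
qed

lemma kword_commute_fwords:
  "word (kword i 1) * word (map Gen_f v) \<approx> const (qpow (- ip (simple_root i) (wt v))) * (word (map Gen_f v) * word (kword i 1))"
proof (induction v)
  case Nil
  show ?case by (simp add: fa.cst_1)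
next
  case (Cons k v)
  have "word (kword i 1) * word (map Gen_f (k # v)) = word (kword i 1) * word [Gen_f k] * word (map Gen_f v)"
    by (simp add: word_Cons[of "Gen_f k" "map Gen_f v"] mult.assoc)
  also have "\<dots> \<approx> const (qpow (- ip (simple_root i) (simple_root k))) * (word [Gen_f k] * word (kword i 1)) * word (map Gen_f v)"
    using kword_commute[of "Gen_f k" k "-1" i 1] by (intro ueq_rmult) simp
  also have "\<dots> = const (qpow (- ip (simple_root i) (simple_root k))) * (word [Gen_f k] * (word (kword i 1) * word (map Gen_f v)))"
    by (simp add: mult.assoc)
  also have "\<dots> \<approx> const (qpow (- ip (simple_root i) (simple_root k))) * (word [Gen_f k] *
      (const (qpow (- ip (simple_root i) (wt v))) * (word (map Gen_f v) * word (kword i 1))))"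
    by (intro ueq_lmult Cons.IH)
  also have "\<dots> = const (qpow (- ip (simple_root i) (wt (k # v)))) * (word (map Gen_f (k # v)) * word (kword i 1))"
    by (simp add: word_Cons[of "Gen_f k" "map Gen_f v"] mult.assoc ip_simps qpow_diff qpow_minus divide_inverse mult.commute[of "inverse _" "inverse _"] flip: fa.sc_def)
  finally show ?case .
qed

lemma prod_ke:
  "prod_list (map (\<lambda>i. word (kword i (- 1)) * word [Gen_e i]) v)
    \<approx> const (qpow (inversion_form v)) * (word (kwords (- 1) v) * word (map Gen_e v))"
proof (induction v)
  case Nil
  show ?case by (simp add: kwords_def fa.cst_1)
next
  case (Cons i v)
  have pass: "word [Gen_e i] * word (kwords (- 1) v) \<approx> const (qpow (ip (simple_root i) (wt v))) * (word (kwords (- 1) v) * word [Gen_e i])"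
    using ueq_sym[OF ueq_lmult[OF kwords_commute[of "Gen_e i" i 1 "- 1" v], of "const (qpow (ip (simple_root i) (wt v)))"]]
    by (simp flip: fa.sc_def)
  have "prod_list (map (\<lambda>i. word (kword i (- 1)) * word [Gen_e i]) (i # v))
    \<approx> word (kword i (- 1)) * word [Gen_e i] * (const (qpow (inversion_form v)) * (word (kwords (- 1) v) * word (map Gen_e v)))"
    using Cons.IH by (simp add: ueq_lmult)
  also have "\<dots> = const (qpow (inversion_form v)) * (word (kword i (- 1)) * (word [Gen_e i] * word (kwords (- 1) v)) * word (map Gen_e v))"
    by (simp add: mult.assoc flip: fa.sc_def)
  also have "\<dots> \<approx> const (qpow (inversion_form v)) * (word (kword i (- 1)) *
      (const (qpow (ip (simple_root i) (wt v))) * (word (kwords (- 1) v) * word [Gen_e i])) * word (map Gen_e v))"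
    by (intro ueq_lmult ueq_rmult pass)
  also have "\<dots> = const (qpow (inversion_form (i # v))) * (word (kwords (- 1) (i # v)) * word (map Gen_e (i # v)))"
    by (simp add: kwords_def word_append word_Cons[of "Gen_e i" "map Gen_e v"] mult.assoc qpow_add mult.commute[of "qpow _" "qpow _"] flip: fa.sc_def)
  finally show ?case .
qed

lemma prod_fk:
  "prod_list (map (\<lambda>i. word [Gen_f i] * word (kword i 1)) v)
    \<approx> const (qpow (- inversion_form v)) * (word (map Gen_f v) * word (kwords 1 v))"
proof (induction v)
  case Nil
  show ?case by (simp add: kwords_def fa.cst_1)
next
  case (Cons i v)
  have "prod_list (map (\<lambda>i. word [Gen_f i] * word (kword i 1)) (i # v))
    \<approx> word [Gen_f i] * word (kword i 1) * (const (qpow (- inversion_form v)) * (word (map Gen_f v) * word (kwords 1 v)))"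
    using Cons.IH by (simp add: ueq_lmult)
  also have "\<dots> = const (qpow (- inversion_form v)) * (word [Gen_f i] * (word (kword i 1) * word (map Gen_f v)) * word (kwords 1 v))"
    by (simp add: mult.assoc flip: fa.sc_def)
  also have "\<dots> \<approx> const (qpow (- inversion_form v)) * (word [Gen_f i] *
     (const (qpow (- ip (simple_root i) (wt v))) * (word (map Gen_f v) * word (kword i 1))) * word (kwords 1 v))"
    by (intro ueq_lmult ueq_rmult kword_commute_fwords)
  also have "\<dots> = const (qpow (- inversion_form (i # v))) * (word (map Gen_f (i # v)) * word (kwords 1 (i # v)))"
    by (simp add: kwords_def word_append word_Cons[of "Gen_f i" "map Gen_f v"] mult.assoc qpow_minus qpow_diff divide_inverse mult.commute[of "inverse _" "inverse _"] flip: fa.sc_def)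
  finally show ?case .
qed

lemma prod_list_uminus: "prod_list (map (\<lambda>i. - f i) v) = const ((- 1) ^ length v) * prod_list (map f v)"
  for f :: "'a \<Rightarrow> 'g falg"
  by (induction v) (simp_all add: fa.cst_1 const_uminus mult.assoc const_left_commute[of "f _"])

lemma an_e_word: "an (word (map Gen_e v))
    \<approx> const ((- 1) ^ length v * qpow (inversion_form (rev v))) * (word (kwords (- 1) (rev v)) * word (map Gen_e (rev v)))"
proof -
  have "an (word (map Gen_e v)) = const ((- 1) ^ length v) * prod_list (map (\<lambda>i. word (kword i (- 1)) * word [Gen_e i]) (rev v))"
    using prod_list_uminus[of "\<lambda>i. word (kword i (- 1)) * word [Gen_e i]" "rev v"]
    by (simp add: an_def rev_map o_def)
  also have "\<dots> \<approx> const ((- 1) ^ length v) * (const (qpow (inversion_form (rev v))) * (word (kwords (- 1) (rev v)) * word (map Gen_e (rev v))))"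
    by (intro ueq_lmult prod_ke)
  finally show ?thesis by (simp add: fa.cst_mult mult.assoc)
qed

lemma an_f_word: "an (word (map Gen_f v))
    \<approx> const ((- 1) ^ length v * qpow (- inversion_form (rev v))) * (word (map Gen_f (rev v)) * word (kwords 1 (rev v)))"
proof -
  have "an (word (map Gen_f v)) = const ((- 1) ^ length v) * prod_list (map (\<lambda>i. word [Gen_f i] * word (kword i 1)) (rev v))"
    using prod_list_uminus[of "\<lambda>i. word [Gen_f i] * word (kword i 1)" "rev v"]
    by (simp add: an_def rev_map o_def)
  also have "\<dots> \<approx> const ((- 1) ^ length v) * (const (qpow (- inversion_form (rev v))) * (word (map Gen_f (rev v)) * word (kwords 1 (rev v))))"
    by (intro ueq_lmult prod_fk)
  finally show ?thesis by (simp add: fa.cst_mult mult.assoc)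
qed

definition serre_word :: "'i \<Rightarrow> 'i \<Rightarrow> nat \<Rightarrow> 'i list" where
  "serre_word i j m = replicate m i @ [j] @ replicate (nat (1 - a i j) - m) i"

definition serre_coeff :: "'i \<Rightarrow> 'i \<Rightarrow> nat \<Rightarrow> qfield" where
  "serre_coeff i j m = (- 1) ^ m / (q_fact i m * q_fact i (nat (1 - a i j) - m))"

lemma serre_words: "serre X i j = (\<Sum>m = 0..nat (1 - a i j). const (serre_coeff i j m) * word (map X (serre_word i j m)))"
  unfolding serre_def Let_def
  by (rule sum.cong) (simp_all add: free_const_const free_gen_word serre_word_def serre_coeff_def word_append word_replicate
      word_Cons[of "X j" "replicate _ _"] mult.assoc)

lemma serre_coeff_symmetric:
  assumes "m \<le> nat (1 - a i j)"
  shows "serre_coeff i j m = (- 1) ^ nat (1 - a i j) * serre_coeff i j (nat (1 - a i j) - m)"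
proof -
  define n k where "n = nat (1 - a i j)" and "k = n - m"
  then have n: "n = m + k" using assms by simp
  have "(- 1 :: qfield) ^ (m + k) * (- 1) ^ k = (- 1) ^ m * ((- 1) ^ k * (- 1) ^ k)"
    by (simp add: power_add)
  also have "\<dots> = (- 1) ^ m" by (simp flip: power_mult_distrib)
  finally show ?thesis using n by (simp add: serre_coeff_def mult.commute flip: n_def)
qed

text \<open>The antipode reverses each word of the Serre element and adds torus factors. Collected
  on one side, these contribute a torus element and a power of q that depend only on the multiset of
  letters. The reversed words are again Serre words, with m replaced by n - m, and the coefficients
  are symmetric up to (-1)^n; so an invertible multiple of the same Serre element results.\<close>

lemma an_serre:
  assumes ij: "i \<noteq> j"
  shows "an (serre Gen_e i j) \<in> relation_ideal" and "an (serre Gen_f i j) \<in> relation_ideal"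
proof -
  define n where "n = nat (1 - a i j)"
  have rev: "rev (serre_word i j m) = serre_word i j (n - m)" if "m \<le> n" for m
    using that by (simp add: serre_word_def n_def)
  have len: "length (serre_word i j m) = Suc n" if "m \<le> n" for m using that by (simp add: serre_word_def n_def)
  have sums: "(\<Sum>k\<leftarrow>serre_word i j m. f k) = of_nat n * f i + f j" if "m \<le> n" for m and f :: "'i \<Rightarrow> 'b::comm_ring_1"
  proof -
    have "(\<Sum>k\<leftarrow>serre_word i j m. f k) = of_nat m * f i + f j + of_nat (n - m) * f i"
      by (simp add: serre_word_def n_def sum_list_replicate)
    also have "\<dots> = of_nat (m + (n - m)) * f i + f j" by (simp only: of_nat_add algebra_simps)
    finally show ?thesis using that by simp
  qed
  have wts: "wt (serre_word i j m) = of_nat n *s simple_root i + simple_root j" if "m \<le> n" for m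
  proof -
    have "wt (replicate k i) = of_nat k *s simple_root i" for k
      by (induction k) (simp_all add: vec.scale_left_distrib add.commute)
    then have "wt (serre_word i j m) = of_nat m *s simple_root i + simple_root j + of_nat (n - m) *s simple_root i"
      by (simp add: serre_word_def n_def)
    also have "\<dots> = of_nat (m + (n - m)) *s simple_root i + simple_root j"
      by (simp only: of_nat_add vec.scale_left_distrib add.commute add.left_commute)
    finally show ?thesis using that by simp
  qed
  obtain Q where Q: "\<And>m. m \<le> n \<Longrightarrow> inversion_form (serre_word i j m) = Q"
  proof
    fix m assume "m \<le> n"
    then have "2 * inversion_form (serre_word i j m) = 2 * inversion_form (serre_word i j 0)"
      unfolding inversion_form_eq using wts[of m] wts[of 0] sums[of m "\<lambda>k. 2 * d k"] sums[of 0 "\<lambda>k. 2 * d k"] by simp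
    then show "inversion_form (serre_word i j m) = inversion_form (serre_word i j 0)" by simp
  qed
  have K: "word (kwords s (serre_word i j m)) \<approx> word (kwords s (serre_word i j 0))" if "m \<le> n" for s m
  proof (rule tword_eqI)
    fix k
    show "texp (kwords s (serre_word i j m)) k = texp (kwords s (serre_word i j 0)) k"
      unfolding texp_kwords using sums[OF that, of "\<lambda>l. a k l"] sums[of 0 "\<lambda>l. a k l"] by simp
  qed (simp_all add: tword_kwords)
  have reindex: "(\<Sum>m = 0..n. const ((- 1) ^ n * serre_coeff i j (n - m)) * word (map X (serre_word i j (n - m))))
    = const ((- 1) ^ n) * serre X i j" for X :: "'i \<Rightarrow> 'i gen"
    unfolding serre_words n_def[symmetric] sum_distrib_left
    by (subst sum.atLeastAtMost_rev) (simp add: fa.cst_mult mult.assoc)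
  have co: "serre_coeff i j m = (- 1) ^ n * serre_coeff i j (n - m)" if "m \<le> n" for m
    using serre_coeff_symmetric[of m i j] that unfolding n_def .
  have "an (serre Gen_e i j) = (\<Sum>m = 0..n. const (serre_coeff i j m) * an (word (map Gen_e (serre_word i j m))))"
    unfolding serre_words by (simp add: an_sum n_def fa.cst_central[of _ "an _"])
  also have "\<dots> \<approx> (\<Sum>m = 0..n. const ((- 1) ^ Suc n * qpow Q) * (word (kwords (- 1) (serre_word i j 0)) *
      (const ((- 1) ^ n * serre_coeff i j (n - m)) * word (map Gen_e (serre_word i j (n - m))))))"
  proof (rule ueq_sum)
    fix m assume "m \<in> {0..n}"
    then have m: "m \<le> n" by simp
    have "const (serre_coeff i j m) * an (word (map Gen_e (serre_word i j m)))
      \<approx> const (serre_coeff i j m) * (const ((- 1) ^ Suc n * qpow Q) * (word (kwords (- 1) (serre_word i j (n - m))) * word (map Gen_e (serre_word i j (n - m)))))"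
      using an_e_word[of "serre_word i j m"] m Q[of "n - m"] by (intro ueq_lmult) (simp add: rev len)
    also have "\<dots> \<approx> const (serre_coeff i j m) * (const ((- 1) ^ Suc n * qpow Q) * (word (kwords (- 1) (serre_word i j 0)) * word (map Gen_e (serre_word i j (n - m)))))"
      by (intro ueq_lmult ueq_rmult K) simp
    also have "\<dots> = const ((- 1) ^ Suc n * qpow Q) * (word (kwords (- 1) (serre_word i j 0)) *
      (const ((- 1) ^ n * serre_coeff i j (n - m)) * word (map Gen_e (serre_word i j (n - m)))))"
      unfolding co[OF m, symmetric] by (simp add: mult.commute[of "serre_coeff _ _ _"] flip: fa.sc_def)
    finally show "const (serre_coeff i j m) * an (word (map Gen_e (serre_word i j m))) \<approx> \<dots>" .
  qed
  also have "\<dots> = const ((- 1) ^ Suc n * qpow Q) * (word (kwords (- 1) (serre_word i j 0)) * (const ((- 1) ^ n) * serre Gen_e i j))"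
    unfolding reindex[symmetric] sum_distrib_left ..
  finally show "an (serre Gen_e i j) \<in> relation_ideal"
    using serre_mem(1)[OF ij] by (simp add: ueq_mem relation_ideal_lmult)
  have "an (serre Gen_f i j) = (\<Sum>m = 0..n. const (serre_coeff i j m) * an (word (map Gen_f (serre_word i j m))))"
    unfolding serre_words by (simp add: an_sum n_def fa.cst_central[of _ "an _"])
  also have "\<dots> \<approx> (\<Sum>m = 0..n. const ((- 1) ^ Suc n * qpow (- Q)) * ((const ((- 1) ^ n * serre_coeff i j (n - m)) *
      word (map Gen_f (serre_word i j (n - m)))) * word (kwords 1 (serre_word i j 0))))"
  proof (rule ueq_sum)
    fix m assume "m \<in> {0..n}"
    then have m: "m \<le> n" by simp
    have "const (serre_coeff i j m) * an (word (map Gen_f (serre_word i j m)))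
      \<approx> const (serre_coeff i j m) * (const ((- 1) ^ Suc n * qpow (- Q)) * (word (map Gen_f (serre_word i j (n - m))) * word (kwords 1 (serre_word i j (n - m)))))"
      using an_f_word[of "serre_word i j m"] m Q[of "n - m"] by (intro ueq_lmult) (simp add: rev len)
    also have "\<dots> \<approx> const (serre_coeff i j m) * (const ((- 1) ^ Suc n * qpow (- Q)) * (word (map Gen_f (serre_word i j (n - m))) * word (kwords 1 (serre_word i j 0))))"
      by (intro ueq_lmult ueq_rmult K) simp
    also have "\<dots> = const ((- 1) ^ Suc n * qpow (- Q)) * ((const ((- 1) ^ n * serre_coeff i j (n - m)) *
      word (map Gen_f (serre_word i j (n - m)))) * word (kwords 1 (serre_word i j 0)))"
      unfolding co[OF m, symmetric] by (simp add: mult.assoc mult.commute[of "serre_coeff _ _ _"] flip: fa.sc_def)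
    finally show "const (serre_coeff i j m) * an (word (map Gen_f (serre_word i j m))) \<approx> \<dots>" .
  qed
  also have "\<dots> = const ((- 1) ^ Suc n * qpow (- Q)) * ((const ((- 1) ^ n) * serre Gen_f i j) * word (kwords 1 (serre_word i j 0)))"
    unfolding reindex[symmetric] sum_distrib_left sum_distrib_right ..
  finally show "an (serre Gen_f i j) \<in> relation_ideal"
    using serre_mem(2)[OF ij] by (simp add: ueq_mem relation_ideal_lmult relation_ideal_rmult)
qed

end

lemma ring_opposite_ring:
  assumes "ring R"
  shows "ring (opposite_ring R)"
proof -
  interpret ring R by fact
  show ?thesis
  proof (rule ringI)
    show "abelian_group (opposite_ring R)"
      by (rule abelian_groupI) (auto simp: opposite_ring_def a_ac intro: bexI[of _ "a_inv R _"] l_neg)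
    show "monoid (opposite_ring R)"
      by (rule monoidI) (auto simp: opposite_ring_def m_assoc)
  qed (auto simp: opposite_ring_def l_distr r_distr)
qed

context finite_cartan_datum
begin

lemma t_conjugate:
  assumes "x = Gen_e j \<and> s = 1 \<or> x = Gen_f j \<and> s = -1"
  shows "word [Gen_t i] * word [x] * word [Gen_tinv i] \<approx> const (qpow (s * (if i = j then d j else 0))) * word [x]"
proof -
  have "word [Gen_t i] * word [x] * word [Gen_tinv i] \<approx>
    const (qpow (s * d j * of_int (texp_gen (Gen_t i) j))) * (word [x] * word [Gen_t i]) * word [Gen_tinv i]"
    using assms by (intro ueq_rmult t_e_commute) simp_all
  also have "\<dots> = const (qpow (s * d j * of_int (texp_gen (Gen_t i) j))) * (word [x] * (word [Gen_t i] * word [Gen_tinv i]))"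
    by (simp add: mult.assoc)
  also have "\<dots> \<approx> const (qpow (s * d j * of_int (texp_gen (Gen_t i) j))) * (word [x] * 1)"
    using t_letters_inverse[of "Gen_t i"] by (intro ueq_lmult) simp
  finally show ?thesis by (cases "i = j") simp_all
qed

text \<open>Moving k_i^(-1) past f_j and k_j past e_i costs mutually inverse powers of q. So the
  image of the commutator is minus the commutator between k_i^(-1) and k_j, and for i = j these two
  factors cancel around the torus side.\<close>

lemma an_e_f_relation:
  "an (word [Gen_e i] * word [Gen_f j] - word [Gen_f j] * word [Gen_e i]
    - (if i = j then const (qstep i) * (word (kword i 1) - word (kword i (- 1))) else 0)) \<in> relation_ideal"
proof -
  let ?k = "word (kword i (- 1))" and ?l = "word (kword j 1)" and ?e = "word [Gen_e i]" and ?f = "word [Gen_f j]"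
  let ?r = "if i = j then const (qstep i) * (word (kword i 1) - word (kword i (- 1))) else 0"
  have ip: "- 1 * of_int (- 1) * ip (simple_root i) (simple_root j) = ip (simple_root i) (simple_root j)" by simp
  have "?f * ?k = const (qpow (- ip (simple_root i) (simple_root j))) *
      (const (qpow (- 1 * of_int (- 1) * ip (simple_root i) (simple_root j))) * (?f * ?k))"
    unfolding ip by (simp add: qpow_minus flip: fa.sc_def)
  also have "\<dots> \<approx> const (qpow (- ip (simple_root i) (simple_root j))) * (?k * ?f)"
    by (rule ueq_lmult, rule ueq_sym, rule kword_commute) simp
  finally have fk: "?f * ?k \<approx> const (qpow (- ip (simple_root i) (simple_root j))) * (?k * ?f)" .
  have le: "?l * ?e \<approx> const (qpow (ip (simple_root i) (simple_root j))) * (?e * ?l)"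
    using kword_commute[of "Gen_e i" i 1 j 1] by (simp add: ip_sym)
  have lk: "?l * ?k \<approx> ?k * ?l"
    using tword_eqI[of "kword j 1 @ kword i (- 1)" "kword i (- 1) @ kword j 1"]
    by (simp add: tword_kword word_append)
  have "?f * ?l * (?k * ?e) = ?f * (?l * ?k) * ?e" by (simp add: mult.assoc)
  also have "\<dots> \<approx> ?f * (?k * ?l) * ?e" by (intro ueq_lmult ueq_rmult lk)
  also have "\<dots> = (?f * ?k) * (?l * ?e)" by (simp add: mult.assoc)
  also have "\<dots> \<approx> (const (qpow (- ip (simple_root i) (simple_root j))) * (?k * ?f)) *
      (const (qpow (ip (simple_root i) (simple_root j))) * (?e * ?l))"
    by (intro ueq_mult fk le)
  also have "\<dots> = ?k * (?f * ?e) * ?l"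
    by (simp add: mult.assoc qpow_minus flip: fa.sc_def)
  finally have 1: "?f * ?l * (?k * ?e) \<approx> ?k * (?f * ?e) * ?l" .
  have "?f * ?l * (?k * ?e) - ?k * ?e * (?f * ?l) \<approx> ?k * (?f * ?e) * ?l - ?k * ?e * (?f * ?l)"
    by (intro ueq_diff 1 ueq_refl)
  also have "\<dots> = - (?k * (?e * ?f - ?f * ?e) * ?l)" by (simp add: algebra_simps)
  also have "\<dots> \<approx> - (?k * ?r * ?l)"
    using ueq_diff[OF e_f_commute[of i j] ueq_refl[of "?f * ?e"]] by (intro ueq_uminus ueq_lmult ueq_rmult) simp
  also have "\<dots> \<approx> - ?r"
  proof (cases "i = j")
    case True
    have "?k * ?r * ?l = const (qstep i) * ((?k * word (kword i 1)) * ?l - ?k * (?k * ?l))"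
      using True by (simp add: algebra_simps flip: fa.sc_def)
    also have "\<dots> \<approx> const (qstep i) * (1 * ?l - ?k * 1)"
      using True kword_inverse by (intro ueq_lmult ueq_diff ueq_rmult) simp_all
    also have "\<dots> = ?r" using True by simp
    finally show ?thesis by (rule ueq_uminus)
  qed simp
  finally have 2: "?f * ?l * (?k * ?e) - ?k * ?e * (?f * ?l) \<approx> - ?r" .
  have 3: "an ?r \<approx> - ?r"
  proof (cases "i = j")
    case True
    have "an ?r = const (qstep i) * (an (word (kword i 1)) - an (word (kword i (- 1))))"
      using True by (simp add: fa.cst_central)
    also have "\<dots> \<approx> const (qstep i) * (word (kword i (- 1)) - word (kword i (- (- 1))))"
      by (intro ueq_lmult ueq_diff an_kword)
    also have "\<dots> = - ?r" using True by (simp add: algebra_simps)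
    finally show ?thesis .
  qed simp
  show ?thesis using ueq_diff[OF 2 3] by (simp add: ueq_def)
qed

lemma an_relation_ideal: "x \<in> relation_ideal \<Longrightarrow> an x \<in> relation_ideal"
proof (induction rule: relation_ideal_induct)
  case (relation r)
  then show ?case
  proof cases
    case (t_tinv i)
    then show ?thesis using t_letters_inverse[of "Gen_t i"] by (simp add: free_gen_word ueq_def)
  next
    case (tinv_t i)
    then show ?thesis using t_letters_inverse[of "Gen_tinv i"] by (simp add: free_gen_word ueq_def)
  next
    case (t_t i j)
    then show ?thesis using t_t_commute[of "Gen_tinv j" "Gen_tinv i"] by (simp add: free_gen_word ueq_def)
  next
    case (t_e i j)
    let ?c = "const (qpow (if i = j then d i else 0))" and ?k = "word (kword j (- 1))"
    have "word [Gen_t i] * (?k * word [Gen_e j]) * word [Gen_tinv i]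
      = (word [Gen_t i] * ?k) * word [Gen_e j] * word [Gen_tinv i]" by (simp add: mult.assoc)
    also have "\<dots> \<approx> (?k * word [Gen_t i]) * word [Gen_e j] * word [Gen_tinv i]"
      by (intro ueq_rmult t_tword_commute tword_kword) simp
    also have "\<dots> = ?k * (word [Gen_t i] * word [Gen_e j] * word [Gen_tinv i])" by (simp add: mult.assoc)
    also have "\<dots> \<approx> ?k * (?c * word [Gen_e j])"
      using t_conjugate[of "Gen_e j" j 1 i] by (intro ueq_lmult) (simp split: if_splits)
    also have "\<dots> = ?k * word [Gen_e j] * ?c" by (simp add: mult.assoc fa.cst_central)
    finally show ?thesis
      using relation_ideal_uminus by (auto simp: t_e free_gen_word free_const_const ueq_def mult.assoc dest: relation_ideal_uminus)
  next
    case (t_f i j)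
    let ?c = "const (qpow (if i = j then - d i else 0))" and ?k = "word (kword j 1)"
    have "word [Gen_t i] * (word [Gen_f j] * ?k) * word [Gen_tinv i]
      = word [Gen_t i] * word [Gen_f j] * (?k * word [Gen_tinv i])" by (simp add: mult.assoc)
    also have "\<dots> \<approx> word [Gen_t i] * word [Gen_f j] * (word [Gen_tinv i] * ?k)"
      by (rule ueq_lmult, rule ueq_sym, rule t_tword_commute[OF _ tword_kword]) simp
    also have "\<dots> = (word [Gen_t i] * word [Gen_f j] * word [Gen_tinv i]) * ?k" by (simp add: mult.assoc)
    also have "\<dots> \<approx> (?c * word [Gen_f j]) * ?k"
      using t_conjugate[of "Gen_f j" j "-1" i] by (intro ueq_rmult) (simp split: if_splits)
    also have "\<dots> = word [Gen_f j] * ?k * ?c" by (simp add: mult.assoc fa.cst_central)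
    finally show ?thesis
      using relation_ideal_uminus by (auto simp: t_f free_gen_word free_const_const ueq_def mult.assoc dest: relation_ideal_uminus)
  next
    case (e_f i j)
    then show ?thesis using an_e_f_relation[of i j]
      by (simp only: free_gen_word free_const_const k_power_word qstep_def)
  next
    case (serre_e i j)
    then show ?thesis using an_serre(1) by simp
  next
    case (serre_f i j)
    then show ?thesis using an_serre(2) by simp
  qed
qed (simp_all add: relation_ideal_add relation_ideal_lmult relation_ideal_rmult)

lemma antipode_proj: "antipode (proj x) = proj (an x)"
proof -
  have cong: "proj (an x) = proj (an y)" if "x \<approx> y" for x y
    using an_relation_ideal[of "x - y"] that by (simp add: ueq_def proj_eq_iff)
  have k: "Uk i = proj (word (kword i 1))" "Ukinv i = proj (word (kword i (- 1)))" for i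
    by (simp_all add: Uk_def Ukinv_def k_power_word)
  have "antipode = descend (\<lambda>x. proj (an x))"
    unfolding antipode_def
    by (rule the_Uq_hom[OF ring_opposite_ring[OF ring_Uq] cong])
      (auto simp: descend_proj[of "\<lambda>x. proj (an x)", OF cong] scalar_proj Ugen_proj proj_mult proj_add proj_1 proj_uminus
        opposite_ring_def k)
  then show ?thesis using descend_proj[of "\<lambda>x. proj (an x)", OF cong] by simp
qed

lemma omega_proj: "omega (proj x) = proj (an (th x))"
  by (simp add: omega_def theta_proj antipode_proj)

section \<open>The subalgebras U^-, U^+, U^0 and the characters of U^0\<close>

lemma subalgebra_gen_letters:
  "subalgebra_gen (range (\<lambda>b. proj (word [X b]))) = range (\<lambda>z. proj (fa_ev (\<lambda>b. word [X b]) z))"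
    (is "?L = ?R")
proof
  show "?L \<subseteq> ?R"
  proof
    fix x assume "x \<in> ?L"
    then show "x \<in> ?R" unfolding subalgebra_gen_def
    proof (induction rule: generate_ring.induct)
      case one
      show ?case by (rule range_eqI[of _ _ 1]) (simp add: proj_1)
    next
      case (incl h)
      then show ?case
      proof
        assume "h \<in> range scalar"
        then obtain c where "h = scalar c" by auto
        then show ?thesis by (intro range_eqI[of _ _ "const c"]) (simp add: scalar_proj)
      next
        assume "h \<in> range (\<lambda>b. proj (word [X b]))"
        then obtain b where "h = proj (word [X b])" by auto
        then show ?thesis by (intro range_eqI[of _ _ "word [b]"]) simp
      qed
    next
      case (a_inv h)
      then obtain z where "h = proj (fa_ev (\<lambda>b. word [X b]) z)" by auto
      then show ?case by (intro range_eqI[of _ _ "- z"]) (simp add: proj_uminus)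
    next
      case (eng_add h h')
      then obtain z z' where "h = proj (fa_ev (\<lambda>b. word [X b]) z)" "h' = proj (fa_ev (\<lambda>b. word [X b]) z')" by auto
      then show ?case by (intro range_eqI[of _ _ "z + z'"]) (simp add: proj_add)
    next
      case (eng_mult h h')
      then obtain z z' where "h = proj (fa_ev (\<lambda>b. word [X b]) z)" "h' = proj (fa_ev (\<lambda>b. word [X b]) z')" by auto
      then show ?case by (intro range_eqI[of _ _ "z * z'"]) (simp add: proj_mult)
    qed
  qed
  have const: "proj (const c) \<in> ?L" for c
    unfolding subalgebra_gen_def by (rule generate_ring.incl) (auto simp: scalar_proj)
  have "proj (fa_ev (\<lambda>b. word [X b]) z) \<in> ?L" for z
  proof (induction z rule: falg_induct)
    case (word w)
    show ?case
    proof (induction w)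
      case Nil
      show ?case using const[of 1] by (simp add: fa.cst_1)
    next
      case (Cons b w)
      have "proj (word [X b]) \<in> ?L" unfolding subalgebra_gen_def by (rule generate_ring.incl) auto
      from generate_ring.eng_mult[OF this[unfolded subalgebra_gen_def] Cons[unfolded subalgebra_gen_def]]
      show ?case by (simp add: subalgebra_gen_def proj_mult)
    qed
  next
    case (scale c z)
    from generate_ring.eng_mult[OF const[of c, unfolded subalgebra_gen_def] scale[unfolded subalgebra_gen_def]]
    show ?case by (simp add: subalgebra_gen_def proj_mult)
  next
    case (add y z)
    from generate_ring.eng_add[OF add[unfolded subalgebra_gen_def]]
    show ?case by (simp add: subalgebra_gen_def proj_add)
  qed
  then show "?R \<subseteq> ?L" by auto
qed

lemma U_minus_eq: "U_minus = range (\<lambda>z. proj (inf_alg z))"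
  unfolding U_minus_def inf_alg_def Ugen_proj by (rule subalgebra_gen_letters)

lemma U_plus_eq: "U_plus = range (\<lambda>z. proj (ine_alg z))"
  unfolding U_plus_def ine_alg_def Ugen_proj by (rule subalgebra_gen_letters)

definition t_letter :: "'i \<times> bool \<Rightarrow> 'i gen" where
  "t_letter = (\<lambda>(i, b). if b then Gen_t i else Gen_tinv i)"

definition int_alg :: "('i \<times> bool) falg \<Rightarrow> 'i free_alg" where "int_alg = fa_ev (\<lambda>b. word [t_letter b])"

lemma int_alg_simps [simp]:
  "int_alg (x + y) = int_alg x + int_alg y" "int_alg (x - y) = int_alg x - int_alg y" "int_alg (x * y) = int_alg x * int_alg y"
  "int_alg 0 = 0" "int_alg 1 = 1" "int_alg (const c) = const c" "int_alg (word w) = word (map t_letter w)"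
  by (simp_all add: int_alg_def prod_list_letters)

lemma U_zero_eq: "U_zero = range (\<lambda>z. proj (int_alg z))"
proof -
  have t: "Ut i = proj (word [t_letter (i, True)])" "Utinv i = proj (word [t_letter (i, False)])" for i
    by (simp_all add: Ugen_proj t_letter_def)
  have "range Ut \<union> range Utinv = range (\<lambda>b. proj (word [t_letter b]))"
  proof (intro equalityI subsetI)
    fix x assume "x \<in> range (\<lambda>b. proj (word [t_letter b]))"
    then obtain i s where "x = proj (word [t_letter (i, s)])" by auto
    then show "x \<in> range Ut \<union> range Utinv" by (cases s) (simp_all flip: t)
  qed (auto simp: t)
  then show ?thesis unfolding U_zero_def int_alg_def by (simp add: subalgebra_gen_letters)
qed

lemma tword_iff: "tword w \<longleftrightarrow> (\<exists>u. w = map t_letter u)"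
proof
  assume "tword w"
  then show "\<exists>u. w = map t_letter u"
  proof (induction w)
    case (Cons g w)
    then obtain u where u: "w = map t_letter u" by auto
    obtain b where "g = t_letter b"
      using Cons.prems by (auto simp: t_letter_def split: if_splits intro: that[of "(_, True)"] that[of "(_, False)"])
    with u show ?case by (intro exI[of _ "b # u"]) simp
  qed simp
qed (auto simp: tword_def t_letter_def)

lemma vac_const [simp]: "vac (const c) = c"
  using vac_simps(3)[of c 1] by simp

lemma diag_one: "app (diag \<kappa>) 1 = const (\<kappa> 0)"
  using diag_word[of \<kappa> "[]"] by simp

text \<open>The matrix coefficient of x at the highest weight vector of M(\<nu>). It kills U^-_+ U
  and U U^+_+ and therefore computes q^\<nu>((x)_0), see \<open>qchar_proj_zero\<close>.\<close>

definition qv :: "'i weight \<Rightarrow> 'i free_alg \<Rightarrow> qfield" where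
  "qv \<nu> x = vac (app (act \<nu> x) 1)"

lemma qv_simps [simp]: "qv \<nu> (x + y) = qv \<nu> x + qv \<nu> y" "qv \<nu> (x - y) = qv \<nu> x - qv \<nu> y" "qv \<nu> (- x) = - qv \<nu> x"
  "qv \<nu> 0 = 0" "qv \<nu> 1 = 1" "qv \<nu> (const c * x) = c * qv \<nu> x" "qv \<nu> (const c) = c"
  by (simp_all add: qv_def)

lemma qv_cong: "x \<approx> y \<Longrightarrow> qv \<nu> x = qv \<nu> y"
  using act_ueq[of x y \<nu> 1] vac_serre_ideal[of "app (act \<nu> x) 1 - app (act \<nu> y) 1"] by (simp add: qv_def eqv_def)

lemma act_int: "app (act \<nu> (int_alg z)) 1 = const (qv \<nu> (int_alg z))"
proof (induction z rule: falg_induct)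
  case (word w)
  have "tword (map t_letter w)" using tword_iff by auto
  then show ?case
    by (simp add: qv_def act_tword diag_one)
qed (simp_all add: fa.cst_add fa.cst_mult)

lemma qv_mult_int: "qv \<nu> (x * int_alg z) = qv \<nu> x * qv \<nu> (int_alg z)"
proof -
  have "app (act \<nu> (x * int_alg z)) 1 = const (qv \<nu> (int_alg z)) * app (act \<nu> x) 1"
    using app_scale[of "act \<nu> x" "qv \<nu> (int_alg z)" 1] by (simp add: act_int)
  then show ?thesis by (simp add: qv_def mult.commute)
qed

lemma qv_tword: "tword w \<Longrightarrow> qv \<nu> (word w) = qpow (texp_weight w \<nu>)"
  by (simp add: qv_def act_tword diag_one)

text \<open>The existence of the character comes from the Verma module: U^0 acts on its highest
  weight vector by scalars, so \<open>qv \<nu>\<close> is multiplicative on U^0. The values at the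
  t_i determine it, because they determine those at the inverses.\<close>

lemma qchar_int: "qchar \<nu> (proj (int_alg z)) = qv \<nu> (int_alg z)"
proof -
  let ?h = "restrict (descend (qv \<nu>)) U_zero"
  have sub: "U_zero \<subseteq> carrier Uq" by (auto simp: U_zero_eq)
  have h: "?h (proj (int_alg z)) = qv \<nu> (int_alg z)" for z
    using descend_proj[of "qv \<nu>"] qv_cong by (simp add: U_zero_eq)
  have gen: "scalar c = proj (int_alg (const c))" "Ut i = proj (int_alg (word [(i, True)]))"
    "Utinv i = proj (int_alg (word [(i, False)]))" for c i
    by (simp_all add: scalar_proj Ugen_proj t_letter_def)
  have carr [simp]: "proj (int_alg z) \<in> U_zero" for z by (simp add: U_zero_eq)
  have gens_in: "scalar c \<in> U_zero" "Ut i \<in> U_zero" "Utinv i \<in> U_zero" for c i by (simp_all only: gen carr)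
  have ht: "?h (Ut i) = qpow (d i * pairing \<nu> (simple_coweight i))" for i
    unfolding gen h
    by (simp add: t_letter_def qv_tword texp_weight_letter texp_weight_def[of "[]"] pairing_def simple_coweight_def axis_def
        if_distrib[of "\<lambda>x. _ * x"] if_distrib[of of_int] if_distrib[of "\<lambda>x. x * _"] cong: if_cong)
  have hc: "?h (scalar c) = c" for c unfolding gen h by simp
  have "qchar \<nu> = ?h"
    unfolding qchar_def
  proof (rule the_equality)
    have "?h \<in> Ring.ring_hom (Uq\<lparr>carrier := U_zero\<rparr>) univ_ring"
    proof (rule ring_hom_memI)
      fix x y assume "x \<in> carrier (Uq\<lparr>carrier := U_zero\<rparr>)" "y \<in> carrier (Uq\<lparr>carrier := U_zero\<rparr>)"
      then obtain u v where uv: "x = proj (int_alg u)" "y = proj (int_alg v)" by (auto simp: U_zero_eq)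
      show "?h (x \<otimes>\<^bsub>Uq\<lparr>carrier := U_zero\<rparr>\<^esub> y) = ?h x \<otimes>\<^bsub>univ_ring\<^esub> ?h y"
        using h[of "u * v"] h[of u] h[of v] qv_mult_int[of \<nu> "int_alg u" v] unfolding uv by (simp add: proj_mult)
      show "?h (x \<oplus>\<^bsub>Uq\<lparr>carrier := U_zero\<rparr>\<^esub> y) = ?h x \<oplus>\<^bsub>univ_ring\<^esub> ?h y"
        using h[of "u + v"] h[of u] h[of v] unfolding uv by (simp add: proj_add)
    qed (use h[of 1] in \<open>simp_all add: proj_1\<close>)
    then show "?h \<in> extensional U_zero \<and> ?h \<in> Ring.ring_hom (Uq\<lparr>carrier := U_zero\<rparr>) univ_ring \<and>
      (\<forall>c. ?h (scalar c) = c) \<and> (\<forall>i. ?h (Ut i) = qpow (d i * pairing \<nu> (simple_coweight i)))"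
      using ht hc by blast
  next
    fix h' assume h': "h' \<in> extensional U_zero \<and> h' \<in> Ring.ring_hom (Uq\<lparr>carrier := U_zero\<rparr>) univ_ring \<and>
      (\<forall>c. h' (scalar c) = c) \<and> (\<forall>i. h' (Ut i) = qpow (d i * pairing \<nu> (simple_coweight i)))"
    then have hom: "h' \<in> Ring.ring_hom (Uq\<lparr>carrier := U_zero\<rparr>) univ_ring" by blast
    have mult: "h' (proj (int_alg (u * v))) = h' (proj (int_alg u)) * h' (proj (int_alg v))" for u v
      using ring_hom_mult[OF hom, of "proj (int_alg u)" "proj (int_alg v)"] by (simp add: proj_mult)
    have add: "h' (proj (int_alg (u + v))) = h' (proj (int_alg u)) + h' (proj (int_alg v))" for u v
      using ring_hom_add[OF hom, of "proj (int_alg u)" "proj (int_alg v)"] by (simp add: proj_add)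
    have const: "h' (proj (int_alg (const c))) = c" for c
      using h' unfolding gen(1) by blast
    have one: "h' (proj (int_alg 1)) = 1" using const[of 1] by (simp add: fa.cst_1)
    have t: "h' (proj (int_alg (word [(i, True)]))) = qv \<nu> (int_alg (word [(i, True)]))" for i
      unfolding h[symmetric] using ht h' by (simp only: flip: gen)
    have tinv: "h' (proj (int_alg (word [(i, False)]))) = qv \<nu> (int_alg (word [(i, False)]))" for i
    proof -
      have e: "proj (int_alg (word [(i, True)] * word [(i, False)])) = proj (int_alg 1)"
        using t_letters_inverse[of "Gen_t i"] by (simp add: proj_eq_iff t_letter_def)
      have "h' (proj (int_alg (word [(i, True)]))) * h' (proj (int_alg (word [(i, False)]))) = 1"
        unfolding mult[symmetric] e one ..
      moreover have "qv \<nu> (int_alg (word [(i, True)])) * qv \<nu> (int_alg (word [(i, False)])) = 1"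
        using qv_cong[OF e[unfolded proj_eq_iff], of \<nu>] qv_mult_int[of \<nu> "int_alg (word [(i, True)])" "word [(i, False)]"] by simp
      ultimately show ?thesis unfolding t by (metis mult_cancel_left mult_zero_left zero_neq_one)
    qed
    have eq: "h' (proj (int_alg z)) = qv \<nu> (int_alg z)" for z
    proof (induction z rule: falg_induct)
      case (word w)
      show ?case
      proof (induction w)
        case Nil
        then show ?case using one by simp
      next
        case (Cons b w)
        obtain i s where b: "b = (i, s)" by force
        have "h' (proj (int_alg (word [b]))) = qv \<nu> (int_alg (word [b]))" using t tinv by (cases s) (simp_all only: b)
        then show ?case
          unfolding word_Cons[of b w] mult Cons by (simp only: int_alg_simps(3) qv_mult_int)
      qed
    next
      case (scale c z)
      then show ?case unfolding mult const by simp
    next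
      case (add y z)
      then show ?case using \<open>\<And>u v. h' (proj (int_alg (u + v))) = _\<close> by simp
    qed
    show "h' = ?h"
      by (rule extensionalityI[of _ U_zero]) (use h' eq h in \<open>auto simp: U_zero_eq\<close>)
  qed
  then show ?thesis using h by simp
qed

end

section \<open>Triangular decomposition and the forms\<close>

context finite_cartan_datum
begin

lemma span_mult_induct [consumes 1, case_names zero gen uminus add]:
  assumes "X \<in> span_mult Uq A B"
    and "P \<zero>\<^bsub>Uq\<^esub>" "\<And>x y. x \<in> A \<Longrightarrow> y \<in> B \<Longrightarrow> P (x \<otimes>\<^bsub>Uq\<^esub> y)" "\<And>x y. x \<in> A \<Longrightarrow> y \<in> B \<Longrightarrow> P (\<ominus>\<^bsub>Uq\<^esub> (x \<otimes>\<^bsub>Uq\<^esub> y))"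
      "\<And>x y. P x \<Longrightarrow> P y \<Longrightarrow> P (x \<oplus>\<^bsub>Uq\<^esub> y)"
  shows "P X"
  using assms(1) unfolding span_mult_def
proof (induction rule: generate.induct)
  case (inv h)
  then show ?case using assms(4) unfolding a_inv_def[symmetric] by blast
qed (use assms(2-) in auto)

lemma span_mult_closed:
  "\<zero>\<^bsub>Uq\<^esub> \<in> span_mult Uq A B" "x \<in> A \<Longrightarrow> y \<in> B \<Longrightarrow> x \<otimes>\<^bsub>Uq\<^esub> y \<in> span_mult Uq A B"
  "X \<in> span_mult Uq A B \<Longrightarrow> Y \<in> span_mult Uq A B \<Longrightarrow> X \<oplus>\<^bsub>Uq\<^esub> Y \<in> span_mult Uq A B"
  using generate.one[of "add_monoid Uq"] generate.eng[of X "add_monoid Uq"]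
    generate.incl[of "x \<otimes>\<^bsub>Uq\<^esub> y" "{x \<otimes>\<^bsub>Uq\<^esub> y | x y. x \<in> A \<and> y \<in> B}" "add_monoid Uq"]
  unfolding span_mult_def by auto

lemma tword_commute_fwords:
  assumes "tword w"
  shows "word w * word (map Gen_f u) \<approx> const (qpow (- texp_weight w (wt u))) * (word (map Gen_f u) * word w)"
proof (induction u)
  case Nil
  show ?case by (simp add: texp_weight_def fa.cst_1)
next
  case (Cons k u)
  have tw: "texp_weight w (wt (k # u)) = d k * of_int (texp w k) + texp_weight w (wt u)"
    by (simp add: texp_weight_def distrib_left sum.distrib simple_root_nth if_distrib[of "\<lambda>x. _ * x"] cong: if_cong)
  have "word w * word (map Gen_f (k # u)) = word w * word [Gen_f k] * word (map Gen_f u)"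
    by (simp add: word_Cons[of "Gen_f k" "map Gen_f u"] mult.assoc)
  also have "\<dots> \<approx> const (qpow (- 1 * d k * of_int (texp w k))) * (word [Gen_f k] * word w) * word (map Gen_f u)"
    by (intro ueq_rmult tword_commute assms) simp
  also have "\<dots> = const (qpow (- 1 * d k * of_int (texp w k))) * (word [Gen_f k] * (word w * word (map Gen_f u)))"
    by (simp add: mult.assoc)
  also have "\<dots> \<approx> const (qpow (- 1 * d k * of_int (texp w k))) * (word [Gen_f k] *
      (const (qpow (- texp_weight w (wt u))) * (word (map Gen_f u) * word w)))"
    by (intro ueq_lmult Cons.IH)
  also have "\<dots> = const (qpow (- texp_weight w (wt (k # u)))) * (word (map Gen_f (k # u)) * word w)"
    unfolding tw by (simp add: word_Cons[of "Gen_f k" "map Gen_f u"] mult.assoc qpow_diff qpow_minus divide_inverse mult.commute[of "inverse _" "inverse _"] flip: fa.sc_def)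
  finally show ?case .
qed

inductive_set tri :: "'i free_alg set" where
  gen: "tword t \<Longrightarrow> const c * (word (map Gen_f u) * (word t * word (map Gen_e v))) \<in> tri"
| add: "x \<in> tri \<Longrightarrow> y \<in> tri \<Longrightarrow> x + y \<in> tri"
| congr: "x \<approx> y \<Longrightarrow> y \<in> tri \<Longrightarrow> x \<in> tri"

lemma tri_scale: "x \<in> tri \<Longrightarrow> const b * x \<in> tri"
proof (induction rule: tri.induct)
  case (gen t c u v)
  then show ?case using tri.gen[of t "b * c" u v] by (simp add: fa.cst_mult mult.assoc)
next
  case (congr x y)
  then show ?case using tri.congr[OF ueq_lmult] by blast
qed (simp add: distrib_left tri.add)

lemma tri_f: "x \<in> tri \<Longrightarrow> word [Gen_f k] * x \<in> tri"
proof (induction rule: tri.induct)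
  case (gen t c u v)
  then show ?case using tri.gen[of t c "k # u" v] by (simp add: word_Cons[of "Gen_f k" "map Gen_f u"] mult.assoc flip: fa.sc_def)
next
  case (congr x y)
  then show ?case using tri.congr[OF ueq_lmult] by blast
qed (simp add: distrib_left tri.add)

lemma tri_tword: "x \<in> tri \<Longrightarrow> tword w \<Longrightarrow> word w * x \<in> tri"
proof (induction rule: tri.induct)
  case (gen t c u v)
  have "word w * (const c * (word (map Gen_f u) * (word t * word (map Gen_e v))))
    = const c * (word w * word (map Gen_f u) * (word t * word (map Gen_e v)))" by (simp add: mult.assoc flip: fa.sc_def)
  also have "\<dots> \<approx> const c * (const (qpow (- texp_weight w (wt u))) * (word (map Gen_f u) * word w) * (word t * word (map Gen_e v)))"
    by (intro ueq_lmult ueq_rmult tword_commute_fwords gen.prems)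
  also have "\<dots> = const (c * qpow (- texp_weight w (wt u))) * (word (map Gen_f u) * (word (w @ t) * word (map Gen_e v)))"
    by (simp add: word_append mult.assoc mult.commute[of c] flip: fa.sc_def)
  finally show ?case using gen by (rule_tac tri.congr) (auto intro: tri.gen)
next
  case (congr x y)
  then show ?case using tri.congr[OF ueq_lmult] by blast
qed (simp add: distrib_left tri.add)

text \<open>The substantial case of the triangular decomposition: e_i moves through the f-word
  letter by letter, and the commutators leave torus words, which \<open>tri_tword\<close> absorbs.
  Once the span is stable under left multiplication by every generator, it is everything.\<close>

lemma tri_e: "x \<in> tri \<Longrightarrow> word [Gen_e i] * x \<in> tri"
proof (induction rule: tri.induct)
  case (gen t c u v)
  have "word [Gen_e i] * (word (map Gen_f u) * (word t * word (map Gen_e v))) \<in> tri"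
  proof (induction u)
    case Nil
    have "word [Gen_e i] * word t = const (qpow (- (d i * of_int (texp t i)))) * (const (qpow (1 * d i * of_int (texp t i))) * (word [Gen_e i] * word t))"
      by (simp add: qpow_minus flip: fa.sc_def)
    also have "\<dots> \<approx> const (qpow (- (d i * of_int (texp t i)))) * (word t * word [Gen_e i])"
      by (rule ueq_lmult, rule ueq_sym, rule tword_commute[OF gen]) simp
    finally have "word [Gen_e i] * word t * word (map Gen_e v)
      \<approx> const (qpow (- (d i * of_int (texp t i)))) * (word t * word [Gen_e i]) * word (map Gen_e v)"
      by (rule ueq_rmult)
    moreover have "const (qpow (- (d i * of_int (texp t i)))) * (word t * word [Gen_e i]) * word (map Gen_e v)
      = const (qpow (- (d i * of_int (texp t i)))) * (word (map Gen_f []) * (word t * word (map Gen_e (i # v))))"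
      by (simp add: word_Cons[of "Gen_e i" "map Gen_e v"] mult.assoc)
    ultimately have "word [Gen_e i] * word t * word (map Gen_e v) \<in> tri"
      using tri.congr tri.gen[OF gen, of _ "[]"] by metis
    then show ?case by (simp add: mult.assoc)
  next
    case (Cons k u)
    define T where "T = word (map Gen_f u) * (word t * word (map Gen_e v))"
    have T: "T \<in> tri" unfolding T_def using tri.gen[OF gen, of 1] by (simp add: fa.cst_1)
    have IH: "word [Gen_e i] * T \<in> tri" using Cons by (simp add: T_def)
    have "word [Gen_e i] * (word (map Gen_f (k # u)) * (word t * word (map Gen_e v))) = word [Gen_e i] * word [Gen_f k] * T"
      by (simp add: word_Cons[of "Gen_f k" "map Gen_f u"] mult.assoc T_def)
    also have "\<dots> \<approx> (word [Gen_f k] * word [Gen_e i]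
      + (if i = k then const (qstep i) * (word (kword i 1) - word (kword i (- 1))) else 0)) * T"
      by (intro ueq_rmult e_f_commute)
    also have "\<dots> = word [Gen_f k] * (word [Gen_e i] * T)
      + const (if i = k then qstep i else 0) * (word (kword i 1) * T + const (- 1) * (word (kword i (- 1)) * T))"
      by (simp add: algebra_simps fa.cst_minus fa.cst_1)
    finally show ?case
      by (rule tri.congr) (intro tri.add tri_f tri_scale tri_tword IH T tword_kword)
  qed
  then show ?case using tri_scale[of _ c] by (simp flip: fa.sc_def)
next
  case (congr x y)
  then show ?case using tri.congr[OF ueq_lmult] by blast
qed (simp add: distrib_left tri.add)

lemma tri_all: "x \<in> tri"
proof (induction x rule: falg_induct)
  case (word w)
  show ?case
  proof (induction w)
    case Nil
    show ?case using tri.gen[of "[]" 1 "[]" "[]"] by (simp add: fa.cst_1)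
  next
    case (Cons g w)
    have "tword [g] \<Longrightarrow> word [g] * word w \<in> tri" using tri_tword[OF Cons] .
    then show ?case unfolding word_Cons[of g w] using tri_f[OF Cons] tri_e[OF Cons] by (cases g) auto
  qed
qed (simp_all add: tri_scale tri.add)

section \<open>The projection to U^0\<close>

lemma cu_in_alg: "cu (inf_alg z) = vac z" "cu (ine_alg z) = vac z"
proof -
  have "cu (inf_alg z) = vac z \<and> cu (ine_alg z) = vac z"
  proof (induction z rule: falg_induct)
    case (word w)
    then show ?case
    proof (cases w)
      case (Cons k u)
      then show ?thesis by (simp add: vac_word word_Cons[of "Gen_f k" "map Gen_f u"] word_Cons[of "Gen_e k" "map Gen_e u"])
    qed simp
  qed simp_all
  then show "cu (inf_alg z) = vac z" "cu (ine_alg z) = vac z" by blast+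
qed

lemma qv_inf_mult: "qv \<nu> (inf_alg z * x) = vac z * qv \<nu> x"
  by (simp add: qv_def vac_mult)

lemma act_ine_1: "app (act \<nu> (ine_alg z)) 1 = const (vac z)"
proof (induction z rule: falg_induct)
  case (word w)
  then show ?case
  proof (cases w rule: rev_cases)
    case (snoc u k)
    then show ?thesis by (simp add: word_append eop_1 vac_mult, simp add: vac_word)
  qed (simp add: fa.cst_1)
qed (simp_all add: fa.cst_mult fa.cst_add)

lemma qv_mult_ine: "qv \<nu> (x * ine_alg z) = vac z * qv \<nu> x"
  using app_scale[of "act \<nu> x" "vac z" 1] by (simp add: qv_def act_ine_1)

lemma U_minus_aug_eq: "U_minus_aug = {proj (inf_alg z) | z. vac z = 0}"
  by (auto simp: U_minus_aug_def U_minus_eq counit_proj cu_in_alg)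

lemma U_plus_aug_eq: "U_plus_aug = {proj (ine_alg z) | z. vac z = 0}"
  by (auto simp: U_plus_aug_def U_plus_eq counit_proj cu_in_alg)

abbreviation "SA \<equiv> span_mult Uq U_minus_aug (carrier Uq)"
abbreviation "SB \<equiv> span_mult Uq (carrier Uq) U_plus_aug"

lemma SA_qv: "X \<in> SA \<Longrightarrow> \<exists>x. X = proj x \<and> (\<forall>\<nu>. qv \<nu> x = 0)"
proof (induction rule: span_mult_induct)
  case zero
  show ?case by (rule exI[of _ 0]) (simp add: proj_0)
next
  case (gen x y)
  then obtain z y' where "x = proj (inf_alg z)" "vac z = 0" "y = proj y'" by (auto simp: U_minus_aug_eq carrier_Uq)
  then show ?case by (intro exI[of _ "inf_alg z * y'"]) (simp add: proj_mult qv_inf_mult)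
next
  case (uminus x y)
  then obtain z y' where "x = proj (inf_alg z)" "vac z = 0" "y = proj y'" by (auto simp: U_minus_aug_eq carrier_Uq)
  then show ?case by (intro exI[of _ "- (inf_alg z * y')"]) (simp add: proj_mult proj_uminus qv_inf_mult)
next
  case (add X Y)
  then obtain x y where "X = proj x" "Y = proj y" "\<forall>\<nu>. qv \<nu> x = 0" "\<forall>\<nu>. qv \<nu> y = 0" by blast
  then show ?case by (intro exI[of _ "x + y"]) (simp add: proj_add)
qed

lemma SB_qv: "X \<in> SB \<Longrightarrow> \<exists>x. X = proj x \<and> (\<forall>\<nu>. qv \<nu> x = 0)"
proof (induction rule: span_mult_induct)
  case zero
  show ?case by (rule exI[of _ 0]) (simp add: proj_0)
next
  case (gen y x)
  then obtain z y' where "x = proj (ine_alg z)" "vac z = 0" "y = proj y'" by (auto simp: U_plus_aug_eq carrier_Uq)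
  then show ?case by (intro exI[of _ "y' * ine_alg z"]) (simp add: proj_mult qv_mult_ine)
next
  case (uminus y x)
  then obtain z y' where "x = proj (ine_alg z)" "vac z = 0" "y = proj y'" by (auto simp: U_plus_aug_eq carrier_Uq)
  then show ?case by (intro exI[of _ "- (y' * ine_alg z)"]) (simp add: proj_mult proj_uminus qv_mult_ine)
next
  case (add X Y)
  then obtain x y where "X = proj x" "Y = proj y" "\<forall>\<nu>. qv \<nu> x = 0" "\<forall>\<nu>. qv \<nu> y = 0" by blast
  then show ?case by (intro exI[of _ "x + y"]) (simp add: proj_add)
qed

lemma proj_zero_exists: "\<exists>z s r. x \<approx> int_alg z + (s + r) \<and> proj s \<in> SA \<and> proj r \<in> SB"
  using tri_all[of x]
proof (induction rule: tri.induct)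
  case (gen t c u v)
  let ?x = "const c * (word (map Gen_f u) * (word t * word (map Gen_e v)))"
  have zero: "proj 0 \<in> SA" "proj 0 \<in> SB" by (simp_all add: proj_0 span_mult_closed)
  consider "u \<noteq> []" | "u = []" "v \<noteq> []" | "u = []" "v = []" by blast
  then show ?case
  proof cases
    case 1
    have "?x = inf_alg (const c * word u) * (word t * word (map Gen_e v))" by (simp add: mult.assoc)
    then have "proj ?x = proj (inf_alg (const c * word u)) \<otimes>\<^bsub>Uq\<^esub> proj (word t * word (map Gen_e v))"
      by (simp only: proj_mult)
    moreover have "proj (inf_alg (const c * word u)) \<in> U_minus_aug"
      unfolding U_minus_aug_eq using 1 by (intro CollectI exI[of _ "const c * word u"]) (simp add: vac_word)
    ultimately have "proj ?x \<in> SA" using span_mult_closed(2) by simp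
    then show ?thesis using zero by (intro exI[of _ 0] exI[of _ ?x]) simp
  next
    case 2
    have "?x = const c * word t * ine_alg (word v)" using 2 by (simp add: mult.assoc)
    then have "proj ?x = proj (const c * word t) \<otimes>\<^bsub>Uq\<^esub> proj (ine_alg (word v))"
      by (simp only: proj_mult)
    moreover have "proj (ine_alg (word v)) \<in> U_plus_aug"
      unfolding U_plus_aug_eq using 2 by (intro CollectI exI[of _ "word v"]) (simp add: vac_word)
    ultimately have "proj ?x \<in> SB" using span_mult_closed(2) by simp
    then show ?thesis using zero by (intro exI[of _ 0] exI[of _ ?x]) simp
  next
    case 3
    obtain w where "t = map t_letter w" using gen tword_iff by blast
    then have "?x = int_alg (const c * word w) + (0 + 0)" using 3 by simp
    then show ?thesis using zero ueq_refl by metis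
  qed
next
  case (add x y)
  then obtain z s r z' s' r' where *: "x \<approx> int_alg z + (s + r)" "proj s \<in> SA" "proj r \<in> SB"
    "y \<approx> int_alg z' + (s' + r')" "proj s' \<in> SA" "proj r' \<in> SB" by blast
  have "x + y \<approx> int_alg z + (s + r) + (int_alg z' + (s' + r'))" by (rule ueq_add[OF *(1) *(4)])
  also have "\<dots> = int_alg (z + z') + ((s + s') + (r + r'))" by simp
  finally show ?case using * span_mult_closed(3) by (metis proj_add)
next
  case (congr x y)
  then show ?case using ueq_trans by blast
qed

definition tcanon :: "('i \<Rightarrow> int) \<Rightarrow> 'i gen list" where
  "tcanon n = concat (map (\<lambda>j. tpow j (n j)) (sorted_list_of_set UNIV))"

lemma tcanon: "tword (tcanon n)" "texp (tcanon n) = n"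
proof -
  have "tword (concat (map (\<lambda>j. tpow j (n j)) L))" for L
    by (induction L) (simp_all add: tword_tpow)
  moreover have "distinct L \<Longrightarrow> texp (concat (map (\<lambda>j. tpow j (n j)) L)) j = (if j \<in> set L then n j else 0)" for L j
    by (induction L) (auto simp: texp_tpow)
  ultimately show "tword (tcanon n)" "texp (tcanon n) = n" by (simp_all add: tcanon_def fun_eq_iff)
qed

lemma int_alg_sum: "int_alg (sum f A) = (\<Sum>a\<in>A. int_alg (f a))"
  by (simp add: int_alg_def fa.ev_sum)

lemma int_alg_expansion:
  "\<exists>S c. finite S \<and> int_alg z \<approx> (\<Sum>n\<in>S. const (c n) * word (tcanon n))"
proof -
  let ?K = "Poly_Mapping.keys z" and ?e = "\<lambda>w. texp (map t_letter w)"
  have z: "z = (\<Sum>w\<in>?K. const (Poly_Mapping.lookup z w) * word w)"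
    by (rule poly_mapping_eqI) (simp add: lookup_sum word_def lookup_single when_def in_keys_iff if_distrib[of "\<lambda>x. _ * x"] cong: if_cong)
  have "int_alg z = int_alg (\<Sum>w\<in>?K. const (Poly_Mapping.lookup z w) * word w)" using z by simp
  also have "\<dots> = (\<Sum>w\<in>?K. const (Poly_Mapping.lookup z w) * word (map t_letter w))"
    by (simp add: int_alg_sum)
  also have "\<dots> \<approx> (\<Sum>w\<in>?K. const (Poly_Mapping.lookup z w) * word (tcanon (?e w)))"
  proof (intro ueq_sum ueq_lmult tword_eqI)
    show "tword (map t_letter w)" for w by (subst tword_iff) blast
  qed (simp_all add: tcanon)
  also have "\<dots> = (\<Sum>n\<in>?e ` ?K. \<Sum>w\<in>{w \<in> ?K. ?e w = n}. const (Poly_Mapping.lookup z w) * word (tcanon (?e w)))"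
    by (rule sum.image_gen) simp
  also have "\<dots> = (\<Sum>n\<in>?e ` ?K. const (\<Sum>w\<in>{w \<in> ?K. ?e w = n}. Poly_Mapping.lookup z w) * word (tcanon n))"
  proof (rule sum.cong)
    fix n
    have const_sum: "const (sum f A) = (\<Sum>a\<in>A. const (f a))" for f :: "('i \<times> bool) list \<Rightarrow> qfield" and A
      by (induction A rule: infinite_finite_induct) (simp_all add: fa.cst_add)
    show "(\<Sum>w\<in>{w \<in> ?K. ?e w = n}. const (Poly_Mapping.lookup z w) * word (tcanon (?e w)))
      = const (\<Sum>w\<in>{w \<in> ?K. ?e w = n}. Poly_Mapping.lookup z w) * word (tcanon n)"
      by (simp add: const_sum sum_distrib_right)
  qed simp
  finally show ?thesis
    by (intro exI[of _ "?e ` ?K"] exI[of _ "\<lambda>n. \<Sum>w\<in>{w \<in> ?K. ?e w = n}. Poly_Mapping.lookup z w"]) simp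
qed

text \<open>Torus words with distinct exponent vectors give distinct characters of the group of
  weights, so Dedekind's lemma makes all coefficients vanish. Hence the q^\<nu> separate the
  elements of U^0.\<close>

lemma int_alg_zero:
  assumes "\<And>\<nu>. qv \<nu> (int_alg z) = 0"
  shows "int_alg z \<approx> 0"
proof -
  obtain S c where S: "finite S" "int_alg z \<approx> (\<Sum>n\<in>S. const (c n) * word (tcanon n))"
    using int_alg_expansion by blast
  let ?ch = "\<lambda>n \<nu>. qpow (\<Sum>j\<in>UNIV. of_int (n j) * d j * \<nu> $ j)"
  have qs: "qv \<nu> (sum f A) = (\<Sum>a\<in>A. qv \<nu> (f a))" for \<nu> A and f :: "('i \<Rightarrow> int) \<Rightarrow> _"
    by (induction A rule: infinite_finite_induct) simp_all
  have v: "(\<Sum>n\<in>S. ?ch n \<nu> * c n) = 0" for \<nu>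
    using qv_cong[OF S(2), of \<nu>] assms[of \<nu>]
    by (simp add: qs qv_tword tcanon texp_weight_def mult.commute)
  have "\<forall>n\<in>S. c n \<in> {0}"
  proof (rule independence_of_characters[of S "{0}" "(*)" ?ch "(+)"])
    fix n n' :: "'i \<Rightarrow> int" assume "n \<noteq> n'"
    then obtain j where j: "n j \<noteq> n' j" by auto
    have e: "(\<Sum>k\<in>UNIV. of_int (m k) * d k * simple_root j $ k) = of_int (m j) * d j" for m
      by (simp add: simple_root_nth if_distrib[of "\<lambda>x. _ * x"] cong: if_cong)
    have "?ch n (simple_root j) \<noteq> ?ch n' (simple_root j)"
      unfolding e using j d_pos[of j] by (simp add: qpow_inj)
    then show "\<exists>x. ?ch n x \<noteq> ?ch n' x" by blast
  qed (use S(1) v in \<open>simp_all add: algebra_simps sum.distrib qpow_add\<close>)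
  then have "(\<Sum>n\<in>S. const (c n) * word (tcanon n)) = 0" by simp
  with S(2) show ?thesis by simp
qed

text \<open>The triangular decomposition provides a U^0-part. It is unique because every
  \<open>qv \<nu>\<close> kills both complementary summands and together the \<open>qv \<nu>\<close>
  separate U^0; so the description in \<open>proj_zero\<close> is meaningful.\<close>

lemma qchar_proj_zero: "qchar \<nu> (proj_zero (proj x)) = qv \<nu> x"
proof -
  interpret U: ring Uq by (rule ring_Uq)
  obtain z s r where x: "x \<approx> int_alg z + (s + r)" and s: "proj s \<in> SA" and r: "proj r \<in> SB"
    using proj_zero_exists by blast
  have qsum: "\<And>\<nu>. qv \<nu> y = 0" if "proj y \<in> SA <+>\<^bsub>Uq\<^esub> SB" for y
  proof -
    fix \<nu>
    obtain s r where "s \<in> SA" "r \<in> SB" "proj y = s \<oplus>\<^bsub>Uq\<^esub> r" using \<open>proj y \<in> _\<close> by (auto simp: set_add_def')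
    then obtain s' r' where "proj y = proj (s' + r')" "qv \<nu> s' = 0" "qv \<nu> r' = 0"
      using SA_qv SB_qv by (metis proj_add)
    then show "qv \<nu> y = 0" using qv_cong[of y "s' + r'" \<nu>] by (simp add: proj_eq_iff)
  qed
  have mem: "proj x \<ominus>\<^bsub>Uq\<^esub> proj (int_alg z) \<in> SA <+>\<^bsub>Uq\<^esub> SB"
  proof -
    have "x - int_alg z \<approx> s + r" using ueq_diff[OF x ueq_refl[of "int_alg z"]] by simp
    then have "proj x \<ominus>\<^bsub>Uq\<^esub> proj (int_alg z) = proj s \<oplus>\<^bsub>Uq\<^esub> proj r" by (simp flip: proj_diff proj_add add: proj_eq_iff)
    then show ?thesis using s r by (auto simp: set_add_def')
  qed
  have "proj_zero (proj x) = proj (int_alg z)"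
    unfolding proj_zero_def
  proof (rule the_equality)
    show "proj (int_alg z) \<in> U_zero \<and> proj x \<ominus>\<^bsub>Uq\<^esub> proj (int_alg z) \<in> SA <+>\<^bsub>Uq\<^esub> SB"
      using mem by (auto simp: U_zero_eq)
  next
    fix Z assume Z: "Z \<in> U_zero \<and> proj x \<ominus>\<^bsub>Uq\<^esub> Z \<in> SA <+>\<^bsub>Uq\<^esub> SB"
    then obtain z' where z': "Z = proj (int_alg z')" by (auto simp: U_zero_eq)
    have "qv \<nu> (x - int_alg z') = 0" "qv \<nu> (x - int_alg z) = 0" for \<nu>
      using qsum[of "x - int_alg z'" \<nu>] qsum[of "x - int_alg z" \<nu>] Z mem unfolding z' by (simp_all add: proj_diff)
    then have "qv \<nu> (int_alg (z' - z)) = 0" for \<nu> by (simp add: algebra_simps)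
    from int_alg_zero[OF this] show "Z = proj (int_alg z)" by (simp add: z' proj_eq_iff ueq_def)
  qed
  moreover have "qv \<nu> (x - int_alg z) = 0" using qsum[of "x - int_alg z" \<nu>] mem by (simp add: proj_diff)
  ultimately show ?thesis by (simp add: qchar_int)
qed

lemma pi_form_proj: "pi_form \<nu> (proj x) (proj y) = qv \<nu> (an x * y)"
  by (simp add: pi_form_def antipode_proj qchar_proj_zero flip: proj_mult)

lemma shapovalov_proj: "shapovalov \<nu> (proj x) (proj y) = qv \<nu> (an (th x) * y)"
  by (simp add: shapovalov_def omega_proj qchar_proj_zero flip: proj_mult)

end

section \<open>Quotients of left modules\<close>

lemma quotient_smult:
  fixes R (structure) and M (structure)
  assumes "left_module R M" and N: "additive_subgroup N M"
    and smult: "\<And>a x. a \<in> carrier R \<Longrightarrow> x \<in> N \<Longrightarrow> a \<odot>\<^bsub>M\<^esub> x \<in> N"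
    and that: "a \<in> carrier R" "x \<in> carrier M"
  shows "N <+>\<^bsub>M\<^esub> ((\<lambda>y. a \<odot>\<^bsub>M\<^esub> y) ` (N +>\<^bsub>M\<^esub> x)) = N +>\<^bsub>M\<^esub> (a \<odot>\<^bsub>M\<^esub> x)"
proof -
  interpret left_module R M by fact
  interpret N: abelian_subgroup N M by (rule abelian_subgroupI3[OF N M.abelian_group_axioms])
  have sub: "N \<subseteq> carrier M" by (rule N.a_subset)
  show ?thesis
  proof (intro equalityI subsetI)
    fix y assume "y \<in> N <+>\<^bsub>M\<^esub> ((\<lambda>y. a \<odot>\<^bsub>M\<^esub> y) ` (N +>\<^bsub>M\<^esub> x))"
    then obtain m n where mn: "m \<in> N" "n \<in> N" "y = m \<oplus>\<^bsub>M\<^esub> a \<odot>\<^bsub>M\<^esub> (n \<oplus>\<^bsub>M\<^esub> x)"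
      by (auto simp: set_add_def' a_r_coset_def')
    then have "y = (m \<oplus>\<^bsub>M\<^esub> a \<odot>\<^bsub>M\<^esub> n) \<oplus>\<^bsub>M\<^esub> a \<odot>\<^bsub>M\<^esub> x"
      using that sub by (simp add: smult_r_distr M.a_assoc subset_eq)
    then show "y \<in> N +>\<^bsub>M\<^esub> (a \<odot>\<^bsub>M\<^esub> x)" using mn smult that by (auto simp: a_r_coset_def')
  next
    fix y assume "y \<in> N +>\<^bsub>M\<^esub> (a \<odot>\<^bsub>M\<^esub> x)"
    then obtain n where n: "n \<in> N" "y = n \<oplus>\<^bsub>M\<^esub> a \<odot>\<^bsub>M\<^esub> x" by (auto simp: a_r_coset_def')
    moreover have "x \<in> N +>\<^bsub>M\<^esub> x" using that by (rule_tac N.a_rcos_self)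
    ultimately show "y \<in> N <+>\<^bsub>M\<^esub> ((\<lambda>y. a \<odot>\<^bsub>M\<^esub> y) ` (N +>\<^bsub>M\<^esub> x))" by (auto simp: set_add_def')
  qed
qed

lemma quotient_left_module:
  fixes R (structure) and M (structure)
  assumes "left_module R M" and N: "additive_subgroup N M"
    and smult: "\<And>a x. a \<in> carrier R \<Longrightarrow> x \<in> N \<Longrightarrow> a \<odot>\<^bsub>M\<^esub> x \<in> N"
  shows "left_module R (quotient_module M N)"
proof -
  interpret left_module R M by fact
  interpret N: abelian_subgroup N M by (rule abelian_subgroupI3[OF N M.abelian_group_axioms])
  have sub: "N \<subseteq> carrier M" by (rule N.a_subset)
  have mem: "C \<in> a_rcosets\<^bsub>M\<^esub> N \<longleftrightarrow> (\<exists>x\<in>carrier M. C = N +>\<^bsub>M\<^esub> x)" for C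
    by (auto simp: A_RCOSETS_def')
  note sm = quotient_smult[OF assms]
  have N0: "N +>\<^bsub>M\<^esub> \<zero>\<^bsub>M\<^esub> = N" using sub by simp
  have "abelian_group (quotient_module M N)"
  proof (rule abelian_groupI)
    fix C assume C: "C \<in> carrier (quotient_module M N)"
    then obtain x where x: "x \<in> carrier M" "C = N +>\<^bsub>M\<^esub> x" by (auto simp: quotient_module_def mem)
    show "\<zero>\<^bsub>quotient_module M N\<^esub> \<oplus>\<^bsub>quotient_module M N\<^esub> C = C"
      using N.a_rcos_sum[of "\<zero>\<^bsub>M\<^esub>" x] x by (simp add: quotient_module_def N0)
    have "(N +>\<^bsub>M\<^esub> (\<ominus>\<^bsub>M\<^esub> x)) <+>\<^bsub>M\<^esub> C = N"
      using N.a_rcos_sum[of "\<ominus>\<^bsub>M\<^esub> x" x] x by (simp add: N0 M.l_neg)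
    then show "\<exists>D\<in>carrier (quotient_module M N). D \<oplus>\<^bsub>quotient_module M N\<^esub> C = \<zero>\<^bsub>quotient_module M N\<^esub>"
      using x by (intro bexI[of _ "N +>\<^bsub>M\<^esub> (\<ominus>\<^bsub>M\<^esub> x)"]) (auto simp: quotient_module_def mem)
  next
    show "\<zero>\<^bsub>quotient_module M N\<^esub> \<in> carrier (quotient_module M N)"
      unfolding quotient_module_def by (simp add: mem) (metis N0 M.zero_closed)
  qed (auto simp: quotient_module_def mem N.a_rcos_sum M.a_ac)
  then show ?thesis
  proof (intro left_module.intro left_module_axioms.intro)
    show "ring R" by (rule ring_axioms)
  qed (auto simp: quotient_module_def mem sm N.a_rcos_sum smult_l_distr smult_r_distr smult_assoc)
qed

lemma regular_left_module: "ring R \<Longrightarrow> left_module R (regular_module R)"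
proof -
  assume "ring R"
  then interpret ring R .
  have "abelian_group (regular_module R)"
    by (rule abelian_groupI) (auto simp: regular_module_def a_ac intro: bexI[of _ "a_inv R _"] l_neg)
  then show ?thesis
    by (intro left_module.intro left_module_axioms.intro)
      (auto simp: regular_module_def l_distr r_distr m_assoc ring_axioms)
qed

context finite_cartan_datum
begin

section \<open>Weight spaces of U^- and kernels of the form \<open>pi_form\<close>\<close>

lemma Uq_inverse:
  assumes "tword w"
  shows "inv\<^bsub>Uq\<^esub> (proj (word w)) = proj (word (tw_inv w))"
proof -
  interpret U: ring Uq by (rule ring_Uq)
  show ?thesis
    by (rule sym, rule U.inv_unique') (simp_all flip: proj_mult proj_1 add: proj_eq_iff tword_inverse assms)
qed

lemma T_groupD: "X \<in> T_group \<Longrightarrow> \<exists>w. tword w \<and> X = proj (word w)"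
  unfolding T_group_def
proof (induction rule: generate.induct)
  case one
  show ?case by (rule exI[of _ "[]"]) (simp add: proj_1)
next
  case (incl h)
  then obtain i where "h = proj (word [Gen_t i])" by (auto simp: Ugen_proj)
  then show ?case by (intro exI[of _ "[Gen_t i]"]) simp
next
  case (inv h)
  then obtain i where "h = proj (word [Gen_t i])" by (auto simp: Ugen_proj)
  then show ?case using Uq_inverse[of "[Gen_t i]"] tw_inv(1)[of "[Gen_t i]"] by auto
next
  case (eng h h')
  then obtain w w' where "h = proj (word w)" "h' = proj (word w')" "tword w" "tword w'" by blast
  then show ?case by (intro exI[of _ "w @ w'"]) (simp add: word_append proj_mult)
qed

lemma qchar_tword: "tword w \<Longrightarrow> qchar \<nu> (proj (word w)) = qpow (texp_weight w \<nu>)"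
proof -
  assume w: "tword w"
  then obtain u where "w = map t_letter u" using tword_iff by blast
  then show ?thesis using qchar_int[of \<nu> "word u"] qv_tword[OF w] by simp
qed

lemma fa_expansion: "z = (\<Sum>w\<in>Poly_Mapping.keys z. const (Poly_Mapping.lookup z w) * word w)" for z :: "'g falg"
  by (rule poly_mapping_eqI) (simp add: lookup_sum word_def lookup_single when_def in_keys_iff if_distrib[of "\<lambda>x. _ * x"] cong: if_cong)

lemma tword_conjugate:
  assumes w: "tword w" and z: "homog \<beta> z"
  shows "word w * inf_alg z * word (tw_inv w) \<approx> const (qpow (texp_weight w (- \<beta>))) * inf_alg z"
proof -
  let ?c = "const (qpow (texp_weight w (- \<beta>)))" and ?K = "Poly_Mapping.keys z"
  have m: "texp_weight w (- \<beta>) = - texp_weight w \<beta>" by (simp add: texp_weight_def sum_negf)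
  have z': "inf_alg z = (\<Sum>u\<in>?K. const (Poly_Mapping.lookup z u) * word (map Gen_f u))"
    using arg_cong[OF fa_expansion[of z], of inf_alg] unfolding inf_alg_sum by simp
  have "word w * inf_alg z = (\<Sum>u\<in>?K. const (Poly_Mapping.lookup z u) * (word w * word (map Gen_f u)))"
    unfolding z' sum_distrib_left by (simp flip: fa.sc_def)
  also have "\<dots> \<approx> (\<Sum>u\<in>?K. const (Poly_Mapping.lookup z u) * (?c * (word (map Gen_f u) * word w)))"
    using tword_commute_fwords[OF w] z by (intro ueq_sum ueq_lmult) (auto simp: homog_def m)
  also have "\<dots> = ?c * (inf_alg z * word w)"
    unfolding z' sum_distrib_left sum_distrib_right by (simp add: mult.commute[of "qpow _"] flip: fa.sc_def)
  finally have "word w * inf_alg z * word (tw_inv w) \<approx> ?c * (inf_alg z * word w) * word (tw_inv w)" by (rule ueq_rmult)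
  also have "\<dots> = ?c * inf_alg z * (word w * word (tw_inv w))" by (simp add: mult.assoc)
  also have "\<dots> \<approx> ?c * inf_alg z * 1" by (intro ueq_lmult tword_inverse w)
  finally show ?thesis by simp
qed

text \<open>A weight \<gamma> other than \<beta> differs from it in some coordinate
  \<open>f \<gamma>\<close>, so t_i for that index i has different eigenvalues on the two. Dividing
  by the difference of the eigenvalues, which is what \<open>?\<kappa>\<close> does, recovers all
  components of z outside \<beta> from elements of the Serre ideal.\<close>

lemma weight_component:
  assumes "\<And>i. app (diag (\<lambda>\<gamma>. qpow (- (d i * \<gamma> $ i)))) z \<doteq> const (qpow (- (d i * \<beta> $ i))) * z"
  shows "z \<doteq> app (diag (\<lambda>\<gamma>. if \<gamma> = \<beta> then 1 else 0)) z"
proof -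
  define f where "f \<gamma> = (SOME i. \<gamma> $ i \<noteq> \<beta> $ i)" for \<gamma>
  have f: "\<gamma> $ f \<gamma> \<noteq> \<beta> $ f \<gamma>" if "\<gamma> \<noteq> \<beta>" for \<gamma>
    using that unfolding f_def by (rule_tac someI_ex) (auto simp: weight_eq_iff)
  let ?\<kappa> = "\<lambda>i \<gamma>. if \<gamma> \<noteq> \<beta> \<and> f \<gamma> = i then 1 / (qpow (- (d i * \<gamma> $ i)) - qpow (- (d i * \<beta> $ i))) else 0"
  let ?x = "\<lambda>i. app (diag (\<lambda>\<gamma>. qpow (- (d i * \<gamma> $ i)))) z - const (qpow (- (d i * \<beta> $ i))) * z"
  have "?x i \<in> serre_ideal" for i using assms by (simp add: eqv_def)
  then have "(\<Sum>i\<in>UNIV. app (diag (?\<kappa> i)) (?x i)) \<in> serre_ideal"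
    by (intro serre_ideal_sum diag_serre_ideal)
  also have "(\<Sum>i\<in>UNIV. app (diag (?\<kappa> i)) (?x i)) = z - app (diag (\<lambda>\<gamma>. if \<gamma> = \<beta> then 1 else 0)) z"
  proof (rule poly_mapping_eqI)
    fix w
    let ?i = "f (wt w)"
    have "Poly_Mapping.lookup (\<Sum>i\<in>UNIV. app (diag (?\<kappa> i)) (?x i)) w
      = (\<Sum>i\<in>UNIV. if i = ?i then ?\<kappa> i (wt w) * (qpow (- (d i * wt w $ i)) * Poly_Mapping.lookup z w - qpow (- (d i * \<beta> $ i)) * Poly_Mapping.lookup z w) else 0)"
      unfolding lookup_sum by (rule sum.cong) (auto simp: lookup_diag lookup_minus diff_divide_distrib)
    also have "\<dots> = (if wt w = \<beta> then 0 else Poly_Mapping.lookup z w)"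
      using f[of "wt w"] d_pos[of ?i] by (simp flip: left_diff_distrib)
    finally show "Poly_Mapping.lookup (\<Sum>i\<in>UNIV. app (diag (?\<kappa> i)) (?x i)) w
      = Poly_Mapping.lookup (z - app (diag (\<lambda>\<gamma>. if \<gamma> = \<beta> then 1 else 0)) z) w"
      by (simp add: lookup_diag lookup_minus)
  qed
  finally show ?thesis by (simp add: eqv_def)
qed

lemma homog_component: "homog \<beta> (app (diag (\<lambda>\<gamma>. if \<gamma> = \<beta> then 1 else 0)) z)"
  by (auto simp: homog_def in_keys_iff lookup_diag split: if_splits)

lemma U_minus_weight_eq: "U_minus_weight \<beta> = {proj (inf_alg z) | z. homog \<beta> z}"
proof (intro equalityI subsetI)
  fix y assume y: "y \<in> U_minus_weight \<beta>"
  then obtain z where z: "y = proj (inf_alg z)" by (auto simp: U_minus_weight_def U_minus_eq)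
  have "app (diag (\<lambda>\<gamma>. qpow (- (d i * \<gamma> $ i)))) z \<doteq> const (qpow (- (d i * \<beta> $ i))) * z" for i
  proof -
    have "Ut i \<in> T_group" unfolding T_group_def by (rule generate.incl) simp
    then have "Ut i \<otimes>\<^bsub>Uq\<^esub> y \<otimes>\<^bsub>Uq\<^esub> inv\<^bsub>Uq\<^esub> (Ut i) = scalar (qchar (- \<beta>) (Ut i)) \<otimes>\<^bsub>Uq\<^esub> y"
      using y by (simp add: U_minus_weight_def)
    then have "word [Gen_t i] * inf_alg z * word (tw_inv [Gen_t i]) \<approx> const (qpow (texp_weight [Gen_t i] (- \<beta>))) * inf_alg z"
      using Uq_inverse[of "[Gen_t i]"] qchar_tword[of "[Gen_t i]" "- \<beta>"]
      by (simp add: z Ugen_proj scalar_proj proj_eq_iff flip: proj_mult)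
    moreover have "texp_weight [Gen_t i] (- \<beta>) = - (d i * \<beta> $ i)"
      unfolding texp_weight_letter texp_gen_sum texp_weight_def[of "[]"] by simp
    ultimately have "word [Gen_t i] * inf_alg z * word (tw_inv [Gen_t i]) \<approx> const (qpow (- (d i * \<beta> $ i))) * inf_alg z" by simp
    from act_ueq[OF this, of 0 1] show ?thesis
      by (simp add: tw_inv_def diag_one fa.cst_1)
  qed
  from weight_component[OF this] show "y \<in> {proj (inf_alg z) | z. homog \<beta> z}"
    using homog_component[of \<beta> z] unfolding z by (auto simp: proj_eq_iff inf_ueq_iff)
next
  fix y assume "y \<in> {proj (inf_alg z) | z. homog \<beta> z}"
  then obtain z where z: "y = proj (inf_alg z)" "homog \<beta> z" by blast
  show "y \<in> U_minus_weight \<beta>"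
    unfolding U_minus_weight_def
  proof (intro CollectI conjI ballI)
    fix g assume "g \<in> T_group"
    then obtain w where w: "tword w" "g = proj (word w)" using T_groupD by blast
    show "g \<otimes>\<^bsub>Uq\<^esub> y \<otimes>\<^bsub>Uq\<^esub> inv\<^bsub>Uq\<^esub> g = scalar (qchar (- \<beta>) g) \<otimes>\<^bsub>Uq\<^esub> y"
      unfolding w(2) Uq_inverse[OF w(1)] qchar_tword[OF w(1)] z(1) scalar_proj proj_mult[symmetric] proj_eq_iff
      by (rule tword_conjugate[OF w(1) z(2)])
  qed (auto simp: z U_minus_eq)
qed

text \<open>The vectors from which no element of U reaches the highest weight vector, that is, the
  maximal proper submodule. Quantifying over all of U makes its stability evident.\<close>

definition KF :: "'i weight \<Rightarrow> 'i falg set" where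
  "KF \<nu> = {z. \<forall>x. vac (app (act \<nu> x) z) = 0}"

lemma vac_act_ueq: "x \<approx> y \<Longrightarrow> vac (app (act \<nu> x) z) = vac (app (act \<nu> y) z)"
  using act_ueq[of x y \<nu> z] vac_serre_ideal[of "app (act \<nu> x) z - app (act \<nu> y) z"] by (simp add: eqv_def)

lemma vac_act_tword: "tword w \<Longrightarrow> vac (app (act \<nu> (word w)) z) = qpow (texp_weight w \<nu>) * vac z"
  by (simp add: act_tword vac_def lookup_diag)

lemma pi_form_in_alg: "pi_form \<nu> (proj (ine_alg x)) (proj (inf_alg z)) = vac (app (act \<nu> (an (ine_alg x))) z)"
  by (simp add: pi_form_proj qv_def)

lemma vac_act_an_e: "vac (app (act \<nu> (an (word (map Gen_e v)))) z) = (- 1) ^ length v * qpow (inversion_form (rev v))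
    * qpow (texp_weight (kwords (- 1) (rev v)) \<nu>) * vac (app (act \<nu> (word (map Gen_e (rev v)))) z)"
  using vac_act_ueq[OF an_e_word[of v], of \<nu> z] vac_act_tword[OF tword_kwords] by simp

text \<open>By the triangular decomposition the coefficients vac(x z) are determined by those with x
  a word in the e_j, and the antipode changes the effect of such a word only by reversal and a
  nonzero scalar.\<close>

lemma K_minus_eq: "K_minus \<nu> = (\<lambda>z. proj (inf_alg z)) ` KF \<nu>"
proof (intro equalityI subsetI)
  fix y assume "y \<in> K_minus \<nu>"
  then obtain z where z: "y = proj (inf_alg z)" and K: "\<And>x. vac (app (act \<nu> (an (ine_alg x))) z) = 0"
    by (auto simp: K_minus_def U_minus_eq U_plus_eq pi_form_in_alg)
  have e: "vac (app (act \<nu> (word (map Gen_e v))) z) = 0" for v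
    using K[of "word (rev v)"] vac_act_an_e[where \<nu> = \<nu> and v = "rev v" and z = z] by simp
  have "vac (app (act \<nu> x) z) = 0" for x
    using tri_all[of x]
  proof (induction rule: tri.induct)
    case (gen t c u v)
    have "vac (word u * app (act \<nu> (word t * word (map Gen_e v))) z) = 0"
      using gen e by (simp add: vac_mult vac_act_tword)
    moreover have "act \<nu> (word (map Gen_f u)) = lmult (word u)" using act_inf[of \<nu> "word u"] by simp
    ultimately show ?case by simp
  qed (simp_all add: vac_act_ueq)
  then show "y \<in> (\<lambda>z. proj (inf_alg z)) ` KF \<nu>" by (auto simp: KF_def z)
qed (auto simp: K_minus_def U_minus_eq U_plus_eq pi_form_in_alg KF_def)

lemma wt_replicate:
  assumes "wt w = of_nat n *s simple_root i"
  shows "w = replicate n i"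
  using assms
proof (induction w arbitrary: n)
  case Nil
  from arg_cong[OF Nil, of "\<lambda>x. x $ i"] show ?case by (simp add: simple_root_nth)
next
  case (Cons k u)
  have pos: "0 \<le> wt u $ j" for j using wt_nonneg[of u j] by (auto elim: Nats_cases)
  have comp: "(if k = j then 1 else 0) + wt u $ j = (if i = j then of_nat n else 0)" for j
    using arg_cong[OF Cons.prems, of "\<lambda>x. x $ j"] by (simp add: simple_root_nth split: if_splits)
  have k: "k = i" using comp[of k] pos[of k] by (auto split: if_splits)
  then have "n > 0" using comp[of i] pos[of i] by (cases n) auto
  then obtain m where m: "n = Suc m" using gr0_conv_Suc by blast
  have "wt u = of_nat m *s simple_root i"
    unfolding weight_eq_iff
  proof
    fix j
    show "wt u $ j = (of_nat m *s simple_root i) $ j"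
      using comp[of j] by (auto simp: simple_root_nth m k split: if_splits)
  qed
  then show ?case using Cons.IH m k by simp
qed

text \<open>For reasons of weight only z = f_i^n can contribute, and there e_i f_i^n = 0 already,
  because n = \<langle>\<nu> + rho, \<alpha>_i^\<vee>\<rangle>.\<close>

lemma eop_power_vac:
  assumes "cow i \<nu> + 1 = of_nat n" "n > 0"
  shows "vac (app (eop \<nu> i ^ n) z) = 0"
proof (induction z rule: falg_induct)
  case (word w)
  have h: "homog (wt w - of_nat m *s simple_root i) (app (eop \<nu> i ^ m) (word w))" for m
  proof (induction m)
    case (Suc m)
    have e: "wt w - of_nat m *s simple_root i - simple_root i = wt w - of_nat (Suc m) *s simple_root i"
      by (simp add: weight_eq_iff algebra_simps)
    show ?case using eop_homog[OF Suc, of i \<nu>, unfolded e] by (simp del: of_nat_Suc)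
  qed (simp add: homog_word)
  show ?case
  proof (cases "wt w = of_nat n *s simple_root i")
    case True
    have "cow i (\<nu> - 0) - of_nat n + 1 = 0" "bracket (d i) 0 = 0" using assms(1) by (simp_all add: bracket_def)
    then have "app (eop \<nu> i) (word [i] ^ n) = 0"
      using eop_power_left[OF homog_1, where \<nu> = \<nu> and i = i and j = i and n = n] by (simp only: mult_1_right eop_1 mult_zero_right mult_zero_left) simp
    moreover obtain m where m: "n = Suc m" using assms(2) gr0_conv_Suc by blast
    moreover have "word w = word [i] ^ n" using wt_replicate[OF True] word_replicate by metis
    moreover have "eop \<nu> i ^ n = eop \<nu> i ^ m * eop \<nu> i" unfolding m by (rule power_Suc2)
    ultimately show ?thesis by (simp del: power_Suc)
  next
    case False
    then show ?thesis using homog_vac[OF h[of n]] by simp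
  qed
qed simp_all

lemma e_power_K_tilde:
  assumes "cow i \<nu> + 1 = of_nat n" "n > 0"
  shows "proj (word [Gen_e i] ^ n) \<in> K_tilde \<nu>"
proof -
  have e: "proj (word [Gen_e i] ^ n) = proj (ine_alg (word (replicate n i)))"
    by (simp add: word_replicate)
  have "pi_form \<nu> (proj (word [Gen_e i] ^ n)) (proj (inf_alg z)) = 0" for z
    unfolding e pi_form_in_alg
    using vac_act_an_e[where \<nu> = \<nu> and v = "replicate n i" and z = z] eop_power_vac[OF assms, of z]
    by (simp add: word_replicate act_def)
  then show ?thesis unfolding K_tilde_def U_minus_eq U_plus_eq
    using rangeI[of "\<lambda>z. proj (ine_alg z)" "word (replicate n i)"] by (auto simp: word_replicate)
qed

end

section \<open>Simple modules and the function algebra\<close>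

lemma a_coset_eqI:
  fixes M (structure)
  assumes "abelian_subgroup N M" "x \<in> carrier M" "y \<in> carrier M" "x \<ominus> y \<in> N"
  shows "N +> x = N +> y"
proof -
  interpret abelian_subgroup N M by fact
  have "N +> x = (N +> (x \<ominus> y)) <+> (N +> y)"
    using assms a_rcos_sum[of "x \<ominus> y" y] by (simp add: a_minus_def a_assoc l_neg)
  also have "N +> (x \<ominus> y) = N" using assms(4) by (rule a_rcos_const)
  finally show ?thesis using assms(3) rcosets_add_eq[of "N +> y"] by (simp add: a_rcosetsI a_subset)
qed

context finite_cartan_datum
begin

section \<open>Verma modules as quotients of U\<close>

lemma verma_ideal_closed:
  "\<zero>\<^bsub>Uq\<^esub> \<in> verma_ideal \<nu>" "proj x \<in> verma_ideal \<nu> \<Longrightarrow> proj y \<in> verma_ideal \<nu> \<Longrightarrow> proj (x + y) \<in> verma_ideal \<nu>"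
  unfolding verma_ideal_def proj_add by (rule span_mult_closed; assumption)+

lemma verma_ideal_carrier: "X \<in> verma_ideal \<nu> \<Longrightarrow> \<exists>x. X = proj x"
  unfolding verma_ideal_def
proof (induction rule: span_mult_induct)
  case (add x y)
  then show ?case by (metis proj_add)
qed (auto simp: carrier_Uq Ugen_proj scalar_proj simp flip: proj_0 proj_mult proj_uminus proj_diff)

lemma verma_ideal_gen:
  "proj (x * word [Gen_e i]) \<in> verma_ideal \<nu>"
  "proj (x * (word [Gen_t i] - const (qpow (d i * \<nu> $ i)))) \<in> verma_ideal \<nu>"
proof -
  have q: "qchar \<nu> (Ut i) = qpow (d i * \<nu> $ i)"
    unfolding Ugen_proj using qchar_tword[of "[Gen_t i]" \<nu>]
    by (simp only: texp_weight_letter texp_gen_sum texp_weight_def[of "[]"] tword_simps) simp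
  show "proj (x * word [Gen_e i]) \<in> verma_ideal \<nu>"
    unfolding verma_ideal_def proj_mult by (rule span_mult_closed) (auto simp: Ugen_proj)
  show "proj (x * (word [Gen_t i] - const (qpow (d i * \<nu> $ i)))) \<in> verma_ideal \<nu>"
    unfolding verma_ideal_def proj_mult
  proof (rule span_mult_closed)
    have "proj (word [Gen_t i] - const (qpow (d i * \<nu> $ i))) = Ut i \<ominus>\<^bsub>Uq\<^esub> scalar (qchar \<nu> (Ut i))"
      unfolding q by (simp add: Ugen_proj scalar_proj proj_diff)
    then show "proj (word [Gen_t i] - const (qpow (d i * \<nu> $ i))) \<in> range Ue \<union> range (\<lambda>i. Ut i \<ominus>\<^bsub>Uq\<^esub> scalar (qchar \<nu> (Ut i)))"
      by blast
  qed simp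
qed

lemma verma_ideal_lmult:
  assumes "proj x \<in> verma_ideal \<nu>"
  shows "proj (b * x) \<in> verma_ideal \<nu>"
proof -
  interpret U: ring Uq by (rule ring_Uq)
  have gens: "g \<in> carrier Uq" if "g \<in> range Ue \<union> range (\<lambda>i. Ut i \<ominus>\<^bsub>Uq\<^esub> scalar (qchar \<nu> (Ut i)))" for g
    using that by (auto simp: Ugen_proj scalar_proj)
  have "X \<in> carrier Uq \<and> proj b \<otimes>\<^bsub>Uq\<^esub> X \<in> verma_ideal \<nu>" if "X \<in> verma_ideal \<nu>" for X
    using that unfolding verma_ideal_def
  proof (induction rule: span_mult_induct)
    case (gen u g)
    then show ?case using gens[of g] span_mult_closed(2)[of "proj b \<otimes>\<^bsub>Uq\<^esub> u" "carrier Uq" g] by (simp add: U.m_assoc)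
  next
    case (uminus u g)
    then show ?case using gens[of g] span_mult_closed(2)[of "\<ominus>\<^bsub>Uq\<^esub> (proj b \<otimes>\<^bsub>Uq\<^esub> u)" "carrier Uq" g]
      by (simp add: U.m_assoc U.l_minus U.r_minus)
  qed (auto simp: U.r_distr span_mult_closed)
  then show ?thesis using assms by (simp add: proj_mult)
qed

lemma verma_ideal_cong: "x \<approx> y \<Longrightarrow> proj y \<in> verma_ideal \<nu> \<Longrightarrow> proj x \<in> verma_ideal \<nu>"
  by (metis proj_eq_iff)

text \<open>In the quotient of U by \<open>verma_ideal \<nu>\<close>, the element x acts on the
  class of z as the operator \<open>act \<nu> x\<close> prescribes; this ties the operators on the
  free algebra to the module \<open>verma \<nu>\<close>.\<close>

definition reduces :: "'i weight \<Rightarrow> 'i free_alg \<Rightarrow> 'i falg \<Rightarrow> bool" where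
  "reduces \<nu> x z \<longleftrightarrow> proj (x * inf_alg z - inf_alg (app (act \<nu> x) z)) \<in> verma_ideal \<nu>"

lemma reduces_add: "reduces \<nu> x z \<Longrightarrow> reduces \<nu> y z \<Longrightarrow> reduces \<nu> (x + y) z"
  unfolding reduces_def by (erule (1) verma_ideal_cong[rotated, OF verma_ideal_closed(2)]) (simp add: algebra_simps)

lemma reduces_scale: "reduces \<nu> x z \<Longrightarrow> reduces \<nu> (const c * x) z"
  using verma_ideal_lmult[of _ \<nu> "const c"] by (fastforce simp: reduces_def algebra_simps)

lemma reduces_add_right: "reduces \<nu> x z \<Longrightarrow> reduces \<nu> x z' \<Longrightarrow> reduces \<nu> x (z + z')"
  unfolding reduces_def by (erule (1) verma_ideal_cong[rotated, OF verma_ideal_closed(2)]) (simp add: algebra_simps)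

lemma reduces_scale_right:
  assumes "reduces \<nu> x z"
  shows "reduces \<nu> x (const c * z)"
proof -
  have "x * inf_alg (const c * z) - inf_alg (app (act \<nu> x) (const c * z)) = const c * (x * inf_alg z - inf_alg (app (act \<nu> x) z))"
    by (simp add: right_diff_distrib const_left_commute[of x])
  then show ?thesis using verma_ideal_lmult assms unfolding reduces_def by metis
qed

lemma reduces_mult:
  assumes "reduces \<nu> y z" "reduces \<nu> x (app (act \<nu> y) z)"
  shows "reduces \<nu> (x * y) z"
proof -
  have "x * y * inf_alg z - inf_alg (app (act \<nu> (x * y)) z) = x * (y * inf_alg z - inf_alg (app (act \<nu> y) z))
    + (x * inf_alg (app (act \<nu> y) z) - inf_alg (app (act \<nu> x) (app (act \<nu> y) z)))"
    by (simp add: algebra_simps)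
  then show ?thesis using assms verma_ideal_lmult verma_ideal_closed(2) unfolding reduces_def by metis
qed

lemma reduces_cong:
  assumes "x \<approx> y" "reduces \<nu> y z"
  shows "reduces \<nu> x z"
proof -
  have "inf_alg (app (act \<nu> x) z) \<approx> inf_alg (app (act \<nu> y) z)" using act_ueq[OF assms(1)] inf_ueq_iff by blast
  then have "x * inf_alg z - inf_alg (app (act \<nu> x) z) \<approx> y * inf_alg z - inf_alg (app (act \<nu> y) z)"
    using assms(1) by (intro ueq_diff ueq_rmult)
  then show ?thesis using assms(2) verma_ideal_cong unfolding reduces_def by blast
qed

lemma reduces_tletter:
  assumes g: "g \<in> range Gen_t \<union> range Gen_tinv"
  shows "reduces \<nu> (word [g]) z"
proof (induction z rule: falg_induct)
  case (word u)
  have tw: "tword [g]" using g by simp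
  let ?q = "\<lambda>\<nu>. qpow (texp_weight [g] \<nu>)"
  have t: "proj (x * (word [g] - const (?q \<nu>))) \<in> verma_ideal \<nu>" for x
    using g
  proof
    assume "g \<in> range Gen_t"
    then obtain i where g: "g = Gen_t i" by auto
    have "texp_weight [g] \<nu> = d i * \<nu> $ i" unfolding g texp_weight_letter texp_gen_sum by (simp add: texp_weight_def)
    then show ?thesis using verma_ideal_gen(2)[of x i \<nu>] by (simp add: g)
  next
    assume "g \<in> range Gen_tinv"
    then obtain i where g: "g = Gen_tinv i" by auto
    have e: "texp_weight [g] \<nu> = - (d i * \<nu> $ i)" unfolding g texp_weight_letter texp_gen_sum by (simp add: texp_weight_def)
    have "x * (word [g] - const (?q \<nu>)) \<approx> x * (word [g] * 1 - const (?q \<nu>) * (word [Gen_tinv i] * word [Gen_t i]))"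
      using ueq_sym[OF t_letters_inverse[of "Gen_tinv i"]] ueq_lmult[of 1 _ "const (?q \<nu>)"]
      by (intro ueq_lmult ueq_diff) auto
    also have "\<dots> = const (- ?q \<nu>) * x * word [Gen_tinv i] * (word [Gen_t i] - const (qpow (d i * \<nu> $ i)))"
      unfolding e
      by (simp add: g algebra_simps const_uminus qpow_minus fa.cst_central[of "qpow _" "word _", symmetric] flip: fa.sc_def)
    finally show ?thesis using verma_ideal_cong[OF _ verma_ideal_gen(2)] by blast
  qed
  have t': "texp_weight [g] (\<nu> - wt u) = - texp_weight [g] (wt u) + texp_weight [g] \<nu>"
    by (simp add: texp_weight_def right_diff_distrib sum_subtractf)
  have \<kappa>: "inf_alg (app (act \<nu> (word [g])) (word u)) = const (qpow (- texp_weight [g] (wt u))) * (word (map Gen_f u) * const (?q \<nu>))"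
    unfolding act_tword[OF tw] diag_word t' qpow_add fa.cst_mult in_alg_simps in_alg_word mult.assoc
      fa.cst_central[of "?q \<nu>" "word (map Gen_f u)"] ..
  have "word [g] * inf_alg (word u) - inf_alg (app (act \<nu> (word [g])) (word u))
    \<approx> const (qpow (- texp_weight [g] (wt u))) * (word (map Gen_f u) * word [g])
      - const (qpow (- texp_weight [g] (wt u))) * (word (map Gen_f u) * const (?q \<nu>))"
    unfolding \<kappa> using tword_commute_fwords[OF tw, of u] by (intro ueq_diff) simp_all
  also have "\<dots> = const (qpow (- texp_weight [g] (wt u))) * word (map Gen_f u) * (word [g] - const (?q \<nu>))"
    by (simp add: right_diff_distrib mult.assoc)
  finally show ?case unfolding reduces_def using t verma_ideal_cong by blast
qed (simp_all add: reduces_add_right reduces_scale_right)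

lemma reduces_f: "reduces \<nu> (word [Gen_f k]) z"
  using verma_ideal_closed(1) by (simp add: reduces_def fop_def proj_0)

lemma reduces_0: "reduces \<nu> 0 z" "reduces \<nu> 1 z"
  using verma_ideal_closed(1) by (simp_all add: reduces_def proj_0)

lemma reduces_tword: "tword w \<Longrightarrow> reduces \<nu> (word w) z"
proof (induction w arbitrary: z)
  case (Cons g w)
  then show ?case unfolding word_Cons[of g w] by (intro reduces_mult reduces_tletter) simp_all
qed (simp add: reduces_0)

lemma reduces_e: "reduces \<nu> (word [Gen_e i]) z"
proof (induction z rule: falg_induct)
  case (word u)
  show ?case
  proof (induction u)
    case Nil
    show ?case using verma_ideal_gen(1)[of 1 i \<nu>] by (simp add: reduces_def eop_1)
  next
    case (Cons k u)
    have "reduces \<nu> (word [Gen_f k] * word [Gen_e i] + const (if i = k then qstep i else 0) * (word (kword i 1) + const (- 1) * word (kword i (- 1)))) (word u)"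
      by (intro reduces_add reduces_scale reduces_mult reduces_tword tword_kword Cons reduces_f)
    moreover have "word [Gen_e i] * word [Gen_f k] \<approx> word [Gen_f k] * word [Gen_e i]
      + const (if i = k then qstep i else 0) * (word (kword i 1) + const (- 1) * word (kword i (- 1)))"
      using e_f_commute[of i k] by (cases "i = k") (simp_all add: const_uminus fa.cst_1)
    ultimately have "reduces \<nu> (word [Gen_e i] * word [Gen_f k]) (word u)" by (rule reduces_cong[rotated])
    then show ?case by (simp add: reduces_def fop_def word_Cons[of k u] word_Cons[of "Gen_f k" "map Gen_f u"] mult.assoc)
  qed
qed (simp_all add: reduces_add_right reduces_scale_right)

lemma reduces: "reduces \<nu> x z"
proof (induction x arbitrary: z rule: falg_induct)
  case (word w)
  show ?case
  proof (induction w arbitrary: z)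
    case (Cons g w)
    have "reduces \<nu> (word [g]) z" for z
      using reduces_e reduces_f reduces_tletter[of g] by (cases g) simp_all
    then show ?case unfolding word_Cons[of g w] by (intro reduces_mult Cons)
  qed (simp add: reduces_0)
qed (simp_all add: reduces_add reduces_scale)

lemma regular_module_simps [simp]:
  "carrier (regular_module Uq) = carrier Uq" "X \<oplus>\<^bsub>regular_module Uq\<^esub> Y = X \<oplus>\<^bsub>Uq\<^esub> Y"
  "\<zero>\<^bsub>regular_module Uq\<^esub> = \<zero>\<^bsub>Uq\<^esub>" "X \<odot>\<^bsub>regular_module Uq\<^esub> Y = X \<otimes>\<^bsub>Uq\<^esub> Y" "\<ominus>\<^bsub>regular_module Uq\<^esub> X = \<ominus>\<^bsub>Uq\<^esub> X"
  "N +>\<^bsub>regular_module Uq\<^esub> X = N +>\<^bsub>Uq\<^esub> X"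
  by (simp_all add: regular_module_def a_inv_def m_inv_def a_r_coset_def r_coset_def)

lemma verma_ideal_subgroup: "additive_subgroup (verma_ideal \<nu>) (regular_module Uq)"
proof -
  interpret R: left_module Uq "regular_module Uq" by (rule regular_left_module[OF ring_Uq])
  have sub: "verma_ideal \<nu> \<subseteq> carrier Uq" using verma_ideal_carrier[of _ \<nu>] by (auto simp: carrier_Uq)
  show ?thesis
  proof (rule additive_subgroupI, rule R.M.add.subgroupI)
    fix X assume X: "X \<in> verma_ideal \<nu>"
    then obtain x where x: "X = proj x" using verma_ideal_carrier by blast
    show "\<ominus>\<^bsub>regular_module Uq\<^esub> X \<in> verma_ideal \<nu>"
      using verma_ideal_lmult[of x \<nu> "- 1"] X by (simp add: x proj_uminus)
    fix Y assume Y: "Y \<in> verma_ideal \<nu>"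
    then obtain y where y: "Y = proj y" using verma_ideal_carrier by blast
    show "X \<oplus>\<^bsub>regular_module Uq\<^esub> Y \<in> verma_ideal \<nu>"
      using verma_ideal_closed(2) X Y by (simp add: x y proj_add)
  qed (use sub verma_ideal_closed(1) in auto)
qed

lemma verma_ideal_abelian: "abelian_subgroup (verma_ideal \<nu>) (regular_module Uq)"
  by (rule abelian_subgroupI3[OF verma_ideal_subgroup left_module.axioms(2)[OF regular_left_module[OF ring_Uq]]])

lemma verma_smult:
  "proj b \<odot>\<^bsub>verma \<nu>\<^esub> (verma_ideal \<nu> +>\<^bsub>Uq\<^esub> proj x) = verma_ideal \<nu> +>\<^bsub>Uq\<^esub> proj (b * x)"
proof -
  have "X \<otimes>\<^bsub>Uq\<^esub> Y \<in> verma_ideal \<nu>" if "X \<in> carrier Uq" "Y \<in> verma_ideal \<nu>" for X Y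
    using that verma_ideal_carrier[of Y \<nu>] verma_ideal_lmult by (auto simp: carrier_Uq simp flip: proj_mult)
  then show ?thesis
    using quotient_smult[OF regular_left_module[OF ring_Uq] verma_ideal_subgroup, where a = "proj b" and x = "proj x"]
    by (simp add: verma_def quotient_module_def proj_mult)
qed

lemma left_module_verma: "left_module Uq (verma \<nu>)"
proof -
  have "X \<otimes>\<^bsub>Uq\<^esub> Y \<in> verma_ideal \<nu>" if "X \<in> carrier Uq" "Y \<in> verma_ideal \<nu>" for X Y
    using that verma_ideal_carrier[of Y \<nu>] verma_ideal_lmult by (auto simp: carrier_Uq simp flip: proj_mult)
  then show ?thesis
    unfolding verma_def
    by (intro quotient_left_module regular_left_module ring_Uq verma_ideal_subgroup) simp_all
qed

lemma verma_coset_eqI: "proj (x - y) \<in> verma_ideal \<nu> \<Longrightarrow> verma_ideal \<nu> +>\<^bsub>Uq\<^esub> proj x = verma_ideal \<nu> +>\<^bsub>Uq\<^esub> proj y"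
  using a_coset_eqI[OF verma_ideal_abelian, where x = "proj x" and y = "proj y"]
  by (simp add: a_minus_def proj_diff)

lemma KF_closed: "0 \<in> KF \<nu>" "x \<in> KF \<nu> \<Longrightarrow> y \<in> KF \<nu> \<Longrightarrow> x + y \<in> KF \<nu>" "x \<in> KF \<nu> \<Longrightarrow> - x \<in> KF \<nu>"
  "x \<in> KF \<nu> \<Longrightarrow> app (act \<nu> b) x \<in> KF \<nu>"
  by (auto simp: KF_def simp flip: app_lin(6) act_simps(3))

text \<open>The point is that K_\<nu> 1_\<nu> is a submodule: its elements are the classes of
  \<open>KF \<nu>\<close>, the action on them is computed by \<open>reduces\<close>, and
  \<open>KF \<nu>\<close> is stable. The module axioms are what makes matrix elements linear on U
  and their span stable under the left action.\<close>

lemma left_module_simple: "left_module Uq (simple_module \<nu>)"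
proof -
  interpret V: left_module Uq "verma \<nu>" by (rule left_module_verma)
  interpret I: abelian_subgroup "verma_ideal \<nu>" "regular_module Uq"
    by (rule verma_ideal_abelian)
  let ?c = "\<lambda>x. verma_ideal \<nu> +>\<^bsub>Uq\<^esub> proj x"
  let ?N = "(\<lambda>y. y \<odot>\<^bsub>verma \<nu>\<^esub> hw_vector \<nu>) ` K_minus \<nu>"
  have N: "?N = (\<lambda>z. ?c (inf_alg z)) ` KF \<nu>"
    using verma_smult[of \<nu> _ 1] by (simp add: K_minus_eq hw_vector_def image_image proj_1)
  have add: "?c x \<oplus>\<^bsub>verma \<nu>\<^esub> ?c y = ?c (x + y)" for x y
    using I.a_rcos_sum[of "proj x" "proj y"] by (simp add: verma_def quotient_module_def proj_add)
  have zero: "\<zero>\<^bsub>verma \<nu>\<^esub> = ?c 0"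
    using I.a_rcos_const[of "\<zero>\<^bsub>Uq\<^esub>"] verma_ideal_closed(1) by (simp add: verma_def quotient_module_def proj_0)
  have carr: "carrier (verma \<nu>) = range ?c"
    by (auto simp: verma_def quotient_module_def A_RCOSETS_def' carrier_Uq)
  have minus: "\<ominus>\<^bsub>verma \<nu>\<^esub> (?c x) = ?c (- x)" for x
    using V.M.minus_equality[of "?c (- x)" "?c x"] by (simp add: add zero carr)
  have "additive_subgroup ?N (verma \<nu>)"
  proof (rule additive_subgroupI, rule V.M.add.subgroupI)
    show "?N \<subseteq> carrier (verma \<nu>)" unfolding N carr by auto
    show "?N \<noteq> {}" unfolding N using KF_closed(1) by blast
    show "\<ominus>\<^bsub>verma \<nu>\<^esub> X \<in> ?N" if "X \<in> ?N" for X
      using that unfolding N by (auto simp: minus intro!: image_eqI[of _ _ "- _"] KF_closed)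
    show "X \<oplus>\<^bsub>verma \<nu>\<^esub> Y \<in> ?N" if "X \<in> ?N" "Y \<in> ?N" for X Y
      using that unfolding N by (auto simp: add intro!: image_eqI[of _ _ "_ + _"] KF_closed)
  qed
  moreover have "a \<odot>\<^bsub>verma \<nu>\<^esub> X \<in> ?N" if "a \<in> carrier Uq" "X \<in> ?N" for a X
  proof -
    obtain b where b: "a = proj b" using \<open>a \<in> carrier Uq\<close> by (auto simp: carrier_Uq)
    obtain z where z: "z \<in> KF \<nu>" "X = ?c (inf_alg z)" using \<open>X \<in> ?N\<close> unfolding N by blast
    have "a \<odot>\<^bsub>verma \<nu>\<^esub> X = ?c (b * inf_alg z)" unfolding b z(2) by (rule verma_smult)
    also have "\<dots> = ?c (inf_alg (app (act \<nu> b) z))"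
      by (rule verma_coset_eqI) (use reduces[of \<nu> b z] in \<open>simp add: reduces_def\<close>)
    finally show ?thesis unfolding N using KF_closed(4)[OF z(1)] by blast
  qed
  ultimately show ?thesis
    unfolding simple_module_def by (intro quotient_left_module left_module_verma)
qed

section \<open>Matrix elements and the left regular action\<close>

definition uform :: "('i uq \<Rightarrow> qfield) \<Rightarrow> bool" where
  "uform f \<longleftrightarrow> (\<forall>X. X \<notin> carrier Uq \<longrightarrow> f X = 0) \<and> (\<forall>x y. f (proj (x + y)) = f (proj x) + f (proj y))
    \<and> (\<forall>c x. f (proj (const c * x)) = c * f (proj x))"

lemma matrix_element_uform:
  assumes "left_module Uq V" "linear_functional V \<phi>" "v \<in> carrier V"
  shows "uform (matrix_element V \<phi> v)"
proof -
  interpret left_module Uq V by fact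
  show ?thesis
    using assms(2,3)
    by (simp add: uform_def matrix_element_def linear_functional_def proj_add proj_mult smult_l_distr smult_assoc
        flip: scalar_proj) (simp add: scalar_proj smult_assoc)
qed

lemma FG_cases:
  assumes "f \<in> FG"
  obtains n c g where "f = (\<lambda>x. \<Sum>s<n. c s * g s x)" "\<And>s. s < (n :: nat) \<Longrightarrow> g s \<in> matrix_elements"
  using assms unfolding FG_def by blast

lemma matrix_elements_uform: "g \<in> matrix_elements \<Longrightarrow> uform g"
  by (auto simp: matrix_elements_def intro!: matrix_element_uform left_module_simple)

lemma FG_uform: "f \<in> FG \<Longrightarrow> uform f"
proof (erule FG_cases)
  fix n c g assume f: "f = (\<lambda>x. \<Sum>s<n. c s * g s x)" "\<And>s. s < (n :: nat) \<Longrightarrow> g s \<in> matrix_elements"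
  have "uform (g s)" if "s < n" for s using matrix_elements_uform[OF f(2)[OF that]] .
  then show "uform f"
    unfolding f(1) by (auto simp: uform_def sum_distrib_left sum.distrib[symmetric] distrib_left mult.left_commute intro!: sum.cong sum.neutral)
qed

lemma FG_0: "(\<lambda>_. 0) \<in> FG"
  unfolding FG_def by (intro CollectI exI[of _ 0]) simp

lemma FG_matrix_element: "g \<in> matrix_elements \<Longrightarrow> g \<in> FG"
  unfolding FG_def by (intro CollectI exI[of _ 1] exI[of _ "\<lambda>_. 1"] exI[of _ "\<lambda>_. g"]) simp

lemma FG_scale: "f \<in> FG \<Longrightarrow> (\<lambda>X. b * f X) \<in> FG"
proof (erule FG_cases)
  fix n c g assume f: "f = (\<lambda>x. \<Sum>s<n. c s * g s x)" "\<And>s. s < (n :: nat) \<Longrightarrow> g s \<in> matrix_elements"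
  show "(\<lambda>X. b * f X) \<in> FG" unfolding FG_def
    using f by (intro CollectI exI[of _ n] exI[of _ "\<lambda>s. b * c s"] exI[of _ g]) (simp add: sum_distrib_left mult.assoc)
qed

lemma FG_add_matrix_element:
  assumes "f \<in> FG" "g \<in> matrix_elements"
  shows "(\<lambda>X. f X + b * g X) \<in> FG"
proof (rule FG_cases[OF assms(1)])
  fix n c h assume f: "f = (\<lambda>x. \<Sum>s<n. c s * h s x)" "\<And>s. s < (n :: nat) \<Longrightarrow> h s \<in> matrix_elements"
  show ?thesis unfolding FG_def
    using f assms(2) by (intro CollectI exI[of _ "Suc n"] exI[of _ "c(n := b)"] exI[of _ "h(n := g)"]) (auto simp: less_Suc_eq)
qed

lemma FG_add:
  assumes "f \<in> FG" "f' \<in> FG"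
  shows "(\<lambda>X. f X + f' X) \<in> FG"
proof (rule FG_cases[OF assms(2)])
  fix n c g assume f': "f' = (\<lambda>x. \<Sum>s<n. c s * g s x)" "\<And>s. s < (n :: nat) \<Longrightarrow> g s \<in> matrix_elements"
  have "m \<le> n \<Longrightarrow> (\<lambda>X. f X + (\<Sum>s<m. c s * g s X)) \<in> FG" for m
  proof (induction m)
    case (Suc m)
    then have "(\<lambda>X. (f X + (\<Sum>s<m. c s * g s X)) + c m * g m X) \<in> FG"
      using f'(2)[of m] by (intro FG_add_matrix_element) simp_all
    then show ?case by (simp add: add.assoc)
  qed (simp add: assms(1))
  then show ?thesis using f'(1) by simp
qed

lemma FG_sum: "(\<And>a. a \<in> A \<Longrightarrow> f a \<in> FG) \<Longrightarrow> (\<lambda>X. \<Sum>a\<in>A. c a * f a X) \<in> FG"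
  by (induction A rule: infinite_finite_induct) (simp_all add: FG_0 FG_add FG_scale)

definition la :: "'i free_alg \<Rightarrow> ('i uq \<Rightarrow> qfield) \<Rightarrow> 'i uq \<Rightarrow> qfield" where
  "la x = left_action (proj x)"

lemma la_proj [simp]: "la x f (proj y) = f (proj (y * x))"
  by (simp add: la_def left_action_def proj_mult)

lemma uform_eqI:
  assumes "\<And>y. f (proj y) = g (proj y)" "\<And>X. X \<notin> carrier Uq \<Longrightarrow> f X = g X"
  shows "f = g"
proof
  fix X show "f X = g X" using assms by (cases "X \<in> carrier Uq") (auto simp: carrier_Uq)
qed

lemma la_outside: "X \<notin> carrier Uq \<Longrightarrow> la x f X = 0"
  by (simp add: la_def left_action_def)

lemma la_mult: "la (x * y) f = la x (la y f)"
  by (rule uform_eqI) (simp_all add: la_outside mult.assoc)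

lemma la_cong: "x \<approx> y \<Longrightarrow> la x f = la y f"
  using proj_eq_iff[of x y] by (simp add: la_def)

lemma la_linear:
  assumes "uform f"
  shows "la (x + y) f X = la x f X + la y f X" "la (const c * x) f X = c * la x f X" "la 0 f X = 0" "la (- x) f X = - la x f X"
proof -
  have f: "f (proj (x + y)) = f (proj x) + f (proj y)" "f (proj (const c * x)) = c * f (proj x)" for x y c
    using assms by (simp_all add: uform_def)
  have f0: "f (proj 0) = 0" "f (proj (- x)) = - f (proj x)" for x
    using f(2)[of 0 0] f(2)[of "- 1" x] by (simp_all add: const_uminus fa.cst_1)
  show "la (x + y) f X = la x f X + la y f X"
    by (cases "X \<in> carrier Uq") (auto simp: carrier_Uq la_outside f distrib_left)
  show "la (const c * x) f X = c * la x f X"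
    using f(2) by (cases "X \<in> carrier Uq") (auto simp: carrier_Uq la_outside simp flip: fa.sc_def)
  show "la 0 f X = 0" "la (- x) f X = - la x f X"
    by (cases "X \<in> carrier Uq"; auto simp: carrier_Uq la_outside f0)+
qed

lemma la_FG: "f \<in> FG \<Longrightarrow> la x f \<in> FG"
proof (erule FG_cases)
  fix n c g assume f: "f = (\<lambda>x. \<Sum>s<n. c s * g s x)" "\<And>s. s < (n :: nat) \<Longrightarrow> g s \<in> matrix_elements"
  have "la x (g s) \<in> FG" if "s < n" for s
  proof -
    from f(2)[OF that] obtain \<mu> \<phi> v where g: "g s = matrix_element (simple_module \<mu>) \<phi> v" "dominant_integral \<mu>"
      "linear_functional (simple_module \<mu>) \<phi>" "v \<in> carrier (simple_module \<mu>)" unfolding matrix_elements_def by blast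
    interpret V: left_module Uq "simple_module \<mu>" by (rule left_module_simple)
    have "la x (g s) = matrix_element (simple_module \<mu>) \<phi> (proj x \<odot>\<^bsub>simple_module \<mu>\<^esub> v)"
      by (rule uform_eqI) (simp_all add: g la_outside matrix_element_def proj_mult V.smult_assoc)
    moreover have "proj x \<odot>\<^bsub>simple_module \<mu>\<^esub> v \<in> carrier (simple_module \<mu>)" using g(4) by simp
    ultimately show ?thesis using g(2,3) unfolding matrix_elements_def by (intro FG_matrix_element[unfolded matrix_elements_def]) blast
  qed
  then have "(\<lambda>X. \<Sum>s<n. c s * la x (g s) X) \<in> FG" by (intro FG_sum) simp
  also have "(\<lambda>X. \<Sum>s<n. c s * la x (g s) X) = la x f"
    by (rule uform_eqI) (simp_all add: f(1) la_outside)
  finally show "la x f \<in> FG" .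
qed

end

section \<open>Regular families\<close>

lemma tensor_null_add: "X \<in> tensor_null \<iota> M N \<Longrightarrow> Y \<in> tensor_null \<iota> M N \<Longrightarrow> X + Y \<in> tensor_null \<iota> M N"
  using tensor_null.diff[of X \<iota> M N "0 - Y"] tensor_null.diff[OF tensor_null.zero, of Y \<iota> M N] by simp

lemma tensor_null_sum: "(\<And>a. a \<in> A \<Longrightarrow> f a \<in> tensor_null \<iota> M N) \<Longrightarrow> sum f A \<in> tensor_null \<iota> M N"
  by (induction A rule: infinite_finite_induct) (simp_all add: tensor_null.zero tensor_null_add)

lemma tensor_class_eqI:
  assumes "X - Y \<in> tensor_null \<iota> M N"
  shows "tensor_class \<iota> M N X = tensor_class \<iota> M N Y"
proof -
  have "Z - Y \<in> tensor_null \<iota> M N \<longleftrightarrow> Z - X \<in> tensor_null \<iota> M N" for Z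
    using tensor_null_add[OF _ assms, of "Z - X"] tensor_null.diff[OF _ assms, of "Z - Y"] by auto
  then show ?thesis by (auto simp: tensor_class_def)
qed

context finite_cartan_datum
begin

lemma scalar_action: "f \<in> FG \<Longrightarrow> left_action (scalar c) f = (\<lambda>X. c * f X)"
  using FG_uform[of f]
  by (intro uform_eqI) (auto simp: scalar_proj left_action_def uform_def fa.cst_central[of c, symmetric] simp flip: proj_mult)

text \<open>Scalars are moved into the right factor, so for fixed m a sum depends only on the
  function \<Sum> c_a f_a. In \<open>tensor_rewrite\<close> equality of tensors thereby follows from
  equality of functions.\<close>

lemma tensor_collapse:
  assumes m: "m \<in> carrier M" and "finite A" "\<And>a. a \<in> A \<Longrightarrow> f a \<in> FG"
  shows "(\<Sum>a\<in>A. Poly_Mapping.single (m, f a) (c a)) - Poly_Mapping.single (m, \<lambda>X. \<Sum>a\<in>A. c a * f a X) 1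
    \<in> tensor_null scalar M FG_module"
  using assms(2,3)
proof (induction A rule: finite_induct)
  case empty
  have "left_action (scalar 0) (\<lambda>_. 0) = (\<lambda>_. 0)" using scalar_action[OF FG_0, of 0] by simp
  then have "Poly_Mapping.single (m, \<lambda>_. 0) 1 - Poly_Mapping.single (m, \<lambda>_. 0) (0 * 1) \<in> tensor_null scalar M FG_module"
    using tensor_null.smult_right[of m M "\<lambda>_. 0" FG_module scalar 0 1] m FG_0 by (simp add: FG_module_def)
  from tensor_null.diff[OF tensor_null.zero this] show ?case by simp
next
  case (insert b A)
  let ?N = "tensor_null scalar M FG_module" and ?S = "\<lambda>X. \<Sum>a\<in>A. c a * f a X" and ?t = "\<lambda>X. c b * f b X"
  have F: "?S \<in> FG" "?t \<in> FG" "f b \<in> FG" using insert.prems by (auto intro: FG_sum FG_scale)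
  have 1: "(\<Sum>a\<in>A. Poly_Mapping.single (m, f a) (c a)) - Poly_Mapping.single (m, ?S) 1 \<in> ?N"
    using insert by simp
  have 2: "Poly_Mapping.single (m, ?t) 1 - Poly_Mapping.single (m, f b) (c b) \<in> ?N"
    using tensor_null.smult_right[of m M "f b" FG_module scalar "c b" 1] m F(3) by (simp add: FG_module_def scalar_action)
  have 3: "Poly_Mapping.single (m, \<lambda>X. ?t X + ?S X) 1 - Poly_Mapping.single (m, ?t) 1 - Poly_Mapping.single (m, ?S) 1 \<in> ?N"
    using tensor_null.add_right[of m M ?t FG_module ?S 1 scalar] m F by (simp add: FG_module_def)
  show ?case
    using tensor_null.diff[OF tensor_null.diff[OF 1 2] 3] insert.hyps by (simp add: algebra_simps)
qed

lemma tensor_rewrite: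
  assumes "m \<in> carrier M" "finite A" "\<And>a. a \<in> A \<Longrightarrow> f a \<in> FG" "finite B" "\<And>b. b \<in> B \<Longrightarrow> g b \<in> FG"
    and "\<And>X. (\<Sum>a\<in>A. c a * f a X) = (\<Sum>b\<in>B. c' b * g b X)"
  shows "(\<Sum>a\<in>A. Poly_Mapping.single (m, f a) (c a)) - (\<Sum>b\<in>B. Poly_Mapping.single (m, g b) (c' b))
    \<in> tensor_null scalar M FG_module"
proof -
  have "(\<lambda>X. \<Sum>a\<in>A. c a * f a X) = (\<lambda>X. \<Sum>b\<in>B. c' b * g b X)" using assms(6) by blast
  moreover have "(\<Sum>a\<in>A. Poly_Mapping.single (m, f a) (c a)) - Poly_Mapping.single (m, \<lambda>X. \<Sum>a\<in>A. c a * f a X) 1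
    \<in> tensor_null scalar M FG_module" by (rule tensor_collapse) (use assms in auto)
  moreover have "(\<Sum>b\<in>B. Poly_Mapping.single (m, g b) (c' b)) - Poly_Mapping.single (m, \<lambda>X. \<Sum>b\<in>B. c' b * g b X) 1
    \<in> tensor_null scalar M FG_module" by (rule tensor_collapse) (use assms in auto)
  ultimately show ?thesis using tensor_null.diff by fastforce
qed

section \<open>Germs of regular functions and of regular families\<close>

definition tval :: "'i weight \<Rightarrow> ('i \<times> bool) falg \<Rightarrow> qfield" where
  "tval \<nu> z = qchar \<nu> (proj (int_alg z))"

lemma tval_simps [simp]: "tval \<nu> (x + y) = tval \<nu> x + tval \<nu> y" "tval \<nu> (x * y) = tval \<nu> x * tval \<nu> y"
  "tval \<nu> 0 = 0" "tval \<nu> 1 = 1" "tval \<nu> (const c) = c"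
  unfolding tval_def qchar_int by (simp_all add: qv_mult_int)

text \<open>\<open>near \<nu>\<^sub>0 P\<close> states that \<open>P\<close> holds in a principal Zariski neighbourhood of \<open>\<nu>\<^sub>0\<close>.\<close>

definition near :: "'i weight \<Rightarrow> ('i weight \<Rightarrow> bool) \<Rightarrow> bool" where
  "near \<nu>\<^sub>0 P \<longleftrightarrow> (\<exists>h. tval \<nu>\<^sub>0 h \<noteq> 0 \<and> (\<forall>\<nu>. tval \<nu> h \<noteq> 0 \<longrightarrow> P \<nu>))"

lemma near_all: "(\<And>\<nu>. P \<nu>) \<Longrightarrow> near \<nu>\<^sub>0 P"
  unfolding near_def by (rule exI[of _ 1]) simp

lemma near_mono: "near \<nu>\<^sub>0 P \<Longrightarrow> (\<And>\<nu>. P \<nu> \<Longrightarrow> Q \<nu>) \<Longrightarrow> near \<nu>\<^sub>0 Q"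
  unfolding near_def by blast

lemma near_conj: "near \<nu>\<^sub>0 P \<Longrightarrow> near \<nu>\<^sub>0 Q \<Longrightarrow> near \<nu>\<^sub>0 (\<lambda>\<nu>. P \<nu> \<and> Q \<nu>)"
  unfolding near_def by (metis mult_eq_0_iff tval_simps(2))

lemma near_ball: "finite A \<Longrightarrow> (\<And>a. a \<in> A \<Longrightarrow> near \<nu>\<^sub>0 (P a)) \<Longrightarrow> near \<nu>\<^sub>0 (\<lambda>\<nu>. \<forall>a\<in>A. P a \<nu>)"
  by (induction A rule: finite_induct) (simp_all add: near_all near_conj)

lemma near_nonzero: "tval \<nu>\<^sub>0 h \<noteq> 0 \<Longrightarrow> near \<nu>\<^sub>0 (\<lambda>\<nu>. tval \<nu> h \<noteq> 0)"
  unfolding near_def by blast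

lemma near_self: "near \<nu>\<^sub>0 P \<Longrightarrow> P \<nu>\<^sub>0"
  unfolding near_def by blast

definition regular_coeff :: "'i weight \<Rightarrow> ('i weight \<Rightarrow> qfield) \<Rightarrow> bool" where
  "regular_coeff \<nu>\<^sub>0 r \<longleftrightarrow> (\<exists>g h. tval \<nu>\<^sub>0 h \<noteq> 0 \<and> near \<nu>\<^sub>0 (\<lambda>\<nu>. r \<nu> = tval \<nu> g / tval \<nu> h))"

lemma regular_coeff_tval: "regular_coeff \<nu>\<^sub>0 (\<lambda>\<nu>. tval \<nu> z)"
  unfolding regular_coeff_def by (rule exI[of _ z], rule exI[of _ 1]) (simp add: near_all)

lemma regular_coeff_const: "regular_coeff \<nu>\<^sub>0 (\<lambda>\<nu>. c)"
  using regular_coeff_tval[of \<nu>\<^sub>0 "const c"] by simp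

lemma regular_coeff_mult:
  assumes "regular_coeff \<nu>\<^sub>0 r" "regular_coeff \<nu>\<^sub>0 s"
  shows "regular_coeff \<nu>\<^sub>0 (\<lambda>\<nu>. r \<nu> * s \<nu>)"
proof -
  obtain g h g' h' where *: "tval \<nu>\<^sub>0 h \<noteq> 0" "near \<nu>\<^sub>0 (\<lambda>\<nu>. r \<nu> = tval \<nu> g / tval \<nu> h)"
    "tval \<nu>\<^sub>0 h' \<noteq> 0" "near \<nu>\<^sub>0 (\<lambda>\<nu>. s \<nu> = tval \<nu> g' / tval \<nu> h')" using assms unfolding regular_coeff_def by blast
  have "near \<nu>\<^sub>0 (\<lambda>\<nu>. r \<nu> * s \<nu> = tval \<nu> (g * g') / tval \<nu> (h * h'))"
    by (rule near_mono[OF near_conj[OF *(2,4)]]) simp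
  then show ?thesis unfolding regular_coeff_def using *(1,3) by (intro exI[of _ "g * g'"] exI[of _ "h * h'"]) simp
qed

lemma regular_coeff_add:
  assumes "regular_coeff \<nu>\<^sub>0 r" "regular_coeff \<nu>\<^sub>0 s"
  shows "regular_coeff \<nu>\<^sub>0 (\<lambda>\<nu>. r \<nu> + s \<nu>)"
proof -
  obtain g h g' h' where *: "tval \<nu>\<^sub>0 h \<noteq> 0" "near \<nu>\<^sub>0 (\<lambda>\<nu>. r \<nu> = tval \<nu> g / tval \<nu> h)"
    "tval \<nu>\<^sub>0 h' \<noteq> 0" "near \<nu>\<^sub>0 (\<lambda>\<nu>. s \<nu> = tval \<nu> g' / tval \<nu> h')" using assms unfolding regular_coeff_def by blast
  have "near \<nu>\<^sub>0 (\<lambda>\<nu>. r \<nu> + s \<nu> = tval \<nu> (g * h' + g' * h) / tval \<nu> (h * h'))"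
    by (rule near_mono[OF near_conj[OF near_conj[OF *(2,4)] near_conj[OF near_nonzero[OF *(1)] near_nonzero[OF *(3)]]]])
      (simp add: add_frac_eq)
  then show ?thesis unfolding regular_coeff_def using *(1,3)
    by (intro exI[of _ "g * h' + g' * h"] exI[of _ "h * h'"]) simp
qed

lemma regular_coeff_uminus: "regular_coeff \<nu>\<^sub>0 r \<Longrightarrow> regular_coeff \<nu>\<^sub>0 (\<lambda>\<nu>. - r \<nu>)"
  using regular_coeff_mult[OF regular_coeff_const[of \<nu>\<^sub>0 "- 1"], of r] by simp

lemma regular_coeff_diff: "regular_coeff \<nu>\<^sub>0 r \<Longrightarrow> regular_coeff \<nu>\<^sub>0 s \<Longrightarrow> regular_coeff \<nu>\<^sub>0 (\<lambda>\<nu>. r \<nu> - s \<nu>)"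
  using regular_coeff_add[OF _ regular_coeff_uminus] by fastforce

lemma regular_coeff_near_nonzero:
  assumes "regular_coeff \<nu>\<^sub>0 r" "r \<nu>\<^sub>0 \<noteq> 0"
  shows "near \<nu>\<^sub>0 (\<lambda>\<nu>. r \<nu> \<noteq> 0)" "regular_coeff \<nu>\<^sub>0 (\<lambda>\<nu>. inverse (r \<nu>))"
proof -
  obtain g h where *: "tval \<nu>\<^sub>0 h \<noteq> 0" "near \<nu>\<^sub>0 (\<lambda>\<nu>. r \<nu> = tval \<nu> g / tval \<nu> h)"
    using assms(1) unfolding regular_coeff_def by blast
  have g: "tval \<nu>\<^sub>0 g \<noteq> 0" using near_self[OF *(2)] assms(2) by auto
  show "near \<nu>\<^sub>0 (\<lambda>\<nu>. r \<nu> \<noteq> 0)"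
    by (rule near_mono[OF near_conj[OF *(2) near_conj[OF near_nonzero[OF g] near_nonzero[OF *(1)]]]]) auto
  have "near \<nu>\<^sub>0 (\<lambda>\<nu>. inverse (r \<nu>) = tval \<nu> h / tval \<nu> g)"
    by (rule near_mono[OF *(2)]) simp
  then show "regular_coeff \<nu>\<^sub>0 (\<lambda>\<nu>. inverse (r \<nu>))" unfolding regular_coeff_def using g by blast
qed

lemma common_denominator:
  assumes "finite A" "\<And>a. a \<in> A \<Longrightarrow> regular_coeff \<nu>\<^sub>0 (r a)"
  shows "\<exists>h g. tval \<nu>\<^sub>0 h \<noteq> 0 \<and> near \<nu>\<^sub>0 (\<lambda>\<nu>. \<forall>a\<in>A. r a \<nu> = tval \<nu> (g a) / tval \<nu> h)"
  using assms
proof (induction A rule: finite_induct)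
  case empty
  show ?case by (rule exI[of _ 1]) (simp add: near_all)
next
  case (insert b A)
  then obtain h g where *: "tval \<nu>\<^sub>0 h \<noteq> 0" "near \<nu>\<^sub>0 (\<lambda>\<nu>. \<forall>a\<in>A. r a \<nu> = tval \<nu> (g a) / tval \<nu> h)" by auto
  obtain g' h' where b: "tval \<nu>\<^sub>0 h' \<noteq> 0" "near \<nu>\<^sub>0 (\<lambda>\<nu>. r b \<nu> = tval \<nu> g' / tval \<nu> h')"
    using insert.prems[of b] unfolding regular_coeff_def by auto
  have "near \<nu>\<^sub>0 (\<lambda>\<nu>. \<forall>a\<in>insert b A. r a \<nu> = tval \<nu> (if a = b then g' * h else g a * h') / tval \<nu> (h * h'))"
    by (rule near_mono[OF near_conj[OF near_conj[OF *(2) b(2)] near_conj[OF near_nonzero[OF *(1)] near_nonzero[OF b(1)]]]])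
      (use insert.hyps in auto)
  then show ?case using *(1) b(1) by (intro exI[of _ "h * h'"] exI[of _ "\<lambda>a. if a = b then g' * h else g a * h'"]) simp
qed

text \<open>A germ at \<open>\<nu>\<^sub>0\<close> of a map into a finite-dimensional subspace of
  \<open>FG\<close>. The identity is demanded for generic \<nu> near \<open>\<nu>\<^sub>0\<close>,
  where the inverse Gram matrices are meaningful.\<close>

definition regular_family :: "'i weight \<Rightarrow> ('i weight \<Rightarrow> 'i uq \<Rightarrow> qfield) \<Rightarrow> bool" where
  "regular_family \<nu>\<^sub>0 \<psi> \<longleftrightarrow> (\<exists>S r. finite S \<and> S \<subseteq> FG \<and> (\<forall>f\<in>S. regular_coeff \<nu>\<^sub>0 (r f)) \<and>
    near \<nu>\<^sub>0 (\<lambda>\<nu>. generic \<nu> \<longrightarrow> (\<forall>X. \<psi> \<nu> X = (\<Sum>f\<in>S. r f \<nu> * f X))))"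

lemma regular_family_cong:
  assumes "regular_family \<nu>\<^sub>0 \<psi>" "near \<nu>\<^sub>0 (\<lambda>\<nu>. generic \<nu> \<longrightarrow> \<psi>' \<nu> = \<psi> \<nu>)"
  shows "regular_family \<nu>\<^sub>0 \<psi>'"
proof -
  obtain S r where *: "finite S" "S \<subseteq> FG" "\<forall>f\<in>S. regular_coeff \<nu>\<^sub>0 (r f)"
    "near \<nu>\<^sub>0 (\<lambda>\<nu>. generic \<nu> \<longrightarrow> (\<forall>X. \<psi> \<nu> X = (\<Sum>f\<in>S. r f \<nu> * f X)))" using assms(1) unfolding regular_family_def by blast
  have "near \<nu>\<^sub>0 (\<lambda>\<nu>. generic \<nu> \<longrightarrow> (\<forall>X. \<psi>' \<nu> X = (\<Sum>f\<in>S. r f \<nu> * f X)))"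
    by (rule near_mono[OF near_conj[OF *(4) assms(2)]]) simp
  then show ?thesis unfolding regular_family_def using *(1-3) by blast
qed

lemma regular_family_const: "f \<in> FG \<Longrightarrow> regular_family \<nu>\<^sub>0 (\<lambda>\<nu>. f)"
  unfolding regular_family_def
  by (rule exI[of _ "{f}"], rule exI[of _ "\<lambda>_ _. 1"]) (simp add: regular_coeff_const near_all)

lemma regular_family_scale:
  assumes "regular_coeff \<nu>\<^sub>0 s" "regular_family \<nu>\<^sub>0 \<psi>"
  shows "regular_family \<nu>\<^sub>0 (\<lambda>\<nu> X. s \<nu> * \<psi> \<nu> X)"
proof -
  obtain S r where *: "finite S" "S \<subseteq> FG" "\<forall>f\<in>S. regular_coeff \<nu>\<^sub>0 (r f)"
    "near \<nu>\<^sub>0 (\<lambda>\<nu>. generic \<nu> \<longrightarrow> (\<forall>X. \<psi> \<nu> X = (\<Sum>f\<in>S. r f \<nu> * f X)))" using assms(2) unfolding regular_family_def by blast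
  have "near \<nu>\<^sub>0 (\<lambda>\<nu>. generic \<nu> \<longrightarrow> (\<forall>X. s \<nu> * \<psi> \<nu> X = (\<Sum>f\<in>S. (s \<nu> * r f \<nu>) * f X)))"
    by (rule near_mono[OF *(4)]) (simp add: sum_distrib_left mult.assoc)
  then show ?thesis unfolding regular_family_def using *(1-3) regular_coeff_mult[OF assms(1)]
    by (intro exI[of _ S] exI[of _ "\<lambda>f \<nu>. s \<nu> * r f \<nu>"]) simp
qed

lemma regular_family_add:
  assumes "regular_family \<nu>\<^sub>0 \<psi>" "regular_family \<nu>\<^sub>0 \<psi>'"
  shows "regular_family \<nu>\<^sub>0 (\<lambda>\<nu> X. \<psi> \<nu> X + \<psi>' \<nu> X)"
proof -
  obtain S r where *: "finite S" "S \<subseteq> FG" "\<forall>f\<in>S. regular_coeff \<nu>\<^sub>0 (r f)"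
    "near \<nu>\<^sub>0 (\<lambda>\<nu>. generic \<nu> \<longrightarrow> (\<forall>X. \<psi> \<nu> X = (\<Sum>f\<in>S. r f \<nu> * f X)))" using assms(1) unfolding regular_family_def by blast
  obtain S' r' where **: "finite S'" "S' \<subseteq> FG" "\<forall>f\<in>S'. regular_coeff \<nu>\<^sub>0 (r' f)"
    "near \<nu>\<^sub>0 (\<lambda>\<nu>. generic \<nu> \<longrightarrow> (\<forall>X. \<psi>' \<nu> X = (\<Sum>f\<in>S'. r' f \<nu> * f X)))" using assms(2) unfolding regular_family_def by blast
  let ?r = "\<lambda>f \<nu>. (if f \<in> S then r f \<nu> else 0) + (if f \<in> S' then r' f \<nu> else 0)"
  have ext: "(\<Sum>f\<in>S \<union> S'. ?r f \<nu> * f X) = (\<Sum>f\<in>S. r f \<nu> * f X) + (\<Sum>f\<in>S'. r' f \<nu> * f X)" for \<nu> X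
  proof -
    have "(\<Sum>f\<in>S. r f \<nu> * f X) = (\<Sum>f\<in>S \<union> S'. (if f \<in> S then r f \<nu> else 0) * f X)"
      using *(1) **(1) by (intro sum.mono_neutral_cong_left) auto
    moreover have "(\<Sum>f\<in>S'. r' f \<nu> * f X) = (\<Sum>f\<in>S \<union> S'. (if f \<in> S' then r' f \<nu> else 0) * f X)"
      using *(1) **(1) by (intro sum.mono_neutral_cong_left) auto
    ultimately show ?thesis by (simp add: distrib_right sum.distrib)
  qed
  have "near \<nu>\<^sub>0 (\<lambda>\<nu>. generic \<nu> \<longrightarrow> (\<forall>X. \<psi> \<nu> X + \<psi>' \<nu> X = (\<Sum>f\<in>S \<union> S'. ?r f \<nu> * f X)))"
    by (rule near_mono[OF near_conj[OF *(4) **(4)]]) (simp add: ext)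
  moreover have "regular_coeff \<nu>\<^sub>0 (?r f)" if "f \<in> S \<union> S'" for f
    using that *(3) **(3) by (cases "f \<in> S"; cases "f \<in> S'") (simp_all add: regular_coeff_add)
  ultimately show ?thesis unfolding regular_family_def using *(1,2) **(1,2) by (intro exI[of _ "S \<union> S'"] exI[of _ ?r]) simp
qed

lemma regular_family_sum:
  "finite A \<Longrightarrow> (\<And>a. a \<in> A \<Longrightarrow> regular_family \<nu>\<^sub>0 (\<psi> a)) \<Longrightarrow> regular_family \<nu>\<^sub>0 (\<lambda>\<nu> X. \<Sum>a\<in>A. \<psi> a \<nu> X)"
  by (induction A rule: finite_induct) (simp_all add: regular_family_const[OF FG_0] regular_family_add)

lemma regular_family_la:
  assumes "regular_family \<nu>\<^sub>0 \<psi>"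
  shows "regular_family \<nu>\<^sub>0 (\<lambda>\<nu>. la x (\<psi> \<nu>))"
proof -
  obtain S r where *: "finite S" "S \<subseteq> FG" "\<forall>f\<in>S. regular_coeff \<nu>\<^sub>0 (r f)"
    "near \<nu>\<^sub>0 (\<lambda>\<nu>. generic \<nu> \<longrightarrow> (\<forall>X. \<psi> \<nu> X = (\<Sum>f\<in>S. r f \<nu> * f X)))" using assms(1) unfolding regular_family_def by blast
  have "regular_family \<nu>\<^sub>0 (\<lambda>\<nu> X. \<Sum>f\<in>S. r f \<nu> * la x f X)"
    using * by (intro regular_family_sum regular_family_scale regular_family_const la_FG) auto
  moreover have "near \<nu>\<^sub>0 (\<lambda>\<nu>. generic \<nu> \<longrightarrow> la x (\<psi> \<nu>) = (\<lambda>X. \<Sum>f\<in>S. r f \<nu> * la x f X))"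
    by (rule near_mono[OF *(4)]) (auto intro!: uform_eqI simp: la_outside)
  ultimately show ?thesis by (rule regular_family_cong)
qed

text \<open>By elimination: a coefficient that does not vanish at \<open>\<nu>\<^sub>0\<close> is invertible near \<open>\<nu>\<^sub>0\<close>.\<close>

lemma regular_solution:
  fixes A :: "'l \<Rightarrow> 'x \<Rightarrow> 'i weight \<Rightarrow> qfield"
  assumes "finite I" and A: "\<And>l i. l \<in> L \<Longrightarrow> i \<in> I \<Longrightarrow> regular_coeff \<nu>\<^sub>0 (A l i)"
    and b: "\<And>l. l \<in> L \<Longrightarrow> regular_family \<nu>\<^sub>0 (b l)"
    and eq: "\<And>l. l \<in> L \<Longrightarrow> near \<nu>\<^sub>0 (\<lambda>\<nu>. generic \<nu> \<longrightarrow> (\<forall>X. (\<Sum>i\<in>I. A l i \<nu> * \<psi> i \<nu> X) = b l \<nu> X))"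
    and inj: "\<And>c. (\<And>l. l \<in> L \<Longrightarrow> (\<Sum>i\<in>I. A l i \<nu>\<^sub>0 * c i) = 0) \<Longrightarrow> \<forall>i\<in>I. c i = 0"
  shows "\<forall>i\<in>I. regular_family \<nu>\<^sub>0 (\<psi> i)"
  using assms
proof (induction I arbitrary: A b rule: finite_induct)
  case (insert k I)
  \<comment> \<open>A pivot exists, since otherwise the k-th unit vector would lie in the kernel at
    \<open>\<nu>\<^sub>0\<close>.\<close>
  obtain l0 where l0: "l0 \<in> L" "A l0 k \<nu>\<^sub>0 \<noteq> 0"
  proof (rule ccontr)
    assume "\<not> thesis"
    then have "(\<Sum>i\<in>insert k I. A l i \<nu>\<^sub>0 * (if i = k then 1 else 0)) = 0" if "l \<in> L" for l
      using that insert.hyps \<open>\<And>l0. l0 \<in> L \<Longrightarrow> A l0 k \<nu>\<^sub>0 \<noteq> 0 \<Longrightarrow> thesis\<close> by (simp add: if_distrib[of "\<lambda>x. _ * x"] cong: if_cong) blast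
    from insert.prems(4)[OF this] show False by simp
  qed
  let ?p = "A l0 k"
  note p = regular_coeff_near_nonzero[OF insert.prems(1)[OF l0(1), of k, simplified] l0(2)]
  let ?A = "\<lambda>l i \<nu>. A l i \<nu> - A l k \<nu> * inverse (?p \<nu>) * A l0 i \<nu>"
  let ?b = "\<lambda>l \<nu> X. b l \<nu> X + (- (A l k \<nu> * inverse (?p \<nu>))) * b l0 \<nu> X"
  have IH: "\<forall>i\<in>I. regular_family \<nu>\<^sub>0 (\<psi> i)"
  proof (rule insert.IH)
    show "regular_coeff \<nu>\<^sub>0 (?A l i)" if "l \<in> L" "i \<in> I" for l i
      using that insert.prems(1) p l0(1) by (intro regular_coeff_diff regular_coeff_mult) auto
    show "regular_family \<nu>\<^sub>0 (?b l)" if "l \<in> L" for l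
      using that insert.prems(1,2) p l0(1) by (intro regular_family_add regular_family_scale regular_coeff_uminus regular_coeff_mult) auto
    show "near \<nu>\<^sub>0 (\<lambda>\<nu>. generic \<nu> \<longrightarrow> (\<forall>X. (\<Sum>i\<in>I. ?A l i \<nu> * \<psi> i \<nu> X) = ?b l \<nu> X))" if "l \<in> L" for l
    proof (rule near_mono[OF near_conj[OF near_conj[OF insert.prems(3)[OF that] insert.prems(3)[OF l0(1)]] p(1)]], intro impI allI)
      fix \<nu> X
      assume *: "((generic \<nu> \<longrightarrow> (\<forall>X. (\<Sum>i\<in>insert k I. A l i \<nu> * \<psi> i \<nu> X) = b l \<nu> X)) \<and>
        (generic \<nu> \<longrightarrow> (\<forall>X. (\<Sum>i\<in>insert k I. A l0 i \<nu> * \<psi> i \<nu> X) = b l0 \<nu> X))) \<and> ?p \<nu> \<noteq> 0" "generic \<nu>"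
      have 1: "A l k \<nu> * \<psi> k \<nu> X + (\<Sum>i\<in>I. A l i \<nu> * \<psi> i \<nu> X) = b l \<nu> X"
        "?p \<nu> * \<psi> k \<nu> X + (\<Sum>i\<in>I. A l0 i \<nu> * \<psi> i \<nu> X) = b l0 \<nu> X" using * insert.hyps by simp_all
      have "(\<Sum>i\<in>I. ?A l i \<nu> * \<psi> i \<nu> X) = (\<Sum>i\<in>I. A l i \<nu> * \<psi> i \<nu> X) - A l k \<nu> * inverse (?p \<nu>) * (\<Sum>i\<in>I. A l0 i \<nu> * \<psi> i \<nu> X)"
        by (simp add: left_diff_distrib sum_subtractf sum_distrib_left mult.assoc)
      also have "\<dots> = ?b l \<nu> X"
        unfolding 1[symmetric] using * by (simp add: distrib_left)
      finally show "(\<Sum>i\<in>I. ?A l i \<nu> * \<psi> i \<nu> X) = ?b l \<nu> X" .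
    qed
    show "\<forall>i\<in>I. c i = 0" if c: "\<And>l. l \<in> L \<Longrightarrow> (\<Sum>i\<in>I. ?A l i \<nu>\<^sub>0 * c i) = 0" for c
    proof -
      \<comment> \<open>A kernel vector of the reduced system is extended by the k-th coordinate
        that the pivot equation dictates.\<close>
      let ?c = "c(k := - inverse (?p \<nu>\<^sub>0) * (\<Sum>i\<in>I. A l0 i \<nu>\<^sub>0 * c i))"
      have "(\<Sum>i\<in>insert k I. A l i \<nu>\<^sub>0 * ?c i) = 0" if "l \<in> L" for l
      proof -
        have "(\<Sum>i\<in>insert k I. A l i \<nu>\<^sub>0 * ?c i) = A l k \<nu>\<^sub>0 * ?c k + (\<Sum>i\<in>I. A l i \<nu>\<^sub>0 * c i)"
          using insert.hyps by (simp add: sum.insert) (intro sum.cong, auto)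
        also have "\<dots> = (\<Sum>i\<in>I. ?A l i \<nu>\<^sub>0 * c i)"
          by (simp add: left_diff_distrib sum_subtractf sum_distrib_left mult.assoc sum_negf)
        finally show ?thesis using c[OF that] by simp
      qed
      from insert.prems(4)[OF this] have "\<forall>i\<in>insert k I. ?c i = 0" .
      moreover have "i \<in> I \<Longrightarrow> ?c i = c i" for i using insert.hyps by auto
      ultimately show ?thesis by (metis insertI2)
    qed
  qed
  have "regular_family \<nu>\<^sub>0 (\<lambda>\<nu> X. inverse (?p \<nu>) * (b l0 \<nu> X + (\<Sum>i\<in>I. (- A l0 i \<nu>) * \<psi> i \<nu> X)))"
    using insert.prems(1,2) p l0(1) IH insert.hyps(1)
    by (intro regular_family_scale regular_family_add regular_family_sum regular_coeff_uminus) auto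
  moreover have "near \<nu>\<^sub>0 (\<lambda>\<nu>. generic \<nu> \<longrightarrow> \<psi> k \<nu> = (\<lambda>X. inverse (?p \<nu>) * (b l0 \<nu> X + (\<Sum>i\<in>I. (- A l0 i \<nu>) * \<psi> i \<nu> X))))"
  proof (rule near_mono[OF near_conj[OF insert.prems(3)[OF l0(1)] p(1)]], intro impI ext)
    fix \<nu> X
    assume *: "(generic \<nu> \<longrightarrow> (\<forall>X. (\<Sum>i\<in>insert k I. A l0 i \<nu> * \<psi> i \<nu> X) = b l0 \<nu> X)) \<and> ?p \<nu> \<noteq> 0" "generic \<nu>"
    then have "?p \<nu> * \<psi> k \<nu> X + (\<Sum>i\<in>I. A l0 i \<nu> * \<psi> i \<nu> X) = b l0 \<nu> X" using insert.hyps by simp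
    then show "\<psi> k \<nu> X = inverse (?p \<nu>) * (b l0 \<nu> X + (\<Sum>i\<in>I. (- A l0 i \<nu>) * \<psi> i \<nu> X))"
      using * by (simp add: sum_negf flip: \<open>_ = b l0 \<nu> X\<close>)
  qed
  ultimately have "regular_family \<nu>\<^sub>0 (\<psi> k)" by (rule regular_family_cong)
  with IH show ?case by simp
qed simp

end

section \<open>Bases of the weight spaces and the Shapovalov form\<close>

context finite_cartan_datum
begin

definition lin_comb :: "(nat \<Rightarrow> qfield) \<Rightarrow> 'g falg list \<Rightarrow> 'g falg" where
  "lin_comb c xs = (\<Sum>i<length xs. const (c i) * xs ! i)"

lemma lin_comb_simps [simp]: "lin_comb c [] = 0"
  "lin_comb c (x # xs) = const (c 0) * x + lin_comb (\<lambda>i. c (Suc i)) xs"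
  unfolding lin_comb_def length_Cons by (simp, subst sum.lessThan_Suc_shift, simp)

lemma Span_map_proj: "ring.Span Uq (range scalar) (map proj xs) = range (\<lambda>c. proj (lin_comb c xs))"
proof (induction xs)
  case Nil
  show ?case by (simp add: ring.Span.simps[OF ring_Uq] proj_0)
next
  case (Cons x xs)
  have "ring.Span Uq (range scalar) (map proj (x # xs))
    = ring.line_extension Uq (range scalar) (proj x) (range (\<lambda>c. proj (lin_comb c xs)))"
    using Cons by (simp add: ring.Span.simps[OF ring_Uq])
  also have "\<dots> = range (\<lambda>c. proj (lin_comb c (x # xs)))"
  proof (intro equalityI subsetI)
    fix u assume "u \<in> ring.line_extension Uq (range scalar) (proj x) (range (\<lambda>c. proj (lin_comb c xs)))"
    then obtain c0 c where "u = scalar c0 \<otimes>\<^bsub>Uq\<^esub> proj x \<oplus>\<^bsub>Uq\<^esub> proj (lin_comb c xs)"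
      by (auto simp: ring.line_extension_mem_iff[OF ring_Uq])
    then have "u = proj (lin_comb (case_nat c0 c) (x # xs))" by (simp add: scalar_proj proj_mult proj_add)
    then show "u \<in> range (\<lambda>c. proj (lin_comb c (x # xs)))" by blast
  next
    fix u assume "u \<in> range (\<lambda>c. proj (lin_comb c (x # xs)))"
    then obtain c where "u = scalar (c 0) \<otimes>\<^bsub>Uq\<^esub> proj x \<oplus>\<^bsub>Uq\<^esub> proj (lin_comb (\<lambda>i. c (Suc i)) xs)"
      by (auto simp: scalar_proj proj_mult proj_add)
    then show "u \<in> ring.line_extension Uq (range scalar) (proj x) (range (\<lambda>c. proj (lin_comb c xs)))"
      by (auto simp: ring.line_extension_mem_iff[OF ring_Uq])
  qed
  finally show ?case .
qed

lemma lin_comb_scale: "const b * lin_comb c xs = lin_comb (\<lambda>i. b * c i) xs"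
  by (simp add: lin_comb_def sum_distrib_left fa.cst_mult mult.assoc)

lemma independent_map_proj:
  "ring.independent Uq (range scalar) (map proj xs) \<Longrightarrow> lin_comb c xs \<approx> 0 \<Longrightarrow> i < length xs \<Longrightarrow> c i = 0"
proof (induction xs arbitrary: c i)
  case (Cons x xs)
  have ind: "proj x \<notin> ring.Span Uq (range scalar) (map proj xs)" "ring.independent Uq (range scalar) (map proj xs)"
    using Cons.prems(1) by (auto elim: ring.independent.cases[OF ring_Uq])
  have c0: "c 0 = 0"
  proof (rule ccontr)
    assume c0: "c 0 \<noteq> 0"
    have "x = const (inverse (c 0)) * (lin_comb c (x # xs) - lin_comb (\<lambda>i. c (Suc i)) xs)"
      using c0 by (simp flip: fa.sc_def)
    also have "\<dots> \<approx> const (inverse (c 0)) * (0 - lin_comb (\<lambda>i. c (Suc i)) xs)"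
      by (intro ueq_lmult ueq_diff Cons.prems(2) ueq_refl)
    also have "\<dots> = const (- inverse (c 0)) * lin_comb (\<lambda>i. c (Suc i)) xs" by (simp add: const_uminus)
    finally have "proj x = proj (lin_comb (\<lambda>i. - inverse (c 0) * c (Suc i)) xs)" unfolding lin_comb_scale by (simp add: proj_eq_iff)
    then show False using ind(1) unfolding Span_map_proj by blast
  qed
  then have "lin_comb (\<lambda>i. c (Suc i)) xs \<approx> 0" using Cons.prems(2) by simp
  then show ?case using Cons.IH[OF ind(2), of "\<lambda>i. c (Suc i)"] Cons.prems(3) c0 by (cases i) auto
qed simp

lemma inf_lin_comb: "inf_alg (lin_comb c zs) = lin_comb c (map inf_alg zs)"
  by (simp add: lin_comb_def inf_alg_sum)

definition is_basis :: "'i weight \<Rightarrow> 'i uq list \<Rightarrow> 'i falg list \<Rightarrow> bool" where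
  "is_basis \<beta> ys zs \<longleftrightarrow> ys = map (\<lambda>z. proj (inf_alg z)) zs \<and> (\<forall>z\<in>set zs. homog \<beta> z)
    \<and> (\<forall>x. homog \<beta> x \<longrightarrow> (\<exists>c. x \<doteq> lin_comb c zs)) \<and> (\<forall>c. lin_comb c zs \<doteq> 0 \<longrightarrow> (\<forall>i<length zs. c i = 0))"

lemma weight_basis_exists:
  assumes "weight_bases y" "\<beta> \<in> Q_plus"
  shows "\<exists>zs. is_basis \<beta> (y \<beta>) zs"
proof -
  have ind: "ring.independent Uq (range scalar) (y \<beta>)" and sp: "ring.Span Uq (range scalar) (y \<beta>) = U_minus_weight \<beta>"
    using assms by (auto simp: weight_bases_def)
  have "\<exists>xs. y \<beta> = map proj xs"
    using ring.independent_in_carrier[OF ring_Uq ind] by (intro exI[of _ "map rep (y \<beta>)"]) (simp add: proj_rep subset_eq map_idI)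
  then obtain xs where xs: "y \<beta> = map proj xs" by blast
  have "Y \<in> U_minus_weight \<beta>" if "Y \<in> set (y \<beta>)" for Y
  proof -
    obtain i where i: "i < length xs" "Y = proj (xs ! i)" using \<open>Y \<in> set (y \<beta>)\<close> by (auto simp: xs in_set_conv_nth)
    have "lin_comb (\<lambda>j. if j = i then 1 else 0) xs = (\<Sum>j<length xs. if j = i then xs ! j else 0)"
      unfolding lin_comb_def by (rule sum.cong) (simp_all add: fa.cst_1)
    also have "\<dots> = xs ! i" using i by simp
    finally show ?thesis unfolding sp[symmetric] xs Span_map_proj i(2) by (metis rangeI)
  qed
  then have "\<forall>Y\<in>set (y \<beta>). \<exists>z. Y = proj (inf_alg z) \<and> homog \<beta> z" by (auto simp: U_minus_weight_eq)
  then obtain f where f: "\<And>Y. Y \<in> set (y \<beta>) \<Longrightarrow> Y = proj (inf_alg (f Y)) \<and> homog \<beta> (f Y)" by metis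
  define zs where "zs = map f (y \<beta>)"
  have ys: "y \<beta> = map (\<lambda>z. proj (inf_alg z)) zs" using f by (simp add: zs_def o_def map_idI)
  then have ys': "y \<beta> = map proj (map inf_alg zs)" by simp
  show ?thesis
    unfolding is_basis_def
  proof (intro exI[of _ zs] conjI allI impI ys)
    show "\<forall>z\<in>set zs. homog \<beta> z" using f by (auto simp: zs_def)
    show "\<exists>c. x \<doteq> lin_comb c zs" if "homog \<beta> x" for x
    proof -
      have "proj (inf_alg x) \<in> range (\<lambda>c. proj (lin_comb c (map inf_alg zs)))"
        unfolding Span_map_proj[symmetric] ys'[symmetric] sp U_minus_weight_eq using that by blast
      then show ?thesis by (auto simp: proj_eq_iff inf_ueq_iff simp flip: inf_lin_comb)
    qed
    show "c i = 0" if "lin_comb c zs \<doteq> 0" "i < length zs" for c i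
    proof (rule independent_map_proj[OF ind[unfolded ys']])
      show "lin_comb c (map inf_alg zs) \<approx> 0" using that(1) inf_ueq_iff[of "lin_comb c zs" 0] by (simp add: inf_lin_comb)
    qed (use that(2) in simp)
  qed
qed

section \<open>The Shapovalov form on the free algebra\<close>

definition sform :: "'i weight \<Rightarrow> 'i falg \<Rightarrow> 'i falg \<Rightarrow> qfield" where
  "sform \<nu> x y = qv \<nu> (an (th (inf_alg x)) * inf_alg y)"

lemma sform_simps [simp]: "sform \<nu> (x + x') y = sform \<nu> x y + sform \<nu> x' y" "sform \<nu> (const c * x) y = c * sform \<nu> x y"
  "sform \<nu> x (y + y') = sform \<nu> x y + sform \<nu> x y'" "sform \<nu> x (const c * y) = c * sform \<nu> x y" "sform \<nu> 0 y = 0" "sform \<nu> x 0 = 0"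
  by (simp_all add: sform_def distrib_left distrib_right fa.cst_central[of c "an _", symmetric] mult.assoc) (simp_all add: qv_def)

lemma sform_cong: "x \<doteq> x' \<Longrightarrow> sform \<nu> x y = sform \<nu> x' y" "y \<doteq> y' \<Longrightarrow> sform \<nu> x y = sform \<nu> x y'"
proof -
  show "sform \<nu> x y = sform \<nu> x y'" if "y \<doteq> y'"
    unfolding sform_def by (intro qv_cong ueq_lmult) (use that inf_ueq_iff in blast)
  show "sform \<nu> x y = sform \<nu> x' y" if "x \<doteq> x'"
  proof -
    have "inf_alg x - inf_alg x' \<in> relation_ideal" using that inf_ueq_iff by (simp add: ueq_def)
    from an_relation_ideal[OF th_relation_ideal[OF this]] show ?thesis
      unfolding sform_def by (intro qv_cong ueq_rmult) (simp add: ueq_def)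
  qed
qed

lemma sform_lin_comb: "sform \<nu> (lin_comb c xs) y = (\<Sum>i<length xs. c i * sform \<nu> (xs ! i) y)"
  "sform \<nu> y (lin_comb c xs) = (\<Sum>i<length xs. c i * sform \<nu> y (xs ! i))"
proof -
  have "sform \<nu> (sum f A) y = (\<Sum>i\<in>A. sform \<nu> (f i) y)" "sform \<nu> y (sum f A) = (\<Sum>i\<in>A. sform \<nu> y (f i))" for f and A :: "nat set"
    by (induction A rule: infinite_finite_induct) simp_all
  then show "sform \<nu> (lin_comb c xs) y = (\<Sum>i<length xs. c i * sform \<nu> (xs ! i) y)"
    "sform \<nu> y (lin_comb c xs) = (\<Sum>i<length xs. c i * sform \<nu> y (xs ! i))" by (simp_all add: lin_comb_def)
qed

text \<open>Contravariance: \<open>omega\<close> sends f_k to k_k^(-1) e_k, so e_k is adjoint to f_k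
  up to an invertible scalar, the value of k_k^(-1) on the weight of e_k y.\<close>

lemma sform_step:
  assumes "homog \<gamma> y"
  shows "sform \<nu> (word [k] * z) y = qpow (- ip (\<nu> - (\<gamma> - simple_root k)) (simple_root k)) * sform \<nu> z (app (eop \<nu> k) y)"
proof -
  have m: "an (- x) = - an x" for x using an_simps(2)[of 0 x] by simp
  have e: "homog (\<gamma> - simple_root k) (app (eop \<nu> k) y)" by (rule eop_homog[OF assms])
  have "app (act \<nu> (word (kword k (- 1)))) (app (eop \<nu> k) y)
    = const (qpow (- ip (\<nu> - (\<gamma> - simple_root k)) (simple_root k))) * app (eop \<nu> k) y"
    by (simp add: act_tword tword_kword texp_weight_kword diag_homog[OF e])
  then show ?thesis by (simp add: sform_def m qv_def)
qed

lemma Q_plus_induct [consumes 1, case_names step]: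
  assumes "\<gamma> \<in> Q_plus"
    and step: "\<And>\<gamma>. \<gamma> \<in> Q_plus \<Longrightarrow> (\<And>k. \<gamma> - simple_root k \<in> Q_plus \<Longrightarrow> P (\<gamma> - simple_root k)) \<Longrightarrow> P \<gamma>"
  shows "P \<gamma>"
proof -
  have "\<forall>\<gamma>\<in>Q_plus. height \<gamma> = of_nat n \<longrightarrow> P \<gamma>" for n
  proof (induction n rule: less_induct)
    case (less n)
    show ?case
    proof (intro ballI impI)
      fix \<gamma> assume \<gamma>: "\<gamma> \<in> Q_plus" "height \<gamma> = of_nat n"
      show "P \<gamma>"
      proof (rule step[OF \<gamma>(1)])
        fix k assume k: "\<gamma> - simple_root k \<in> Q_plus"
        obtain m where m: "height (\<gamma> - simple_root k) = of_nat m" using height_nat[OF k] by (auto elim: Nats_cases)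
        have "height \<gamma> = of_nat m + 1" using height_add[of "\<gamma> - simple_root k" 1 k] m by simp
        then have "rat_of_nat n = of_nat (Suc m)" using \<gamma>(2) by simp
        then have "m < n" unfolding of_nat_eq_iff by simp
        then show "P (\<gamma> - simple_root k)" using less k m by blast
      qed
    qed
  qed
  moreover obtain n where "height \<gamma> = of_nat n" using height_nat[OF assms(1)] by (auto elim: Nats_cases)
  ultimately show ?thesis using assms(1) by blast
qed

text \<open>If x is orthogonal to its weight space, then by contravariance so is every e_k x, which
  is zero by induction. A nonzero x would thus be singular, and generic \<nu> admits no singular
  vectors except in weight \<nu>.\<close>

lemma sform_nondegenerate:
  assumes \<nu>: "generic \<nu>" and "\<gamma> \<in> Q_plus" "homog \<gamma> x" "\<And>z. homog \<gamma> z \<Longrightarrow> sform \<nu> z x = 0"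
  shows "x \<in> serre_ideal"
  using assms(2-)
proof (induction \<gamma> arbitrary: x rule: Q_plus_induct)
  case (step \<gamma>)
  show ?case
  proof (cases "\<gamma> = 0")
    case True
    have "x = const (vac x)" using step.prems(1) True homog_zero_weight by blast
    moreover have "sform \<nu> 1 x = vac x" by (simp add: sform_def qv_def)
    ultimately show ?thesis using step.prems(2)[of 1] homog_1 True serre_ideal.zero by simp
  next
    case False
    show ?thesis
    proof (rule ccontr)
      assume x: "x \<notin> serre_ideal"
      have "app (eop \<nu> k) x \<in> serre_ideal" for k
      proof (cases "\<gamma> - simple_root k \<in> Q_plus")
        case True
        show ?thesis
        proof (rule step.IH[OF True eop_homog[OF step.prems(1)]])
          fix z assume "homog (\<gamma> - simple_root k) z"
          then have "homog \<gamma> (word [k] * z)" using homog_mult[OF homog_gen, of _ z k] by fastforce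
          from step.prems(2)[OF this] show "sform \<nu> z (app (eop \<nu> k) x) = 0"
            unfolding sform_step[OF step.prems(1)] by simp
        qed
      next
        case F: False
        show ?thesis using homog_not_Q_plus[OF eop_homog[OF step.prems(1)] F] serre_ideal.zero by simp
      qed
      then have "singular \<nu> \<gamma>" using x step.prems(1) by (auto simp: singular_def sing_def)
      then show False using generic_no_singular[OF \<nu> False] by blast
    qed
  qed
qed

text \<open>A kernel vector of the Gram matrix would be an element of the radical, so the
  determinant is nonzero and \<open>mat_inverse\<close> does return an inverse under
  \<open>the\<close>.\<close>

lemma gram_inverse:
  assumes \<nu>: "generic \<nu>" and \<beta>: "\<beta> \<in> Q_plus" and zs: "is_basis \<beta> ys zs"
    and j: "j < length zs" and l: "l < length zs"
  shows "(\<Sum>i<length zs. sform \<nu> (zs ! j) (zs ! i) * (the (mat_inverse (gram \<nu> ys)) $$ (i, l))) = (if j = l then 1 else 0)"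
proof -
  let ?n = "length zs" and ?G = "gram \<nu> ys"
  have G: "?G \<in> carrier_mat ?n ?n" using zs by (simp add: gram_def is_basis_def)
  have Gij: "?G $$ (i, k) = sform \<nu> (zs ! i) (zs ! k)" if "i < ?n" "k < ?n" for i k
    using that zs by (simp add: gram_def is_basis_def shapovalov_proj sform_def)
  have "Determinant.det ?G \<noteq> 0"
  proof
    assume "Determinant.det ?G = 0"
    then obtain v where v: "v \<in> carrier_vec ?n" "v \<noteq> 0\<^sub>v ?n" "?G *\<^sub>v v = 0\<^sub>v ?n"
      using det_0_iff_vec_prod_zero_field[OF G] by blast
    let ?x = "lin_comb (Matrix.vec_index v) zs"
    have hx: "homog \<beta> ?x" using zs unfolding lin_comb_def is_basis_def by (intro homog_sum homog_scale) simp
    have row: "sform \<nu> (zs ! i) ?x = 0" if "i < ?n" for i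
    proof -
      have "0 = Matrix.vec_index (?G *\<^sub>v v) i" using v(3) that by simp
      also have "\<dots> = (\<Sum>k<?n. ?G $$ (i, k) * Matrix.vec_index v k)"
        using that G v(1) by (simp add: scalar_prod_def atLeast0LessThan)
      also have "\<dots> = sform \<nu> (zs ! i) ?x" using that by (simp add: sform_lin_comb Gij mult.commute)
      finally show ?thesis by simp
    qed
    have "?x \<in> serre_ideal"
    proof (rule sform_nondegenerate[OF \<nu> \<beta> hx])
      fix z assume "homog \<beta> z"
      then obtain c where c: "z \<doteq> lin_comb c zs" using zs by (auto simp: is_basis_def)
      show "sform \<nu> z ?x = 0" unfolding sform_cong(1)[OF c] sform_lin_comb(1) using row by simp
    qed
    then have "\<forall>i<?n. Matrix.vec_index v i = 0" using zs by (simp add: is_basis_def eqv_def)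
    then have "v = 0\<^sub>v ?n" using v(1) by (intro eq_vecI) auto
    then show False using v(2) by simp
  qed
  then have "?G \<in> Units (ring_mat TYPE(qfield) ?n ())" by (rule det_non_zero_imp_unit[OF G])
  then obtain B where B: "mat_inverse ?G = Some B" using mat_inverse(1)[OF G, where b = "()"] by fastforce
  have B': "?G * B = 1\<^sub>m ?n" "B \<in> carrier_mat ?n ?n" using mat_inverse(2)[OF G B] by auto
  have "(\<Sum>i<?n. ?G $$ (j, i) * (B $$ (i, l))) = (?G * B) $$ (j, l)"
    using G B'(2) j l by (simp add: scalar_prod_def atLeast0LessThan)
  also have "\<dots> = (if j = l then 1 else 0)" using B'(1) j l by simp
  finally show ?thesis using j by (simp add: Gij B)
qed

end

section \<open>Regularity of \<open>J\<close>\<close>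

context finite_cartan_datum
begin

lemma la_sum: "uform f \<Longrightarrow> la (sum g A) f X = (\<Sum>b\<in>A. la (g b) f X)"
  by (induction A rule: infinite_finite_induct) (simp_all add: la_linear)

lemma la_zero: "la x (\<lambda>_. 0) = (\<lambda>_. 0)"
  by (rule uform_eqI) (simp_all add: la_outside)

lemma la_1: "uform f \<Longrightarrow> la 1 f = f"
  by (rule uform_eqI) (simp_all add: la_outside uform_def)

lemma th_inf_cong: "x \<doteq> y \<Longrightarrow> la (th (inf_alg x)) f = la (th (inf_alg y)) f"
proof (rule la_cong)
  assume "x \<doteq> y"
  then have "inf_alg x - inf_alg y \<in> relation_ideal" using inf_ueq_iff by (simp add: ueq_def)
  from th_relation_ideal[OF this] show "th (inf_alg x) \<approx> th (inf_alg y)" by (simp add: ueq_def)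
qed

lemma th_sum: "th (sum f A) = (\<Sum>b\<in>A. th (f b))"
  by (induction A rule: infinite_finite_induct) simp_all

lemma la_lin_comb:
  "uform f \<Longrightarrow> la (th (inf_alg (lin_comb c zs))) f X = (\<Sum>i<length zs. c i * la (th (inf_alg (zs ! i))) f X)"
  by (simp add: lin_comb_def inf_alg_sum th_sum la_sum la_linear)

definition bas :: "('i weight \<Rightarrow> 'i uq list) \<Rightarrow> 'i weight \<Rightarrow> 'i falg list" where
  "bas y \<beta> = (SOME zs. is_basis \<beta> (y \<beta>) zs)"

lemma bas: "weight_bases y \<Longrightarrow> \<beta> \<in> Q_plus \<Longrightarrow> is_basis \<beta> (y \<beta>) (bas y \<beta>)"
  unfolding bas_def by (rule someI_ex) (rule weight_basis_exists)

text \<open>\<open>J(\<nu>)\<close> is \<open>\<Sum>\<^sub>\<beta> \<Sum>\<^sub>i y\<^sub>\<beta>\<^sup>i \<otimes> psi \<beta> i \<nu>\<close>.\<close>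

definition psi :: "('i weight \<Rightarrow> 'i uq list) \<Rightarrow> ('i uq \<Rightarrow> qfield) \<Rightarrow> 'i weight \<Rightarrow> nat \<Rightarrow> 'i weight \<Rightarrow> 'i uq \<Rightarrow> qfield" where
  "psi y f \<beta> i \<nu> X = (\<Sum>j<length (bas y \<beta>).
    (the (mat_inverse (gram \<nu> (y \<beta>))) $$ (i, j)) * la (th (inf_alg (bas y \<beta> ! j))) f X)"

text \<open>Pairing the left factor of J with x gives \<theta>(x) f. This characterises the
  coefficients without mention of the inverse matrix, and all further work relies on it.\<close>

lemma psi_system:
  assumes y: "weight_bases y" and f: "uform f" and \<nu>: "generic \<nu>" and \<beta>: "\<beta> \<in> Q_plus" and x: "homog \<beta> x"
  shows "(\<Sum>i<length (bas y \<beta>). sform \<nu> x (bas y \<beta> ! i) * psi y f \<beta> i \<nu> X) = la (th (inf_alg x)) f X"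
proof -
  let ?zs = "bas y \<beta>" and ?B = "the (mat_inverse (gram \<nu> (y \<beta>)))"
  let ?n = "length ?zs" and ?t = "\<lambda>j. la (th (inf_alg (?zs ! j))) f X"
  note zs = bas[OF y \<beta>]
  obtain c where c: "x \<doteq> lin_comb c ?zs" using zs x by (auto simp: is_basis_def)
  have "(\<Sum>i<?n. sform \<nu> x (?zs ! i) * psi y f \<beta> i \<nu> X)
    = (\<Sum>i<?n. \<Sum>l<?n. \<Sum>j<?n. c j * (sform \<nu> (?zs ! j) (?zs ! i) * (?B $$ (i, l))) * ?t l)"
    unfolding psi_def sform_cong(1)[OF c] sform_lin_comb(1) sum_distrib_left
    by (intro sum.cong refl) (simp add: sum_distrib_right mult.assoc)
  also have "\<dots> = (\<Sum>l<?n. \<Sum>i<?n. \<Sum>j<?n. c j * (sform \<nu> (?zs ! j) (?zs ! i) * (?B $$ (i, l))) * ?t l)"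
    by (rule sum.swap)
  also have "\<dots> = (\<Sum>l<?n. \<Sum>j<?n. \<Sum>i<?n. c j * (sform \<nu> (?zs ! j) (?zs ! i) * (?B $$ (i, l))) * ?t l)"
    by (rule sum.cong[OF refl], rule sum.swap)
  also have "\<dots> = (\<Sum>l<?n. \<Sum>j<?n. c j * (\<Sum>i<?n. sform \<nu> (?zs ! j) (?zs ! i) * (?B $$ (i, l))) * ?t l)"
    by (simp only: sum_distrib_left sum_distrib_right)
  also have "\<dots> = (\<Sum>l<?n. \<Sum>j<?n. c j * (if j = l then 1 else 0) * ?t l)"
    by (intro sum.cong refl) (simp add: gram_inverse[OF \<nu> \<beta> zs])
  also have "\<dots> = (\<Sum>l<?n. c l * ?t l)"
    by (intro sum.cong refl) (simp add: if_distrib[of "\<lambda>x. _ * x"] if_distrib[of "\<lambda>x. x * _"] cong: if_cong)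
  also have "\<dots> = la (th (inf_alg x)) f X" unfolding th_inf_cong[OF c] la_lin_comb[OF f] ..
  finally show ?thesis .
qed

text \<open>Pair both sides with an arbitrary z of weight \<beta> - \<alpha>_k. By contravariance
  e_k on the left becomes f_k z, and \<open>psi_system\<close> turns this into \<theta>(f_k z) f =
  -e_k \<theta>(z) f, whence the sign. For generic \<nu> the form is nondegenerate, so the
  coefficients themselves agree.\<close>

lemma psi_recursion:
  assumes y: "weight_bases y" and f: "uform f" and \<nu>: "generic \<nu>" and \<beta>: "\<beta> \<in> Q_plus" and \<gamma>: "\<beta> - simple_root k \<in> Q_plus"
    and C: "\<And>i. i < length (bas y \<beta>) \<Longrightarrow> app (eop \<nu> k) (bas y \<beta> ! i) \<doteq> lin_comb (\<lambda>l. C l i) (bas y (\<beta> - simple_root k))"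
    and l: "l < length (bas y (\<beta> - simple_root k))"
  shows "(\<Sum>i<length (bas y \<beta>). C l i * psi y f \<beta> i \<nu> X)
    = - qpow (ip (\<nu> - (\<beta> - simple_root k)) (simple_root k)) * la (word [Gen_e k]) (psi y f (\<beta> - simple_root k) l \<nu>) X"
proof (cases "X \<in> carrier Uq")
  case False
  then show ?thesis by (simp add: psi_def la_outside)
next
  case True
  then obtain x where X: "X = proj x" by (auto simp: carrier_Uq)
  let ?\<gamma> = "\<beta> - simple_root k" and ?q = "qpow (ip (\<nu> - (\<beta> - simple_root k)) (simple_root k))"
  let ?m = "length (bas y ?\<gamma>)" and ?n = "length (bas y \<beta>)"
  \<comment> \<open>The difference of the two sides for each basis index l; the combination of the
    basis with these coefficients is shown to be orthogonal to its weight space.\<close>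
  let ?D = "\<lambda>l. (\<Sum>i<?n. C l i * psi y f \<beta> i \<nu> X) + ?q * psi y f ?\<gamma> l \<nu> (proj (x * word [Gen_e k]))"
  note zs = bas[OF y \<beta>] and zs' = bas[OF y \<gamma>]
  have "lin_comb ?D (bas y ?\<gamma>) \<in> serre_ideal"
  proof (rule sform_nondegenerate[OF \<nu> \<gamma>])
    show "homog ?\<gamma> (lin_comb ?D (bas y ?\<gamma>))"
      using zs' unfolding lin_comb_def is_basis_def by (intro homog_sum homog_scale) simp
    fix z assume z: "homog ?\<gamma> z"
    then have kz: "homog \<beta> (word [k] * z)" using homog_mult[OF homog_gen[of k] z] by simp
    have E: "sform \<nu> z (app (eop \<nu> k) (bas y \<beta> ! i)) = ?q * sform \<nu> (word [k] * z) (bas y \<beta> ! i)" if "i < ?n" for i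
      using zs that by (subst sform_step[of \<beta>]) (auto simp: is_basis_def qpow_minus)
    have "(\<Sum>l<?m. (\<Sum>i<?n. C l i * psi y f \<beta> i \<nu> X) * sform \<nu> z (bas y ?\<gamma> ! l))
      = (\<Sum>l<?m. \<Sum>i<?n. C l i * sform \<nu> z (bas y ?\<gamma> ! l) * psi y f \<beta> i \<nu> X)"
      by (simp add: sum_distrib_right sum_distrib_left mult_ac)
    also have "\<dots> = (\<Sum>i<?n. sform \<nu> z (lin_comb (\<lambda>l. C l i) (bas y ?\<gamma>)) * psi y f \<beta> i \<nu> X)"
      by (subst sum.swap) (simp add: sform_lin_comb(2) sum_distrib_right)
    also have "\<dots> = (\<Sum>i<?n. ?q * (sform \<nu> (word [k] * z) (bas y \<beta> ! i) * psi y f \<beta> i \<nu> X))"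
    proof (intro sum.cong refl)
      fix i assume "i \<in> {..<?n}"
      then show "sform \<nu> z (lin_comb (\<lambda>l. C l i) (bas y ?\<gamma>)) * psi y f \<beta> i \<nu> X
        = ?q * (sform \<nu> (word [k] * z) (bas y \<beta> ! i) * psi y f \<beta> i \<nu> X)"
        using E[of i] by (simp add: mult.assoc flip: sform_cong(2)[OF C[of i]])
    qed
    also have "\<dots> = ?q * la (th (inf_alg (word [k] * z))) f X"
      using psi_system[OF y f \<nu> \<beta> kz, of X] by (simp flip: sum_distrib_left)
    also have "\<dots> = - ?q * la (th (inf_alg z)) f (proj (x * word [Gen_e k]))"
      using la_linear(4)[OF f, of "word [Gen_e k] * th (inf_alg z)" X] by (simp add: X mult.assoc)
    also have "\<dots> = - (\<Sum>l<?m. ?q * psi y f ?\<gamma> l \<nu> (proj (x * word [Gen_e k])) * sform \<nu> z (bas y ?\<gamma> ! l))"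
      using psi_system[OF y f \<nu> \<gamma> z, of "proj (x * word [Gen_e k])"] by (simp add: mult_ac flip: sum_distrib_left)
    finally show "sform \<nu> z (lin_comb ?D (bas y ?\<gamma>)) = 0"
      by (simp add: sform_lin_comb(2) distrib_right sum.distrib)
  qed
  then have "?D l = 0" using zs' l unfolding is_basis_def eqv_0 by blast
  then show ?thesis by (simp add: X eq_neg_iff_add_eq_0)
qed

text \<open>This power of q is the value of q^\<nu> at k_k^s, an element of U^0.\<close>

lemma regular_coeff_qpow: "regular_coeff \<nu>\<^sub>0 (\<lambda>\<nu>. qpow (of_int s * ip \<nu> (simple_root k)))"
proof -
  obtain w where w: "kword k s = map t_letter w" using tword_kword tword_iff by blast
  have "tval \<nu> (word w) = qpow (of_int s * ip \<nu> (simple_root k))" for \<nu>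
    using qchar_tword[OF tword_kword, of \<nu> k s] by (simp add: tval_def texp_weight_kword flip: w)
  then show ?thesis using regular_coeff_tval[of \<nu>\<^sub>0 "word w"] by simp
qed

lemma psi_regular:
  assumes y: "weight_bases y" and f: "f \<in> FG"
    and vanish: "\<And>\<beta> x. \<beta> \<noteq> 0 \<Longrightarrow> singular \<nu>\<^sub>0 \<beta> \<Longrightarrow> homog \<beta> x \<Longrightarrow> la (th (inf_alg x)) f = (\<lambda>_. 0)"
    and \<beta>: "\<beta> \<in> Q_plus"
  shows "\<forall>i<length (bas y \<beta>). regular_family \<nu>\<^sub>0 (psi y f \<beta> i)"
  using \<beta>
proof (induction \<beta> rule: Q_plus_induct)
  case (step \<beta>)
  let ?zs = "bas y \<beta>"
  let ?n = "length ?zs"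
  note zs = bas[OF y step.hyps] and uf = FG_uform[OF f]
  have hom: "homog \<beta> (?zs ! i)" if "i < ?n" for i using zs that by (simp add: is_basis_def)
  have indep: "\<forall>i\<in>{..<?n}. c i = 0" if "lin_comb c ?zs \<in> serre_ideal" for c using zs that by (simp add: is_basis_def eqv_0)
  have homc: "homog \<beta> (lin_comb c ?zs)" for c using hom unfolding lin_comb_def by (intro homog_sum homog_scale) simp
  consider "\<beta> = 0" | "\<beta> \<noteq> 0" "singular \<nu>\<^sub>0 \<beta>" | "\<not> singular \<nu>\<^sub>0 \<beta>" by blast
  then have "\<forall>i\<in>{..<?n}. regular_family \<nu>\<^sub>0 (psi y f \<beta> i)"
  proof cases
    case 1
    have s1: "sform \<nu> 1 z = vac z" for \<nu> z by (simp add: sform_def qv_def)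
    \<comment> \<open>In weight 0 a single equation suffices, the pairing with 1; its right-hand
      side is f itself.\<close>
    show ?thesis
    proof (rule regular_solution[where L = "{()}" and A = "\<lambda>_ i \<nu>. vac (?zs ! i)" and b = "\<lambda>_ \<nu>. f"])
      show "near \<nu>\<^sub>0 (\<lambda>\<nu>. generic \<nu> \<longrightarrow> (\<forall>X. (\<Sum>i<?n. vac (?zs ! i) * psi y f \<beta> i \<nu> X) = f X))"
        using psi_system[OF y uf _ step.hyps, of _ 1] homog_1 1 by (intro near_all) (simp add: s1 la_1[OF uf])
      show "\<forall>i\<in>{..<?n}. c i = 0" if "\<And>l. l \<in> {()} \<Longrightarrow> (\<Sum>i<?n. vac (?zs ! i) * c i) = 0" for c
      proof (rule indep)
        have "vac (lin_comb c ?zs) = 0" using that[of "()"] by (simp add: lin_comb_def vac_sum mult.commute)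
        then show "lin_comb c ?zs \<in> serre_ideal"
          using homog_zero_weight[of "lin_comb c ?zs"] homc[of c] 1 serre_ideal.zero by simp
      qed
    qed (simp_all add: regular_coeff_const regular_family_const f)
  next
    case 2
    have "psi y f \<beta> i = (\<lambda>_ _. 0)" for i
      using vanish[OF 2 hom] by (simp add: psi_def fun_eq_iff)
    then show ?thesis using regular_family_const[OF FG_0] by simp
  next
    case 3
    \<comment> \<open>One equation for each k and each coordinate l in the basis of weight \<beta> -
      \<alpha>_k. The coordinates \<open>p\<close> of the skew derivatives do not depend on \<nu>,
      so \<nu> enters the coefficients only through powers of q that are regular.\<close>
    let ?L = "{(k, l). \<beta> - simple_root k \<in> Q_plus \<and> l < length (bas y (\<beta> - simple_root k))}"
    define p where "p k s i = (SOME c. app (skew s k) (?zs ! i) \<doteq> lin_comb c (bas y (\<beta> - simple_root k)))" for k s i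
    have p: "app (skew s k) (?zs ! i) \<doteq> lin_comb (p k s i) (bas y (\<beta> - simple_root k))"
      if "\<beta> - simple_root k \<in> Q_plus" "i < ?n" for k s i
    proof -
      have "\<exists>c. app (skew s k) (?zs ! i) \<doteq> lin_comb c (bas y (\<beta> - simple_root k))"
        using skew_homog[OF hom[OF that(2)], of k s] bas[OF y that(1)] unfolding is_basis_def by blast
      then show ?thesis unfolding p_def by (rule someI_ex)
    qed
    let ?C = "\<lambda>k \<nu> l i. qpow (of_int 1 * ip \<nu> (simple_root k)) * p k 1 i l - qpow (of_int (- 1) * ip \<nu> (simple_root k)) * p k (- 1) i l"
    have C: "app (eop \<nu> k) (?zs ! i) \<doteq> lin_comb (\<lambda>l. ?C k \<nu> l i) (bas y (\<beta> - simple_root k))"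
      if "\<beta> - simple_root k \<in> Q_plus" "i < ?n" for k \<nu> i
    proof -
      have "app (eop \<nu> k) (?zs ! i) = const (qpow (of_int 1 * ip \<nu> (simple_root k))) * app (skew 1 k) (?zs ! i)
        - const (qpow (of_int (- 1) * ip \<nu> (simple_root k))) * app (skew (- 1) k) (?zs ! i)"
        by (simp add: eop_def)
      also have "\<dots> \<doteq> const (qpow (of_int 1 * ip \<nu> (simple_root k))) * lin_comb (p k 1 i) (bas y (\<beta> - simple_root k))
        - const (qpow (of_int (- 1) * ip \<nu> (simple_root k))) * lin_comb (p k (- 1) i) (bas y (\<beta> - simple_root k))"
        using p[OF that] by (intro eqv_diff eqv_lmult)
      also have "\<dots> = lin_comb (\<lambda>l. ?C k \<nu> l i) (bas y (\<beta> - simple_root k))"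
        unfolding lin_comb_scale by (simp add: lin_comb_def fa.cst_diff left_diff_distrib sum_subtractf)
      finally show ?thesis .
    qed
    let ?b = "\<lambda>(k, l) \<nu> X. (qpow (of_int 1 * ip \<nu> (simple_root k)) * - qpow (- ip (\<beta> - simple_root k) (simple_root k)))
      * la (word [Gen_e k]) (psi y f (\<beta> - simple_root k) l \<nu>) X"
    show ?thesis
    proof (rule regular_solution[where L = ?L and A = "\<lambda>(k, l) i \<nu>. ?C k \<nu> l i" and b = ?b])
      fix x i assume "x \<in> ?L"
      then obtain k l where kl: "x = (k, l)" "\<beta> - simple_root k \<in> Q_plus" "l < length (bas y (\<beta> - simple_root k))" by auto
      show "regular_coeff \<nu>\<^sub>0 ((case x of (k, l) \<Rightarrow> \<lambda>i \<nu>. ?C k \<nu> l i) i)"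
        unfolding kl prod.case by (intro regular_coeff_diff regular_coeff_mult regular_coeff_qpow regular_coeff_const)
      show "regular_family \<nu>\<^sub>0 (?b x)"
        unfolding kl prod.case using step.IH[OF kl(2)] kl(3)
        by (intro regular_family_scale regular_coeff_mult regular_coeff_qpow regular_coeff_const regular_family_la) blast
      have q: "qpow (ip (\<nu> - (\<beta> - simple_root k)) (simple_root k))
        = qpow (of_int 1 * ip \<nu> (simple_root k)) * qpow (- ip (\<beta> - simple_root k) (simple_root k))" for \<nu>
        by (simp add: ip_simps flip: qpow_add)
      show "near \<nu>\<^sub>0 (\<lambda>\<nu>. generic \<nu> \<longrightarrow> (\<forall>X. (\<Sum>i<?n. (case x of (k, l) \<Rightarrow> \<lambda>i \<nu>. ?C k \<nu> l i) i \<nu> * psi y f \<beta> i \<nu> X) = ?b x \<nu> X))"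
      proof (rule near_all, intro impI allI)
        fix \<nu> X assume \<nu>: "generic \<nu>"
        show "(\<Sum>i<?n. (case x of (k, l) \<Rightarrow> \<lambda>i \<nu>. ?C k \<nu> l i) i \<nu> * psi y f \<beta> i \<nu> X) = ?b x \<nu> X"
          using psi_recursion[OF y uf \<nu> step.hyps kl(2) C[OF kl(2)] kl(3), of X] unfolding kl prod.case q by simp
      qed
    next
      \<comment> \<open>A kernel vector of the system at \<open>\<nu>\<^sub>0\<close> gives an
        element of weight \<beta> that all e_k kill in the Verma module. There is no singular vector
        in this weight, so the element and its coordinates are zero.\<close>
      fix c assume c: "\<And>x. x \<in> ?L \<Longrightarrow> (\<Sum>i<?n. (case x of (k, l) \<Rightarrow> \<lambda>i \<nu>. ?C k \<nu> l i) i \<nu>\<^sub>0 * c i) = 0"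
      have "app (eop \<nu>\<^sub>0 k) (lin_comb c ?zs) \<in> serre_ideal" for k
      proof (cases "\<beta> - simple_root k \<in> Q_plus")
        case True
        have "app (eop \<nu>\<^sub>0 k) (lin_comb c ?zs) = (\<Sum>i<?n. const (c i) * app (eop \<nu>\<^sub>0 k) (?zs ! i))"
          by (simp add: lin_comb_def app_sum)
        also have "\<dots> \<doteq> (\<Sum>i<?n. const (c i) * lin_comb (\<lambda>l. ?C k \<nu>\<^sub>0 l i) (bas y (\<beta> - simple_root k)))"
          by (intro eqv_sum eqv_lmult C True) simp
        also have "\<dots> = (\<Sum>i<?n. \<Sum>l<length (bas y (\<beta> - simple_root k)). const (?C k \<nu>\<^sub>0 l i * c i) * bas y (\<beta> - simple_root k) ! l)"
          unfolding lin_comb_scale by (simp add: lin_comb_def mult.commute)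
        also have "\<dots> = (\<Sum>l<length (bas y (\<beta> - simple_root k)). \<Sum>i<?n. const (?C k \<nu>\<^sub>0 l i * c i) * bas y (\<beta> - simple_root k) ! l)"
          by (rule sum.swap)
        also have "\<dots> = 0"
        proof (rule sum.neutral, rule ballI)
          fix l assume "l \<in> {..<length (bas y (\<beta> - simple_root k))}"
          then have z: "(\<Sum>i<?n. ?C k \<nu>\<^sub>0 l i * c i) = 0" using c[of "(k, l)"] True by simp
          have e: "(\<Sum>i\<in>A. const (g i) * v) = const (sum g A) * v" for g and A :: "nat set" and v :: "'i falg"
            by (induction A rule: infinite_finite_induct) (simp_all add: fa.cst_add distrib_right)
          show "(\<Sum>i<?n. const (?C k \<nu>\<^sub>0 l i * c i) * bas y (\<beta> - simple_root k) ! l) = 0"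
            unfolding e z by simp
        qed
        finally show ?thesis by (simp add: eqv_0)
      next
        case False
        show ?thesis using homog_not_Q_plus[OF eop_homog[OF homc] False] serre_ideal.zero by simp
      qed
      then have "lin_comb c ?zs \<in> serre_ideal" using 3 homc by (auto simp: singular_def sing_def)
      then show "\<forall>i\<in>{..<?n}. c i = 0" by (rule indep)
    qed simp
  qed
  then show ?case by simp
qed

lemma J_apply_regular:
  assumes y: "weight_bases y" and f: "f \<in> FG" and M: "left_module (Uq\<lparr>carrier := U_minus\<rparr>) M" and m: "m \<in> carrier M"
    and reg: "\<And>\<beta> i. \<beta> \<in> Q_plus \<Longrightarrow> i < length (bas y \<beta>) \<Longrightarrow> regular_family \<nu>\<^sub>0 (psi y f \<beta> i)"
  shows "regular_at M \<nu>\<^sub>0 (\<lambda>\<nu>. J_apply y M \<nu> m f)"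
proof -
  define Bs where "Bs = {\<beta> \<in> Q_plus. \<exists>x\<in>set (y \<beta>). left_action (theta x) f \<noteq> (\<lambda>_. 0)}"
  \<comment> \<open>This follows the convention that a sum over an infinite set is 0.\<close>
  define Bs' where "Bs' = (if finite Bs then Bs else {})"
  define P where "P = Sigma Bs' (\<lambda>\<beta>. {..<length (y \<beta>)})"
  define mm where "mm = (\<lambda>(\<beta>, i). (y \<beta> ! i) \<odot>\<^bsub>M\<^esub> m)"
  have fin: "finite Bs'" "finite P" and Q: "\<And>\<beta>. \<beta> \<in> Bs' \<Longrightarrow> \<beta> \<in> Q_plus"
    by (auto simp: Bs'_def Bs_def P_def split: if_splits)
  have len: "length (bas y \<beta>) = length (y \<beta>)" "j < length (y \<beta>) \<Longrightarrow> y \<beta> ! j = proj (inf_alg (bas y \<beta> ! j))" if "\<beta> \<in> Bs'" for \<beta> j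
    using bas[OF y Q[OF that]] by (simp_all add: is_basis_def)
  have psi: "psi y f \<beta> i \<nu> X = (\<Sum>j<length (y \<beta>). (the (mat_inverse (gram \<nu> (y \<beta>))) $$ (i, j)) * left_action (theta (y \<beta> ! j)) f X)"
    if "\<beta> \<in> Bs'" for \<beta> i \<nu> X
    unfolding psi_def len(1)[OF that] by (rule sum.cong) (simp_all add: len(2)[OF that] theta_proj la_def)
  have mm: "mm p \<in> carrier M" if "p \<in> P" for p
    using that len left_module.smult_closed[OF M _ m] by (auto simp: P_def mm_def U_minus_eq)
  define W where "W p S r \<longleftrightarrow> finite S \<and> S \<subseteq> FG \<and> (\<forall>f\<in>S. regular_coeff \<nu>\<^sub>0 (r f)) \<and>
    near \<nu>\<^sub>0 (\<lambda>\<nu>. generic \<nu> \<longrightarrow> (\<forall>X. psi y f (fst p) (snd p) \<nu> X = (\<Sum>f\<in>S. r f \<nu> * f X)))" for p S r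
  have "\<exists>S r. W p S r" if "p \<in> P" for p
  proof -
    have "fst p \<in> Bs'" "snd p < length (y (fst p))" using that by (auto simp: P_def)
    then have "regular_family \<nu>\<^sub>0 (psi y f (fst p) (snd p))" using reg Q len(1) by simp
    then show ?thesis unfolding regular_family_def W_def .
  qed
  then have "\<forall>p\<in>P. \<exists>t. W p (fst t) (snd t)" by simp
  from bchoice[OF this] obtain t where t: "\<forall>p\<in>P. W p (fst (t p)) (snd (t p))" ..
  define S r where "S p = fst (t p)" and "r p = snd (t p)" for p
  have "W p (S p) (r p)" if "p \<in> P" for p using t that unfolding S_def r_def ..
  then have S: "\<And>p. p \<in> P \<Longrightarrow> finite (S p)" "\<And>p. p \<in> P \<Longrightarrow> S p \<subseteq> FG"
    "\<And>p f. p \<in> P \<Longrightarrow> f \<in> S p \<Longrightarrow> regular_coeff \<nu>\<^sub>0 (r p f)"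
    "\<And>p. p \<in> P \<Longrightarrow> near \<nu>\<^sub>0 (\<lambda>\<nu>. generic \<nu> \<longrightarrow> (\<forall>X. psi y f (fst p) (snd p) \<nu> X = (\<Sum>f\<in>S p. r p f \<nu> * f X)))"
    unfolding W_def by blast+
  define T where "T = Sigma P S"
  have T: "finite T" using fin(2) S(1) by (auto simp: T_def)
  obtain h g where h: "tval \<nu>\<^sub>0 h \<noteq> 0" and g: "near \<nu>\<^sub>0 (\<lambda>\<nu>. \<forall>q\<in>T. r (fst q) (snd q) \<nu> = tval \<nu> (g q) / tval \<nu> h)"
    using common_denominator[OF T, of \<nu>\<^sub>0 "\<lambda>q. r (fst q) (snd q)"] S(3) by (auto simp: T_def)
  have nP: "near \<nu>\<^sub>0 (\<lambda>\<nu>. \<forall>p\<in>P. generic \<nu> \<longrightarrow> (\<forall>X. psi y f (fst p) (snd p) \<nu> X = (\<Sum>f\<in>S p. r p f \<nu> * f X)))"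
    by (rule near_ball[OF fin(2) S(4)])
  obtain h' where h': "tval \<nu>\<^sub>0 h' \<noteq> 0" and near: "\<And>\<nu>. tval \<nu> h' \<noteq> 0 \<Longrightarrow>
     (\<forall>q\<in>T. r (fst q) (snd q) \<nu> = tval \<nu> (g q) / tval \<nu> h) \<and>
     (\<forall>p\<in>P. generic \<nu> \<longrightarrow> (\<forall>X. psi y f (fst p) (snd p) \<nu> X = (\<Sum>f\<in>S p. r p f \<nu> * f X)))"
    using near_conj[OF g nP] unfolding near_def by blast
  obtain e where e: "bij_betw e {..<card T} T"
    using ex_bij_betw_nat_finite[OF T] by (auto simp: atLeast0LessThan)
  have eT: "e s \<in> T" if "s < card T" for s using bij_betwE[OF e] that by auto
  \<comment> \<open>The factor h' enters numerators and denominator alike: where the denominator is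
    nonzero, h' is nonzero too, and the identities that hold near \<open>\<nu>\<^sub>0\<close> are
    available.\<close>
  let ?g = "\<lambda>s. proj (int_alg (g (e s) * h'))" and ?h = "proj (int_alg (h * h'))"
  show ?thesis
    unfolding regular_at_def
  proof (intro exI[of _ "card T"] exI[of _ ?g] exI[of _ ?h] exI[of _ "\<lambda>s. mm (fst (e s))"] exI[of _ "\<lambda>s. snd (e s)"] conjI allI impI)
    fix s assume s: "s < card T"
    show "?g s \<in> U_zero" by (simp only: U_zero_eq) blast
    show "mm (fst (e s)) \<in> carrier M" "snd (e s) \<in> FG" using eT[OF s] mm S(2)[of "fst (e s)"] by (auto simp: T_def mem_Sigma_iff)
  next
    show "?h \<in> U_zero" by (simp only: U_zero_eq) blast
    show "qchar \<nu>\<^sub>0 ?h \<noteq> 0" using h h' unfolding tval_def[symmetric] by simp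
  next
    fix \<nu> assume \<nu>: "generic \<nu> \<and> qchar \<nu> ?h \<noteq> 0"
    then have nz: "tval \<nu> h \<noteq> 0" "tval \<nu> h' \<noteq> 0" unfolding tval_def[symmetric] by simp_all
    let ?c = "\<lambda>p j. the (mat_inverse (gram \<nu> (y (fst p)))) $$ (snd p, j)" and ?t = "\<lambda>p j. left_action (theta (y (fst p) ! j)) f"
    have "J_apply y M \<nu> m f = (\<Sum>\<beta>\<in>Bs'. \<Sum>i<length (y \<beta>). \<Sum>j<length (y \<beta>). Poly_Mapping.single (mm (\<beta>, i), ?t (\<beta>, i) j) (?c (\<beta>, i) j))"
      unfolding J_apply_def Bs_def[symmetric] by (cases "finite Bs") (simp_all add: Bs'_def mm_def)
    also have "\<dots> = (\<Sum>p\<in>P. \<Sum>j<length (y (fst p)). Poly_Mapping.single (mm p, ?t p j) (?c p j))"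
      unfolding P_def by (subst sum.Sigma) (simp_all add: fin split_def)
    finally have J: "J_apply y M \<nu> m f = (\<Sum>p\<in>P. \<Sum>j<length (y (fst p)). Poly_Mapping.single (mm p, ?t p j) (?c p j))" .
    have "(\<Sum>s<card T. Poly_Mapping.single (mm (fst (e s)), snd (e s)) (qchar \<nu> (?g s) / qchar \<nu> ?h))
      = (\<Sum>s<card T. Poly_Mapping.single (mm (fst (e s)), snd (e s)) (r (fst (e s)) (snd (e s)) \<nu>))"
      using near[OF nz(2)] eT nz unfolding tval_def[symmetric] by (intro sum.cong refl) simp
    also have "\<dots> = (\<Sum>q\<in>T. Poly_Mapping.single (mm (fst q), snd q) (r (fst q) (snd q) \<nu>))"
      by (rule sum.reindex_bij_betw[OF e])
    also have "\<dots> = (\<Sum>p\<in>P. \<Sum>f\<in>S p. Poly_Mapping.single (mm p, f) (r p f \<nu>))"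
      unfolding T_def using fin(2) S(1) by (subst sum.Sigma) (simp_all add: split_def)
    finally have R: "(\<Sum>s<card T. Poly_Mapping.single (mm (fst (e s)), snd (e s)) (qchar \<nu> (?g s) / qchar \<nu> ?h))
      = (\<Sum>p\<in>P. \<Sum>f\<in>S p. Poly_Mapping.single (mm p, f) (r p f \<nu>))" .
    show "tensor_class scalar M FG_module (J_apply y M \<nu> m f) = tensor_class scalar M FG_module
      (\<Sum>s<card T. Poly_Mapping.single (mm (fst (e s)), snd (e s)) (qchar \<nu> (?g s) / qchar \<nu> ?h))"
      unfolding J R
    proof (rule tensor_class_eqI, subst sum_subtractf[symmetric], rule tensor_null_sum)
      \<comment> \<open>For p = (\<beta>, i) the left factor is fixed, and both sides represent its
        tensor product with the same function \<open>psi y f \<beta> i \<nu>\<close>.\<close>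
      fix p assume p: "p \<in> P"
      show "(\<Sum>j<length (y (fst p)). Poly_Mapping.single (mm p, ?t p j) (?c p j)) - (\<Sum>f\<in>S p. Poly_Mapping.single (mm p, f) (r p f \<nu>))
        \<in> tensor_null scalar M FG_module"
      proof (rule tensor_rewrite[OF mm[OF p] _ _ S(1)[OF p]])
        have b: "fst p \<in> Bs'" using p by (auto simp: P_def)
        show "?t p j \<in> FG" if "j \<in> {..<length (y (fst p))}" for j
          using that la_FG[OF f] by (simp add: len(2)[OF b] theta_proj flip: la_def)
        show "(\<Sum>j<length (y (fst p)). ?c p j * ?t p j X) = (\<Sum>f\<in>S p. r p f \<nu> * f X)" for X
        proof -
          have "psi y f (fst p) (snd p) \<nu> X = (\<Sum>f\<in>S p. r p f \<nu> * f X)" using near[OF nz(2)] p \<nu> by blast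
          then show ?thesis using psi[OF b, of "snd p" \<nu> X] by simp
        qed
      qed (use S(2)[OF p] in auto)
    qed
  qed
qed

text \<open>Up to sign \<theta>(x f_i^n) equals \<theta>(x) e_i^n, in which e_i^n acts first; and
  e_i^n lies in \<open>K_tilde \<nu>\<close>, which kills f.\<close>

lemma parabolic_annihilates:
  assumes f: "f \<in> FG_invariants (K_tilde \<nu>)" and n: "\<And>i. i \<in> G \<Longrightarrow> cow i \<nu> + 1 = of_nat (n i)" "\<And>i. i \<in> G \<Longrightarrow> n i > 0"
    and "x \<in> parabolic G n"
  shows "la (th (inf_alg x)) f = (\<lambda>_. 0)"
  using assms(4)
proof (induction rule: parabolic.induct)
  case (serre x)
  then have "x \<doteq> 0" by (simp add: eqv_0)
  have "uform f" using f FG_uform by (auto simp: FG_invariants_def FG_weight_def)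
  then show ?case unfolding th_inf_cong[OF \<open>x \<doteq> 0\<close>] by (simp add: la_linear fun_eq_iff)
next
  case (gen i x)
  have p: "th (z ^ k) = th z ^ k" for z k by (induction k) simp_all
  have "la (word [Gen_e i] ^ n i) f = (\<lambda>_. 0)"
    using f e_power_K_tilde[OF n(1)[OF gen] n(2)[OF gen]] by (simp add: FG_invariants_def la_def)
  then show ?case by (simp add: p la_mult power_minus[of "word [Gen_e i]"] la_zero)
next
  case (add x z)
  have "uform f" using f FG_uform by (auto simp: FG_invariants_def FG_weight_def)
  then show ?case using add.IH by (simp add: la_linear fun_eq_iff)
qed

theorem parabolic_J_regular:
  assumes \<Gamma>: "\<Gamma> \<subseteq> range simple_root"
    and int: "\<And>i. simple_root i \<in> \<Gamma> \<Longrightarrow> pairing (\<nu>\<^sub>0 + rho) (simple_coroot i) \<in> pos_nats"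
    and out: "\<And>\<beta>. \<beta> \<in> pos_roots - vec.span \<Gamma> \<Longrightarrow> pairing (\<nu>\<^sub>0 + rho) (coroot \<beta>) \<notin> pos_nats"
  shows "J_regular TYPE('m) \<nu>\<^sub>0"
proof -
  have "\<exists>n :: nat. simple_root i \<in> \<Gamma> \<longrightarrow> cow i \<nu>\<^sub>0 + 1 = of_nat n \<and> n > 0" for i
    using int[of i] by (auto simp: pos_nats_def cow_rho)
  then obtain n where n: "\<And>i. simple_root i \<in> \<Gamma> \<Longrightarrow> cow i \<nu>\<^sub>0 + 1 = of_nat (n i)" "\<And>i. simple_root i \<in> \<Gamma> \<Longrightarrow> n i > 0"
    by metis
  show ?thesis
    unfolding J_regular_def
  proof (intro allI impI ballI)
    fix y and M :: "('i uq, 'm) module" and m f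
    assume y: "weight_bases y" and M: "left_module (Uq\<lparr>carrier := U_minus\<rparr>) M" "m \<in> carrier M" and f: "f \<in> FG_invariants (K_tilde \<nu>\<^sub>0)"
    have FG: "f \<in> FG" using f by (simp add: FG_invariants_def FG_weight_def)
    have "la (th (inf_alg x)) f = (\<lambda>_. 0)" if "\<beta> \<noteq> 0" "singular \<nu>\<^sub>0 \<beta>" "homog \<beta> x" for \<beta> x
      by (rule parabolic_annihilates[OF f _ _ singular_or_parabolic[OF \<Gamma> n out that(2,1,3)]]) (use n in auto)
    then show "regular_at M \<nu>\<^sub>0 (\<lambda>\<nu>. J_apply y M \<nu> m f)"
      using psi_regular[OF y FG] by (intro J_apply_regular[OF y FG M]) blast
  qed
qed

end

theorem theorem22:
  fixes a :: "'i::{finite,linorder} \<Rightarrow> 'i \<Rightarrow> int"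
    and ip :: "'i weight \<Rightarrow> 'i weight \<Rightarrow> rat"
    and \<Gamma> :: "'i weight set"
    and \<nu>\<^sub>0 :: "'i weight"
  assumes "finite_cartan_datum a ip"
    and "\<Gamma> \<subseteq> range simple_root"
    and "\<And>i. simple_root i \<in> \<Gamma> \<Longrightarrow>
      pairing (\<nu>\<^sub>0 + finite_cartan_matrix.rho a) (finite_cartan_matrix.simple_coroot a i) \<in> pos_nats"
    and "\<And>\<beta>. \<beta> \<in> finite_cartan_matrix.pos_roots a - vec.span \<Gamma> \<Longrightarrow>
      pairing (\<nu>\<^sub>0 + finite_cartan_matrix.rho a) (finite_cartan_datum.coroot ip \<beta>) \<notin> pos_nats"
  shows "finite_cartan_datum.J_regular a ip TYPE('m) \<nu>\<^sub>0"
  by (rule finite_cartan_datum.parabolic_J_regular[OF assms])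

end
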